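(* Let $W\subset\mathrm{GL}(E)$ be a finite complex reflection group with holonomy Lie algebra $\mathcal{T}$, let $\rho:\mathcal{T}\to\mathfrak{gl}_N(\mathbb{C})$ be a representation, and let $R$ be its monodromy representation. Let $W_0$ be a parabolic subgroup of $W$, with holonomy Lie algebra $\mathcal{T}_0\subset\mathcal{T}$ and (pure) braid groups $P_0\subset P$, $B_0\subset B$. Let $\rho_0$ be the restriction of $\rho$ to $\mathcal{T}_0$, and $R_0$ be the monodromy representation of $\rho_0$. Then the restriction of $R$ to $P_0$ is isomorphic to $R_0$. If $\omega_\rho$ is $W$-equivariant, then the restriction of $R$ to $B_0$ is isomorphic to $R_0$.
   Context: A reflection of a finite-dimensional complex vector space $E$ is $s\in \mathrm{GL}(E)$ with $s^2=1$ and $\mathrm{Ker}(s-1)$ a hyperplane; a finite complex reflection group is a finite subgroup $W\subset\mathrm{GL}(E)$ generated by reflections. $\mathcal{R}$ is the set of reflections in $W$, $\mathcal{A}=\{\mathrm{Ker}(s-1):s\in\mathcal{R}\}$, $X=E\setminus\bigcup\mathcal{A}$, $P=\pi_1(X)$, $B=\pi_1(X/W)$. $\mathcal{T}$ is the Lie algebra over $\mathbb{C}$ with generators $t_H$, $H\in\mathcal{A}$, and relations $[t_Z,t_{H_0}]=0$ whenever $H_0\in\mathcal{A}$ and $Z$ is a codimension 2 subspace of $E$ contained in $H_0$, where $t_Z=\sum_{H\in\mathcal{A},\,H\supset Z}t_H$. For a representation $\rho:\mathcal{T}\to\mathfrak{gl}_N(\mathbb{C})$, the 1-form $\omega_\rho=\frac{1}{\mathrm{i}\pi}\sum_{H\in\mathcal{A}}\rho(t_H)\,\mathrm{d}b_H/b_H$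 on $X$ ($b_H$ a linear form with kernel $H$) is integrable. $\omega_\rho$ (or $\rho$) is $W$-equivariant if $\mathbb{C}^N$ is endowed with a linear $W$-action such that $\rho(t_{w(H)})=w\rho(t_H)w^{-1}$ for all $w\in W$, $H\in\mathcal{A}$. Monodromy: $h$ is a formal parameter, $A=\mathbb{C}[[h]]$, $K=\mathbb{C}((h))$. Fix $\underline{z}\in X$. For a path $\gamma$ in $X$ starting at $\underline{z}$, $T_\gamma\in \mathrm{GL}_N(A)$ is the endpoint value of the solution along $\gamma$ of $\mathrm{d}F=h\omega_\rho F$ with $F(\underline{z})=\mathrm{Id}$. $R:P\to\mathrm{GL}_N(K)$ is $[\gamma]\mapsto T_\gamma$; in the $W$-equivariant case it extends to $B$ by sending the class of a path $\gamma$ from $\underline{z}$ to $w^{-1}\underline{z}$ to $wT_\gamma$ (products of paths read from right to left). A parabolic subgroup $W_0$ is the pointwise stabilizer in $W$ of a proper subspace $I\subset E$; it is generated by the reflections of $W$ whose hyperplane contains $I$. $\mathcal{A}_0=\{H\in\mathcal{A}:H\supset I\}$, $X_0=E\setminus\bigcup\mathcal{A}_0$, $P_0=\pi_1(X_0)$, $B_0=\pi_1(X_0/W_0)$. $\mathcal{T}_0$ is the holonomy Lie algebra of $\mathcal{A}_0$, namely the Lie algebra over $\mathbb{C}$ with generators $t_H$, $H\in\mathcal{A}_0$, and relations $[t^0_Z,t_{H_0}]=0$ whenever $H_0\in\mathcal{A}_0$ and $Z$ is a codimension 2 subspace of $E$ contained in $H_0$, where $t^0_Z=\sum_{H\in\mathcal{A}_0,\,H\supset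 Z}t_H$; it is identified with a Lie subalgebra of $\mathcal{T}$ by $t_H\mapsto t_H$, $H\in\mathcal{A}_0$. $R_0$ is the monodromy representation, of $P_0$ (respectively $B_0$ in the equivariant case), of $\mathrm{d}F=h\omega_{\rho_0}F$ on $X_0$. Embeddings $P_0\to P$, $B_0\to B$: choose a $W$-invariant Hermitian norm on $E$, $x_1\in I$ lying on no $H\in\mathcal{A}\setminus\mathcal{A}_0$, $\epsilon>0$ such that $\Omega=\{x:\|x-x_1\|\le\epsilon\}$ meets no $H\in\mathcal{A}\setminus\mathcal{A}_0$, and $x_2\in X$ with $\|x_2-x_1\|<\epsilon$. Then $\pi_1(X\cap\Omega,x_2)\to\pi_1(X_0,x_2)$ is an isomorphism; composing its inverse with $\pi_1(X\cap\Omega,x_2)\to\pi_1(X,x_2)$ gives $P_0\to P$, and as $\Omega$ is $W_0$-stable this extends in the same way to $B_0\to B$. These embeddings are well defined up to $P$-conjugation. *)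

theory Defs
  imports
    "HOL-Analysis.Analysis"
    "HOL-Computational_Algebra.Formal_Laurent_Series"
    "HOL-Algebra.Generated_Groups"
begin

section \<open>Complex reflection groups and their arrangements\<close>

definition GL :: "('a::semiring_1^'n^'n) monoid" where
  "GL = \<lparr>carrier = {A. invertible A}, mult = (**), one = mat 1\<rparr>"

definition fixed_space :: "complex^'n^'n \<Rightarrow> (complex^'n) set" where
  "fixed_space s = {v. s *v v = v}"

definition codim_subspace :: "nat \<Rightarrow> (complex^'n) set \<Rightarrow> bool" where
  "codim_subspace k Z \<longleftrightarrow> vec.subspace Z \<and> vec.dim Z + k = CARD('n)"

definition reflection :: "complex^'n^'n \<Rightarrow> bool" where
  "reflection s \<longleftrightarrow> s ** s = mat 1 \<and> codim_subspace 1 (fixed_space s)"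

definition reflections :: "(complex^'n^'n) set \<Rightarrow> (complex^'n^'n) set" where
  "reflections W = {s \<in> W. reflection s}"

definition complex_reflection_group :: "(complex^'n^'n) set \<Rightarrow> bool" where
  "complex_reflection_group W \<longleftrightarrow>
     finite W \<and> subgroup W GL \<and> generate GL (reflections W) = W"

definition arrangement :: "(complex^'n^'n) set \<Rightarrow> (complex^'n) set set" where
  "arrangement W = fixed_space ` reflections W"

definition arr_complement :: "(complex^'n) set set \<Rightarrow> (complex^'n) set" where
  "arr_complement \<A> = - \<Union>\<A>"

definition pointwise_stabilizer :: "(complex^'n^'n) set \<Rightarrow> (complex^'n) set \<Rightarrow> (complex^'n^'n) set" where
  "pointwise_stabilizer W I = {w \<in> W. \<forall>x\<in>I. w *v x = x}"

definition hyperplanes_containing :: "(complex^'n) set set \<Rightarrow> (complex^'n) set \<Rightarrow> (complex^'n) set set" where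
  "hyperplanes_containing \<A> Z = {H \<in> \<A>. Z \<subseteq> H}"


section \<open>Lie algebras given by generators and relations\<close>

record 'a lie_structure = "'a partial_object" +
  lie_add :: "'a \<Rightarrow> 'a \<Rightarrow> 'a"
  lie_zero :: 'a
  lie_smult :: "complex \<Rightarrow> 'a \<Rightarrow> 'a"
  lie_bracket :: "'a \<Rightarrow> 'a \<Rightarrow> 'a"

definition lie_hom :: "'a lie_structure \<Rightarrow> 'b lie_structure \<Rightarrow> ('a \<Rightarrow> 'b) set" where
  "lie_hom L M = {f. f \<in> carrier L \<rightarrow> carrier M \<and>
     (\<forall>x\<in>carrier L. \<forall>y\<in>carrier L. f (lie_add L x y) = lie_add M (f x) (f y)) \<and>
     (\<forall>c. \<forall>x\<in>carrier L. f (lie_smult L c x) = lie_smult M c (f x)) \<and>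
     (\<forall>x\<in>carrier L. \<forall>y\<in>carrier L. f (lie_bracket L x y) = lie_bracket M (f x) (f y))}"

definition gl :: "(complex^'m^'m) lie_structure" where
  "gl = \<lparr>carrier = UNIV, lie_add = (+), lie_zero = 0,
         lie_smult = (\<lambda>c A. \<chi> i j. c * A $ i $ j),
         lie_bracket = (\<lambda>A B. A ** B - B ** A)\<rparr>"

datatype 'g lie_term =
    LGen 'g
  | LZero
  | LAdd "'g lie_term" "'g lie_term"
  | LSmult complex "'g lie_term"
  | LBracket "'g lie_term" "'g lie_term"

definition lie_terms :: "'g set \<Rightarrow> 'g lie_term set" where
  "lie_terms G = {t. set_lie_term t \<subseteq> G}"

text \<open>
  The smallest congruence on the terms over the generators \<open>G\<close> that satisfies the axioms of a
  complex Lie algebra and sends every relator in \<open>R\<close> to zero.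
\<close>

inductive lie_cong :: "'g set \<Rightarrow> 'g lie_term set \<Rightarrow> 'g lie_term \<Rightarrow> 'g lie_term \<Rightarrow> bool"
  for G R where
  refl: "x \<in> lie_terms G \<Longrightarrow> lie_cong G R x x"
| sym: "lie_cong G R x y \<Longrightarrow> lie_cong G R y x"
| trans: "lie_cong G R x y \<Longrightarrow> lie_cong G R y z \<Longrightarrow> lie_cong G R x z"
| add: "lie_cong G R x x' \<Longrightarrow> lie_cong G R y y' \<Longrightarrow> lie_cong G R (LAdd x y) (LAdd x' y')"
| smult: "lie_cong G R x x' \<Longrightarrow> lie_cong G R (LSmult c x) (LSmult c x')"
| bracket: "lie_cong G R x x' \<Longrightarrow> lie_cong G R y y' \<Longrightarrow>
    lie_cong G R (LBracket x y) (LBracket x' y')"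
| add_assoc: "x \<in> lie_terms G \<Longrightarrow> y \<in> lie_terms G \<Longrightarrow> z \<in> lie_terms G \<Longrightarrow>
    lie_cong G R (LAdd (LAdd x y) z) (LAdd x (LAdd y z))"
| add_comm: "x \<in> lie_terms G \<Longrightarrow> y \<in> lie_terms G \<Longrightarrow> lie_cong G R (LAdd x y) (LAdd y x)"
| add_zero: "x \<in> lie_terms G \<Longrightarrow> lie_cong G R (LAdd LZero x) x"
| add_neg: "x \<in> lie_terms G \<Longrightarrow> lie_cong G R (LAdd x (LSmult (-1) x)) LZero"
| smult_add_right: "x \<in> lie_terms G \<Longrightarrow> y \<in> lie_terms G \<Longrightarrow>
    lie_cong G R (LSmult c (LAdd x y)) (LAdd (LSmult c x) (LSmult c y))"
| smult_add_left: "x \<in> lie_terms G \<Longrightarrow>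
    lie_cong G R (LSmult (c + d) x) (LAdd (LSmult c x) (LSmult d x))"
| smult_smult: "x \<in> lie_terms G \<Longrightarrow> lie_cong G R (LSmult c (LSmult d x)) (LSmult (c * d) x)"
| smult_one: "x \<in> lie_terms G \<Longrightarrow> lie_cong G R (LSmult 1 x) x"
| bracket_add_left: "x \<in> lie_terms G \<Longrightarrow> y \<in> lie_terms G \<Longrightarrow> z \<in> lie_terms G \<Longrightarrow>
    lie_cong G R (LBracket (LAdd x y) z) (LAdd (LBracket x z) (LBracket y z))"
| bracket_add_right: "x \<in> lie_terms G \<Longrightarrow> y \<in> lie_terms G \<Longrightarrow> z \<in> lie_terms G \<Longrightarrow>
    lie_cong G R (LBracket x (LAdd y z)) (LAdd (LBracket x y) (LBracket x z))"
| bracket_smult_left: "x \<in> lie_terms G \<Longrightarrow> y \<in> lie_terms G \<Longrightarrow>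
    lie_cong G R (LBracket (LSmult c x) y) (LSmult c (LBracket x y))"
| bracket_smult_right: "x \<in> lie_terms G \<Longrightarrow> y \<in> lie_terms G \<Longrightarrow>
    lie_cong G R (LBracket x (LSmult c y)) (LSmult c (LBracket x y))"
| bracket_self: "x \<in> lie_terms G \<Longrightarrow> lie_cong G R (LBracket x x) LZero"
| jacobi: "x \<in> lie_terms G \<Longrightarrow> y \<in> lie_terms G \<Longrightarrow> z \<in> lie_terms G \<Longrightarrow>
    lie_cong G R (LAdd (LBracket x (LBracket y z))
      (LAdd (LBracket y (LBracket z x)) (LBracket z (LBracket x y)))) LZero"
| relator: "r \<in> R \<Longrightarrow> r \<in> lie_terms G \<Longrightarrow> lie_cong G R r LZero"

definition lie_class :: "'g set \<Rightarrow> 'g lie_term set \<Rightarrow> 'g lie_term \<Rightarrow> 'g lie_term set" where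
  "lie_class G R t = {u. lie_cong G R t u}"

definition presented_lie_algebra :: "'g set \<Rightarrow> 'g lie_term set \<Rightarrow> 'g lie_term set lie_structure" where
  "presented_lie_algebra G R =
     \<lparr>carrier = lie_class G R ` lie_terms G,
      lie_add = (\<lambda>c d. \<Union>s\<in>c. \<Union>t\<in>d. lie_class G R (LAdd s t)),
      lie_zero = lie_class G R LZero,
      lie_smult = (\<lambda>a c. \<Union>s\<in>c. lie_class G R (LSmult a s)),
      lie_bracket = (\<lambda>c d. \<Union>s\<in>c. \<Union>t\<in>d. lie_class G R (LBracket s t))\<rparr>"


lemma lie_class_cong: "lie_cong G R x y \<Longrightarrow> lie_class G R x = lie_class G R y"
  unfolding lie_class_def by (blast intro: lie_cong.sym lie_cong.trans)

lemma presented_lie_operations: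
  assumes "x \<in> lie_terms G" "y \<in> lie_terms G"
  shows "lie_add (presented_lie_algebra G R) (lie_class G R x) (lie_class G R y) =
           lie_class G R (LAdd x y)"
    and "lie_smult (presented_lie_algebra G R) a (lie_class G R x) = lie_class G R (LSmult a x)"
    and "lie_bracket (presented_lie_algebra G R) (lie_class G R x) (lie_class G R y) =
           lie_class G R (LBracket x y)"
proof -
  have x: "x \<in> lie_class G R x" and y: "y \<in> lie_class G R y"
    using assms by (auto simp: lie_class_def lie_cong.refl)
  have eqs: "lie_class G R (LAdd s t) = lie_class G R (LAdd x y)"
    "lie_class G R (LSmult a s) = lie_class G R (LSmult a x)"
    "lie_class G R (LBracket s t) = lie_class G R (LBracket x y)"
    if "s \<in> lie_class G R x" "t \<in> lie_class G R y" for s t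
  proof -
    have s: "lie_cong G R s x" and t: "lie_cong G R t y"
      using that by (simp_all add: lie_class_def lie_cong.sym)
    show "lie_class G R (LAdd s t) = lie_class G R (LAdd x y)"
      by (rule lie_class_cong[OF lie_cong.add[OF s t]])
    show "lie_class G R (LSmult a s) = lie_class G R (LSmult a x)"
      by (rule lie_class_cong[OF lie_cong.smult[OF s]])
    show "lie_class G R (LBracket s t) = lie_class G R (LBracket x y)"
      by (rule lie_class_cong[OF lie_cong.bracket[OF s t]])
  qed
  have "(\<Union>s\<in>lie_class G R x. \<Union>t\<in>lie_class G R y. lie_class G R (LAdd s t)) = lie_class G R (LAdd x y)"
    using x y eqs(1) by blast
  then show "lie_add (presented_lie_algebra G R) (lie_class G R x) (lie_class G R y) =
           lie_class G R (LAdd x y)"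
    by (simp add: presented_lie_algebra_def)
  have "(\<Union>s\<in>lie_class G R x. lie_class G R (LSmult a s)) = lie_class G R (LSmult a x)"
    using x y eqs(2) by blast
  then show "lie_smult (presented_lie_algebra G R) a (lie_class G R x) = lie_class G R (LSmult a x)"
    by (simp add: presented_lie_algebra_def)
  have "(\<Union>s\<in>lie_class G R x. \<Union>t\<in>lie_class G R y. lie_class G R (LBracket s t)) = lie_class G R (LBracket x y)"
    using x y eqs(3) by blast
  then show "lie_bracket (presented_lie_algebra G R) (lie_class G R x) (lie_class G R y) =
           lie_class G R (LBracket x y)"
    by (simp add: presented_lie_algebra_def)
qed


section \<open>The holonomy Lie algebra and its 1-form\<close>

text \<open>
  Terms have no canonical finite sums, so \<open>t\<^sub>Z\<close> is written down once for every enumeration \<open>Hs\<close>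
  of the hyperplanes containing \<open>Z\<close>; all these terms are congruent.
\<close>

definition holonomy_relators :: "(complex^'n) set set \<Rightarrow> (complex^'n) set lie_term set" where
  "holonomy_relators \<A> =
     {LBracket (foldr (\<lambda>H. LAdd (LGen H)) Hs LZero) (LGen H0) | Hs H0 Z.
        H0 \<in> \<A> \<and> codim_subspace 2 Z \<and> Z \<subseteq> H0 \<and>
        distinct Hs \<and> set Hs = hyperplanes_containing \<A> Z}"

definition holonomy :: "(complex^'n) set set \<Rightarrow> (complex^'n) set lie_term set lie_structure" where
  "holonomy \<A> = presented_lie_algebra \<A> (holonomy_relators \<A>)"

definition holonomy_gen :: "(complex^'n) set set \<Rightarrow> (complex^'n) set \<Rightarrow> (complex^'n) set lie_term set" where
  "holonomy_gen \<A> H = lie_class \<A> (holonomy_relators \<A>) (LGen H)"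

text \<open>
  The map from the holonomy Lie algebra of a parabolic subarrangement to that of \<open>\<A>\<close> given by
  \<open>t\<^sub>H \<mapsto> t\<^sub>H\<close>: a class of terms over the smaller set of generators is sent to the class in the
  larger algebra of any of its members.
\<close>

definition holonomy_incl ::
  "(complex^'n) set set \<Rightarrow> (complex^'n) set lie_term set \<Rightarrow> (complex^'n) set lie_term set" where
  "holonomy_incl \<A> c = (\<Union>t\<in>c. lie_class \<A> (holonomy_relators \<A>) t)"

definition is_linear_form_of :: "(complex^'n) set \<Rightarrow> (complex^'n \<Rightarrow> complex) \<Rightarrow> bool" where
  "is_linear_form_of H b \<longleftrightarrow> Vector_Spaces.linear (*s) (*) b \<and> {v. b v = 0} = H"

text \<open>A linear form with kernel \<open>H\<close> is unique up to a scalar, so \<open>db\<^sub>H / b\<^sub>H\<close> is independent of the choice.\<close>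

definition linear_form_of :: "(complex^'n) set \<Rightarrow> complex^'n \<Rightarrow> complex" where
  "linear_form_of H = (SOME b. is_linear_form_of H b)"

text \<open>A matrix-valued 1-form is a function of a point and a tangent vector.\<close>

type_synonym ('n, 'm) matrix_form = "complex^'n \<Rightarrow> complex^'n \<Rightarrow> complex^'m^'m"

definition holonomy_form ::
  "(complex^'n) set set \<Rightarrow> ((complex^'n) set lie_term set \<Rightarrow> complex^'m^'m) \<Rightarrow> ('n, 'm) matrix_form" where
  "holonomy_form \<A> \<rho> x v =
     (\<chi> i j. 1 / (\<i> * of_real pi) *
        (\<Sum>H\<in>\<A>. \<rho> (holonomy_gen \<A> H) $ i $ j * (linear_form_of H v / linear_form_of H x)))"

definition equivariant_rep ::
  "(complex^'n^'n) set \<Rightarrow> (complex^'n^'n \<Rightarrow> complex^'m^'m) \<Rightarrow>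
   ((complex^'n) set lie_term set \<Rightarrow> complex^'m^'m) \<Rightarrow> bool" where
  "equivariant_rep W \<sigma> \<rho> \<longleftrightarrow>
     \<sigma> \<in> hom (GL\<lparr>carrier := W\<rparr>) GL \<and>
     (\<forall>w\<in>W. \<forall>H\<in>arrangement W.
        \<rho> (holonomy_gen (arrangement W) ((*v) w ` H)) =
        \<sigma> w ** \<rho> (holonomy_gen (arrangement W) H) ** matrix_inv (\<sigma> w))"


section \<open>Fundamental groups\<close>

text \<open>
  Orbit spaces live on a set type, which carries no type-class topology, so fundamental groups are
  defined for abstract topologies.
\<close>

definition path_homotopic :: "'a topology \<Rightarrow> (real \<Rightarrow> 'a) \<Rightarrow> (real \<Rightarrow> 'a) \<Rightarrow> bool" where
  "path_homotopic T \<gamma> \<delta> \<longleftrightarrow>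
     homotopic_with (\<lambda>\<eta>. \<eta> 0 = \<gamma> 0 \<and> \<eta> 1 = \<gamma> 1) (top_of_set {0..1}) T \<gamma> \<delta>"

definition path_class :: "'a topology \<Rightarrow> (real \<Rightarrow> 'a) \<Rightarrow> (real \<Rightarrow> 'a) set" where
  "path_class T \<gamma> = {\<delta>. path_homotopic T \<gamma> \<delta>}"

definition path_join :: "(real \<Rightarrow> 'a) \<Rightarrow> (real \<Rightarrow> 'a) \<Rightarrow> real \<Rightarrow> 'a" where
  "path_join \<gamma> \<delta> t = (if t \<le> 1/2 then \<gamma> (2 * t) else \<delta> (2 * t - 1))"

definition path_reverse :: "(real \<Rightarrow> 'a) \<Rightarrow> real \<Rightarrow> 'a" where
  "path_reverse \<gamma> t = \<gamma> (1 - t)"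

text \<open>Products are read from right to left: \<open>[\<gamma>][\<delta>]\<close> runs through \<open>\<delta>\<close> first.\<close>

definition fundamental_group :: "'a topology \<Rightarrow> 'a \<Rightarrow> (real \<Rightarrow> 'a) set monoid" where
  "fundamental_group T p =
     \<lparr>carrier = {path_class T \<gamma> | \<gamma>. pathin T \<gamma> \<and> \<gamma> 0 = p \<and> \<gamma> 1 = p},
      mult = (\<lambda>c d. \<Union>\<gamma>\<in>c. \<Union>\<delta>\<in>d. path_class T (path_join \<delta> \<gamma>)),
      one = path_class T (\<lambda>_. p)\<rparr>"

definition pi1_map :: "'b topology \<Rightarrow> ('a \<Rightarrow> 'b) \<Rightarrow> (real \<Rightarrow> 'a) set \<Rightarrow> (real \<Rightarrow> 'b) set" where
  "pi1_map T f c = (\<Union>\<gamma>\<in>c. path_class T (f \<circ> \<gamma>))"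

text \<open>For a path \<open>\<beta>\<close> from \<open>p\<close> to \<open>q\<close>, this maps the fundamental group at \<open>q\<close> to the one at \<open>p\<close>.\<close>

definition pi1_rebase :: "'a topology \<Rightarrow> (real \<Rightarrow> 'a) \<Rightarrow> (real \<Rightarrow> 'a) set \<Rightarrow> (real \<Rightarrow> 'a) set" where
  "pi1_rebase T \<beta> c = (\<Union>\<gamma>\<in>c. path_class T (path_join \<beta> (path_join \<gamma> (path_reverse \<beta>))))"

definition orbit :: "(complex^'n^'n) set \<Rightarrow> complex^'n \<Rightarrow> (complex^'n) set" where
  "orbit W x = (\<lambda>w. w *v x) ` W"

definition orbit_space :: "(complex^'n^'n) set \<Rightarrow> (complex^'n) set \<Rightarrow> (complex^'n) set topology" where
  "orbit_space W Y =
     topology (\<lambda>U. U \<subseteq> orbit W ` Y \<and> openin (top_of_set Y) {y \<in> Y. orbit W y \<in> U})"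

lemma istopology_orbit_space:
  "istopology (\<lambda>U. U \<subseteq> orbit W ` Y \<and> openin (top_of_set Y) {y \<in> Y. orbit W y \<in> U})"
proof -
  have "{y \<in> Y. orbit W y \<in> S \<inter> T} = {y \<in> Y. orbit W y \<in> S} \<inter> {y \<in> Y. orbit W y \<in> T}" for S T
    by auto
  moreover have "{y \<in> Y. orbit W y \<in> \<Union>\<K>} = (\<Union>U\<in>\<K>. {y \<in> Y. orbit W y \<in> U})" for \<K>
    by auto
  ultimately show ?thesis
    unfolding istopology_def by (auto intro!: openin_Union openin_Int)
qed

lemma openin_orbit_space:
  "openin (orbit_space W Y) U \<longleftrightarrow>
     U \<subseteq> orbit W ` Y \<and> openin (top_of_set Y) {y \<in> Y. orbit W y \<in> U}"
  unfolding orbit_space_def topology_inverse'[OF istopology_orbit_space] ..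

lemma topspace_orbit_space: "topspace (orbit_space W Y) = orbit W ` Y"
proof
  show "topspace (orbit_space W Y) \<subseteq> orbit W ` Y"
    using openin_orbit_space openin_topspace by blast
  have "{y \<in> Y. orbit W y \<in> orbit W ` Y} = Y"
    by auto
  then have "openin (orbit_space W Y) (orbit W ` Y)"
    by (simp add: openin_orbit_space)
  then show "orbit W ` Y \<subseteq> topspace (orbit_space W Y)"
    by (rule openin_subset)
qed

lemma quotient_map_orbit: "quotient_map (top_of_set Y) (orbit_space W Y) (orbit W)"
  unfolding quotient_map_def topspace_orbit_space openin_orbit_space by auto


section \<open>Monodromy\<close>

definition h_times :: "complex^'m^'m \<Rightarrow> complex fps^'m^'m" where
  "h_times A = (\<chi> i j. fps_X * fps_const (A $ i $ j))"

text \<open>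
  \<open>dF = h \<omega> F\<close> on \<open>U\<close> for \<open>F\<close> with values in matrices over \<open>\<complex>[[h]]\<close>, read off on the coefficient of
  each power of \<open>h\<close> in each entry.
\<close>

definition solves_on ::
  "('n, 'm) matrix_form \<Rightarrow> (complex^'n) set \<Rightarrow> (complex^'n \<Rightarrow> complex fps^'m^'m) \<Rightarrow> bool" where
  "solves_on \<omega> U F \<longleftrightarrow>
     (\<forall>x\<in>U. \<forall>i j k.
        ((\<lambda>y. fps_nth (F y $ i $ j) k) has_derivative
         (\<lambda>v. fps_nth ((h_times (\<omega> x v) ** F x) $ i $ j) k)) (at x))"

text \<open>
  \<open>\<Phi>\<close> is a solution along the (continuous) path \<open>\<gamma>\<close>: near every parameter it is the pullback of a
  solution on an open subset of \<open>X\<close>.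
\<close>

definition solution_along ::
  "('n, 'm) matrix_form \<Rightarrow> (complex^'n) set \<Rightarrow> (real \<Rightarrow> complex^'n) \<Rightarrow>
   (real \<Rightarrow> complex fps^'m^'m) \<Rightarrow> bool" where
  "solution_along \<omega> X \<gamma> \<Phi> \<longleftrightarrow>
     (\<forall>t\<in>{0..1}. \<exists>U F. open U \<and> \<gamma> t \<in> U \<and> U \<subseteq> X \<and> solves_on \<omega> U F \<and>
        (\<forall>\<^sub>F s in nhds t. s \<in> {0..1} \<longrightarrow> \<Phi> s = F (\<gamma> s)))"

definition transport ::
  "('n, 'm) matrix_form \<Rightarrow> (complex^'n) set \<Rightarrow> (real \<Rightarrow> complex^'n) \<Rightarrow> complex fps^'m^'m" where
  "transport \<omega> X \<gamma> =
     (THE M. \<exists>\<Phi>. solution_along \<omega> X \<gamma> \<Phi> \<and> \<Phi> 0 = mat 1 \<and> \<Phi> 1 = M)"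

definition to_laurent :: "complex fps^'m^'m \<Rightarrow> complex fls^'m^'m" where
  "to_laurent A = (\<chi> i j. fps_to_fls (A $ i $ j))"

definition const_laurent :: "complex^'m^'m \<Rightarrow> complex fls^'m^'m" where
  "const_laurent A = (\<chi> i j. fls_const (A $ i $ j))"

definition pure_monodromy ::
  "('n, 'm) matrix_form \<Rightarrow> (complex^'n) set \<Rightarrow> (real \<Rightarrow> complex^'n) set \<Rightarrow> complex fls^'m^'m" where
  "pure_monodromy \<omega> X c = (THE M. \<exists>\<gamma>\<in>c. M = to_laurent (transport \<omega> X \<gamma>))"

text \<open>
  \<open>R\<close> is the monodromy representation of the fundamental group of \<open>X/W\<close> at the orbit of \<open>z\<close>: the class
  of a path \<open>\<gamma>\<close> in \<open>X\<close> from \<open>z\<close> to \<open>w\<^sup>-\<^sup>1 z\<close> is sent to \<open>w T\<^sub>\<gamma>\<close>, where \<open>w\<close> acts through \<open>\<sigma>\<close>. This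
  determines \<open>R\<close> on the whole group, since loops in \<open>X/W\<close> lift to such paths.
\<close>

definition braid_monodromy ::
  "(complex^'n^'n) set \<Rightarrow> (complex^'n^'n \<Rightarrow> complex^'m^'m) \<Rightarrow> ('n, 'm) matrix_form \<Rightarrow>
   (complex^'n) set \<Rightarrow> complex^'n \<Rightarrow> ((real \<Rightarrow> (complex^'n) set) set \<Rightarrow> complex fls^'m^'m) \<Rightarrow> bool" where
  "braid_monodromy W \<sigma> \<omega> X z R \<longleftrightarrow>
     (\<forall>w\<in>W. \<forall>\<gamma>. path \<gamma> \<and> path_image \<gamma> \<subseteq> X \<and> pathstart \<gamma> = z \<and> pathfinish \<gamma> = matrix_inv w *v z \<longrightarrow>
        R (path_class (orbit_space W X) (orbit W \<circ> \<gamma>)) =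
          const_laurent (\<sigma> w) ** to_laurent (transport \<omega> X \<gamma>))"

definition isomorphic_reps ::
  "('g, 'e) monoid_scheme \<Rightarrow> ('g \<Rightarrow> 'a::field^'m^'m) \<Rightarrow> ('g \<Rightarrow> 'a^'m^'m) \<Rightarrow> bool" where
  "isomorphic_reps G R R' \<longleftrightarrow>
     R \<in> hom G GL \<and> R' \<in> hom G GL \<and>
     (\<exists>M\<in>carrier GL. \<forall>g\<in>carrier G. M ** R g = R' g ** M)"


section \<open>Embeddings of the braid groups of a parabolic subgroup\<close>

definition hermitian_inner :: "(complex^'n \<Rightarrow> complex^'n \<Rightarrow> complex) \<Rightarrow> bool" where
  "hermitian_inner \<phi> \<longleftrightarrow>
     (\<forall>x y z. \<phi> (x + y) z = \<phi> x z + \<phi> y z) \<and>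
     (\<forall>c x y. \<phi> (c *s x) y = c * \<phi> x y) \<and>
     (\<forall>x y. \<phi> y x = cnj (\<phi> x y)) \<and>
     (\<forall>x. x \<noteq> 0 \<longrightarrow> Re (\<phi> x x) > 0)"

definition invariant_hermitian ::
  "(complex^'n^'n) set \<Rightarrow> (complex^'n \<Rightarrow> complex^'n \<Rightarrow> complex) \<Rightarrow> bool" where
  "invariant_hermitian W \<phi> \<longleftrightarrow>
     hermitian_inner \<phi> \<and> (\<forall>w\<in>W. \<forall>x y. \<phi> (w *v x) (w *v y) = \<phi> x y)"

definition hermitian_norm :: "(complex^'n \<Rightarrow> complex^'n \<Rightarrow> complex) \<Rightarrow> complex^'n \<Rightarrow> real" where
  "hermitian_norm \<phi> x = sqrt (Re (\<phi> x x))"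

text \<open>
  The first two composed factors move the base point of \<open>P\<^sub>0\<close> to \<open>x\<^sub>2\<close> along \<open>\<beta>\<^sub>0\<close> and pull back along
  the isomorphism induced by the inclusion of \<open>X \<inter> \<Omega>\<close> in \<open>X\<^sub>0\<close>; the last one moves the base point
  \<open>x\<^sub>2\<close> of \<open>P\<close> back along \<open>\<beta>\<close>.
\<close>

definition pure_embedding ::
  "(complex^'n) set \<Rightarrow> (complex^'n) set \<Rightarrow> (complex^'n) set \<Rightarrow> complex^'n \<Rightarrow>
   (real \<Rightarrow> complex^'n) \<Rightarrow> (real \<Rightarrow> complex^'n) \<Rightarrow>
   (real \<Rightarrow> complex^'n) set \<Rightarrow> (real \<Rightarrow> complex^'n) set" where
  "pure_embedding X X0 \<Omega> x2 \<beta>0 \<beta> =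
     pi1_rebase (top_of_set X) \<beta> \<circ>
     pi1_map (top_of_set X) id \<circ>
     inv_into (carrier (fundamental_group (top_of_set (X \<inter> \<Omega>)) x2)) (pi1_map (top_of_set X0) id) \<circ>
     pi1_rebase (top_of_set X0) (path_reverse \<beta>0)"

text \<open>
  The same on orbit spaces. The inclusion of \<open>X \<inter> \<Omega>\<close> in \<open>X\<^sub>0\<close> sends each \<open>W\<^sub>0\<close>-orbit to itself, and
  the one in \<open>X\<close> sends a \<open>W\<^sub>0\<close>-orbit to the \<open>W\<close>-orbit containing it.
\<close>

definition braid_embedding ::
  "(complex^'n^'n) set \<Rightarrow> (complex^'n^'n) set \<Rightarrow>
   (complex^'n) set \<Rightarrow> (complex^'n) set \<Rightarrow> (complex^'n) set \<Rightarrow> complex^'n \<Rightarrow>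
   (real \<Rightarrow> complex^'n) \<Rightarrow> (real \<Rightarrow> complex^'n) \<Rightarrow>
   (real \<Rightarrow> (complex^'n) set) set \<Rightarrow> (real \<Rightarrow> (complex^'n) set) set" where
  "braid_embedding W W0 X X0 \<Omega> x2 \<beta>0 \<beta> =
     pi1_rebase (orbit_space W X) (orbit W \<circ> \<beta>) \<circ>
     pi1_map (orbit_space W X) (\<lambda>Q. \<Union>x\<in>Q. orbit W x) \<circ>
     inv_into (carrier (fundamental_group (orbit_space W0 (X \<inter> \<Omega>)) (orbit W0 x2)))
       (pi1_map (orbit_space W0 X0) id) \<circ>
     pi1_rebase (orbit_space W0 X0) (path_reverse (orbit W0 \<circ> \<beta>0))"

end

theory Submission
  imports Defs "HOL-Complex_Analysis.Great_Picard"
begin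

text \<open>
  Near a point \<open>x\<^sub>1\<close> of \<open>I\<close> on no hyperplane outside \<open>\<A>\<^sub>0\<close>, the forms \<open>\<omega>\<^sub>\<rho>\<close> and \<open>\<omega>\<^sub>0\<close> have the same
  singular part. The equation \<open>dP = h(\<omega>\<^sub>\<rho> P - P \<omega>\<^sub>0)\<close> therefore has a formal solution
  \<open>P = 1 + O(h)\<close> whose coefficients are obtained one after the other by integration along rays
  from \<open>x\<^sub>1\<close>: the integrands are closed by flatness, and they stay bounded along the
  rays because \<open>\<omega>\<^sub>\<rho> - \<omega>\<^sub>0\<close> is regular near \<open>x\<^sub>1\<close> and the coefficients of positive order vanish at
  \<open>x\<^sub>1\<close>, which compensates the simple poles. Since \<open>P\<close> carries solutions
  for \<open>\<omega>\<^sub>0\<close> to solutions for \<open>\<omega>\<^sub>\<rho>\<close> on \<open>X \<inter> \<Omega>\<close>, the two transports along a loop in \<open>X \<inter> \<Omega>\<close> are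
  conjugate by \<open>P(x\<^sub>2)\<close>, and every loop of \<open>X\<^sub>0\<close> can be contracted radially into \<open>X \<inter> \<Omega>\<close>. The
  construction of \<open>P\<close> is \<open>W\<^sub>0\<close>-equivariant, and loops in the orbit spaces lift to paths, so the same
  matrix intertwines the two representations of \<open>B\<^sub>0\<close>.
\<close>

section \<open>Integration along rays\<close>

text \<open>In general \<open>X \<inter> \<Omega>\<close> is not simply connected, so a closed form
  there need not have a single-valued primitive. The normalization at \<open>x1\<close> replaces a
  choice of branch: \<open>X \<inter> \<Omega>\<close> lies in an open set
  \<open>cone_domain\<close> that is stable under contraction to \<open>x1\<close>, and every point
  is reached by exactly one ray. The price is that \<open>x1\<close> lies on all hyperplanes of
  \<A>0, hence usually outside the domain, and the integrals are improper. The induction is carried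
  by two growth rates along a ray with parameter \<open>s\<close>: the connection is O(1/s) on all
  matrices but O(1) on the identity, and a coefficient of positive order is O(s). Centred at a point
  off all hyperplanes, the same construction solves \<open>dF = h \<omega> F\<close> on balls, and
  parallel transport is built on this. Flatness needs no differentiation, since each
  \<open>d log b\<close> is closed; what remains is \<open>\<omega> \<and> \<omega> = 0\<close>,
  obtained by averaging Arnold's relation over pencils of hyperplanes. Loops in orbit spaces are
  lifted by regarding a path of orbits as a finite-valued map of the interval that varies
  continuously in the Hausdorff distance.\<close>

definition radial_integral :: "(real \<Rightarrow> 'b::banach) \<Rightarrow> 'b" where
  "radial_integral f = lim (\<lambda>n. integral {1 / real (Suc n)..1} f)"

text \<open>The integrand is controlled only on the half-open interval. Boundedness makes the piece
  from \<open>1 / (n+1)\<close> to \<open>1 / (m+1)\<close> at most \<open>C / (m+1)\<close>, so the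
  truncated integrals are Cauchy. The bound \<open>C\<close> on the limit is what later gives the
  linear decay of the coefficients towards \<open>x1\<close>.\<close>

lemma radial_integral_limit:
  fixes f :: "real \<Rightarrow> 'b::banach"
  assumes cont: "continuous_on {0<..1} f" and bound: "\<And>s. 0 < s \<Longrightarrow> s \<le> 1 \<Longrightarrow> norm (f s) \<le> C"
  shows "(\<lambda>n. integral {1 / real (Suc n)..1} f) \<longlonglongrightarrow> radial_integral f"
    and "norm (radial_integral f) \<le> C"
proof -
  let ?I = "\<lambda>n. integral {1 / real (Suc n)..1} f"
  have C0: "0 \<le> C" using bound[of 1] norm_ge_zero[of "f 1"] by linarith
  have int: "f integrable_on {a..b}" if "0 < a" "b \<le> 1" for a b
    by (rule integrable_continuous_real, rule continuous_on_subset[OF cont]) (use that in auto)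
  have bd: "norm (integral {a..b} f) \<le> C * (b - a)" if "0 < a" "a \<le> b" "b \<le> 1" for a b
    by (rule integral_bound[OF that(2)])
      (use that bound in \<open>auto intro!: continuous_on_subset[OF cont]\<close>)
  have diff: "norm (?I m - ?I n) \<le> C * (1 / real (Suc m))" if "m \<le> n" for m n
  proof -
    have le: "1 / real (Suc n) \<le> 1 / real (Suc m)"
      using that by (simp add: frac_le)
    have "?I n = integral {1 / real (Suc n)..1 / real (Suc m)} f + ?I m"
      by (rule Henstock_Kurzweil_Integration.integral_combine[symmetric]) (use le int in auto)
    then have "norm (?I m - ?I n) = norm (integral {1 / real (Suc n)..1 / real (Suc m)} f)"
      by (simp add: norm_minus_commute)
    also have "\<dots> \<le> C * (1 / real (Suc m) - 1 / real (Suc n))"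
      by (rule bd) (use le in auto)
    also have "\<dots> \<le> C * (1 / real (Suc m))"
      using C0 by (intro mult_left_mono) auto
    finally show ?thesis .
  qed
  have "Cauchy ?I"
  proof (rule CauchyI')
    fix e :: real assume "e > 0"
    obtain M where M: "C / e < real (Suc M)"
      by (metis reals_Archimedean2 lessI of_nat_less_iff order_less_trans)
    then have MC: "C * (1 / real (Suc M)) < e"
      using \<open>e > 0\<close> by (simp add: field_simps)
    show "\<exists>M. \<forall>m\<ge>M. \<forall>n>m. dist (?I m) (?I n) < e"
    proof (intro exI allI impI)
      fix m n assume mn: "M \<le> m" "m < n"
      have "norm (?I m - ?I n) \<le> C * (1 / real (Suc m))"
        using diff mn by simp
      also have "\<dots> \<le> C * (1 / real (Suc M))"
        using C0 mn by (intro mult_left_mono) (auto simp: frac_le)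
      finally show "dist (?I m) (?I n) < e"
        using MC by (simp add: dist_norm)
    qed
  qed
  then have "convergent ?I" by (simp add: Cauchy_convergent_iff)
  then show lim: "?I \<longlonglongrightarrow> radial_integral f"
    unfolding radial_integral_def by (simp add: convergent_LIMSEQ_iff)
  have "norm (?I n) \<le> C" for n
  proof -
    have "norm (?I n) \<le> C * (1 - 1 / real (Suc n))"
      by (rule bd) auto
    also have "\<dots> \<le> C * 1"
      using C0 by (intro mult_left_mono) auto
    finally show ?thesis by simp
  qed
  then show "norm (radial_integral f) \<le> C"
    by (intro LIMSEQ_le_const2[OF tendsto_norm[OF lim]]) auto
qed

lemma radial_integral_linear:
  fixes f :: "real \<Rightarrow> 'b::banach" and L :: "'b \<Rightarrow> 'c::banach"
  assumes L: "bounded_linear L" and cont: "continuous_on {0<..1} f"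
    and bound: "\<And>s. 0 < s \<Longrightarrow> s \<le> 1 \<Longrightarrow> norm (f s) \<le> C"
  shows "radial_integral (\<lambda>s. L (f s)) = L (radial_integral f)"
proof -
  have "integral {1 / real (Suc n)..1} (\<lambda>s. L (f s)) = L (integral {1 / real (Suc n)..1} f)" for n
  proof -
    have "{1 / real (Suc n)..1} \<subseteq> {0<..1}"
    proof
      fix s assume "s \<in> {1 / real (Suc n)..1}"
      moreover have "0 < 1 / real (Suc n)" by simp
      ultimately show "s \<in> {0<..1}" by (metis atLeastAtMost_iff greaterThanAtMost_iff order_less_le_trans)
    qed
    then show ?thesis
      using integral_linear[OF integrable_continuous_real[OF continuous_on_subset[OF cont]] L]
      by (simp add: o_def)
  qed
  then have "(\<lambda>n. integral {1 / real (Suc n)..1} (\<lambda>s. L (f s))) \<longlonglongrightarrow> L (radial_integral f)"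
    using bounded_linear.tendsto[OF L radial_integral_limit(1)[OF cont bound]] by simp
  then show ?thesis
    unfolding radial_integral_def by (rule limI)
qed

lemma radial_derivative_scale:
  fixes \<eta> :: "'a::euclidean_space \<Rightarrow> 'a \<Rightarrow> 'b::euclidean_space"
  assumes der: "((\<lambda>x. \<eta> x v) has_derivative D) (at (x1 + s *\<^sub>R (x - x1)))"
  shows "((\<lambda>s. s *\<^sub>R \<eta> (x1 + s *\<^sub>R (x - x1)) v) has_vector_derivative
      (\<eta> (x1 + s *\<^sub>R (x - x1)) v + s *\<^sub>R D (x - x1))) (at s within S)"
proof -
  have D: "linear D" using der has_derivative_linear by blast
  have "((\<lambda>s. x1 + s *\<^sub>R (x - x1)) has_derivative (\<lambda>h. h *\<^sub>R (x - x1))) (at s within S)"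
    by (auto intro!: derivative_eq_intros)
  from has_derivative_compose[OF this der]
  have "((\<lambda>s. \<eta> (x1 + s *\<^sub>R (x - x1)) v) has_derivative (\<lambda>h. h *\<^sub>R D (x - x1))) (at s within S)"
    by (simp only: linear_scale[OF D])
  from has_derivative_scaleR[OF has_derivative_ident this]
  show ?thesis
    unfolding has_vector_derivative_def
    by (simp add: scaleR_add_right mult.commute add.commute)
qed

text \<open>
  With \<open>x\<^sub>s = x1 + s(x - x1)\<close>, closedness of \<open>\<eta>\<close> turns the derivative of \<open>\<eta>(x\<^sub>s)(x - x1)\<close> in
  direction \<open>v\<close> into \<open>d/ds (s \<eta>(x\<^sub>s)(v))\<close>.
\<close>

lemma radial_primitive_truncated:
  fixes \<eta> :: "'a::euclidean_space \<Rightarrow> 'a \<Rightarrow> 'b::euclidean_space"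
  assumes lin: "\<And>x. x \<in> U \<Longrightarrow> linear (\<eta> x)"
    and der: "\<And>x v. x \<in> U \<Longrightarrow> ((\<lambda>x. \<eta> x v) has_derivative (\<lambda>u. D x u v)) (at x)"
    and sym: "\<And>x u v. x \<in> U \<Longrightarrow> D x u v = D x v u"
    and contD: "\<And>u v. continuous_on U (\<lambda>x. D x u v)"
    and S: "convex S" "S \<subseteq> U" "x \<in> S"
    and cone: "\<And>x s. x \<in> S \<Longrightarrow> 0 < s \<Longrightarrow> s \<le> 1 \<Longrightarrow> x1 + s *\<^sub>R (x - x1) \<in> U"
    and \<epsilon>: "0 < \<epsilon>" "\<epsilon> \<le> 1"
  shows "((\<lambda>x. integral {\<epsilon>..1} (\<lambda>s. \<eta> (x1 + s *\<^sub>R (x - x1)) (x - x1))) has_derivative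
     (\<lambda>v. \<eta> x v - \<epsilon> *\<^sub>R \<eta> (x1 + \<epsilon> *\<^sub>R (x - x1)) v)) (at x within S)"
proof -
  let ?p = "\<lambda>x s. x1 + s *\<^sub>R (x - x1)"
  let ?f = "\<lambda>x s. \<eta> (?p x s) (x - x1)"
  \<comment> \<open>\<open>leibniz_rule\<close> takes the derivative in the space of bounded linear
    maps, hence \<open>Blinfun\<close>; its continuity is then checked on basis vectors.\<close>
  let ?df = "\<lambda>x s. Blinfun (\<lambda>v. \<eta> (?p x s) v + s *\<^sub>R D (?p x s) v (x - x1))"
  have linD: "linear (\<lambda>u. D y u v)" if "y \<in> U" for y v
    using der[OF that] has_derivative_linear by blast
  have pU: "?p x s \<in> U" if "x \<in> S" "s \<in> {\<epsilon>..1}" for x s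
    using cone[OF that(1), of s] that \<epsilon> by auto
  have bl: "bounded_linear (\<lambda>v. \<eta> y v + s *\<^sub>R D y v w)" if "y \<in> U" for y s w
    using linear_compose_add[OF lin[OF that] linear_compose_scale_right[OF linD[OF that]]]
    by (simp add: linear_linear)
  have df: "blinfun_apply (?df x s) v = \<eta> (?p x s) v + s *\<^sub>R D (?p x s) v (x - x1)"
    if "x \<in> S" "s \<in> {\<epsilon>..1}" for x s v
    using bl[OF pU[OF that]] by (simp add: bounded_linear_Blinfun_apply)
  have expand: "g w = (\<Sum>b\<in>Basis. (w \<bullet> b) *\<^sub>R g b)" if "linear g" for g :: "'a \<Rightarrow> 'b" and w
    using linear_sum[OF that, of "\<lambda>b. (w \<bullet> b) *\<^sub>R b" Basis] euclidean_representation[of w]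
    by (simp add: linear_scale[OF that])
  \<comment> \<open>\<open>der\<close> gives linearity of \<open>D\<close> in the direction of
    differentiation; symmetry carries it over to the other slot.\<close>
  have Dexp: "D y u w = (\<Sum>b\<in>Basis. (w \<bullet> b) *\<^sub>R D y u b)" if "y \<in> U" for y u w
    using expand[OF linD[OF that, of u], of w] sym[OF that] by simp
  have contP: "continuous_on T (Pair y)" for T and y :: 'a
    by (rule continuous_on_Pair[OF continuous_on_const continuous_on_id])
  have contp: "continuous_on (S \<times> {\<epsilon>..1}) (\<lambda>(x, s). ?p x s)"
    by (auto intro!: continuous_intros simp: case_prod_unfold)
  have cont\<eta>: "continuous_on U (\<lambda>x. \<eta> x v)" for v
    by (intro continuous_at_imp_continuous_on ballI has_derivative_continuous[OF der])
  have c1: "continuous_on (S \<times> {\<epsilon>..1}) (\<lambda>(x, s). \<eta> (?p x s) v)" for v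
    unfolding case_prod_unfold
    by (rule continuous_on_compose2[OF cont\<eta>])
      (use pU contp in \<open>auto simp: case_prod_unfold\<close>)
  have c2: "continuous_on (S \<times> {\<epsilon>..1}) (\<lambda>(x, s). D (?p x s) u v)" for u v
    unfolding case_prod_unfold
    by (rule continuous_on_compose2[OF contD])
      (use pU contp in \<open>auto simp: case_prod_unfold\<close>)
  have c3: "continuous_on (S \<times> {\<epsilon>..1}) (\<lambda>(x, s). D (?p x s) u (x - x1))" for u
  proof (rule continuous_on_eq)
    show "continuous_on (S \<times> {\<epsilon>..1})
        (\<lambda>z. \<Sum>b\<in>Basis. ((fst z - x1) \<bullet> b) *\<^sub>R D (?p (fst z) (snd z)) u b)"
      using c2 by (auto intro!: continuous_intros simp: case_prod_unfold)
    show "(\<Sum>b\<in>Basis. ((fst z - x1) \<bullet> b) *\<^sub>R D (?p (fst z) (snd z)) u b) =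
        (case z of (x, s) \<Rightarrow> D (?p x s) u (x - x1))" if "z \<in> S \<times> {\<epsilon>..1}" for z
      using Dexp[OF pU, of "fst z" "snd z" u "fst z - x1"] that by (auto simp: case_prod_unfold)
  qed
  have c4: "continuous_on (S \<times> {\<epsilon>..1}) (\<lambda>(x, s). ?f x s)"
  proof (rule continuous_on_eq)
    show "continuous_on (S \<times> {\<epsilon>..1})
        (\<lambda>z. \<Sum>b\<in>Basis. ((fst z - x1) \<bullet> b) *\<^sub>R \<eta> (?p (fst z) (snd z)) b)"
      using c1 by (auto intro!: continuous_intros simp: case_prod_unfold)
    show "(\<Sum>b\<in>Basis. ((fst z - x1) \<bullet> b) *\<^sub>R \<eta> (?p (fst z) (snd z)) b) =
        (case z of (x, s) \<Rightarrow> ?f x s)" if "z \<in> S \<times> {\<epsilon>..1}" for z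
      using expand[OF lin[OF pU], of "fst z" "snd z" "fst z - x1"] that by (auto simp: case_prod_unfold)
  qed
  have "((\<lambda>x. integral (cbox \<epsilon> 1) (?f x)) has_derivative integral (cbox \<epsilon> 1) (?df x)) (at x within S)"
  proof (rule leibniz_rule)
    fix y s assume ys: "y \<in> S" "s \<in> cbox \<epsilon> 1"
    then have ys': "s \<in> {\<epsilon>..1}" by simp
    have yU: "?p y s \<in> U" using pU ys by simp
    have a: "((\<lambda>x. \<eta> (?p x s) b) has_derivative (\<lambda>v. D (?p y s) (s *\<^sub>R v) b)) (at y within S)" for b
    proof -
      have "((\<lambda>x. ?p x s) has_derivative (\<lambda>v. s *\<^sub>R v)) (at y within S)"
        by (auto intro!: derivative_eq_intros)
      from has_derivative_compose[OF this der[OF yU]] show ?thesis .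
    qed
    have b: "((\<lambda>x. (\<Sum>b\<in>Basis. ((x - x1) \<bullet> b) *\<^sub>R \<eta> (?p x s) b)) has_derivative
       (\<lambda>v. \<Sum>b\<in>Basis. ((y - x1) \<bullet> b) *\<^sub>R D (?p y s) (s *\<^sub>R v) b + (v \<bullet> b) *\<^sub>R \<eta> (?p y s) b)) (at y within S)"
      by (rule has_derivative_sum, rule has_derivative_scaleR[OF _ a])
        (auto intro!: derivative_eq_intros)
    have c: "(\<lambda>v. \<Sum>b\<in>Basis. ((y - x1) \<bullet> b) *\<^sub>R D (?p y s) (s *\<^sub>R v) b + (v \<bullet> b) *\<^sub>R \<eta> (?p y s) b)
        = blinfun_apply (?df y s)"
    proof
      fix v
      show "(\<Sum>b\<in>Basis. ((y - x1) \<bullet> b) *\<^sub>R D (?p y s) (s *\<^sub>R v) b + (v \<bullet> b) *\<^sub>R \<eta> (?p y s) b)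
        = blinfun_apply (?df y s) v"
        unfolding df[OF ys(1) ys'] sum.distrib expand[OF lin[OF yU], of v] Dexp[OF yU, of v "y - x1"]
        by (simp add: linear_scale[OF linD[OF yU]] scaleR_sum_right mult.commute)
    qed
    show "((\<lambda>x. ?f x s) has_derivative blinfun_apply (?df y s)) (at y within S)"
    proof (rule has_derivative_transform_within[OF b[unfolded c] zero_less_one ys(1)])
      fix x' assume "x' \<in> S"
      then show "(\<Sum>b\<in>Basis. ((x' - x1) \<bullet> b) *\<^sub>R \<eta> (?p x' s) b) = ?f x' s"
        using expand[OF lin[OF pU[OF _ ys']], of x' "x' - x1"] by simp
    qed
  next
    fix y assume "y \<in> S"
    then have "continuous_on {\<epsilon>..1} (?f y)"
      using continuous_on_compose2[OF c4 contP, of y "{\<epsilon>..1}"] by auto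
    then show "?f y integrable_on cbox \<epsilon> 1"
      by (simp add: integrable_continuous_real)
  next
    show "continuous_on (S \<times> cbox \<epsilon> 1) (\<lambda>(x, s). ?df x s)"
    proof (rule continuous_on_blinfun_componentwise)
      fix b :: 'a assume "b \<in> Basis"
      show "continuous_on (S \<times> cbox \<epsilon> 1) (\<lambda>z. blinfun_apply (case z of (x, s) \<Rightarrow> ?df x s) b)"
      proof (rule continuous_on_eq)
        show "continuous_on (S \<times> cbox \<epsilon> 1)
          (\<lambda>z. \<eta> (?p (fst z) (snd z)) b + snd z *\<^sub>R D (?p (fst z) (snd z)) b (fst z - x1))"
          using c1[of b] c3[of b] by (auto intro!: continuous_intros simp: case_prod_unfold)
      qed (use df in auto)
    qed
  qed (use S in auto)
  moreover have "blinfun_apply (integral (cbox \<epsilon> 1) (?df x)) =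
      (\<lambda>v. \<eta> x v - \<epsilon> *\<^sub>R \<eta> (?p x \<epsilon>) v)"
  proof
    fix v
    show "blinfun_apply (integral (cbox \<epsilon> 1) (?df x)) v
        = \<eta> x v - \<epsilon> *\<^sub>R \<eta> (?p x \<epsilon>) v"
    proof -
    have contdf: "continuous_on {\<epsilon>..1} (?df x)"
    proof (rule continuous_on_blinfun_componentwise)
      fix b :: 'a assume "b \<in> Basis"
      have a1: "continuous_on {\<epsilon>..1} (\<lambda>s. \<eta> (?p x s) b)"
        using continuous_on_compose2[OF c1[of b] contP, of x "{\<epsilon>..1}"] S(3) by auto
      have a2: "continuous_on {\<epsilon>..1} (\<lambda>s. D (?p x s) b (x - x1))"
        using continuous_on_compose2[OF c3[of b] contP, of x "{\<epsilon>..1}"] S(3) by auto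
      show "continuous_on {\<epsilon>..1} (\<lambda>s. blinfun_apply (?df x s) b)"
        by (rule continuous_on_eq[of _ "\<lambda>s. \<eta> (?p x s) b + s *\<^sub>R D (?p x s) b (x - x1)"])
          (use df[OF S(3)] a1 a2 in \<open>auto intro!: continuous_intros\<close>)
    qed
    have "blinfun_apply (integral (cbox \<epsilon> 1) (?df x)) v
        = integral {\<epsilon>..1} (\<lambda>s. blinfun_apply (?df x s) v)"
      using integral_linear[OF integrable_continuous_real[OF contdf]
          blinfun.bounded_linear_left, of v]
      by (simp add: o_def)
    also have "\<dots> = integral {\<epsilon>..1} (\<lambda>s. \<eta> (?p x s) v + s *\<^sub>R D (?p x s) (x - x1) v)"
      by (rule Henstock_Kurzweil_Integration.integral_cong) (use df[OF S(3)] sym[OF pU[OF S(3)]] in auto)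
    also have "\<dots> = 1 *\<^sub>R \<eta> (?p x 1) v - \<epsilon> *\<^sub>R \<eta> (?p x \<epsilon>) v"
    proof (rule integral_unique, rule fundamental_theorem_of_calculus[OF \<epsilon>(2)])
      fix s assume "s \<in> {\<epsilon>..1}"
      then show "((\<lambda>s. s *\<^sub>R \<eta> (?p x s) v) has_vector_derivative
          \<eta> (?p x s) v + s *\<^sub>R D (?p x s) (x - x1) v) (at s within {\<epsilon>..1})"
        by (rule radial_derivative_scale[OF der[OF pU[OF S(3)]]])
    qed
    finally show ?thesis by simp
    qed
  qed
  ultimately show ?thesis
    by simp
qed

text \<open>Truncation leaves the boundary term \<open>\<epsilon> *\<^sub>R \<eta> (x1 + \<epsilon>
  *\<^sub>R (x - x1)) v\<close>. The bound on \<eta>, uniform over the ball and over all its rays,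
  makes this term O(\<epsilon>) uniformly, so the derivatives converge uniformly and the limit may
  be differentiated.\<close>

lemma radial_primitive:
  fixes \<eta> :: "'a::euclidean_space \<Rightarrow> 'a \<Rightarrow> 'b::euclidean_space"
  assumes lin: "\<And>x. x \<in> U \<Longrightarrow> linear (\<eta> x)"
    and der: "\<And>x v. x \<in> U \<Longrightarrow> ((\<lambda>x. \<eta> x v) has_derivative (\<lambda>u. D x u v)) (at x)"
    and sym: "\<And>x u v. x \<in> U \<Longrightarrow> D x u v = D x v u"
    and contD: "\<And>u v. continuous_on U (\<lambda>x. D x u v)"
    and cone: "\<And>x s. x \<in> U \<Longrightarrow> 0 < s \<Longrightarrow> s \<le> 1 \<Longrightarrow> x1 + s *\<^sub>R (x - x1) \<in> U"
    and r: "0 < r" "ball x r \<subseteq> U"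
    and bound: "\<And>y s v. y \<in> ball x r \<Longrightarrow> 0 < s \<Longrightarrow> s \<le> 1 \<Longrightarrow>
        norm (\<eta> (x1 + s *\<^sub>R (y - x1)) v) \<le> C * norm v"
  shows "((\<lambda>x. radial_integral (\<lambda>s. \<eta> (x1 + s *\<^sub>R (x - x1)) (x - x1))) has_derivative \<eta> x) (at x)"
proof -
  let ?S = "ball x r"
  let ?f = "\<lambda>n x. integral {1 / real (Suc n)..1} (\<lambda>s. \<eta> (x1 + s *\<^sub>R (x - x1)) (x - x1))"
  let ?f' = "\<lambda>n x v. \<eta> x v - (1 / real (Suc n)) *\<^sub>R \<eta> (x1 + (1 / real (Suc n)) *\<^sub>R (x - x1)) v"
  have xS: "x \<in> ?S" using r by simp
  have conv: "(\<lambda>n. ?f n y) \<longlonglongrightarrow> radial_integral (\<lambda>s. \<eta> (x1 + s *\<^sub>R (y - x1)) (y - x1))"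
    if "y \<in> ?S" for y
  proof (rule radial_integral_limit(1))
    have yU: "y \<in> U" using that r by auto
    have cont\<eta>: "continuous_on U (\<lambda>x. \<eta> x v)" for v
      by (intro continuous_at_imp_continuous_on ballI has_derivative_continuous[OF der])
    show "continuous_on {0<..1} (\<lambda>s. \<eta> (x1 + s *\<^sub>R (y - x1)) (y - x1))"
      by (rule continuous_on_compose2[OF cont\<eta>]) (auto intro!: continuous_intros cone yU)
  qed (rule bound[OF that])
  have "\<exists>g. \<forall>y\<in>?S. (\<lambda>n. ?f n y) \<longlonglongrightarrow> g y \<and> (g has_derivative \<eta> y) (at y within ?S)"
  proof (rule has_derivative_sequence[where f = ?f and f' = ?f' and ?x0.0 = x,
      OF convex_ball _ _ xS conv[OF xS]])
    fix n y assume y: "y \<in> ?S"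
    show "(?f n has_derivative ?f' n y) (at y within ?S)"
      by (rule radial_primitive_truncated[OF lin der sym contD convex_ball r(2) y])
        (use cone r(2) in auto)
  next
    fix e :: real assume "e > 0"
    obtain M where "C / e < real M" using reals_Archimedean2 by blast
    then have M: "C \<le> e * real M" using \<open>e > 0\<close> by (simp add: field_simps)
    show "\<forall>\<^sub>F n in sequentially. \<forall>y\<in>?S. \<forall>v. norm (?f' n y v - \<eta> y v) \<le> e * norm v"
      unfolding eventually_sequentially
    proof (intro exI allI impI ballI)
      fix n y v assume n: "M \<le> n" and y: "y \<in> ?S"
      have "norm (?f' n y v - \<eta> y v)
          = 1 / real (Suc n) * norm (\<eta> (x1 + (1 / real (Suc n)) *\<^sub>R (y - x1)) v)"
        by simp
      also have "\<dots> \<le> 1 / real (Suc n) * (C * norm v)"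
        by (intro mult_left_mono bound[OF y]) auto
      also have "\<dots> \<le> 1 / real (Suc n) * (e * real (Suc n) * norm v)"
      proof (intro mult_left_mono mult_right_mono)
        have "e * real M \<le> e * real (Suc n)" using n \<open>e > 0\<close> by (intro mult_left_mono) auto
        then show "C \<le> e * real (Suc n)" using M by linarith
      qed auto
      finally show "norm (?f' n y v - \<eta> y v) \<le> e * norm v" by simp
    qed
  qed
  then obtain g where g: "\<And>y. y \<in> ?S \<Longrightarrow> (\<lambda>n. ?f n y) \<longlonglongrightarrow> g y"
    "\<And>y. y \<in> ?S \<Longrightarrow> (g has_derivative \<eta> y) (at y within ?S)" by blast
  have "g y = radial_integral (\<lambda>s. \<eta> (x1 + s *\<^sub>R (y - x1)) (y - x1))" if "y \<in> ?S" for y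
    using LIMSEQ_unique[OF g(1)[OF that] conv[OF that]] .
  from has_derivative_transform_within_open[OF g(2)[OF xS, unfolded at_within_open[OF xS open_ball]]
      open_ball xS this]
  show ?thesis .
qed

section \<open>Formal solutions along rays, order by order\<close>

lemma linear_expansion:
  fixes g :: "'a::euclidean_space \<Rightarrow> 'b::real_vector"
  assumes "linear g"
  shows "g w = (\<Sum>b\<in>Basis. (w \<bullet> b) *\<^sub>R g b)"
  using linear_sum[OF assms, of "\<lambda>b. (w \<bullet> b) *\<^sub>R b" Basis] euclidean_representation[of w]
  by (simp add: linear_scale[OF assms])

text \<open>The equation \<open>dP = h \<Theta> P\<close> determines the coefficient of order
  \<open>k + 1\<close> from that of order \<open>k\<close> alone, so a plain recursion replaces a
  fixed-point argument. The constant \<open>e\<close> is the prescribed value of order zero.\<close>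

primrec radial_solution ::
  "'a::euclidean_space \<Rightarrow> ('a \<Rightarrow> 'a \<Rightarrow> 'b \<Rightarrow> 'b) \<Rightarrow> 'b::euclidean_space \<Rightarrow> nat \<Rightarrow> 'a \<Rightarrow> 'b" where
  "radial_solution x1 \<Theta> e 0 x = e"
| "radial_solution x1 \<Theta> e (Suc k) x =
     radial_integral (\<lambda>s. \<Theta> (x1 + s *\<^sub>R (x - x1)) (x - x1) (radial_solution x1 \<Theta> e k (x1 + s *\<^sub>R (x - x1))))"

text \<open>The values of \<Theta> are endomorphisms because the gauge equation acts by
  \<open>p \<mapsto> \<omega> p - p \<omega>0\<close>. Flatness of \<open>h \<Theta>\<close> splits
  by powers of \<open>h\<close> into \<open>closed_form\<close> (order one) and
  \<open>commute\<close> (order two). In \<open>growth\<close>, the factor \<open>1 / s\<close> is a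
  simple pole at \<open>x1\<close>, absent on the initial value \<open>e\<close>.\<close>

locale radial_connection =
  fixes U :: "'a::euclidean_space set" and x1 :: 'a
    and \<Theta> :: "'a \<Rightarrow> 'a \<Rightarrow> 'b \<Rightarrow> 'b::euclidean_space"
    and D :: "'a \<Rightarrow> 'a \<Rightarrow> 'a \<Rightarrow> 'b \<Rightarrow> 'b" and e :: 'b
  assumes linear_left: "x \<in> U \<Longrightarrow> linear (\<lambda>v. \<Theta> x v p)"
    and linear_right: "x \<in> U \<Longrightarrow> linear (\<Theta> x v)"
    and linear_D: "x \<in> U \<Longrightarrow> linear (D x u v)"
    and derivative: "x \<in> U \<Longrightarrow> ((\<lambda>x. \<Theta> x v p) has_derivative (\<lambda>u. D x u v p)) (at x)"
    and closed_form: "x \<in> U \<Longrightarrow> D x u v p = D x v u p"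
    and continuous_D: "continuous_on U (\<lambda>x. D x u v p)"
    and commute: "x \<in> U \<Longrightarrow> \<Theta> x u (\<Theta> x v p) = \<Theta> x v (\<Theta> x u p)"
    and cone: "x \<in> U \<Longrightarrow> 0 < s \<Longrightarrow> s \<le> 1 \<Longrightarrow> x1 + s *\<^sub>R (x - x1) \<in> U"
    and growth: "x \<in> U \<Longrightarrow> \<exists>r>0. \<exists>C. ball x r \<subseteq> U \<and>
      (\<forall>y\<in>ball x r. \<forall>s\<in>{0<..1}. \<forall>v p.
        norm (\<Theta> (x1 + s *\<^sub>R (y - x1)) v p) \<le> C / s * norm v * norm p \<and>
        norm (\<Theta> (x1 + s *\<^sub>R (y - x1)) v e) \<le> C * norm v)"
begin

abbreviation P :: "nat \<Rightarrow> 'a \<Rightarrow> 'b" where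
  "P \<equiv> radial_solution x1 \<Theta> e"

definition dP :: "nat \<Rightarrow> 'a \<Rightarrow> 'a \<Rightarrow> 'b" where
  "dP k x v = (case k of 0 \<Rightarrow> 0 | Suc j \<Rightarrow> \<Theta> x v (P j x))"

lemma P_0: "P 0 = (\<lambda>x. e)"
  and P_Suc: "P (Suc k) = (\<lambda>x. radial_integral (\<lambda>s. \<Theta> (x1 + s *\<^sub>R (x - x1)) (x - x1) (P k (x1 + s *\<^sub>R (x - x1)))))"
  by auto

lemma open_U: "open U"
  unfolding open_contains_ball using growth by meson

text \<open>The form \<open>v \<mapsto> \<Theta> x v (P k x)\<close> is closed: its derivative has a
  part with \<open>D\<close>, symmetric by \<open>closed_form\<close>, and a part
  \<open>\<Theta> x v (dP k x u)\<close>. The latter is symmetric by \<open>commute\<close>, because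
  \<open>dP k\<close> is zero or itself \<Theta> applied to the preceding coefficient. Hence the
  radial integral is a primitive.\<close>

lemma derivative_step:
  assumes P: "\<And>j x. j \<le> k \<Longrightarrow> x \<in> U \<Longrightarrow> (P j has_derivative dP j x) (at x)" and x: "x \<in> U"
    and r: "0 < r" "ball x r \<subseteq> U"
    and bound: "\<And>y s v. y \<in> ball x r \<Longrightarrow> 0 < s \<Longrightarrow> s \<le> 1 \<Longrightarrow>
      norm (\<Theta> (x1 + s *\<^sub>R (y - x1)) v (P k (x1 + s *\<^sub>R (y - x1)))) \<le> C * norm v"
  shows "(P (Suc k) has_derivative dP (Suc k) x) (at x)"
proof -
  have contP: "continuous_on U (P j)" if "j \<le> k" for j
    by (intro continuous_at_imp_continuous_on ballI has_derivative_continuous[OF P[OF that]])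
  have cont\<Theta>: "continuous_on U (\<lambda>x. \<Theta> x v p)" for v p
    by (intro continuous_at_imp_continuous_on ballI has_derivative_continuous[OF derivative])
  have "((\<lambda>x. radial_integral (\<lambda>s. \<Theta> (x1 + s *\<^sub>R (x - x1)) (x - x1) (P k (x1 + s *\<^sub>R (x - x1)))))
      has_derivative (\<lambda>v. \<Theta> x v (P k x))) (at x)"
  proof (rule radial_primitive[where D = "\<lambda>x u v. D x u v (P k x) + \<Theta> x v (dP k x u)",
        OF _ _ _ _ cone r])
    fix x assume x: "x \<in> U"
    show "linear (\<lambda>v. \<Theta> x v (P k x))" by (rule linear_left[OF x])
    fix v
    have "((\<lambda>y. \<Sum>b\<in>Basis. (P k y \<bullet> b) *\<^sub>R \<Theta> y v b) has_derivative
      (\<lambda>u. \<Sum>b\<in>Basis. (P k x \<bullet> b) *\<^sub>R D x u v b + (dP k x u \<bullet> b) *\<^sub>R \<Theta> x v b)) (at x)"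
      by (intro has_derivative_sum has_derivative_scaleR has_derivative_inner_left P[OF order_refl] x derivative)
    also have "(\<lambda>u. \<Sum>b\<in>Basis. (P k x \<bullet> b) *\<^sub>R D x u v b + (dP k x u \<bullet> b) *\<^sub>R \<Theta> x v b)
      = (\<lambda>u. D x u v (P k x) + \<Theta> x v (dP k x u))"
      unfolding sum.distrib linear_expansion[OF linear_D[OF x], symmetric]
        linear_expansion[OF linear_right[OF x], symmetric] ..
    finally show "((\<lambda>y. \<Theta> y v (P k y)) has_derivative (\<lambda>u. D x u v (P k x) + \<Theta> x v (dP k x u))) (at x)"
      by (rule has_derivative_transform_within_open[OF _ open_U x])
        (rule linear_expansion[OF linear_right, symmetric])
    fix u
    have "\<Theta> x v (dP k x u) = \<Theta> x u (dP k x v)"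
      using commute[OF x] linear_0[OF linear_right[OF x]] by (auto simp: dP_def split: nat.split)
    then show "D x u v (P k x) + \<Theta> x v (dP k x u) = D x v u (P k x) + \<Theta> x u (dP k x v)"
      using closed_form[OF x] by simp
  next
    fix u v
    have "continuous_on U (\<lambda>x. \<Sum>b\<in>Basis. (P k x \<bullet> b) *\<^sub>R D x u v b)"
      by (intro continuous_intros contP continuous_D) simp
    then have 1: "continuous_on U (\<lambda>x. D x u v (P k x))"
      by (rule continuous_on_eq) (rule linear_expansion[OF linear_D, symmetric])
    have 2: "continuous_on U (\<lambda>x. dP k x u)"
    proof (cases k)
      case 0
      then show ?thesis by (simp add: dP_def)
    next
      case (Suc j)
      have "continuous_on U (\<lambda>x. \<Sum>b\<in>Basis. (P j x \<bullet> b) *\<^sub>R \<Theta> x u b)"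
        by (intro continuous_intros contP cont\<Theta>) (simp add: Suc)
      then have "continuous_on U (\<lambda>x. \<Theta> x u (P j x))"
        by (rule continuous_on_eq) (rule linear_expansion[OF linear_right, symmetric])
      then show ?thesis by (simp add: dP_def Suc)
    qed
    have "continuous_on U (\<lambda>x. \<Sum>b\<in>Basis. (dP k x u \<bullet> b) *\<^sub>R \<Theta> x v b)"
      by (intro continuous_intros 2 cont\<Theta>)
    then have 3: "continuous_on U (\<lambda>x. \<Theta> x v (dP k x u))"
      by (rule continuous_on_eq) (rule linear_expansion[OF linear_right, symmetric])
    show "continuous_on U (\<lambda>x. D x u v (P k x) + \<Theta> x v (dP k x u))"
      by (intro continuous_intros 1 3)
  qed (use bound in auto)
  then show ?thesis
    unfolding dP_def P_Suc by simp
qed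

text \<open>The ray to \<open>x1 + s *\<^sub>R (y - x1)\<close> is an initial piece of the ray to
  \<open>y\<close>, run with tangent vector \<open>s *\<^sub>R (y - x1)\<close>. The integrand
  therefore carries a factor \<open>s\<close>.\<close>

lemma solution_growth:
  assumes "x \<in> U"
    and P: "\<And>x. x \<in> U \<Longrightarrow> continuous_on U (P k)"
    and bound: "\<And>y s v. y \<in> ball x r \<Longrightarrow> 0 < s \<Longrightarrow> s \<le> 1 \<Longrightarrow>
      norm (\<Theta> (x1 + s *\<^sub>R (y - x1)) v (P k (x1 + s *\<^sub>R (y - x1)))) \<le> C * norm v"
    and sub: "ball x r \<subseteq> U" and y: "y \<in> ball x r" and s: "0 < s" "s \<le> 1"
  shows "norm (P (Suc k) (x1 + s *\<^sub>R (y - x1))) \<le> C * (s * norm (y - x1))"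
proof -
  let ?y = "x1 + s *\<^sub>R (y - x1)"
  have eq: "x1 + t *\<^sub>R (?y - x1) = x1 + (t * s) *\<^sub>R (y - x1)" for t
    by simp
  have yU: "?y \<in> U" using cone s y sub by blast
  have cont\<Theta>: "continuous_on U (\<lambda>x. \<Theta> x v p)" for v p
    by (intro continuous_at_imp_continuous_on ballI has_derivative_continuous[OF derivative])
  have "continuous_on U (\<lambda>x. \<Sum>b\<in>Basis. (P k x \<bullet> b) *\<^sub>R \<Theta> x v b)" for v
    by (intro continuous_intros P[OF \<open>x \<in> U\<close>] cont\<Theta>)
  then have cont: "continuous_on U (\<lambda>x. \<Theta> x v (P k x))" for v
    by (rule continuous_on_eq) (rule linear_expansion[OF linear_right, symmetric])
  have "norm (radial_integral (\<lambda>t. \<Theta> (x1 + t *\<^sub>R (?y - x1)) (?y - x1) (P k (x1 + t *\<^sub>R (?y - x1)))))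
     \<le> C * (s * norm (y - x1))"
  proof (rule radial_integral_limit(2))
    show "continuous_on {0<..1} (\<lambda>t. \<Theta> (x1 + t *\<^sub>R (?y - x1)) (?y - x1) (P k (x1 + t *\<^sub>R (?y - x1))))"
      by (rule continuous_on_compose2[OF cont]) (auto intro!: continuous_intros cone[OF yU, simplified])
    fix t :: real assume t: "0 < t" "t \<le> 1"
    have ts: "0 < t * s" "t * s \<le> 1" using t s by (auto intro: mult_le_one)
    show "norm (\<Theta> (x1 + t *\<^sub>R (?y - x1)) (?y - x1) (P k (x1 + t *\<^sub>R (?y - x1)))) \<le> C * (s * norm (y - x1))"
      unfolding eq using bound[OF y ts, of "?y - x1"] s by simp
  qed
  then show ?thesis by simp
qed

text \<open>Differentiability and boundedness are proved in one induction: the derivative of order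
  \<open>k + 1\<close> uses the bound of order \<open>k\<close>, and that bound uses the decay of
  \<open>P k\<close>, which comes from the bound of order \<open>k - 1\<close>.\<close>

theorem solution:
  shows "x \<in> U \<Longrightarrow> (P (Suc k) has_derivative (\<lambda>v. \<Theta> x v (P k x))) (at x)"
    and "x \<in> U \<Longrightarrow> \<exists>r>0. \<exists>C. ball x r \<subseteq> U \<and> (\<forall>y\<in>ball x r. \<forall>s\<in>{0<..1}. \<forall>v.
      norm (\<Theta> (x1 + s *\<^sub>R (y - x1)) v (P k (x1 + s *\<^sub>R (y - x1)))) \<le> C * norm v)"
proof -
  let ?B = "\<lambda>k x r C. r > 0 \<and> ball x r \<subseteq> U \<and> (\<forall>y\<in>ball x r. \<forall>s\<in>{0<..1}. \<forall>v.
      norm (\<Theta> (x1 + s *\<^sub>R (y - x1)) v (P k (x1 + s *\<^sub>R (y - x1)))) \<le> C * norm v)"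
  have *: "\<forall>x\<in>U. (P (Suc k) has_derivative dP (Suc k) x) (at x) \<and> (\<exists>r C. ?B k x r C)" for k
  proof (induction k rule: less_induct)
    case (less k)
    have der: "(P j has_derivative dP j x) (at x)" if "j \<le> k" "x \<in> U" for j x
    proof (cases j)
      case 0
      then show ?thesis by (simp add: dP_def[abs_def] P_0 del: radial_solution.simps)
    next
      case (Suc i)
      then show ?thesis using less[of i] that by (simp del: radial_solution.simps)
    qed
    have cont: "continuous_on U (P j)" if "j \<le> k" for j
      by (intro continuous_at_imp_continuous_on ballI has_derivative_continuous[OF der[OF that]])
    show ?case
    proof
      fix x assume x: "x \<in> U"
      obtain r C where r: "r > 0" "ball x r \<subseteq> U" and C: "\<And>y s v p. y \<in> ball x r \<Longrightarrow> s \<in> {0<..1} \<Longrightarrow>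
          norm (\<Theta> (x1 + s *\<^sub>R (y - x1)) v p) \<le> C / s * norm v * norm p \<and>
          norm (\<Theta> (x1 + s *\<^sub>R (y - x1)) v e) \<le> C * norm v"
        using growth[OF x] by meson
      have "\<exists>r C. ?B k x r C"
      proof (cases k)
        case 0
        then show ?thesis using r C by (intro exI[of _ r] exI[of _ C]) auto
      next
        case (Suc j)
        obtain r' C' where B: "?B j x r' C'" using less[of j] x Suc by auto
        define \<delta> where "\<delta> = min r r'"
        have \<delta>: "\<delta> > 0" "ball x \<delta> \<subseteq> ball x r" "ball x \<delta> \<subseteq> ball x r'"
          using r B by (auto simp: \<delta>_def)
        \<comment> \<open>The factor \<open>C / s\<close> of the connection meets
          \<open>C' * s\<close> from the decay of \<open>P k\<close>, so \<open>s\<close> cancels;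
          \<open>norm (x - x1) + \<delta>\<close> bounds \<open>norm (y - x1)\<close> on the
          ball.\<close>
        have "norm (\<Theta> (x1 + s *\<^sub>R (y - x1)) v (P k (x1 + s *\<^sub>R (y - x1))))
            \<le> (\<bar>C\<bar> * (\<bar>C'\<bar> * (norm (x - x1) + \<delta>))) * norm v"
          if y: "y \<in> ball x \<delta>" and s: "s \<in> {0<..1}" for y s v
        proof -
          have "norm (P k (x1 + s *\<^sub>R (y - x1))) \<le> C' * (s * norm (y - x1))"
            unfolding Suc using \<delta> B y s cont[of j] Suc
            by (intro solution_growth[OF x]) auto
          also have "\<dots> \<le> \<bar>C'\<bar> * (s * norm (y - x1))"
            using s by (intro mult_right_mono) auto
          also have "\<dots> \<le> \<bar>C'\<bar> * (s * (norm (x - x1) + \<delta>))"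
          proof (intro mult_left_mono)
            have "y - x1 = (x - x1) + (y - x)" by simp
            then have "norm (y - x1) \<le> norm (x - x1) + norm (y - x)"
              by (metis norm_triangle_ineq)
            then show "norm (y - x1) \<le> norm (x - x1) + \<delta>"
              using y by (simp add: dist_norm norm_minus_commute)
          qed (use s in auto)
          finally have 1: "norm (P k (x1 + s *\<^sub>R (y - x1))) \<le> \<bar>C'\<bar> * (s * (norm (x - x1) + \<delta>))" .
          have "norm (\<Theta> (x1 + s *\<^sub>R (y - x1)) v (P k (x1 + s *\<^sub>R (y - x1))))
            \<le> C / s * norm v * norm (P k (x1 + s *\<^sub>R (y - x1)))"
            using C y s \<delta> by blast
          also have "\<dots> \<le> \<bar>C\<bar> / s * norm v * norm (P k (x1 + s *\<^sub>R (y - x1)))"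
            using s by (intro mult_right_mono divide_right_mono) auto
          also have "\<dots> \<le> \<bar>C\<bar> / s * norm v * (\<bar>C'\<bar> * (s * (norm (x - x1) + \<delta>)))"
            using s by (intro mult_left_mono 1) auto
          also have "\<dots> = (\<bar>C\<bar> * (\<bar>C'\<bar> * (norm (x - x1) + \<delta>))) * norm v"
            using s by simp
          finally show ?thesis .
        qed
        then show ?thesis using \<delta> r by blast
      qed
      then obtain r C where B: "?B k x r C" by blast
      then have "(P (Suc k) has_derivative dP (Suc k) x) (at x)"
        by (intro derivative_step[OF der x, of k r C]) auto
      then show "(P (Suc k) has_derivative dP (Suc k) x) (at x) \<and> (\<exists>r C. ?B k x r C)"
        using B by blast
    qed
  qed
  show "(P (Suc k) has_derivative (\<lambda>v. \<Theta> x v (P k x))) (at x)" if "x \<in> U" for x k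
    using * that by (simp add: dP_def[abs_def] del: radial_solution.simps)
  show "\<exists>r>0. \<exists>C. ball x r \<subseteq> U \<and> (\<forall>y\<in>ball x r. \<forall>s\<in>{0<..1}. \<forall>v.
      norm (\<Theta> (x1 + s *\<^sub>R (y - x1)) v (P k (x1 + s *\<^sub>R (y - x1)))) \<le> C * norm v)"
    if "x \<in> U" for x k
    using * that by meson
qed

text \<open>The tangent vector \<open>x - x1\<close> vanishes at the centre. This supplies the
  initial condition of local solutions when the centre lies in the domain.\<close>

lemma solution_at_center:
  assumes "x1 \<in> U" shows "P (Suc k) x1 = 0"
  using linear_0[OF linear_left[OF assms]] by (simp add: radial_integral_def limI)

text \<open>\<open>L\<close> is linear and fixes \<open>x1\<close>, so it maps the ray to
  \<open>x\<close> onto the ray to \<open>L x\<close> with the same parameter; \<open>M\<close> then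
  passes through each radial integral.\<close>

lemma solution_equivariant:
  assumes L: "linear L" "L x1 = x1" and M: "linear M" "M e = e"
    and \<Theta>: "\<And>x v p. x \<in> U \<Longrightarrow> \<Theta> (L x) (L v) (M p) = M (\<Theta> x v p)"
    and x: "x \<in> U"
  shows "P k (L x) = M (P k x)"
  using x
proof (induction k arbitrary: x)
  case (Suc k)
  let ?f = "\<lambda>s. \<Theta> (x1 + s *\<^sub>R (x - x1)) (x - x1) (P k (x1 + s *\<^sub>R (x - x1)))"
  have Lr: "L x - x1 = L (x - x1)" "x1 + s *\<^sub>R L (x - x1) = L (x1 + s *\<^sub>R (x - x1))" for s
    by (simp_all add: linear_add[OF L(1)] linear_diff[OF L(1)] linear_scale[OF L(1)] L(2))
  obtain r C where B: "r > 0" "ball x r \<subseteq> U" "\<And>s v. s \<in> {0<..1} \<Longrightarrow>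
      norm (\<Theta> (x1 + s *\<^sub>R (x - x1)) v (P k (x1 + s *\<^sub>R (x - x1)))) \<le> C * norm v"
    using solution(2)[OF Suc.prems, of k] centre_in_ball by metis
  have contP: "continuous_on U (P k)"
    by (cases k) (auto intro!: continuous_at_imp_continuous_on has_derivative_continuous[OF solution(1)]
        simp: P_0 simp del: radial_solution.simps)
  have cont\<Theta>: "continuous_on U (\<lambda>x. \<Theta> x v p)" for v p
    by (intro continuous_at_imp_continuous_on ballI has_derivative_continuous[OF derivative])
  have "continuous_on U (\<lambda>x. \<Sum>b\<in>Basis. (P k x \<bullet> b) *\<^sub>R \<Theta> x v b)" for v
    by (intro continuous_intros contP cont\<Theta>)
  then have cont: "continuous_on U (\<lambda>x. \<Theta> x v (P k x))" for v
    by (rule continuous_on_eq) (rule linear_expansion[OF linear_right, symmetric])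
  have contf: "continuous_on {0<..1} ?f"
    by (rule continuous_on_compose2[OF cont]) (auto intro!: continuous_intros cone[OF Suc.prems])
  have "P (Suc k) (L x) = radial_integral (\<lambda>s. \<Theta> (L (x1 + s *\<^sub>R (x - x1))) (L (x - x1)) (P k (L (x1 + s *\<^sub>R (x - x1)))))"
    unfolding P_Suc Lr ..
  also have "\<dots> = radial_integral (\<lambda>s. M (?f s))"
    unfolding radial_integral_def
  proof (rule arg_cong[where f = lim], intro ext Henstock_Kurzweil_Integration.integral_cong)
    fix n s assume s: "s \<in> {1 / real (Suc n)..1}"
    have "0 < 1 / real (Suc n)" by simp
    then have U: "x1 + s *\<^sub>R (x - x1) \<in> U"
      using s by (intro cone[OF Suc.prems]) (simp_all only: atLeastAtMost_iff, linarith)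
    show "\<Theta> (L (x1 + s *\<^sub>R (x - x1))) (L (x - x1)) (P k (L (x1 + s *\<^sub>R (x - x1)))) = M (?f s)"
      unfolding Suc.IH[OF U] \<Theta>[OF U] ..
  qed
  also have "\<dots> = M (radial_integral ?f)"
    by (rule radial_integral_linear[OF _ contf B(3)]) (use M in \<open>auto simp: linear_linear\<close>)
  finally show ?case by (simp add: P_Suc del: radial_solution.simps)
qed (simp add: M)

end

section \<open>Logarithmic forms of arrangements\<close>

lemma bounded_bilinear_matrix_mult:
  "bounded_bilinear ((**) :: complex^'m^'m \<Rightarrow> complex^'m^'m \<Rightarrow> complex^'m^'m)"
  unfolding bilinear_conv_bounded_bilinear[symmetric] bilinear_def
  by (auto intro!: linearI simp: matrix_add_ldistrib matrix_scalar_ac scalar_matrix_assoc[symmetric])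
    (simp_all add: matrix_matrix_mult_def vec_eq_iff algebra_simps sum.distrib scaleR_sum_right)

interpretation matrix_mult: bounded_bilinear "(**) :: complex^'m^'m \<Rightarrow> complex^'m^'m \<Rightarrow> complex^'m^'m"
  by (rule bounded_bilinear_matrix_mult)

text \<open>The scalar multiplication of the real vector space of matrices is by reals, whereas the
  coefficients \<open>b(v) / b(x) / (i pi)\<close> are complex.\<close>

definition cscale :: "complex \<Rightarrow> complex^'m^'m \<Rightarrow> complex^'m^'m" where
  "cscale c A = (\<chi> i j. c * A $ i $ j)"

lemma bounded_linear_cscale: "bounded_linear (\<lambda>c. cscale c A)"
  unfolding linear_conv_bounded_linear[symmetric]
  by (auto intro!: linearI simp: cscale_def vec_eq_iff algebra_simps)

lemma cscale_component: "cscale c A $ i $ j = c * A $ i $ j"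
  by (simp add: cscale_def)

lemma cscale_mult: "cscale a A ** cscale b B = cscale (a * b) (A ** B)"
  by (simp add: cscale_def matrix_matrix_mult_def vec_eq_iff sum_distrib_left mult_ac)

text \<open>The residues are a function of the hyperplane, detached from the representation, so that
  restricting the index set turns \<omega> into \<omega>0 with the same \<open>t\<close>.\<close>

definition log_form :: "(complex^'n) set set \<Rightarrow> ((complex^'n) set \<Rightarrow> complex^'m^'m) \<Rightarrow> ('n, 'm) matrix_form" where
  "log_form S t x v = (\<Sum>H\<in>S. cscale (linear_form_of H v / linear_form_of H x / (\<i> * of_real pi)) (t H))"

lemma log_form_entry:
  "log_form S t x v $ i $ j =
     1 / (\<i> * of_real pi) * (\<Sum>H\<in>S. t H $ i $ j * (linear_form_of H v / linear_form_of H x))"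
  by (simp add: log_form_def cscale_def sum_distrib_left mult_ac)

lemma holonomy_form_log_form: "holonomy_form \<A> \<rho> = log_form \<A> (\<lambda>H. \<rho> (holonomy_gen \<A> H))"
  by (intro ext) (simp add: vec_eq_iff holonomy_form_def log_form_entry)

text \<open>
  For linear forms \<open>a, b, c\<close> with \<open>Ker a \<inter> Ker b \<subseteq> Ker c\<close>, the forms
  \<open>d log a \<and> d log b\<close>, \<open>d log b \<and> d log c\<close> and \<open>d log c \<and> d log a\<close> sum to zero.
\<close>

lemma arnold_relation:
  fixes a b c :: "complex^'n \<Rightarrow> complex"
  assumes lin: "Vector_Spaces.linear (*s) (*) a" "Vector_Spaces.linear (*s) (*) b" "Vector_Spaces.linear (*s) (*) c"
    and ne: "a e1 = 1" "b e1 = 0" "a e2 = 0" "b e2 = 1"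
    and ker: "\<And>y. a y = 0 \<Longrightarrow> b y = 0 \<Longrightarrow> c y = 0"
    and x: "a x \<noteq> 0" "b x \<noteq> 0" "c x \<noteq> 0"
  shows "(a u / a x) * (b v / b x) - (b u / b x) * (a v / a x)
       = ((a u / a x) * (c v / c x) - (c u / c x) * (a v / a x))
       + ((c u / c x) * (b v / b x) - (b u / b x) * (c v / c x))"
proof -
  interpret a: Vector_Spaces.linear "(*s)" "(*)" a by fact
  interpret b: Vector_Spaces.linear "(*s)" "(*)" b by fact
  interpret c: Vector_Spaces.linear "(*s)" "(*)" c by fact
  have c: "c y = a y * c e1 + b y * c e2" for y
  proof -
    have "c (y - (a y *s e1 + b y *s e2)) = 0"
      by (rule ker) (simp_all add: a.diff a.add a.scale b.diff b.add b.scale ne)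
    then show ?thesis by (simp add: c.diff c.add c.scale)
  qed
  show ?thesis
    using x by (simp add: divide_simps) (simp add: c[of u] c[of v] c[of x] algebra_simps)
qed

text \<open>\<open>not_subset\<close> records that all members have the same codimension: it makes
  the forms of two distinct members linearly independent.\<close>

locale hyperplane_system =
  fixes S :: "(complex^'n) set set"
  assumes finite_S: "finite S"
    and linear_form: "H \<in> S \<Longrightarrow> Vector_Spaces.linear (*s) (*) (linear_form_of H)"
    and kernel: "H \<in> S \<Longrightarrow> linear_form_of H x = 0 \<longleftrightarrow> x \<in> H"
    and not_subset: "H \<in> S \<Longrightarrow> K \<in> S \<Longrightarrow> H \<subseteq> K \<Longrightarrow> H = K"
begin

lemma dual_vectors:
  assumes "H \<in> S" "K \<in> S" "H \<noteq> K"
  obtains e1 e2 where "linear_form_of H e1 = 1" "linear_form_of K e1 = 0"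
    "linear_form_of H e2 = 0" "linear_form_of K e2 = 1"
proof -
  interpret a: Vector_Spaces.linear "(*s)" "(*)" "linear_form_of H" by (rule linear_form[OF assms(1)])
  interpret b: Vector_Spaces.linear "(*s)" "(*)" "linear_form_of K" by (rule linear_form[OF assms(2)])
  obtain y where y: "y \<in> K" "y \<notin> H" using not_subset[of K H] assms by blast
  obtain z where z: "z \<in> H" "z \<notin> K" using not_subset[of H K] assms by blast
  show thesis
    by (rule that[of "inverse (linear_form_of H y) *s y" "inverse (linear_form_of K z) *s z"])
      (use y z kernel assms in \<open>simp_all add: a.scale b.scale\<close>)
qed

text \<open>The form of \<open>K\<close> is a combination of those of \<open>H\<close> and
  \<open>H'\<close>, and the coefficient of the latter is nonzero, since otherwise
  \<open>H \<subseteq> K\<close>. So a pencil is determined by any two of its members.\<close>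

lemma same_intersection:
  assumes "H \<in> S" "H' \<in> S" "K \<in> S" "H \<noteq> H'" "K \<noteq> H" "H \<inter> H' \<subseteq> K"
  shows "H \<inter> K = H \<inter> H'"
proof -
  interpret a: Vector_Spaces.linear "(*s)" "(*)" "linear_form_of H" by (rule linear_form[OF assms(1)])
  interpret b: Vector_Spaces.linear "(*s)" "(*)" "linear_form_of H'" by (rule linear_form[OF assms(2)])
  interpret c: Vector_Spaces.linear "(*s)" "(*)" "linear_form_of K" by (rule linear_form[OF assms(3)])
  obtain e1 e2 where e: "linear_form_of H e1 = 1" "linear_form_of H' e1 = 0"
    "linear_form_of H e2 = 0" "linear_form_of H' e2 = 1"
    by (rule dual_vectors[OF assms(1,2,4)])
  have c: "linear_form_of K y = linear_form_of H y * linear_form_of K e1 + linear_form_of H' y * linear_form_of K e2" for y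
  proof -
    have "y - (linear_form_of H y *s e1 + linear_form_of H' y *s e2) \<in> H \<inter> H'"
      by (simp add: kernel[OF assms(1), symmetric] kernel[OF assms(2), symmetric] a.diff a.add a.scale b.diff b.add b.scale e)
    then have "y - (linear_form_of H y *s e1 + linear_form_of H' y *s e2) \<in> K"
      using assms by blast
    then show ?thesis
      by (simp add: kernel[OF assms(3), symmetric] c.diff c.add c.scale)
  qed
  have "linear_form_of K e2 \<noteq> 0"
  proof
    assume "linear_form_of K e2 = 0"
    then have "linear_form_of K y = 0" if "linear_form_of H y = 0" for y using c[of y] that by simp
    then have "H \<subseteq> K" by (auto simp: kernel[OF assms(1), symmetric] kernel[OF assms(3), symmetric])
    then show False using not_subset[of H K] assms by simp
  qed
  then have "y \<in> H'" if "y \<in> H" "y \<in> K" for y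
    using c[of y] that
    by (simp add: kernel[OF assms(1), symmetric] kernel[OF assms(2), symmetric] kernel[OF assms(3), symmetric])
  then show ?thesis using assms by blast
qed

text \<open>\<open>w H K\<close> is the wedge of \<open>d log b_H\<close> and
  \<open>d log b_K\<close>. Arnold's relation, averaged over the pencil through
  \<open>H \<inter> K\<close>, writes \<open>w H K\<close> through \<open>w H L\<close> and
  \<open>w L K\<close>. With \<open>H\<close> and \<open>L\<close> fixed, summing over
  \<open>K\<close> in that pencil gives a multiple of \<open>rel\<close>, hence zero. So the sum of
  \<open>w H K * c H K\<close> vanishes, and by antisymmetry of \<open>c\<close> it is twice the sum
  in question.\<close>

lemma scalar_flatness:
  fixes c :: "(complex^'n) set \<Rightarrow> (complex^'n) set \<Rightarrow> complex"
  assumes anti: "\<And>H K. H \<in> S \<Longrightarrow> K \<in> S \<Longrightarrow> c H K = - c K H"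
    and rel: "\<And>H K. H \<in> S \<Longrightarrow> K \<in> S \<Longrightarrow> H \<noteq> K \<Longrightarrow> (\<Sum>L\<in>{L\<in>S. H \<inter> K \<subseteq> L}. c L H) = 0"
    and x: "x \<notin> \<Union>S"
  shows "(\<Sum>H\<in>S. \<Sum>K\<in>S. (linear_form_of H u / linear_form_of H x) * (linear_form_of K v / linear_form_of K x) * c H K) = 0"
proof -
  define a where "a H v = linear_form_of H v / linear_form_of H x" for H v
  define w where "w H K = a H u * a K v - a K u * a H v" for H K
  define N where "N Z = (of_nat (card {L\<in>S. Z \<subseteq> L}) :: complex)" for Z
  have wHH: "w H H = 0" for H by (simp add: w_def)
  have wanti: "w K H = - w H K" for H K by (simp add: w_def)
  have cHH: "c H H = 0" if "H \<in> S" for H using anti[OF that that] by simp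
  have N0: "N (H \<inter> K) \<noteq> 0" if "H \<in> S" for H K
    using that finite_S by (auto simp: N_def card_eq_0_iff)
  have arnold: "w H K = w H L + w L K" if HKL: "H \<in> S" "K \<in> S" "L \<in> S" "H \<noteq> K" "H \<inter> K \<subseteq> L" for H K L
  proof -
    obtain e1 e2 where e: "linear_form_of H e1 = 1" "linear_form_of K e1 = 0"
      "linear_form_of H e2 = 0" "linear_form_of K e2 = 1"
      by (rule dual_vectors[OF HKL(1,2,4)])
    show ?thesis
      unfolding w_def a_def
      by (rule arnold_relation[OF linear_form linear_form linear_form e])
        (use that x kernel in auto)
  qed
  \<comment> \<open>Dividing by the size \<open>N\<close> of the pencil treats all its members
    alike; the weight depends on the pencil only.\<close>
  have avg: "w H K = (\<Sum>L\<in>{L\<in>S. H \<inter> K \<subseteq> L}. w H L / N (H \<inter> K)) + (\<Sum>L\<in>{L\<in>S. H \<inter> K \<subseteq> L}. w L K / N (H \<inter> K))"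
    if "H \<in> S" "K \<in> S" "H \<noteq> K" for H K
  proof -
    have "(\<Sum>L\<in>{L\<in>S. H \<inter> K \<subseteq> L}. w H L / N (H \<inter> K)) + (\<Sum>L\<in>{L\<in>S. H \<inter> K \<subseteq> L}. w L K / N (H \<inter> K))
        = (\<Sum>L\<in>{L\<in>S. H \<inter> K \<subseteq> L}. w H K / N (H \<inter> K))"
      unfolding sum.distrib[symmetric]
    proof (rule sum.cong[OF HOL.refl])
      fix L assume "L \<in> {L\<in>S. H \<inter> K \<subseteq> L}"
      then show "w H L / N (H \<inter> K) + w L K / N (H \<inter> K) = w H K / N (H \<inter> K)"
        using arnold[of H K L] that by (simp add: add_divide_distrib)
    qed
    also have "\<dots> = w H K" using N0[OF that(1)] by (simp add: N_def)
    finally show ?thesis by simp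
  qed
  define q where "q H K L = (if H \<noteq> K \<and> H \<inter> K \<subseteq> L then w H L / N (H \<inter> K) * c H K else 0)" for H K L
  have half: "(\<Sum>H\<in>S. \<Sum>K\<in>S. \<Sum>L\<in>S. q H K L) = 0"
  proof -
    have "(\<Sum>K\<in>S. \<Sum>L\<in>S. q H K L) = 0" if H: "H \<in> S" for H
    proof -
      have "(\<Sum>K\<in>S. \<Sum>L\<in>S. q H K L) = (\<Sum>L\<in>S. \<Sum>K\<in>S. q H K L)" by (rule sum.swap)
      also have "\<dots> = (\<Sum>L\<in>S. 0)"
      proof (rule sum.cong[OF HOL.refl])
        fix L assume L: "L \<in> S"
        show "(\<Sum>K\<in>S. q H K L) = 0"
        proof (cases "L = H")
          case True
          then show ?thesis by (simp add: q_def wHH cong: if_cong)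
        next
          case False
          \<comment> \<open>For \<open>L \<noteq> H\<close> the condition that \<open>L\<close> lies
            in the pencil of \<open>H\<close> and \<open>K\<close> becomes the condition that
            \<open>K\<close> lies in the pencil of \<open>H\<close> and \<open>L\<close>, with the
            same weight. The extra term \<open>K = H\<close> on the right is harmless because
            \<open>c H H = 0\<close>.\<close>
          have "q H K L = (if H \<inter> L \<subseteq> K then w H L / N (H \<inter> L) * c H K else 0)" if K: "K \<in> S" for K
          proof (cases "K = H")
            case True
            then show ?thesis by (simp add: q_def cHH H)
          next
            case neq: False
            show ?thesis
            proof (cases "H \<inter> K \<subseteq> L")
              case True
              then have "H \<inter> L = H \<inter> K"
                using same_intersection[OF H K L] neq False by auto
              then show ?thesis using neq by (auto simp: q_def)
            next
              case no: False
              have "\<not> H \<inter> L \<subseteq> K"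
                using same_intersection[OF H L K] neq False no by auto
              then show ?thesis using no by (simp add: q_def)
            qed
          qed
          then have "(\<Sum>K\<in>S. q H K L) = (\<Sum>K\<in>{K\<in>S. H \<inter> L \<subseteq> K}. w H L / N (H \<inter> L) * c H K)"
            unfolding sum.inter_filter[OF finite_S] by (intro sum.cong HOL.refl)
          also have "\<dots> = - (w H L / N (H \<inter> L)) * (\<Sum>K\<in>{K\<in>S. H \<inter> L \<subseteq> K}. c K H)"
            unfolding sum_distrib_left
          proof (rule sum.cong[OF HOL.refl])
            fix K assume "K \<in> {K\<in>S. H \<inter> L \<subseteq> K}"
            then show "w H L / N (H \<inter> L) * c H K = - (w H L / N (H \<inter> L)) * c K H"
              using anti[of H K] H by simp
          qed
          also have "\<dots> = 0" using rel[OF H L] False by simp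
          finally show ?thesis .
        qed
      qed
      finally show ?thesis by simp
    qed
    then show ?thesis by simp
  qed
  have "(\<Sum>H\<in>S. \<Sum>K\<in>S. w H K * c H K) = (\<Sum>H\<in>S. \<Sum>K\<in>S. (\<Sum>L\<in>S. q H K L) + (\<Sum>L\<in>S. q K H L))"
  proof (intro sum.cong HOL.refl)
    fix H K assume HK: "H \<in> S" "K \<in> S"
    show "w H K * c H K = (\<Sum>L\<in>S. q H K L) + (\<Sum>L\<in>S. q K H L)"
    proof (cases "H = K")
      case True
      then show ?thesis by (simp add: wHH q_def)
    next
      case False
      have 1: "(\<Sum>L\<in>S. q H K L) = (\<Sum>L\<in>{L\<in>S. H \<inter> K \<subseteq> L}. w H L / N (H \<inter> K)) * c H K"
        unfolding sum_distrib_right sum.inter_filter[OF finite_S]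
        using False by (intro sum.cong) (auto simp: q_def)
      \<comment> \<open>Both \<open>w\<close> and \<open>c\<close> change sign when their arguments
        are exchanged, so the second half of the average is the first with \<open>H\<close> and
        \<open>K\<close> swapped.\<close>
      have "w K L / N (H \<inter> K) * c K H = w L K / N (H \<inter> K) * c H K" for L
        unfolding anti[OF HK] by (simp add: w_def algebra_simps diff_divide_distrib)
      then have 2: "(\<Sum>L\<in>S. q K H L) = (\<Sum>L\<in>{L\<in>S. H \<inter> K \<subseteq> L}. w L K / N (H \<inter> K)) * c H K"
        unfolding sum_distrib_right sum.inter_filter[OF finite_S]
        using False by (intro sum.cong) (auto simp: q_def Int_commute)
      show ?thesis
        unfolding 1 2 distrib_right[symmetric] avg[OF HK False, symmetric] ..
    qed
  qed
  also have "\<dots> = (\<Sum>H\<in>S. \<Sum>K\<in>S. \<Sum>L\<in>S. q H K L) + (\<Sum>H\<in>S. \<Sum>K\<in>S. \<Sum>L\<in>S. q K H L)"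
    by (simp only: sum.distrib)
  also have "(\<Sum>H\<in>S. \<Sum>K\<in>S. \<Sum>L\<in>S. q K H L) = (\<Sum>K\<in>S. \<Sum>H\<in>S. \<Sum>L\<in>S. q K H L)"
    by (rule sum.swap)
  also have "(\<Sum>H\<in>S. \<Sum>K\<in>S. \<Sum>L\<in>S. q H K L) + \<dots> = 0"
    by (simp only: half add_0)
  \<comment> \<open>Renaming the summation indices and using antisymmetry of \<open>c\<close> turns
    the right-hand side into the negative of the left-hand side.\<close>
  finally have "(\<Sum>H\<in>S. \<Sum>K\<in>S. a H u * a K v * c H K) = (\<Sum>H\<in>S. \<Sum>K\<in>S. a K u * a H v * c H K)"
    by (simp add: w_def algebra_simps sum_subtractf)
  also have "\<dots> = (\<Sum>K\<in>S. \<Sum>H\<in>S. a K u * a H v * c H K)" by (rule sum.swap)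
  also have "\<dots> = - (\<Sum>H\<in>S. \<Sum>K\<in>S. a H u * a K v * c H K)"
    unfolding sum_negf[symmetric]
  proof (intro sum.cong HOL.refl)
    fix H K assume "K \<in> S" "H \<in> S"
    then show "a K u * a H v * c H K = - (a K u * a H v * c K H)"
      using anti[of H K] by simp
  qed
  finally show ?thesis by (simp add: a_def)
qed

text \<open>Each matrix entry of the commutators \<open>[t H, t K]\<close> is an antisymmetric
  scalar array whose sums over pencils vanish by \<open>rel\<close>, so
  \<open>scalar_flatness\<close> applies entry by entry.\<close>

lemma log_form_commute:
  fixes t :: "(complex^'n) set \<Rightarrow> complex^'m^'m"
  assumes rel: "\<And>H K. H \<in> S \<Longrightarrow> K \<in> S \<Longrightarrow> H \<noteq> K \<Longrightarrow>
      (\<Sum>L\<in>{L\<in>S. H \<inter> K \<subseteq> L}. t L) ** t H = t H ** (\<Sum>L\<in>{L\<in>S. H \<inter> K \<subseteq> L}. t L)"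
    and x: "x \<notin> \<Union>S"
  shows "log_form S t x u ** log_form S t x v = log_form S t x v ** log_form S t x u"
proof -
  let ?a = "\<lambda>H v. linear_form_of H v / linear_form_of H x"
  let ?k = "\<i> * of_real pi :: complex"
  have mm: "log_form S t x u ** log_form S t x v
      = (\<Sum>H\<in>S. \<Sum>K\<in>S. cscale (?a H u / ?k * (?a K v / ?k)) (t H ** t K))" for u v
    unfolding log_form_def matrix_mult.sum_left matrix_mult.sum_right
    unfolding cscale_mult by (rule sum.swap)
  have "(log_form S t x u ** log_form S t x v) $ i $ j = (log_form S t x v ** log_form S t x u) $ i $ j" for i j
  proof -
    define c where "c H K = (t H ** t K - t K ** t H) $ i $ j" for H K
    define g where "g H K = ?a H u / ?k * (?a K v / ?k)" for H K
    have "(log_form S t x u ** log_form S t x v) $ i $ j = (\<Sum>H\<in>S. \<Sum>K\<in>S. g H K * (t H ** t K) $ i $ j)"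
      unfolding mm g_def by (simp only: sum_component cscale_component)
    moreover have "(log_form S t x v ** log_form S t x u) $ i $ j = (\<Sum>H\<in>S. \<Sum>K\<in>S. g K H * (t H ** t K) $ i $ j)"
      unfolding mm g_def by (simp only: sum_component cscale_component mult.commute)
    moreover have "\<dots> = (\<Sum>H\<in>S. \<Sum>K\<in>S. g H K * (t K ** t H) $ i $ j)"
      by (rule sum.swap)
    ultimately have "(log_form S t x u ** log_form S t x v) $ i $ j - (log_form S t x v ** log_form S t x u) $ i $ j
       = (\<Sum>H\<in>S. \<Sum>K\<in>S. g H K * c H K)"
      unfolding c_def by (simp only: sum_subtractf right_diff_distrib vector_minus_component)
    also have "\<dots> = 1 / (?k * ?k) * (\<Sum>H\<in>S. \<Sum>K\<in>S. ?a H u * ?a K v * c H K)"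
      unfolding sum_distrib_left by (intro sum.cong HOL.refl) (simp add: g_def)
    also have "(\<Sum>H\<in>S. \<Sum>K\<in>S. ?a H u * ?a K v * c H K) = 0"
    proof (rule scalar_flatness[OF _ _ x])
      fix H K assume HK: "H \<in> S" "K \<in> S" "H \<noteq> K"
      have "(\<Sum>L\<in>{L\<in>S. H \<inter> K \<subseteq> L}. c L H)
         = ((\<Sum>L\<in>{L\<in>S. H \<inter> K \<subseteq> L}. t L) ** t H - t H ** (\<Sum>L\<in>{L\<in>S. H \<inter> K \<subseteq> L}. t L)) $ i $ j"
        by (simp add: c_def matrix_mult.sum_left matrix_mult.sum_right sum_subtractf)
      then show "(\<Sum>L\<in>{L\<in>S. H \<inter> K \<subseteq> L}. c L H) = 0" using rel[OF HK] by simp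
    qed (simp add: c_def)
    finally show ?thesis by simp
  qed
  then show ?thesis by (simp add: vec_eq_iff)
qed

end

section \<open>The gauge transformation at a point\<close>

lemma form_real_linear:
  fixes f :: "complex^'n \<Rightarrow> complex"
  assumes "Vector_Spaces.linear (*s) (*) f"
  shows "bounded_linear f"
proof -
  interpret f: Vector_Spaces.linear "(*s)" "(*)" f by fact
  have "f (r *\<^sub>R x) = r *\<^sub>R f x" for r x
  proof -
    have "r *\<^sub>R x = complex_of_real r *s x"
      by (simp add: vec_eq_iff scaleR_conv_of_real[symmetric])
    then show ?thesis by (simp add: f.scale scaleR_conv_of_real)
  qed
  then show ?thesis
    by (intro linear_conv_bounded_linear[THEN iffD1] linearI) (simp_all add: f.add)
qed

text \<open>Forms with a common kernel are proportional and the factor cancels in the quotient.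
  Where the denominator is zero, both sides are zero by the convention for division.\<close>

lemma form_ratio:
  fixes f g :: "complex^'n \<Rightarrow> complex"
  assumes "Vector_Spaces.linear (*s) (*) f" "Vector_Spaces.linear (*s) (*) g"
    and ker: "\<And>y. f y = 0 \<longleftrightarrow> g y = 0"
  shows "f v / f x = g v / g x"
proof (cases "f x = 0")
  case True
  then show ?thesis using ker[of x] by simp
next
  case False
  interpret f: Vector_Spaces.linear "(*s)" "(*)" f by fact
  interpret g: Vector_Spaces.linear "(*s)" "(*)" g by fact
  have "f (v - (f v / f x) *s x) = 0" using False by (simp add: f.diff f.scale)
  then have "g (v - (f v / f x) *s x) = 0" using ker by blast
  then have "g v = (f v / f x) * g x" by (simp add: g.diff g.scale)
  then show ?thesis using False ker[of x] by simp
qed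

definition dlog_form ::
  "(complex^'n) set set \<Rightarrow> ((complex^'n) set \<Rightarrow> complex^'m^'m) \<Rightarrow> complex^'n \<Rightarrow> complex^'n \<Rightarrow> complex^'n \<Rightarrow> complex^'m^'m" where
  "dlog_form S t x u v = (\<Sum>H\<in>S. cscale
     (- (linear_form_of H u * linear_form_of H v) / (linear_form_of H x * linear_form_of H x) / (\<i> * of_real pi)) (t H))"

text \<open>These are the points whose half-open segment to \<open>x1\<close>, with
  \<open>x1\<close> left out, misses every hyperplane. Along the segment a form vanishing at
  \<open>x1\<close> is multiplied by \<open>s\<close>; for another form the quotient by its value at
  \<open>x1\<close> runs from 1 to \<open>q\<close> and meets 0 exactly when \<open>q\<close> is a
  nonpositive real. In this description openness is visible.\<close>

definition cone_domain :: "(complex^'n) set set \<Rightarrow> complex^'n \<Rightarrow> (complex^'n) set" where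
  "cone_domain S x1 = {x. \<forall>H\<in>S. if linear_form_of H x1 = 0 then linear_form_of H x \<noteq> 0
     else linear_form_of H x / linear_form_of H x1 \<notin> \<real>\<^sub>\<le>\<^sub>0}"

text \<open>The right-hand form keeps exactly the hyperplanes through \<open>x1\<close>, which in
  the application are those of \<A>0.\<close>

definition gauge_connection ::
  "(complex^'n) set set \<Rightarrow> ((complex^'n) set \<Rightarrow> complex^'m^'m) \<Rightarrow> complex^'n \<Rightarrow>
   complex^'n \<Rightarrow> complex^'n \<Rightarrow> complex^'m^'m \<Rightarrow> complex^'m^'m" where
  "gauge_connection S t x1 x v p =
     log_form S t x v ** p - p ** log_form {H \<in> S. linear_form_of H x1 = 0} t x v"

definition gauge :: "(complex^'n) set set \<Rightarrow> ((complex^'n) set \<Rightarrow> complex^'m^'m) \<Rightarrow> complex^'n \<Rightarrow> nat \<Rightarrow> complex^'n \<Rightarrow> complex^'m^'m" where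
  "gauge S t x1 = radial_solution x1 (gauge_connection S t x1) (mat 1)"

lemma linear_cscale: "linear (\<lambda>c. cscale c A)"
  using bounded_linear_cscale by (rule bounded_linear.linear)

locale flat_system = hyperplane_system S for S :: "(complex^'n) set set" +
  fixes t :: "(complex^'n) set \<Rightarrow> complex^'m^'m"
  assumes relation: "H \<in> S \<Longrightarrow> K \<in> S \<Longrightarrow> H \<noteq> K \<Longrightarrow>
      (\<Sum>L\<in>{L\<in>S. H \<inter> K \<subseteq> L}. t L) ** t H = t H ** (\<Sum>L\<in>{L\<in>S. H \<inter> K \<subseteq> L}. t L)"
begin

lemma bounded_linear_form: "H \<in> S \<Longrightarrow> bounded_linear (linear_form_of H)"
  by (rule form_real_linear[OF linear_form])

lemma linear_log_form: "S' \<subseteq> S \<Longrightarrow> linear (log_form S' t x)"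
proof -
  assume S': "S' \<subseteq> S"
  have "linear (\<lambda>v. linear_form_of H v / linear_form_of H x / (\<i> * of_real pi))" if "H \<in> S'" for H
  proof -
    have "bounded_linear (\<lambda>v. linear_form_of H v * (1 / linear_form_of H x / (\<i> * of_real pi)))"
      using that S' by (intro bounded_linear_mult_const bounded_linear_form) auto
    then show ?thesis by (simp add: bounded_linear.linear)
  qed
  then show ?thesis
    unfolding log_form_def
    by (intro linear_compose_sum ballI linear_compose[OF _ linear_cscale, unfolded o_def]) auto
qed

lemma has_derivative_log_form:
  assumes "S' \<subseteq> S" "x \<notin> \<Union>S'"
  shows "((\<lambda>x. log_form S' t x v) has_derivative (\<lambda>u. dlog_form S' t x u v)) (at x)"
  unfolding log_form_def dlog_form_def
proof (rule has_derivative_sum)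
  fix H assume H: "H \<in> S'"
  then have HS: "H \<in> S" and ne: "linear_form_of H x \<noteq> 0" using assms kernel by auto
  have "((\<lambda>x. linear_form_of H v / linear_form_of H x / (\<i> * of_real pi)) has_derivative
     (\<lambda>u. - (linear_form_of H u * linear_form_of H v) / (linear_form_of H x * linear_form_of H x) / (\<i> * of_real pi))) (at x)"
    by (rule has_derivative_eq_rhs, rule bounded_linear.has_derivative[OF bounded_linear_divide],
        rule has_derivative_divide'[OF has_derivative_const
          bounded_linear_imp_has_derivative[OF bounded_linear_form[OF HS]] ne])
      (simp add: mult.commute)
  then show "((\<lambda>x. cscale (linear_form_of H v / linear_form_of H x / (\<i> * of_real pi)) (t H)) has_derivative
     (\<lambda>u. cscale (- (linear_form_of H u * linear_form_of H v) / (linear_form_of H x * linear_form_of H x) / (\<i> * of_real pi)) (t H))) (at x)"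
    by (rule bounded_linear.has_derivative[OF bounded_linear_cscale])
qed

lemma continuous_dlog_form:
  assumes "S' \<subseteq> S" "U \<inter> \<Union>S' = {}"
  shows "continuous_on U (\<lambda>x. dlog_form S' t x u v)"
  unfolding dlog_form_def
proof (rule continuous_on_sum, rule bounded_linear.continuous_on[OF bounded_linear_cscale])
  fix H assume H: "H \<in> S'"
  then have "H \<in> S" using assms by auto
  moreover have "\<forall>x\<in>U. linear_form_of H x \<noteq> 0"
    using assms H by (auto simp: kernel[OF \<open>H \<in> S\<close>])
  ultimately show "continuous_on U (\<lambda>x. - (linear_form_of H u * linear_form_of H v) /
      (linear_form_of H x * linear_form_of H x) / (\<i> * of_real pi))"
    by (intro continuous_intros bounded_linear.continuous_on[OF bounded_linear_form]) auto
qed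

text \<open>The terms with a pole at \<open>x1\<close> cancel. The remainder is the value of the
  gauge connection at the identity matrix and stays bounded along rays.\<close>

lemma log_form_diff:
  "log_form S t x v - log_form {H \<in> S. linear_form_of H x1 = 0} t x v
     = log_form {H \<in> S. linear_form_of H x1 \<noteq> 0} t x v"
proof -
  have "S - {H \<in> S. linear_form_of H x1 = 0} = {H \<in> S. linear_form_of H x1 \<noteq> 0}" by auto
  then show ?thesis
    unfolding log_form_def by (subst sum_diff[OF finite_S, symmetric]) auto
qed

text \<open>If two hyperplanes contain \<open>x1\<close>, so does every member of their pencil;
  hence the relations of the full arrangement are already those of the hyperplanes through
  \<open>x1\<close>.\<close>

lemma sub_commute:
  assumes "x \<notin> \<Union>{H \<in> S. linear_form_of H x1 = 0}"
  defines "S1 \<equiv> {H \<in> S. linear_form_of H x1 = 0}"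
  shows "log_form S1 t x u ** log_form S1 t x v = log_form S1 t x v ** log_form S1 t x u"
proof -
  interpret sub: hyperplane_system S1
  proof (rule hyperplane_system.intro)
    show "Vector_Spaces.linear (*s) (*) (linear_form_of H)" if "H \<in> S1" for H
      by (rule linear_form) (use that in \<open>simp add: S1_def\<close>)
  qed (use not_subset in \<open>simp_all add: S1_def finite_S kernel\<close>)
  show ?thesis
  proof (rule sub.log_form_commute)
    fix H K assume HK: "H \<in> S1" "K \<in> S1" "H \<noteq> K"
    have "{L\<in>S1. H \<inter> K \<subseteq> L} = {L\<in>S. H \<inter> K \<subseteq> L}"
      using HK kernel by (auto simp: S1_def)
    then show "(\<Sum>L\<in>{L\<in>S1. H \<inter> K \<subseteq> L}. t L) ** t H = t H ** (\<Sum>L\<in>{L\<in>S1. H \<inter> K \<subseteq> L}. t L)"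
      using relation[of H K] HK by (simp add: S1_def)
  qed (use assms in auto)
qed

section \<open>The cone domain and estimates along its rays\<close>

lemma open_cone_domain: "open (cone_domain S x1)"
proof -
  have *: "open {x. if linear_form_of H x1 = 0 then linear_form_of H x \<noteq> 0
     else linear_form_of H x / linear_form_of H x1 \<notin> \<real>\<^sub>\<le>\<^sub>0}" (is "open ?A") if H: "H \<in> S" for H
  proof (cases "linear_form_of H x1 = 0")
    case True
    have "open (linear_form_of H -` (- {0}))"
      by (intro open_vimage bounded_linear.continuous_on[OF bounded_linear_form[OF H]] continuous_intros)
    then show ?thesis using True by (simp add: vimage_def)
  next
    case False
    have "open ((\<lambda>x. linear_form_of H x / linear_form_of H x1) -` (- \<real>\<^sub>\<le>\<^sub>0))"
      using False
      by (intro open_vimage continuous_intros bounded_linear.continuous_on[OF bounded_linear_form[OF H]] open_Compl) auto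
    then show ?thesis using False by (simp add: vimage_def)
  qed
  have eq: "cone_domain S x1 = (\<Inter>H\<in>S. {x. if linear_form_of H x1 = 0 then linear_form_of H x \<noteq> 0
     else linear_form_of H x / linear_form_of H x1 \<notin> \<real>\<^sub>\<le>\<^sub>0})"
    by (auto simp: cone_domain_def)
  show ?thesis
    unfolding eq by (rule open_INT[OF finite_S]) (blast intro: *)
qed

lemma cone_domain_avoids: "x \<in> cone_domain S x1 \<Longrightarrow> x \<notin> \<Union>S"
  by (auto simp: cone_domain_def kernel[symmetric] split: if_splits)

lemma radial_form:
  assumes "H \<in> S"
  shows "linear_form_of H (x1 + s *\<^sub>R (x - x1)) = of_real (1 - s) * linear_form_of H x1 + of_real s * linear_form_of H x"
proof -
  interpret bounded_linear "linear_form_of H" by (rule bounded_linear_form[OF assms])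
  show ?thesis unfolding add diff scaleR by (simp add: scaleR_conv_of_real algebra_simps)
qed

text \<open>For a form not vanishing at \<open>x1\<close>, contraction moves the quotient along the
  segment from \<open>q\<close> to 1, and the plane slit along the nonpositive reals is star-shaped
  about 1.\<close>

lemma cone_domain_star:
  assumes x: "x \<in> cone_domain S x1" and s: "0 < s" "s \<le> 1"
  shows "x1 + s *\<^sub>R (x - x1) \<in> cone_domain S x1"
  unfolding cone_domain_def
proof (intro CollectI ballI)
  fix H assume H: "H \<in> S"
  show "if linear_form_of H x1 = 0 then linear_form_of H (x1 + s *\<^sub>R (x - x1)) \<noteq> 0
      else linear_form_of H (x1 + s *\<^sub>R (x - x1)) / linear_form_of H x1 \<notin> \<real>\<^sub>\<le>\<^sub>0"
  proof (cases "linear_form_of H x1 = 0")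
    case True
    then show ?thesis using x H s by (auto simp: radial_form[OF H] cone_domain_def)
  next
    case False
    define q where "q = linear_form_of H x / linear_form_of H x1"
    have q: "q \<notin> \<real>\<^sub>\<le>\<^sub>0" using x H False by (auto simp: cone_domain_def q_def)
    have eq: "linear_form_of H (x1 + s *\<^sub>R (x - x1)) / linear_form_of H x1 = of_real (1 - s) + of_real s * q"
      using False by (simp add: radial_form[OF H] q_def add_divide_distrib)
    have "of_real (1 - s) + of_real s * q \<notin> \<real>\<^sub>\<le>\<^sub>0"
    proof
      assume "of_real (1 - s) + of_real s * q \<in> \<real>\<^sub>\<le>\<^sub>0"
      then have im: "s * Im q = 0" and re: "(1 - s) + s * Re q \<le> 0"
        by (auto simp: complex_nonpos_Reals_iff)
      have "s * Re q \<le> 0" using re s by linarith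
      then have "Re q \<le> 0" using s by (simp add: mult_le_0_iff)
      then show False using q im s by (auto simp: complex_nonpos_Reals_iff)
    qed
    then show ?thesis using False eq by simp
  qed
qed

lemma cone_domainI:
  assumes "x \<notin> \<Union>S" and seg: "\<And>H s. H \<in> S \<Longrightarrow> x1 \<notin> H \<Longrightarrow> 0 \<le> s \<Longrightarrow> s \<le> 1 \<Longrightarrow> x1 + s *\<^sub>R (x - x1) \<notin> H"
  shows "x \<in> cone_domain S x1"
  unfolding cone_domain_def
proof (intro CollectI ballI)
  fix H assume H: "H \<in> S"
  show "if linear_form_of H x1 = 0 then linear_form_of H x \<noteq> 0
      else linear_form_of H x / linear_form_of H x1 \<notin> \<real>\<^sub>\<le>\<^sub>0"
  proof (cases "linear_form_of H x1 = 0")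
    case True
    then show ?thesis using assms(1) H by (auto simp: kernel)
  next
    case False
    have "linear_form_of H x / linear_form_of H x1 \<notin> \<real>\<^sub>\<le>\<^sub>0"
    proof
      assume "linear_form_of H x / linear_form_of H x1 \<in> \<real>\<^sub>\<le>\<^sub>0"
      then obtain r where r: "linear_form_of H x / linear_form_of H x1 = of_real r" "r \<le> 0"
        by (auto elim: nonpos_Reals_cases)
      then have x: "linear_form_of H x = of_real r * linear_form_of H x1" using False by (simp add: field_simps)
      \<comment> \<open>The parameter at which the real segment from 1 to \<open>r\<close> crosses
        zero; \<open>r \<le> 0\<close> places it in the unit interval.\<close>
      let ?s = "1 / (1 - r)"
      have "linear_form_of H (x1 + ?s *\<^sub>R (x - x1)) = (of_real ((1 - ?s) + ?s * r)) * linear_form_of H x1"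
        by (simp only: radial_form[OF H] x of_real_add of_real_mult ring_distribs mult.assoc)
      also have "(1 - ?s) + ?s * r = 0" using r by (simp add: field_simps)
      finally have "x1 + ?s *\<^sub>R (x - x1) \<in> H" using kernel[OF H] by simp
      moreover have "x1 + ?s *\<^sub>R (x - x1) \<notin> H"
        by (rule seg[OF H]) (use False kernel[OF H] r in auto)
      ultimately show False by simp
    qed
    then show ?thesis using False by simp
  qed
qed

lemma center_in_cone_domain: "x1 \<notin> \<Union>S \<Longrightarrow> x1 \<in> cone_domain S x1"
  by (rule cone_domainI) auto

lemma ball_subset_cone_domain:
  assumes "ball x1 r \<inter> \<Union>S = {}"
  shows "ball x1 r \<subseteq> cone_domain S x1"
proof
  fix x assume x: "x \<in> ball x1 r"
  have "x1 + s *\<^sub>R (x - x1) \<in> ball x1 r" if "0 \<le> s" "s \<le> 1" for s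
  proof -
    have "s * norm (x - x1) \<le> 1 * norm (x - x1)" using that by (intro mult_right_mono) auto
    then show ?thesis using x that by (simp add: dist_norm norm_minus_commute)
  qed
  then have seg: "x1 + s *\<^sub>R (x - x1) \<notin> \<Union>S" if "0 \<le> s" "s \<le> 1" for s
    using assms that by blast
  show "x \<in> cone_domain S x1"
    using seg[of 1] by (intro cone_domainI) (use seg in auto)
qed

text \<open>A form vanishing at \<open>x1\<close> takes the value \<open>s\<close> times its value
  at \<open>y\<close>, which gives \<open>M / s\<close>. Otherwise the compact segment from 1 to
  \<open>q x\<close> misses 0 and has a distance \<open>m > 0\<close> from it; moving
  \<open>q x\<close> by less than \<open>m / 2\<close> leaves distance \<open>m / 2\<close>, a bound
  independent of \<open>s\<close>.\<close>

lemma form_lower_bound: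
  assumes x: "x \<in> cone_domain S x1" and H: "H \<in> S"
  obtains M where "0 \<le> M" "\<forall>\<^sub>F y in nhds x. \<forall>s\<in>{0<..1}. 1 / cmod (linear_form_of H (x1 + s *\<^sub>R (y - x1))) \<le> M / s \<and>
     (linear_form_of H x1 \<noteq> 0 \<longrightarrow> 1 / cmod (linear_form_of H (x1 + s *\<^sub>R (y - x1))) \<le> M)"
proof (cases "linear_form_of H x1 = 0")
  case True
  let ?l = "linear_form_of H"
  have lx: "cmod (?l x) > 0" using x H True by (auto simp: cone_domain_def)
  have "((\<lambda>y. cmod (?l y)) \<longlongrightarrow> cmod (?l x)) (nhds x)"
    by (intro tendsto_norm bounded_linear.tendsto[OF bounded_linear_form[OF H]] filterlim_ident)
  then have "\<forall>\<^sub>F y in nhds x. cmod (?l x) / 2 < cmod (?l y)"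
    by (rule order_tendstoD) (use lx in auto)
  then have "\<forall>\<^sub>F y in nhds x. \<forall>s\<in>{0<..1}. 1 / cmod (?l (x1 + s *\<^sub>R (y - x1))) \<le> (2 / cmod (?l x)) / s"
  proof eventually_elim
    case (elim y)
    have "0 < cmod (?l y)" using elim lx by linarith
    then have "1 / cmod (?l y) \<le> 2 / cmod (?l x)" using elim lx by (simp add: frac_le_eq divide_le_0_iff divide_simps)
    then have *: "1 / cmod (?l y) / s \<le> 2 / cmod (?l x) / s" if "s \<in> {0<..1}" for s
      using that by (intro divide_right_mono) auto
    show ?case
    proof
      fix s :: real assume s: "s \<in> {0<..1}"
      have "?l (x1 + s *\<^sub>R (y - x1)) = of_real s * ?l y"
        unfolding radial_form[OF H] True by simp
      then have "cmod (?l (x1 + s *\<^sub>R (y - x1))) = cmod (?l y) * s"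
        using s by (simp add: norm_mult)
      then show "1 / cmod (?l (x1 + s *\<^sub>R (y - x1))) \<le> (2 / cmod (?l x)) / s"
        using *[OF s] by (simp only: divide_divide_eq_left)
    qed
  qed
  then show ?thesis using True by (intro that[of "2 / cmod (?l x)"]) simp_all
next
  case False
  let ?l = "linear_form_of H"
  define q where "q y = ?l y / ?l x1" for y
  have q: "q x \<notin> \<real>\<^sub>\<le>\<^sub>0" using x H False by (auto simp: cone_domain_def q_def)
  have "\<exists>s0\<in>{0..1}. \<forall>s\<in>{0..1}. cmod (of_real (1 - s0) + of_real s0 * q x) \<le> cmod (of_real (1 - s) + of_real s * q x)"
    by (rule continuous_attains_inf) (auto intro!: continuous_intros)
  then obtain s0 where s0: "s0 \<in> {0..1}"
    "\<And>s. s \<in> {0..1} \<Longrightarrow> cmod (of_real (1 - s0) + of_real s0 * q x) \<le> cmod (of_real (1 - s) + of_real s * q x)"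
    by blast
  define m where "m = cmod (of_real (1 - s0) + of_real s0 * q x)"
  have m: "m > 0"
  proof (rule ccontr)
    assume "\<not> m > 0"
    then have z: "of_real (1 - s0) + of_real s0 * q x = 0" unfolding m_def by auto
    have im: "s0 * Im (q x) = 0" and re: "(1 - s0) + s0 * Re (q x) = 0"
      using arg_cong[OF z, of Im] arg_cong[OF z, of Re] by auto
    have "s0 \<noteq> 0" using re by auto
    moreover have "s0 * Re (q x) \<le> 0" using re s0 by auto
    ultimately show False using q im s0 by (auto simp: complex_nonpos_Reals_iff mult_le_0_iff)
  qed
  have "(q \<longlongrightarrow> q x) (nhds x)"
    unfolding q_def using False
    by (intro tendsto_divide bounded_linear.tendsto[OF bounded_linear_form[OF H]] filterlim_ident tendsto_const) auto
  then have "\<forall>\<^sub>F y in nhds x. dist (q y) (q x) < m / 2"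
    by (rule tendstoD) (use m in simp)
  then have "\<forall>\<^sub>F y in nhds x. \<forall>s\<in>{0<..1}. 1 / cmod (?l (x1 + s *\<^sub>R (y - x1))) \<le> 2 / (m * cmod (?l x1))"
  proof eventually_elim
    case (elim y)
    show ?case
    proof
      fix s :: real assume s: "s \<in> {0<..1}"
      have "?l (x1 + s *\<^sub>R (y - x1)) = (of_real (1 - s) + of_real s * q y) * ?l x1"
        unfolding radial_form[OF H] q_def using False by (simp add: distrib_right)
      moreover have "m / 2 \<le> cmod (of_real (1 - s) + of_real s * q y)"
      proof -
        have "of_real (1 - s) + of_real s * q x = (of_real (1 - s) + of_real s * q y) + of_real s * (q x - q y)"
          by (simp add: algebra_simps)
        then have "cmod (of_real (1 - s) + of_real s * q x) \<le> cmod (of_real (1 - s) + of_real s * q y) + cmod (of_real s * (q x - q y))"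
          by (metis norm_triangle_ineq)
        moreover have "cmod (of_real s * (q x - q y)) \<le> 1 * cmod (q x - q y)"
          unfolding norm_mult using s by (intro mult_right_mono) auto
        moreover have "m \<le> cmod (of_real (1 - s) + of_real s * q x)"
          unfolding m_def using s by (intro s0) auto
        ultimately show ?thesis using elim by (simp add: dist_norm norm_minus_commute)
      qed
      ultimately have "m / 2 * cmod (?l x1) \<le> cmod (?l (x1 + s *\<^sub>R (y - x1)))"
        by (simp only: norm_mult) (intro mult_right_mono, auto)
      then have le: "m / 2 * cmod (?l x1) \<le> cmod (?l (x1 + s *\<^sub>R (y - x1)))" .
      have "1 / cmod (?l (x1 + s *\<^sub>R (y - x1))) \<le> 1 / (m / 2 * cmod (?l x1))"
      proof (rule divide_left_mono[OF le])
        have pos: "0 < m / 2 * cmod (?l x1)" using m False by simp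
        have "0 < cmod (?l (x1 + s *\<^sub>R (y - x1)))" using pos le by linarith
        then show "0 < cmod (?l (x1 + s *\<^sub>R (y - x1))) * (m / 2 * cmod (?l x1))"
          using pos by (rule mult_pos_pos)
      qed simp
      then show "1 / cmod (?l (x1 + s *\<^sub>R (y - x1))) \<le> 2 / (m * cmod (?l x1))" by simp
    qed
  qed
  then show ?thesis
  proof (intro that[of "2 / (m * cmod (?l x1))"])
    assume *: "\<forall>\<^sub>F y in nhds x. \<forall>s\<in>{0<..1}. 1 / cmod (?l (x1 + s *\<^sub>R (y - x1))) \<le> 2 / (m * cmod (?l x1))"
    have le: "2 / (m * cmod (?l x1)) \<le> 2 / (m * cmod (?l x1)) / s" if "s \<in> {0<..1}" for s
    proof -
      have "2 / (m * cmod (?l x1)) / 1 \<le> 2 / (m * cmod (?l x1)) / s"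
        using that m by (intro divide_left_mono) auto
      then show ?thesis by simp
    qed
    show "\<forall>\<^sub>F y in nhds x. \<forall>s\<in>{0<..1}. 1 / cmod (?l (x1 + s *\<^sub>R (y - x1))) \<le> 2 / (m * cmod (?l x1)) / s \<and>
      (?l x1 \<noteq> 0 \<longrightarrow> 1 / cmod (?l (x1 + s *\<^sub>R (y - x1))) \<le> 2 / (m * cmod (?l x1)))"
      using *
    proof eventually_elim
      case (elim y)
      then show ?case using le by (meson order_trans)
    qed
  qed (use m in auto)
qed

text \<open>The estimates of the single terms add up over the finite set. The last conclusion is
  stated under a premise so that one constant serves a form with poles at \<open>x1\<close> and,
  when there are none, the regular difference \<open>\<omega> - \<omega>0\<close>.\<close>

lemma log_form_growth:
  assumes x: "x \<in> cone_domain S x1" and S': "S' \<subseteq> S"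
  obtains C where "0 \<le> C"
    "\<forall>\<^sub>F y in nhds x. \<forall>s\<in>{0<..1}. \<forall>v. norm (log_form S' t (x1 + s *\<^sub>R (y - x1)) v) \<le> C / s * norm v"
    "(\<And>H. H \<in> S' \<Longrightarrow> linear_form_of H x1 \<noteq> 0) \<Longrightarrow>
       \<forall>\<^sub>F y in nhds x. \<forall>s\<in>{0<..1}. \<forall>v. norm (log_form S' t (x1 + s *\<^sub>R (y - x1)) v) \<le> C * norm v"
proof -
  let ?T = "\<lambda>H x v. cscale (linear_form_of H v / linear_form_of H x / (\<i> * of_real pi)) (t H)"
  have "\<exists>C\<ge>0. \<forall>\<^sub>F y in nhds x. \<forall>s\<in>{0<..1}. \<forall>v. norm (?T H (x1 + s *\<^sub>R (y - x1)) v) \<le> C / s * norm v \<and>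
       (linear_form_of H x1 \<noteq> 0 \<longrightarrow> norm (?T H (x1 + s *\<^sub>R (y - x1)) v) \<le> C * norm v)"
    if HS: "H \<in> S" for H
  proof -
    obtain M where M: "0 \<le> M" "\<forall>\<^sub>F y in nhds x. \<forall>s\<in>{0<..1}. 1 / cmod (linear_form_of H (x1 + s *\<^sub>R (y - x1))) \<le> M / s \<and>
     (linear_form_of H x1 \<noteq> 0 \<longrightarrow> 1 / cmod (linear_form_of H (x1 + s *\<^sub>R (y - x1))) \<le> M)"
      by (rule form_lower_bound[OF x HS])
    obtain L where L: "0 \<le> L" "\<And>v. norm (linear_form_of H v) \<le> norm v * L"
      using bounded_linear.nonneg_bounded[OF bounded_linear_form[OF HS]] by blast
    obtain K where K: "0 \<le> K" "\<And>c. norm (cscale c (t H)) \<le> norm c * K"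
      using bounded_linear.nonneg_bounded[OF bounded_linear_cscale[of "t H"]] by blast
    have le: "norm (?T H z v) \<le> (L * m * K) * norm v" if m: "1 / cmod (linear_form_of H z) \<le> m" for z v m
    proof -
      have m0: "0 \<le> m" using m by (rule order_trans[rotated]) simp
      have "cmod (linear_form_of H v / linear_form_of H z / (\<i> * of_real pi))
          = cmod (linear_form_of H v) * (1 / cmod (linear_form_of H z)) * (1 / pi)"
        by (simp add: norm_divide norm_mult)
      also have "\<dots> \<le> (norm v * L) * m * 1"
        using L m m0 pi_ge_two by (intro mult_mono mult_nonneg_nonneg) auto
      finally have "cmod (linear_form_of H v / linear_form_of H z / (\<i> * of_real pi)) * K \<le> norm v * L * m * 1 * K"
        using K(1) by (rule mult_right_mono)
      then show ?thesis using K(2)[of "linear_form_of H v / linear_form_of H z / (\<i> * of_real pi)"]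
        by (simp add: mult_ac)
    qed
    show ?thesis
    proof (intro exI[of _ "L * M * K"] conjI)
      show "\<forall>\<^sub>F y in nhds x. \<forall>s\<in>{0<..1}. \<forall>v. norm (?T H (x1 + s *\<^sub>R (y - x1)) v) \<le> L * M * K / s * norm v \<and>
       (linear_form_of H x1 \<noteq> 0 \<longrightarrow> norm (?T H (x1 + s *\<^sub>R (y - x1)) v) \<le> L * M * K * norm v)"
        using M(2)
      proof eventually_elim
        case (elim y)
        show ?case
        proof (intro ballI allI conjI impI)
          fix s :: real and v assume s: "s \<in> {0<..1}"
          show "norm (?T H (x1 + s *\<^sub>R (y - x1)) v) \<le> L * M * K / s * norm v"
            using le[of "x1 + s *\<^sub>R (y - x1)" "M / s" v] elim s by simp
          assume "linear_form_of H x1 \<noteq> 0"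
          then show "norm (?T H (x1 + s *\<^sub>R (y - x1)) v) \<le> L * M * K * norm v"
            using le[of "x1 + s *\<^sub>R (y - x1)" M v] elim s by simp
        qed
      qed
    qed (use L M K in auto)
  qed
  then have "\<forall>H\<in>S'. \<exists>C. 0 \<le> C \<and> (\<forall>\<^sub>F y in nhds x. \<forall>s\<in>{0<..1}. \<forall>v. norm (?T H (x1 + s *\<^sub>R (y - x1)) v) \<le> C / s * norm v \<and>
       (linear_form_of H x1 \<noteq> 0 \<longrightarrow> norm (?T H (x1 + s *\<^sub>R (y - x1)) v) \<le> C * norm v))"
    using S' by blast
  from bchoice[OF this] obtain C where C0: "\<And>H. H \<in> S' \<Longrightarrow> 0 \<le> C H"
    and C: "\<forall>H\<in>S'. \<forall>\<^sub>F y in nhds x. \<forall>s\<in>{0<..1}. \<forall>v. norm (?T H (x1 + s *\<^sub>R (y - x1)) v) \<le> C H / s * norm v \<and>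
       (linear_form_of H x1 \<noteq> 0 \<longrightarrow> norm (?T H (x1 + s *\<^sub>R (y - x1)) v) \<le> C H * norm v)"
    by blast
  have fin: "finite S'" using finite_S S' by (rule finite_subset[rotated])
  have "\<forall>\<^sub>F y in nhds x. \<forall>H\<in>S'. \<forall>s\<in>{0<..1}. \<forall>v. norm (?T H (x1 + s *\<^sub>R (y - x1)) v) \<le> C H / s * norm v \<and>
       (linear_form_of H x1 \<noteq> 0 \<longrightarrow> norm (?T H (x1 + s *\<^sub>R (y - x1)) v) \<le> C H * norm v)"
    using C by (rule eventually_ball_finite[OF fin])
  note ev = this
  show thesis
  proof (rule that[of "\<Sum>H\<in>S'. C H"])
    show "0 \<le> (\<Sum>H\<in>S'. C H)" using C0 by (rule sum_nonneg)
    show "\<forall>\<^sub>F y in nhds x. \<forall>s\<in>{0<..1}. \<forall>v. norm (log_form S' t (x1 + s *\<^sub>R (y - x1)) v) \<le> (\<Sum>H\<in>S'. C H) / s * norm v"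
      using ev
    proof eventually_elim
      case (elim y)
      show ?case
        unfolding log_form_def sum_divide_distrib sum_distrib_right
        using elim by (intro ballI allI order_trans[OF norm_sum sum_mono]) auto
    qed
    assume ne: "\<And>H. H \<in> S' \<Longrightarrow> linear_form_of H x1 \<noteq> 0"
    show "\<forall>\<^sub>F y in nhds x. \<forall>s\<in>{0<..1}. \<forall>v. norm (log_form S' t (x1 + s *\<^sub>R (y - x1)) v) \<le> (\<Sum>H\<in>S'. C H) * norm v"
      using ev
    proof eventually_elim
      case (elim y)
      show ?case
        unfolding log_form_def sum_distrib_right
        using elim ne by (intro ballI allI order_trans[OF norm_sum sum_mono]) auto
    qed
  qed
qed

lemma dlog_form_sym: "dlog_form S' t x u v = dlog_form S' t x v u"
  by (simp add: dlog_form_def mult.commute)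

abbreviation center_hyperplanes :: "complex^'n \<Rightarrow> (complex^'n) set set" where
  "center_hyperplanes x1 \<equiv> {H \<in> S. linear_form_of H x1 = 0}"

lemma matrix_mult_norm:
  obtains K where "0 \<le> K" "\<And>(a :: complex^'m^'m) (b :: complex^'m^'m). norm (a ** b) \<le> norm a * norm b * K"
  using matrix_mult.nonneg_bounded by metis

lemma gauge_connection_growth:
  assumes x: "x \<in> cone_domain S x1"
  shows "\<exists>r>0. \<exists>C. ball x r \<subseteq> cone_domain S x1 \<and>
      (\<forall>y\<in>ball x r. \<forall>s\<in>{0<..1}. \<forall>v p.
        norm (gauge_connection S t x1 (x1 + s *\<^sub>R (y - x1)) v p) \<le> C / s * norm v * norm p \<and>
        norm (gauge_connection S t x1 (x1 + s *\<^sub>R (y - x1)) v (mat 1)) \<le> C * norm v)"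
proof -
  let ?S1 = "center_hyperplanes x1"
  have S1: "?S1 \<subseteq> S" by auto
  let ?S2 = "{H \<in> S. linear_form_of H x1 \<noteq> 0}"
  have S2: "?S2 \<subseteq> S" by auto
  have ne: "linear_form_of H x1 \<noteq> 0" if "H \<in> ?S2" for H using that by simp
  have "\<exists>C\<ge>0. \<forall>\<^sub>F y in nhds x. \<forall>s\<in>{0<..1}. \<forall>v. norm (log_form S t (x1 + s *\<^sub>R (y - x1)) v) \<le> C / s * norm v"
    by (rule log_form_growth[OF x order_refl], rule exI, rule conjI)
  then obtain C where C: "0 \<le> C" "\<forall>\<^sub>F y in nhds x. \<forall>s\<in>{0<..1}. \<forall>v. norm (log_form S t (x1 + s *\<^sub>R (y - x1)) v) \<le> C / s * norm v"
    by (elim exE conjE)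
  have "\<exists>C\<ge>0. \<forall>\<^sub>F y in nhds x. \<forall>s\<in>{0<..1}. \<forall>v. norm (log_form ?S1 t (x1 + s *\<^sub>R (y - x1)) v) \<le> C / s * norm v"
    by (rule log_form_growth[OF x S1], rule exI, rule conjI)
  then obtain C1 where C1: "0 \<le> C1" "\<forall>\<^sub>F y in nhds x. \<forall>s\<in>{0<..1}. \<forall>v. norm (log_form ?S1 t (x1 + s *\<^sub>R (y - x1)) v) \<le> C1 / s * norm v"
    by (elim exE conjE)
  have "\<exists>C\<ge>0. \<forall>\<^sub>F y in nhds x. \<forall>s\<in>{0<..1}. \<forall>v. norm (log_form ?S2 t (x1 + s *\<^sub>R (y - x1)) v) \<le> C * norm v"
  proof (rule log_form_growth[OF x S2])
    fix C assume C: "0 \<le> C" "(\<And>H. H \<in> ?S2 \<Longrightarrow> linear_form_of H x1 \<noteq> 0) \<Longrightarrow>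
       \<forall>\<^sub>F y in nhds x. \<forall>s\<in>{0<..1}. \<forall>v. norm (log_form ?S2 t (x1 + s *\<^sub>R (y - x1)) v) \<le> C * norm v"
    show "\<exists>C\<ge>0. \<forall>\<^sub>F y in nhds x. \<forall>s\<in>{0<..1}. \<forall>v. norm (log_form ?S2 t (x1 + s *\<^sub>R (y - x1)) v) \<le> C * norm v"
      by (rule exI[of _ C], rule conjI[OF C(1)], rule C(2), rule ne)
  qed
  then obtain C2 where C2: "0 \<le> C2" "\<forall>\<^sub>F y in nhds x. \<forall>s\<in>{0<..1}. \<forall>v. norm (log_form ?S2 t (x1 + s *\<^sub>R (y - x1)) v) \<le> C2 * norm v"
    by (elim exE conjE)
  obtain K where K: "0 \<le> K" "\<And>(a :: complex^'m^'m) (b :: complex^'m^'m). norm (a ** b) \<le> norm a * norm b * K"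
    using matrix_mult_norm by blast
  \<comment> \<open>The first summand bounds left and right multiplication, with \<open>K\<close>
    the constant of the matrix product; \<open>C2\<close> bounds the regular difference. Their sum
    serves in both estimates.\<close>
  define M where "M = (C + C1) * K + C2"
  define Q where "Q y \<longleftrightarrow> y \<in> cone_domain S x1 \<and> (\<forall>s\<in>{0<..1}. \<forall>v p.
      norm (gauge_connection S t x1 (x1 + s *\<^sub>R (y - x1)) v p) \<le> M / s * norm v * norm p \<and>
      norm (gauge_connection S t x1 (x1 + s *\<^sub>R (y - x1)) v (mat 1)) \<le> M * norm v)" for y
  have "\<forall>\<^sub>F y in nhds x. Q y"
    using C(2) C1(2) C2(2) eventually_nhds_in_open[OF open_cone_domain x]
  proof eventually_elim
    case (elim y)
    show ?case
      unfolding Q_def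
    proof (intro conjI ballI allI)
      fix s :: real and v :: "complex^'n" and p :: "complex^'m^'m" assume s: "s \<in> {0<..1}"
      let ?y = "x1 + s *\<^sub>R (y - x1)"
      have e: "norm (log_form S t ?y v) \<le> C / s * norm v" "norm (log_form ?S1 t ?y v) \<le> C1 / s * norm v"
        "norm (log_form ?S2 t ?y v) \<le> C2 * norm v"
        by (rule elim(1)[THEN bspec, OF s, THEN spec] elim(2)[THEN bspec, OF s, THEN spec]
            elim(3)[THEN bspec, OF s, THEN spec])+
      have a1: "norm (log_form S t ?y v ** p) \<le> (C / s * norm v) * norm p * K"
        by (rule order_trans[OF K(2)[of "log_form S t ?y v" p] mult_right_mono[OF mult_right_mono[OF e(1) norm_ge_zero] K(1)]])
      have a2: "norm (p ** log_form ?S1 t ?y v) \<le> norm p * (C1 / s * norm v) * K"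
        by (rule order_trans[OF K(2)[of p "log_form ?S1 t ?y v"] mult_right_mono[OF mult_left_mono[OF e(2) norm_ge_zero] K(1)]])
      have "norm (gauge_connection S t x1 ?y v p) \<le> (C / s * norm v) * norm p * K + norm p * (C1 / s * norm v) * K"
        unfolding gauge_connection_def by (rule order_trans[OF norm_triangle_ineq4 add_mono[OF a1 a2]])
      also have "\<dots> = ((C + C1) * K) * (norm v * norm p / s)"
        by (simp add: divide_inverse algebra_simps)
      also have "\<dots> \<le> M * (norm v * norm p / s)"
        using C2(1) s by (intro mult_right_mono) (auto simp: M_def)
      finally show "norm (gauge_connection S t x1 ?y v p) \<le> M / s * norm v * norm p"
        by (simp add: mult_ac)
      have "gauge_connection S t x1 ?y v (mat 1) = log_form ?S2 t ?y v"
        by (simp add: gauge_connection_def log_form_diff)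
      moreover note e(3)
      moreover have "C2 * norm v \<le> M * norm v"
        using C(1) C1(1) K(1) by (intro mult_right_mono) (auto simp: M_def)
      ultimately show "norm (gauge_connection S t x1 ?y v (mat 1)) \<le> M * norm v" by simp
    qed (rule elim(4))
  qed
  then obtain r where r: "r > 0" "\<And>y. dist y x < r \<Longrightarrow> Q y"
    unfolding eventually_nhds_metric by blast
  show ?thesis
  proof (rule exI[of _ r], rule conjI[OF r(1)], rule exI[of _ M], rule conjI)
    show "ball x r \<subseteq> cone_domain S x1"
      using r(2) unfolding Q_def by (simp add: dist_commute subset_iff)
    show "\<forall>y\<in>ball x r. \<forall>s\<in>{0<..1}. \<forall>v p.
        norm (gauge_connection S t x1 (x1 + s *\<^sub>R (y - x1)) v p) \<le> M / s * norm v * norm p \<and>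
        norm (gauge_connection S t x1 (x1 + s *\<^sub>R (y - x1)) v (mat 1)) \<le> M * norm v"
    proof
      fix y assume "y \<in> ball x r"
      then have "Q y" by (intro r) (simp add: dist_commute)
      then show "\<forall>s\<in>{0<..1}. \<forall>v p.
        norm (gauge_connection S t x1 (x1 + s *\<^sub>R (y - x1)) v p) \<le> M / s * norm v * norm p \<and>
        norm (gauge_connection S t x1 (x1 + s *\<^sub>R (y - x1)) v (mat 1)) \<le> M * norm v"
        unfolding Q_def by (rule conjunct2)
    qed
  qed
qed

section \<open>The gauge connection of a flat system\<close>

lemma linear_gauge_connection:
  "linear (gauge_connection S t x1 x v)" "linear (\<lambda>v. gauge_connection S t x1 x v p)"
proof -
  show "linear (gauge_connection S t x1 x v)"
    unfolding gauge_connection_def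
    by (intro bounded_linear.linear[OF bounded_linear_sub]
        matrix_mult.bounded_linear_left matrix_mult.bounded_linear_right)
  have 1: "linear (\<lambda>v. log_form S t x v ** p)"
    using linear_compose[OF linear_log_form[OF order_refl] bounded_linear.linear[OF matrix_mult.bounded_linear_left]]
    by (simp only: o_def)
  have 2: "linear (\<lambda>v. p ** log_form (center_hyperplanes x1) t x v)"
    using linear_compose[OF linear_log_form bounded_linear.linear[OF matrix_mult.bounded_linear_right], of "center_hyperplanes x1"]
    by (simp only: o_def) blast
  show "linear (\<lambda>v. gauge_connection S t x1 x v p)"
    unfolding gauge_connection_def by (rule linear_compose_sub[OF 1 2])
qed

text \<open>Left multiplications by values of \<omega> commute with each other by flatness, right
  multiplications by values of \<omega>0 likewise, and left and right multiplications always
  commute.\<close>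

lemma gauge_connection_commute:
  assumes x: "x \<in> cone_domain S x1"
  shows "gauge_connection S t x1 x u (gauge_connection S t x1 x v p) =
      gauge_connection S t x1 x v (gauge_connection S t x1 x u p)"
proof -
  let ?w = "log_form S t x" and ?w1 = "log_form (center_hyperplanes x1) t x"
  have av: "x \<notin> \<Union>S" "x \<notin> \<Union>(center_hyperplanes x1)" using cone_domain_avoids[OF x] by auto
  have 1: "?w u ** ?w v ** p = ?w v ** ?w u ** p"
    using log_form_commute[OF relation av(1)] by simp
  have 2: "p ** ?w1 v ** ?w1 u = p ** ?w1 u ** ?w1 v"
    using sub_commute[OF av(2), of u v] by (simp add: matrix_mul_assoc[symmetric])
  show ?thesis
    unfolding gauge_connection_def matrix_mult.diff_left matrix_mult.diff_right matrix_mul_assoc 1 2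
    by simp
qed

lemma has_derivative_gauge_connection:
  assumes x: "x \<in> cone_domain S x1"
  shows "((\<lambda>x. gauge_connection S t x1 x v p) has_derivative
      (\<lambda>u. dlog_form S t x u v ** p - p ** dlog_form (center_hyperplanes x1) t x u v)) (at x)"
proof -
  have av: "x \<notin> \<Union>S" "x \<notin> \<Union>(center_hyperplanes x1)" using cone_domain_avoids[OF x] by auto
  show ?thesis
    unfolding gauge_connection_def
    by (rule has_derivative_diff[OF
        bounded_linear.has_derivative[OF matrix_mult.bounded_linear_left has_derivative_log_form[OF order_refl av(1)]]
        bounded_linear.has_derivative[OF matrix_mult.bounded_linear_right has_derivative_log_form[OF _ av(2)]]]) blast
qed

lemma radial_connection_gauge:
  "radial_connection (cone_domain S x1) x1 (gauge_connection S t x1)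
     (\<lambda>x u v p. dlog_form S t x u v ** p - p ** dlog_form (center_hyperplanes x1) t x u v) (mat 1)"
proof (rule radial_connection.intro)
  fix x u v :: "complex^'n" and p :: "complex^'m^'m" and s :: real
  let ?S1 = "center_hyperplanes x1"
  show "linear (gauge_connection S t x1 x v)" "linear (\<lambda>v. gauge_connection S t x1 x v p)"
    by (rule linear_gauge_connection)+
  show "linear (\<lambda>p. dlog_form S t x u v ** p - p ** dlog_form ?S1 t x u v)"
    by (intro bounded_linear.linear[OF bounded_linear_sub]
        matrix_mult.bounded_linear_left matrix_mult.bounded_linear_right)
  have "continuous_on (cone_domain S x1) (\<lambda>x. dlog_form S t x u v)"
    using cone_domain_avoids by (intro continuous_dlog_form) blast+
  moreover have "continuous_on (cone_domain S x1) (\<lambda>x. dlog_form ?S1 t x u v)"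
    using cone_domain_avoids by (intro continuous_dlog_form) blast+
  ultimately show "continuous_on (cone_domain S x1) (\<lambda>x. dlog_form S t x u v ** p - p ** dlog_form ?S1 t x u v)"
    by (intro continuous_on_diff matrix_mult.continuous_on continuous_on_const)
  show "dlog_form S t x u v ** p - p ** dlog_form ?S1 t x u v = dlog_form S t x v u ** p - p ** dlog_form ?S1 t x v u"
    by (simp only: dlog_form_sym[of _ x u v])
  assume x: "x \<in> cone_domain S x1"
  show "((\<lambda>x. gauge_connection S t x1 x v p) has_derivative
      (\<lambda>u. dlog_form S t x u v ** p - p ** dlog_form ?S1 t x u v)) (at x)"
    by (rule has_derivative_gauge_connection[OF x])
  show "gauge_connection S t x1 x u (gauge_connection S t x1 x v p) =
      gauge_connection S t x1 x v (gauge_connection S t x1 x u p)"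
    by (rule gauge_connection_commute[OF x])
  show "x1 + s *\<^sub>R (x - x1) \<in> cone_domain S x1" if "0 < s" "s \<le> 1"
    by (rule cone_domain_star[OF x that])
  show "\<exists>r>0. \<exists>C. ball x r \<subseteq> cone_domain S x1 \<and>
      (\<forall>y\<in>ball x r. \<forall>s\<in>{0<..1}. \<forall>v p.
        norm (gauge_connection S t x1 (x1 + s *\<^sub>R (y - x1)) v p) \<le> C / s * norm v * norm p \<and>
        norm (gauge_connection S t x1 (x1 + s *\<^sub>R (y - x1)) v (mat 1)) \<le> C * norm v)"
    by (rule gauge_connection_growth[OF x])
qed

theorem has_derivative_gauge:
  assumes "x \<in> cone_domain S x1"
  shows "(gauge S t x1 (Suc k) has_derivative
    (\<lambda>v. log_form S t x v ** gauge S t x1 k x - gauge S t x1 k x ** log_form (center_hyperplanes x1) t x v)) (at x)"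
  using radial_connection.solution(1)[OF radial_connection_gauge assms]
  unfolding gauge_def gauge_connection_def .

lemma gauge_0: "gauge S t x1 0 x = mat 1"
  by (simp add: gauge_def)

lemma gauge_at_center: "x1 \<notin> \<Union>S \<Longrightarrow> gauge S t x1 (Suc k) x1 = 0"
  unfolding gauge_def
  by (rule radial_connection.solution_at_center[OF radial_connection_gauge center_in_cone_domain])

text \<open>The forms are picked by choice, so the one of the image hyperplane need not correspond
  to that of \<open>H\<close> under \<open>w\<close>. Composed with \<open>w\<close> it has kernel
  \<open>H\<close>, and quotients see only the kernel.\<close>

lemma form_image:
  assumes H: "H \<in> S" "(*v) w ` H \<in> S" and w: "invertible w"
  shows "linear_form_of ((*v) w ` H) (w *v v) / linear_form_of ((*v) w ` H) (w *v x)
       = linear_form_of H v / linear_form_of H x"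
proof (rule form_ratio)
  interpret f: Vector_Spaces.linear "(*s)" "(*)" "linear_form_of ((*v) w ` H)" by (rule linear_form[OF H(2)])
  show "Vector_Spaces.linear (*s) (*) (\<lambda>v. linear_form_of ((*v) w ` H) (w *v v))"
    by unfold_locales (simp_all add: matrix_vector_right_distrib vector_scalar_commute f.add f.scale algebra_simps)
  have "inj ((*v) w)" using w by (simp add: inj_matrix_vector_mult)
  then have "w *v y \<in> (*v) w ` H \<longleftrightarrow> y \<in> H" for y by (simp add: inj_image_mem_iff)
  then show "linear_form_of ((*v) w ` H) (w *v y) = 0 \<longleftrightarrow> linear_form_of H y = 0" for y
    by (simp add: kernel H)
qed (rule linear_form[OF H(1)])

text \<open>\<open>w\<close> permutes the finite set of hyperplanes, so the sum can be reindexed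
  along this permutation; then each quotient of forms is invariant and each residue is
  conjugated.\<close>

lemma log_form_equivariant:
  fixes s s' :: "complex^'m^'m"
  assumes S': "S' \<subseteq> S" "\<And>H. H \<in> S' \<Longrightarrow> (*v) w ` H \<in> S'" and w: "invertible w"
    and t: "\<And>H. H \<in> S' \<Longrightarrow> t ((*v) w ` H) = s ** t H ** s'"
  shows "log_form S' t (w *v x) (w *v v) = s ** log_form S' t x v ** s'"
proof -
  have "inj ((*v) w)" using w by (simp add: inj_matrix_vector_mult)
  then have inj: "inj_on ((`) ((*v) w)) S'" by (auto simp: inj_on_def inj_image_eq_iff)
  moreover have fin: "finite S'" using finite_S S'(1) by (rule finite_subset[rotated])
  ultimately have bij: "(`) ((*v) w) ` S' = S'"
    using S' by (intro endo_inj_surj) auto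
  have "log_form S' t (w *v x) (w *v v) =
    (\<Sum>H\<in>(`) ((*v) w) ` S'. cscale (linear_form_of H (w *v v) / linear_form_of H (w *v x) / (\<i> * of_real pi)) (t H))"
    by (simp only: log_form_def bij)
  also have "\<dots> = (\<Sum>H\<in>S'. cscale (linear_form_of H v / linear_form_of H x / (\<i> * of_real pi)) (s ** t H ** s'))"
    unfolding sum.reindex[OF inj] o_def
    by (intro sum.cong HOL.refl arg_cong2[where f = cscale] t arg_cong2[where f = "(/)"] form_image w) (use S' in auto)
  also have "\<dots> = (\<Sum>H\<in>S'. s ** cscale (linear_form_of H v / linear_form_of H x / (\<i> * of_real pi)) (t H) ** s')"
  proof (intro sum.cong HOL.refl)
    fix H
    have 1: "cscale c (a ** b) = cscale c a ** b" "cscale c (a ** b) = a ** cscale c b" for c and a b :: "complex^'m^'m"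
      by (simp_all add: cscale_def matrix_matrix_mult_def vec_eq_iff sum_distrib_left mult_ac)
    show "cscale (linear_form_of H v / linear_form_of H x / (\<i> * of_real pi)) (s ** t H ** s')
       = s ** cscale (linear_form_of H v / linear_form_of H x / (\<i> * of_real pi)) (t H) ** s'"
      by (simp only: 1(1)[of _ "s ** t H" s'] 1(2)[of _ s "t H"])
  qed
  also have "\<dots> = s ** log_form S' t x v ** s'"
    by (simp only: log_form_def matrix_mult.sum_left matrix_mult.sum_right)
  finally show ?thesis .
qed

lemma gauge_equivariant:
  fixes s s' :: "complex^'m^'m"
  assumes w: "invertible w" "w *v x1 = x1" and S: "\<And>H. H \<in> S \<Longrightarrow> (*v) w ` H \<in> S"
    and s: "s ** s' = mat 1" "s' ** s = mat 1"
    and t: "\<And>H. H \<in> S \<Longrightarrow> t ((*v) w ` H) = s ** t H ** s'"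
    and x: "x \<in> cone_domain S x1"
  shows "gauge S t x1 k (w *v x) = s ** gauge S t x1 k x ** s'"
  unfolding gauge_def
proof (rule radial_connection.solution_equivariant[where L = "(*v) w" and M = "\<lambda>a. s ** a ** s'",
      OF radial_connection_gauge _ w(2) _ _ _ x])
  show "linear ((*v) w)" by (rule matrix_vector_mul_linear)
  show "linear (\<lambda>a. s ** a ** s')"
    by (intro bounded_linear.linear bounded_linear_compose[OF matrix_mult.bounded_linear_left matrix_mult.bounded_linear_right])
  show "s ** mat 1 ** s' = mat 1" by (simp add: s)
  fix x v p
  \<comment> \<open>\<open>w\<close> fixes \<open>x1\<close>, so it permutes the hyperplanes through
    \<open>x1\<close>, and \<omega>0 is equivariant together with \<omega>.\<close>
  have S1: "(*v) w ` H \<in> center_hyperplanes x1" if "H \<in> center_hyperplanes x1" for H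
  proof -
    have "x1 \<in> (*v) w ` H" using that w(2) kernel by (metis (mono_tags, lifting) image_eqI mem_Collect_eq)
    then show ?thesis using that S kernel by auto
  qed
  have e: "log_form S t (w *v x) (w *v v) = s ** log_form S t x v ** s'"
    by (rule log_form_equivariant) (use S w t in auto)
  have e1: "log_form (center_hyperplanes x1) t (w *v x) (w *v v) = s ** log_form (center_hyperplanes x1) t x v ** s'"
    by (rule log_form_equivariant[OF _ S1]) (use w t in auto)
  have c: "(s ** a ** s') ** (s ** b ** s') = s ** (a ** b) ** s'" for a b
  proof -
    have "(s ** a ** s') ** (s ** b ** s') = s ** a ** (s' ** s) ** b ** s'" by (simp only: matrix_mul_assoc)
    then show ?thesis by (simp add: s matrix_mul_assoc)
  qed
  show "gauge_connection S t x1 (w *v x) (w *v v) (s ** p ** s') = s ** gauge_connection S t x1 x v p ** s'"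
    unfolding gauge_connection_def e e1 c matrix_mult.diff_left matrix_mult.diff_right ..
qed

end

section \<open>Transport of solutions\<close>

definition coeff_matrix :: "nat \<Rightarrow> complex fps^'m^'m \<Rightarrow> complex^'m^'m" where
  "coeff_matrix k F = (\<chi> i j. fps_nth (F $ i $ j) k)"

definition series_matrix :: "(nat \<Rightarrow> complex^'m^'m) \<Rightarrow> complex fps^'m^'m" where
  "series_matrix P = (\<chi> i j. Abs_fps (\<lambda>k. P k $ i $ j))"

lemma coeff_series_matrix: "coeff_matrix k (series_matrix P) = P k"
  by (simp add: coeff_matrix_def series_matrix_def vec_eq_iff)

lemma series_coeff_matrix: "series_matrix (\<lambda>k. coeff_matrix k F) = F"
  by (simp add: coeff_matrix_def series_matrix_def vec_eq_iff fps_eq_iff)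

lemma coeff_matrix_eqI:
  assumes "\<And>k. coeff_matrix k F = coeff_matrix k G"
  shows "F = G"
  using arg_cong[of "\<lambda>k. coeff_matrix k F" "\<lambda>k. coeff_matrix k G" series_matrix] assms
  unfolding series_coeff_matrix by blast

lemma coeff_matrix_one: "coeff_matrix k (mat 1) = (if k = 0 then mat 1 else 0)"
  by (auto simp: coeff_matrix_def mat_def vec_eq_iff)

lemma coeff_matrix_mult:
  "coeff_matrix k (F ** G) = (\<Sum>a\<le>k. coeff_matrix a F ** coeff_matrix (k - a) G)"
proof -
  have "fps_nth (\<Sum>l\<in>UNIV. F $ i $ l * G $ l $ j) k
      = (\<Sum>a\<le>k. \<Sum>l\<in>UNIV. fps_nth (F $ i $ l) a * fps_nth (G $ l $ j) (k - a))" for i j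
    unfolding fps_sum_nth fps_mult_nth atLeast0AtMost by (rule sum.swap)
  then show ?thesis
    by (simp add: coeff_matrix_def matrix_matrix_mult_def vec_eq_iff)
qed

lemma coeff_matrix_h_times:
  "coeff_matrix k (h_times A ** F) = (if k = 0 then 0 else A ** coeff_matrix (k - 1) F)"
  by (auto simp: coeff_matrix_def h_times_def matrix_matrix_mult_def vec_eq_iff fps_sum_nth mult.assoc)

lemma matrix_has_derivative:
  fixes f :: "'a::real_normed_vector \<Rightarrow> complex^'m^'m"
  shows "(f has_derivative f') F \<longleftrightarrow> (\<forall>i j. ((\<lambda>y. f y $ i $ j) has_derivative (\<lambda>v. f' v $ i $ j)) F)"
proof
  assume "(f has_derivative f') F"
  then show "\<forall>i j. ((\<lambda>y. f y $ i $ j) has_derivative (\<lambda>v. f' v $ i $ j)) F"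
    by (intro allI bounded_linear.has_derivative[OF bounded_linear_vec_nth])
next
  assume *: "\<forall>i j. ((\<lambda>y. f y $ i $ j) has_derivative (\<lambda>v. f' v $ i $ j)) F"
  define E :: "'m \<Rightarrow> 'm \<Rightarrow> complex^'m^'m" where "E i j = (\<chi> a b. if a = i \<and> b = j then 1 else 0)" for i j
  have rep: "A = (\<Sum>i\<in>UNIV. \<Sum>j\<in>UNIV. cscale (A $ i $ j) (E i j))" for A :: "complex^'m^'m"
  proof -
    have "(\<Sum>i\<in>UNIV. \<Sum>j\<in>UNIV. A $ i $ j * (if a = i \<and> b = j then 1 else 0)) = A $ a $ b" for a b
    proof -
      have "(\<Sum>j\<in>UNIV. A $ i $ j * (if a = i \<and> b = j then 1 else 0)) = (if a = i then A $ i $ b else 0)" for i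
        by (auto simp: if_distrib[of "(*) _"] cong: if_cong)
      then show ?thesis by simp
    qed
    then show ?thesis
      by (simp add: vec_eq_iff cscale_component E_def)
  qed
  have "((\<lambda>y. \<Sum>i\<in>UNIV. \<Sum>j\<in>UNIV. cscale (f y $ i $ j) (E i j)) has_derivative
      (\<lambda>v. \<Sum>i\<in>UNIV. \<Sum>j\<in>UNIV. cscale (f' v $ i $ j) (E i j))) F"
    using * by (intro has_derivative_sum bounded_linear.has_derivative[OF bounded_linear_cscale]) blast
  then show "(f has_derivative f') F"
    by (simp only: rep[symmetric])
qed

text \<open>
  \<open>gauges \<omega> \<omega>' U P\<close> is \<open>dP = h(\<omega> P - P \<omega>')\<close> on \<open>U\<close>; solutions of \<open>dF = h \<omega> F\<close> are the case
  \<open>\<omega>' = 0\<close>, and \<open>P\<close> carries solutions for \<open>\<omega>'\<close> to solutions for \<open>\<omega>\<close>.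
\<close>

definition gauges ::
  "('n, 'm) matrix_form \<Rightarrow> ('n, 'm) matrix_form \<Rightarrow> (complex^'n) set \<Rightarrow> (complex^'n \<Rightarrow> complex fps^'m^'m) \<Rightarrow> bool" where
  "gauges \<omega> \<omega>' U P \<longleftrightarrow> (\<forall>x\<in>U. \<forall>k. ((\<lambda>y. coeff_matrix k (P y)) has_derivative
     (\<lambda>v. if k = 0 then 0 else \<omega> x v ** coeff_matrix (k - 1) (P x) - coeff_matrix (k - 1) (P x) ** \<omega>' x v)) (at x))"

lemma solves_on_gauges: "solves_on \<omega> U F \<longleftrightarrow> gauges \<omega> (\<lambda>x v. 0) U F"
proof -
  have "fps_nth ((h_times (\<omega> x v) ** F x) $ i $ j) k =
     (if k = 0 then 0 else \<omega> x v ** coeff_matrix (k - 1) (F x) - coeff_matrix (k - 1) (F x) ** 0) $ i $ j" for x v i j k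
    using arg_cong[OF coeff_matrix_h_times[of k "\<omega> x v" "F x"], of "\<lambda>A. A $ i $ j"]
    by (simp add: coeff_matrix_def split: if_splits)
  then show ?thesis
    unfolding solves_on_def gauges_def matrix_has_derivative
    by (simp add: coeff_matrix_def) blast
qed

text \<open>In the product rule the two terms containing the middle form \<omega>' cancel. With it,
  multiplication by a gauge transformation and by a constant matrix become instances of one
  fact.\<close>

lemma gauges_mult:
  fixes P Q :: "complex^'n \<Rightarrow> complex fps^'m^'m"
  assumes P: "gauges \<omega> \<omega>' U P" and Q: "gauges \<omega>' \<omega>'' U Q"
  shows "gauges \<omega> \<omega>'' U (\<lambda>x. P x ** Q x)"
  unfolding gauges_def
proof (intro ballI allI)
  fix x k assume x: "x \<in> U"
  define p where "p a = coeff_matrix a (P x)" for a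
  define q where "q a = coeff_matrix a (Q x)" for a
  define dp where "dp a v = (if a = 0 then 0 else \<omega> x v ** p (a - 1) - p (a - 1) ** \<omega>' x v)" for a v
  define dq where "dq a v = (if a = 0 then 0 else \<omega>' x v ** q (a - 1) - q (a - 1) ** \<omega>'' x v)" for a v
  have "((\<lambda>y. \<Sum>a\<le>k. coeff_matrix a (P y) ** coeff_matrix (k - a) (Q y)) has_derivative
      (\<lambda>v. \<Sum>a\<le>k. p a ** dq (k - a) v + dp a v ** q (k - a))) (at x)"
    using P Q x unfolding gauges_def p_def q_def dp_def dq_def
    by (intro has_derivative_sum matrix_mult.FDERIV) blast+
  moreover have "(\<Sum>a\<le>k. p a ** dq (k - a) v + dp a v ** q (k - a)) =
     (if k = 0 then 0 else \<omega> x v ** (\<Sum>a\<le>k - 1. p a ** q (k - 1 - a)) - (\<Sum>a\<le>k - 1. p a ** q (k - 1 - a)) ** \<omega>'' x v)" for v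
  proof (cases k)
    case (Suc n)
    \<comment> \<open>The derivative of a coefficient of order zero vanishes, so each sum loses one
      end term and both can be indexed by \<open>a \<le> n\<close>.\<close>
    have 1: "(\<Sum>a\<le>Suc n. p a ** dq (Suc n - a) v) = (\<Sum>a\<le>n. p a ** dq (Suc n - a) v)"
      by (simp add: dq_def)
    have 2: "(\<Sum>a\<le>Suc n. dp a v ** q (Suc n - a)) = (\<Sum>a\<le>n. dp (Suc a) v ** q (n - a))"
      by (subst sum.atMost_Suc_shift) (simp add: dp_def)
    have "(\<Sum>a\<le>Suc n. p a ** dq (Suc n - a) v + dp a v ** q (Suc n - a))
        = (\<Sum>a\<le>n. p a ** dq (Suc n - a) v + dp (Suc a) v ** q (n - a))"
      by (simp only: sum.distrib 1 2)
    also have "\<dots> = (\<Sum>a\<le>n. \<omega> x v ** (p a ** q (n - a)) - (p a ** q (n - a)) ** \<omega>'' x v)"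
    proof (rule sum.cong[OF HOL.refl])
      fix a assume "a \<in> {..n}"
      then have "Suc n - a = Suc (n - a)" by auto
      then show "p a ** dq (Suc n - a) v + dp (Suc a) v ** q (n - a)
          = \<omega> x v ** (p a ** q (n - a)) - (p a ** q (n - a)) ** \<omega>'' x v"
        by (simp add: dq_def dp_def matrix_mult.diff_left matrix_mult.diff_right matrix_mul_assoc)
    qed
    finally show ?thesis
      by (simp add: Suc sum_subtractf matrix_mult.sum_left matrix_mult.sum_right)
  qed (simp add: dp_def dq_def)
  ultimately show "((\<lambda>y. coeff_matrix k (P y ** Q y)) has_derivative
     (\<lambda>v. if k = 0 then 0 else \<omega> x v ** coeff_matrix (k - 1) (P x ** Q x) - coeff_matrix (k - 1) (P x ** Q x) ** \<omega>'' x v)) (at x)"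
    unfolding coeff_matrix_mult p_def q_def by (simp only:)
qed

section \<open>Uniqueness of solutions on convex sets and along paths\<close>

lemma gauges_subset: "gauges \<omega> \<omega>' U P \<Longrightarrow> V \<subseteq> U \<Longrightarrow> gauges \<omega> \<omega>' V P"
  unfolding gauges_def by blast

lemma gauges_const: "gauges (\<lambda>x v. 0) (\<lambda>x v. 0) U (\<lambda>x. C)"
  unfolding gauges_def by (simp cong: if_cong)

lemma solves_on_subset: "solves_on \<omega> U F \<Longrightarrow> V \<subseteq> U \<Longrightarrow> solves_on \<omega> V F"
  unfolding solves_on_gauges by (rule gauges_subset)

lemma solves_on_mult_const: "solves_on \<omega> U F \<Longrightarrow> solves_on \<omega> U (\<lambda>x. F x ** C)"
  unfolding solves_on_gauges by (rule gauges_mult[OF _ gauges_const])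

lemma solves_on_gauge: "gauges \<omega> \<omega>' U P \<Longrightarrow> solves_on \<omega>' U F \<Longrightarrow> solves_on \<omega> U (\<lambda>x. P x ** F x)"
  unfolding solves_on_gauges by (rule gauges_mult)

text \<open>The derivative of the coefficient of order \<open>k + 1\<close> involves only the
  coefficient of order \<open>k\<close>. Once the latter agree, the difference of the former is
  constant on a convex set, and it vanishes at \<open>p\<close>.\<close>

lemma solves_on_unique:
  assumes F: "solves_on \<omega> U F" and G: "solves_on \<omega> U G" and U: "convex U" "p \<in> U" "x \<in> U"
    and eq: "F p = G p"
  shows "F x = G x"
proof (rule coeff_matrix_eqI)
  fix k
  have "\<forall>x\<in>U. coeff_matrix k (F x) = coeff_matrix k (G x)"
  proof (induction k)
    case 0
    have "((\<lambda>y. coeff_matrix 0 (F y) - coeff_matrix 0 (G y)) has_derivative (\<lambda>v. 0)) (at x within U)" if "x \<in> U" for x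
    proof (rule has_derivative_at_withinI)
      have "((\<lambda>y. coeff_matrix 0 (F y)) has_derivative (\<lambda>v. 0)) (at x)"
        "((\<lambda>y. coeff_matrix 0 (G y)) has_derivative (\<lambda>v. 0)) (at x)"
        using F[unfolded solves_on_gauges gauges_def, rule_format, OF that, of 0]
          G[unfolded solves_on_gauges gauges_def, rule_format, OF that, of 0] by simp_all
      from has_derivative_diff[OF this]
      show "((\<lambda>y. coeff_matrix 0 (F y) - coeff_matrix 0 (G y)) has_derivative (\<lambda>v. 0)) (at x)" by simp
    qed
    from has_derivative_zero_constant[OF U(1) this]
    obtain c where c: "\<And>x. x \<in> U \<Longrightarrow> coeff_matrix 0 (F x) - coeff_matrix 0 (G x) = c" by blast
    have "c = 0" using c[OF U(2)] eq by simp
    then show ?case using c by simp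
  next
    case (Suc k)
    have "((\<lambda>y. coeff_matrix (Suc k) (F y) - coeff_matrix (Suc k) (G y)) has_derivative (\<lambda>v. 0)) (at x within U)" if "x \<in> U" for x
    proof (rule has_derivative_at_withinI)
      have "((\<lambda>y. coeff_matrix (Suc k) (F y)) has_derivative (\<lambda>v. \<omega> x v ** coeff_matrix k (F x))) (at x)"
        "((\<lambda>y. coeff_matrix (Suc k) (G y)) has_derivative (\<lambda>v. \<omega> x v ** coeff_matrix k (G x))) (at x)"
        using F[unfolded solves_on_gauges gauges_def, rule_format, OF that, of "Suc k"]
          G[unfolded solves_on_gauges gauges_def, rule_format, OF that, of "Suc k"] by simp_all
      from has_derivative_diff[OF this]
      show "((\<lambda>y. coeff_matrix (Suc k) (F y) - coeff_matrix (Suc k) (G y)) has_derivative (\<lambda>v. 0)) (at x)"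
        using Suc that by simp
    qed
    from has_derivative_zero_constant[OF U(1) this]
    obtain c where c: "\<And>x. x \<in> U \<Longrightarrow> coeff_matrix (Suc k) (F x) - coeff_matrix (Suc k) (G x) = c" by blast
    have "c = 0" using c[OF U(2)] eq by simp
    then show ?case using c by simp
  qed
  then show "coeff_matrix k (F x) = coeff_matrix k (G x)" using U(3) by blast
qed

text \<open>The same notion as \<open>solution_along\<close> on an arbitrary interval, so that paths
  can be cut and glued.\<close>

definition solution_on ::
  "('n, 'm) matrix_form \<Rightarrow> (complex^'n) set \<Rightarrow> (real \<Rightarrow> complex^'n) \<Rightarrow> real \<Rightarrow> real \<Rightarrow>
   (real \<Rightarrow> complex fps^'m^'m) \<Rightarrow> bool" where
  "solution_on \<omega> X \<gamma> a b \<Phi> \<longleftrightarrow>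
     (\<forall>t\<in>{a..b}. \<exists>U F. open U \<and> \<gamma> t \<in> U \<and> U \<subseteq> X \<and> solves_on \<omega> U F \<and>
        (\<forall>\<^sub>F s in nhds t. s \<in> {a..b} \<longrightarrow> \<Phi> s = F (\<gamma> s)))"

lemma solution_along_on: "solution_along \<omega> X \<gamma> \<Phi> \<longleftrightarrow> solution_on \<omega> X \<gamma> 0 1 \<Phi>"
  unfolding solution_along_def solution_on_def ..

lemma solution_onE:
  assumes "solution_on \<omega> X \<gamma> a b \<Phi>" "t \<in> {a..b}"
  obtains r F where "0 < r" "ball (\<gamma> t) r \<subseteq> X" "solves_on \<omega> (ball (\<gamma> t) r) F" "\<Phi> t = F (\<gamma> t)"
    "\<forall>\<^sub>F s in nhds t. s \<in> {a..b} \<longrightarrow> \<Phi> s = F (\<gamma> s)"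
proof -
  obtain U F where U: "open U" "\<gamma> t \<in> U" "U \<subseteq> X" "solves_on \<omega> U F"
    and ev: "\<forall>\<^sub>F s in nhds t. s \<in> {a..b} \<longrightarrow> \<Phi> s = F (\<gamma> s)"
    using assms unfolding solution_on_def by blast
  obtain r where r: "0 < r" "ball (\<gamma> t) r \<subseteq> U" using U(1,2) unfolding open_contains_ball by blast
  have "\<Phi> t = F (\<gamma> t)" using eventually_nhds_x_imp_x[OF ev] assms(2) by blast
  then show thesis using that[OF r(1) _ solves_on_subset[OF U(4) r(2)] _ ev] r(2) U(3) by blast
qed

lemma path_eventually_ball:
  fixes \<gamma> :: "real \<Rightarrow> 'a::metric_space"
  assumes "continuous_on S \<gamma>" "t \<in> S" "0 < r"
  shows "\<forall>\<^sub>F s in nhds t. s \<in> S \<longrightarrow> \<gamma> s \<in> ball (\<gamma> t) r"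
proof -
  have "(\<gamma> \<longlongrightarrow> \<gamma> t) (at t within S)" using assms by (simp add: continuous_on_def)
  then have "\<forall>\<^sub>F s in at t within S. dist (\<gamma> s) (\<gamma> t) < r" using assms(3) by (rule tendstoD)
  then show ?thesis
    unfolding eventually_at_filter by eventually_elim (use assms(3) in \<open>auto simp: dist_commute\<close>)
qed

text \<open>Near each parameter the two solutions agree either everywhere or nowhere, by uniqueness
  on a ball in both directions. Agreement is thus a locally constant property on a connected
  interval.\<close>

lemma solution_on_unique:
  assumes \<Phi>: "solution_on \<omega> X \<gamma> a b \<Phi>" and \<Psi>: "solution_on \<omega> X \<gamma> a b \<Psi>"
    and \<gamma>: "continuous_on {a..b} \<gamma>" and eq: "\<Phi> a = \<Psi> a" and t: "t \<in> {a..b}"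
  shows "\<Phi> t = \<Psi> t"
proof -
  have loc: "\<forall>\<^sub>F s in nhds t. s \<in> {a..b} \<longrightarrow> (\<Phi> s = \<Psi> s \<longleftrightarrow> \<Phi> t = \<Psi> t)" if t: "t \<in> {a..b}" for t
  proof -
    obtain r F where F: "0 < r" "ball (\<gamma> t) r \<subseteq> X" "solves_on \<omega> (ball (\<gamma> t) r) F" "\<Phi> t = F (\<gamma> t)"
      "\<forall>\<^sub>F s in nhds t. s \<in> {a..b} \<longrightarrow> \<Phi> s = F (\<gamma> s)" by (rule solution_onE[OF \<Phi> t])
    obtain r' G where G: "0 < r'" "ball (\<gamma> t) r' \<subseteq> X" "solves_on \<omega> (ball (\<gamma> t) r') G" "\<Psi> t = G (\<gamma> t)"
      "\<forall>\<^sub>F s in nhds t. s \<in> {a..b} \<longrightarrow> \<Psi> s = G (\<gamma> s)" by (rule solution_onE[OF \<Psi> t])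
    define m where "m = min r r'"
    have m: "0 < m" "ball (\<gamma> t) m \<subseteq> ball (\<gamma> t) r" "ball (\<gamma> t) m \<subseteq> ball (\<gamma> t) r'"
      using F(1) G(1) by (auto simp: m_def)
    have u: "F y = G y \<longleftrightarrow> F (\<gamma> t) = G (\<gamma> t)" if "y \<in> ball (\<gamma> t) m" for y
      using solves_on_unique[OF solves_on_subset[OF F(3) m(2)] solves_on_subset[OF G(3) m(3)] convex_ball, of "\<gamma> t" y]
        solves_on_unique[OF solves_on_subset[OF F(3) m(2)] solves_on_subset[OF G(3) m(3)] convex_ball, of y "\<gamma> t"]
        that m(1) centre_in_ball by blast
    show ?thesis
      using F(5) G(5) path_eventually_ball[OF \<gamma> t m(1)]
    proof eventually_elim
      case (elim s)
      show ?case
      proof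
        assume s: "s \<in> {a..b}"
        have "\<Phi> s = F (\<gamma> s)" "\<Psi> s = G (\<gamma> s)" "\<gamma> s \<in> ball (\<gamma> t) m" using elim s by blast+
        then show "\<Phi> s = \<Psi> s \<longleftrightarrow> \<Phi> t = \<Psi> t" using u[of "\<gamma> s"] F(4) G(4) by (simp only:)
      qed
    qed
  qed
  have "(\<lambda>t. \<Phi> t = \<Psi> t) constant_on {a..b}"
  proof (rule locally_constant_imp_constant)
    show "connected {a..b}" by (rule connected_Icc)
    fix t assume "t \<in> {a..b}"
    from loc[OF this] obtain T where T: "open T" "t \<in> T" "\<And>s. s \<in> T \<Longrightarrow> s \<in> {a..b} \<Longrightarrow> (\<Phi> s = \<Psi> s \<longleftrightarrow> \<Phi> t = \<Psi> t)"
      unfolding eventually_nhds by blast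
    then show "\<exists>T. openin (top_of_set {a..b}) T \<and> t \<in> T \<and> (\<forall>x\<in>T. (\<Phi> x = \<Psi> x) = (\<Phi> t = \<Psi> t))"
      using \<open>t \<in> {a..b}\<close> by (intro exI[of _ "{a..b} \<inter> T"] conjI openin_open_Int ballI) blast+
  qed
  then obtain c where c: "\<And>s. s \<in> {a..b} \<Longrightarrow> (\<Phi> s = \<Psi> s) = c" unfolding constant_on_def by blast
  have "a \<in> {a..b}" using t by simp
  then show ?thesis using c[of a] c[OF t] eq by simp
qed

lemma solution_on_mult_const: "solution_on \<omega> X \<gamma> a b \<Phi> \<Longrightarrow> solution_on \<omega> X \<gamma> a b (\<lambda>t. \<Phi> t ** C)"
  unfolding solution_on_def
proof (intro ballI)
  fix t assume *: "\<forall>t\<in>{a..b}. \<exists>U F. open U \<and> \<gamma> t \<in> U \<and> U \<subseteq> X \<and> solves_on \<omega> U F \<and>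
        (\<forall>\<^sub>F s in nhds t. s \<in> {a..b} \<longrightarrow> \<Phi> s = F (\<gamma> s))" and t: "t \<in> {a..b}"
  obtain U F where F: "open U" "\<gamma> t \<in> U" "U \<subseteq> X" "solves_on \<omega> U F"
        "\<forall>\<^sub>F s in nhds t. s \<in> {a..b} \<longrightarrow> \<Phi> s = F (\<gamma> s)" using *[rule_format, OF t] by blast
  show "\<exists>U F. open U \<and> \<gamma> t \<in> U \<and> U \<subseteq> X \<and> solves_on \<omega> U F \<and>
        (\<forall>\<^sub>F s in nhds t. s \<in> {a..b} \<longrightarrow> \<Phi> s ** C = F (\<gamma> s))"
    using F(1-3) solves_on_mult_const[OF F(4), of C] eventually_mono[OF F(5), of "\<lambda>s. s \<in> {a..b} \<longrightarrow> \<Phi> s ** C = F (\<gamma> s) ** C"]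
    by (intro exI[of _ U] exI[of _ "\<lambda>x. F x ** C"]) auto
qed

lemma solution_on_reparametrize:
  assumes \<Phi>: "solution_on \<omega> X \<gamma> a b \<Phi>" and f: "\<And>t. isCont f t" "\<And>t. t \<in> {c..d} \<Longrightarrow> f t \<in> {a..b}"
    and eq: "\<And>t. t \<in> {c..d} \<Longrightarrow> \<gamma>' t = \<gamma> (f t)" "\<And>t. t \<in> {c..d} \<Longrightarrow> \<Phi>' t = \<Phi> (f t)"
  shows "solution_on \<omega> X \<gamma>' c d \<Phi>'"
  unfolding solution_on_def
proof
  fix t assume t: "t \<in> {c..d}"
  obtain U F where F: "open U" "\<gamma> (f t) \<in> U" "U \<subseteq> X" "solves_on \<omega> U F"
        "\<forall>\<^sub>F s in nhds (f t). s \<in> {a..b} \<longrightarrow> \<Phi> s = F (\<gamma> s)" using \<Phi> f(2)[OF t] unfolding solution_on_def by blast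
  have "filterlim f (nhds (f t)) (nhds t)"
    using f(1)[of t] by (simp add: isCont_def tendsto_at_iff_tendsto_nhds)
  then have "\<forall>\<^sub>F s in nhds t. f s \<in> {a..b} \<longrightarrow> \<Phi> (f s) = F (\<gamma> (f s))"
    by (rule eventually_compose_filterlim[OF F(5)])
  then have "\<forall>\<^sub>F s in nhds t. s \<in> {c..d} \<longrightarrow> \<Phi>' s = F (\<gamma>' s)"
  proof eventually_elim
    case (elim s)
    show ?case
    proof
      assume s: "s \<in> {c..d}"
      show "\<Phi>' s = F (\<gamma>' s)" unfolding eq[OF s] using elim f(2)[OF s] by blast
    qed
  qed
  then show "\<exists>U F. open U \<and> \<gamma>' t \<in> U \<and> U \<subseteq> X \<and> solves_on \<omega> U F \<and>
        (\<forall>\<^sub>F s in nhds t. s \<in> {c..d} \<longrightarrow> \<Phi>' s = F (\<gamma>' s))"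
    using F(1-4) unfolding eq(1)[OF t, symmetric] by (intro exI[of _ U] exI[of _ F] conjI)
qed

lemma solution_on_glue:
  assumes \<Phi>: "solution_on \<omega> X \<gamma> a b \<Phi>" and \<Psi>: "solution_on \<omega> X \<gamma> b c \<Psi>"
    and \<gamma>: "continuous_on {a..c} \<gamma>" and eq: "\<Phi> b = \<Psi> b" and le: "a \<le> b" "b \<le> c"
  shows "solution_on \<omega> X \<gamma> a c (\<lambda>s. if s \<le> b then \<Phi> s else \<Psi> s)"
  unfolding solution_on_def
proof
  fix t assume t: "t \<in> {a..c}"
  consider "t < b" | "t = b" | "b < t" by linarith
  then show "\<exists>U F. open U \<and> \<gamma> t \<in> U \<and> U \<subseteq> X \<and> solves_on \<omega> U F \<and>
        (\<forall>\<^sub>F s in nhds t. s \<in> {a..c} \<longrightarrow> (if s \<le> b then \<Phi> s else \<Psi> s) = F (\<gamma> s))"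
  proof cases
    case 1
    then have "t \<in> {a..b}" using t by simp
    then obtain U F where F: "open U" "\<gamma> t \<in> U" "U \<subseteq> X" "solves_on \<omega> U F"
        "\<forall>\<^sub>F s in nhds t. s \<in> {a..b} \<longrightarrow> \<Phi> s = F (\<gamma> s)" using \<Phi> unfolding solution_on_def by blast
    have "\<forall>\<^sub>F s in nhds t. s \<in> {..<b}" using 1 by (intro eventually_nhds_in_open) auto
    with F(5) have "\<forall>\<^sub>F s in nhds t. s \<in> {a..c} \<longrightarrow> (if s \<le> b then \<Phi> s else \<Psi> s) = F (\<gamma> s)"
      by eventually_elim auto
    then show ?thesis using F by blast
  next
    case 3
    then have "t \<in> {b..c}" using t by simp
    then obtain U F where F: "open U" "\<gamma> t \<in> U" "U \<subseteq> X" "solves_on \<omega> U F"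
        "\<forall>\<^sub>F s in nhds t. s \<in> {b..c} \<longrightarrow> \<Psi> s = F (\<gamma> s)" using \<Psi> unfolding solution_on_def by blast
    have "\<forall>\<^sub>F s in nhds t. s \<in> {b<..}" using 3 by (intro eventually_nhds_in_open) auto
    with F(5) have "\<forall>\<^sub>F s in nhds t. s \<in> {a..c} \<longrightarrow> (if s \<le> b then \<Phi> s else \<Psi> s) = F (\<gamma> s)"
      by eventually_elim auto
    then show ?thesis using F by blast
  next
    \<comment> \<open>At the junction both local solutions have the same value at
      \<open>\<gamma> b\<close>, hence agree on a common ball, and the one from the left serves on
      both sides.\<close>
    case 2
    have "b \<in> {a..b}" "b \<in> {b..c}" using le by auto
    obtain r F where F: "0 < r" "ball (\<gamma> b) r \<subseteq> X" "solves_on \<omega> (ball (\<gamma> b) r) F" "\<Phi> b = F (\<gamma> b)"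
      "\<forall>\<^sub>F s in nhds b. s \<in> {a..b} \<longrightarrow> \<Phi> s = F (\<gamma> s)" by (rule solution_onE[OF \<Phi> \<open>b \<in> {a..b}\<close>])
    obtain r' G where G: "0 < r'" "ball (\<gamma> b) r' \<subseteq> X" "solves_on \<omega> (ball (\<gamma> b) r') G" "\<Psi> b = G (\<gamma> b)"
      "\<forall>\<^sub>F s in nhds b. s \<in> {b..c} \<longrightarrow> \<Psi> s = G (\<gamma> s)" by (rule solution_onE[OF \<Psi> \<open>b \<in> {b..c}\<close>])
    define m where "m = min r r'"
    have m: "0 < m" "ball (\<gamma> b) m \<subseteq> ball (\<gamma> b) r" "ball (\<gamma> b) m \<subseteq> ball (\<gamma> b) r'"
      using F(1) G(1) by (auto simp: m_def)
    have u: "G y = F y" if "y \<in> ball (\<gamma> b) m" for y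
      using solves_on_unique[OF solves_on_subset[OF G(3) m(3)] solves_on_subset[OF F(3) m(2)] convex_ball, of "\<gamma> b" y]
        that m(1) eq F(4) G(4) by simp
    have "b \<in> {a..c}" using le by simp
    have "\<forall>\<^sub>F s in nhds b. s \<in> {a..c} \<longrightarrow> (if s \<le> b then \<Phi> s else \<Psi> s) = F (\<gamma> s)"
      using F(5) G(5) path_eventually_ball[OF \<gamma> \<open>b \<in> {a..c}\<close> m(1)]
      by eventually_elim (auto simp: u)
    then show ?thesis
      using F(1,2) solves_on_subset[OF F(3) m(2)] 2 F(3) by (intro exI[of _ "ball (\<gamma> b) r"] exI[of _ F]) auto
  qed
qed


locale local_system =
  fixes \<omega> :: "('n::finite, 'm::finite) matrix_form" and X :: "(complex^'n) set"
  assumes open_X: "open X"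
    and local_solution: "ball p r \<subseteq> X \<Longrightarrow> 0 < r \<Longrightarrow> \<exists>F. solves_on \<omega> (ball p r) F \<and> F p = mat 1"
begin

section \<open>Existence of transport and its homotopy invariance\<close>

lemma solution_on_exists_small:
  assumes \<gamma>: "continuous_on {a..b} \<gamma>" and r: "0 < r" "ball (\<gamma> a) r \<subseteq> X"
    and near: "\<And>s. s \<in> {a..b} \<Longrightarrow> \<gamma> s \<in> ball (\<gamma> a) r"
  shows "\<exists>\<Phi>. solution_on \<omega> X \<gamma> a b \<Phi> \<and> \<Phi> a = C"
proof -
  obtain F where F: "solves_on \<omega> (ball (\<gamma> a) r) F" "F (\<gamma> a) = mat 1" using local_solution[OF r(2,1)] by blast
  have "solution_on \<omega> X \<gamma> a b (\<lambda>t. F (\<gamma> t) ** C)"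
    unfolding solution_on_def
    using near r solves_on_mult_const[OF F(1), of C]
    by (intro ballI exI[of _ "ball (\<gamma> a) r"] exI[of _ "\<lambda>x. F x ** C"]) auto
  then show ?thesis using F(2) by (intro exI[of _ "\<lambda>t. F (\<gamma> t) ** C"]) auto
qed

text \<open>Solvability for every initial value is additive on adjacent intervals by gluing, and it
  holds on short intervals, where the path stays in one ball; \<open>Bolzano\<close> passes from
  these to the whole interval.\<close>

lemma solution_on_exists:
  assumes \<gamma>: "path \<gamma>" "path_image \<gamma> \<subseteq> X"
  shows "\<exists>\<Phi>. solution_on \<omega> X \<gamma> 0 1 \<Phi> \<and> \<Phi> 0 = C"
proof -
  have cont: "continuous_on {0..1} \<gamma>" using \<gamma>(1) by (simp add: path_def)
  have X: "\<gamma> t \<in> X" if "t \<in> {0..1}" for t using \<gamma>(2) that by (auto simp: path_image_def)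
  define P where "P a b \<longleftrightarrow> (0 \<le> a \<longrightarrow> b \<le> 1 \<longrightarrow> (\<forall>C. \<exists>\<Phi>. solution_on \<omega> X \<gamma> a b \<Phi> \<and> \<Phi> a = C))" for a b
  have "P 0 1"
  proof (rule Bolzano)
    show "(0::real) \<le> 1" by simp
    fix a b c :: real assume ab: "P a b" and bc: "P b c" and le: "a \<le> b" "b \<le> c"
    show "P a c"
      unfolding P_def
    proof (intro impI allI)
      fix C assume *: "0 \<le> a" "c \<le> 1"
      obtain \<Phi> where \<Phi>: "solution_on \<omega> X \<gamma> a b \<Phi>" "\<Phi> a = C" using ab * le unfolding P_def by (meson order_trans)
      obtain \<Psi> where \<Psi>: "solution_on \<omega> X \<gamma> b c \<Psi>" "\<Psi> b = \<Phi> b" using bc * le unfolding P_def by (meson order_trans)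
      have "continuous_on {a..c} \<gamma>" by (rule continuous_on_subset[OF cont]) (use * in auto)
      from solution_on_glue[OF \<Phi>(1) \<Psi>(1) this _ le] \<Psi>(2)
      show "\<exists>\<Phi>. solution_on \<omega> X \<gamma> a c \<Phi> \<and> \<Phi> a = C"
        using \<Phi>(2) le by (intro exI[of _ "\<lambda>s. if s \<le> b then \<Phi> s else \<Psi> s"]) auto
    qed
  next
    fix x :: real assume x: "0 \<le> x" "x \<le> 1"
    then have x01: "x \<in> {0..1}" by simp
    obtain r where r: "0 < r" "ball (\<gamma> x) r \<subseteq> X"
      using open_X X[OF x01] unfolding open_contains_ball by blast
    \<comment> \<open>With all of the piece within \<open>r / 4\<close> of
      \<open>\<gamma> x\<close>, the ball of radius \<open>r / 2\<close> about its starting point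
      contains the piece and still lies in \<open>X\<close>.\<close>
    obtain d where d: "0 < d" "\<And>s. dist s x < d \<Longrightarrow> s \<in> {0..1} \<longrightarrow> \<gamma> s \<in> ball (\<gamma> x) (r / 4)"
      using path_eventually_ball[OF cont x01, of "r / 4"] r(1) unfolding eventually_nhds_metric by auto
    show "\<exists>d>0. \<forall>a b. a \<le> x \<and> x \<le> b \<and> b - a < d \<longrightarrow> P a b"
    proof (intro exI[of _ d] conjI d allI impI, unfold P_def, intro impI allI)
      fix a b :: real and C assume *: "a \<le> x \<and> x \<le> b \<and> b - a < d" "0 \<le> a" "b \<le> 1"
      have near: "dist (\<gamma> x) (\<gamma> s) < r / 4" if "s \<in> {a..b}" for s
        using d(2)[of s] that * by (auto simp: dist_real_def)
      have a: "a \<in> {a..b}" using * by simp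
      show "\<exists>\<Phi>. solution_on \<omega> X \<gamma> a b \<Phi> \<and> \<Phi> a = C"
      proof (rule solution_on_exists_small[of _ _ _ "r / 2"])
        show "continuous_on {a..b} \<gamma>" by (rule continuous_on_subset[OF cont]) (use * in auto)
        show "ball (\<gamma> a) (r / 2) \<subseteq> X"
        proof
          fix y assume "y \<in> ball (\<gamma> a) (r / 2)"
          then have "dist (\<gamma> x) y < r" using near[OF a] dist_triangle[of "\<gamma> x" y "\<gamma> a"] r(1) by simp
          then show "y \<in> X" using r(2) by auto
        qed
        fix s assume "s \<in> {a..b}"
        then show "\<gamma> s \<in> ball (\<gamma> a) (r / 2)"
          using near[OF a] near[of s] dist_triangle3[of "\<gamma> a" "\<gamma> s" "\<gamma> x"] by simp
      qed (use r in simp)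
    qed
  qed
  then show ?thesis unfolding P_def by simp
qed

lemma transport_eq:
  assumes \<gamma>: "path \<gamma>" "path_image \<gamma> \<subseteq> X" and \<Phi>: "solution_on \<omega> X \<gamma> 0 1 \<Phi>" "\<Phi> 0 = mat 1"
  shows "transport \<omega> X \<gamma> = \<Phi> 1"
  unfolding transport_def solution_along_on
proof (rule the_equality)
  show "\<exists>\<Phi>'. solution_on \<omega> X \<gamma> 0 1 \<Phi>' \<and> \<Phi>' 0 = mat 1 \<and> \<Phi>' 1 = \<Phi> 1" using \<Phi> by blast
  have cont: "continuous_on {0..1} \<gamma>" using \<gamma>(1) by (simp add: path_def)
  show "M = \<Phi> 1" if M: "\<exists>\<Phi>'. solution_on \<omega> X \<gamma> 0 1 \<Phi>' \<and> \<Phi>' 0 = mat 1 \<and> \<Phi>' 1 = M" for M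
  proof -
    obtain \<Psi> where \<Psi>: "solution_on \<omega> X \<gamma> 0 1 \<Psi>" "\<Psi> 0 = mat 1" "\<Psi> 1 = M" using M by blast
    have "\<Psi> 1 = \<Phi> 1"
      by (rule solution_on_unique[OF \<Psi>(1) \<Phi>(1) cont]) (use \<Psi>(2) \<Phi>(2) in auto)
    then show ?thesis using \<Psi>(3) by simp
  qed
qed

lemma transport_solution:
  assumes \<gamma>: "path \<gamma>" "path_image \<gamma> \<subseteq> X" and \<Phi>: "solution_on \<omega> X \<gamma> 0 1 \<Phi>"
  shows "\<Phi> 1 = transport \<omega> X \<gamma> ** \<Phi> 0"
proof -
  obtain \<Psi> where \<Psi>: "solution_on \<omega> X \<gamma> 0 1 \<Psi>" "\<Psi> 0 = mat 1" using solution_on_exists[OF \<gamma>] by blast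
  have "\<Phi> 1 = \<Psi> 1 ** \<Phi> 0"
    using \<gamma>(1) \<Psi>(2)
    by (intro solution_on_unique[OF \<Phi> solution_on_mult_const[OF \<Psi>(1)], of "\<Phi> 0" 1]) (auto simp: path_def)
  then show ?thesis using transport_eq[OF \<gamma> \<Psi>] by simp
qed

lemma transport_cong:
  assumes "\<And>t. t \<in> {0..1} \<Longrightarrow> \<gamma> t = \<delta> t" and \<gamma>: "path \<gamma>" "path_image \<gamma> \<subseteq> X"
  shows "transport \<omega> X \<delta> = transport \<omega> X \<gamma>"
proof -
  obtain \<Psi> where \<Psi>: "solution_on \<omega> X \<gamma> 0 1 \<Psi>" "\<Psi> 0 = mat 1" using solution_on_exists[OF \<gamma>] by blast
  have "solution_on \<omega> X \<delta> 0 1 \<Psi>"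
    by (rule solution_on_reparametrize[OF \<Psi>(1), of "\<lambda>t. t"]) (use assms(1) in auto)
  moreover have "path \<delta>" using \<gamma>(1) assms(1) unfolding path_def by (metis continuous_on_cong)
  moreover have "path_image \<delta> \<subseteq> X" using \<gamma>(2) assms(1) by (auto simp: path_image_def)
  ultimately show ?thesis using transport_eq \<gamma> \<Psi> by metis
qed

text \<open>The solution on the second half starts at the value reached on the first, so the later
  factor stands on the left. This matches the right-to-left product in the fundamental
  group.\<close>

lemma transport_join:
  assumes \<gamma>: "path \<gamma>" "path_image \<gamma> \<subseteq> X" and \<delta>: "path \<delta>" "path_image \<delta> \<subseteq> X" and j: "pathfinish \<gamma> = pathstart \<delta>"
  shows "transport \<omega> X (\<gamma> +++ \<delta>) = transport \<omega> X \<delta> ** transport \<omega> X \<gamma>"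
proof -
  have jj: "\<gamma> 1 = \<delta> 0" using j by (simp add: pathfinish_def pathstart_def)
  have p: "path (\<gamma> +++ \<delta>)" "path_image (\<gamma> +++ \<delta>) \<subseteq> X"
    using assms by (simp_all add: subset_path_image_join)
  obtain \<Phi> where \<Phi>: "solution_on \<omega> X \<gamma> 0 1 \<Phi>" "\<Phi> 0 = mat 1" using solution_on_exists[OF \<gamma>] by blast
  obtain \<Psi> where \<Psi>: "solution_on \<omega> X \<delta> 0 1 \<Psi>" "\<Psi> 0 = \<Phi> 1" using solution_on_exists[OF \<delta>] by blast
  have 1: "solution_on \<omega> X (\<gamma> +++ \<delta>) 0 (1/2) (\<lambda>t. \<Phi> (2 * t))"
    by (rule solution_on_reparametrize[OF \<Phi>(1), of "\<lambda>t. 2 * t"]) (auto simp: joinpaths_def)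
  have 2: "solution_on \<omega> X (\<gamma> +++ \<delta>) (1/2) 1 (\<lambda>t. \<Psi> (2 * t - 1))"
  proof (rule solution_on_reparametrize[OF \<Psi>(1), of "\<lambda>t. 2 * t - 1"])
    fix t :: real assume t: "t \<in> {1/2..1}"
    show "(\<gamma> +++ \<delta>) t = \<delta> (2 * t - 1)"
    proof (cases "t = 1/2")
      case True
      then have "2 * t = 1" by simp
      then show ?thesis using jj True by (simp only: joinpaths_def) simp
    next
      case False
      then show ?thesis using t by (simp add: joinpaths_def)
    qed
  qed auto
  have "solution_on \<omega> X (\<gamma> +++ \<delta>) 0 1 (\<lambda>s. if s \<le> 1/2 then \<Phi> (2 * s) else \<Psi> (2 * s - 1))"
    by (rule solution_on_glue[OF 1 2]) (use p(1) \<Psi>(2) in \<open>auto simp: path_def\<close>)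
  from transport_eq[OF p this] have "transport \<omega> X (\<gamma> +++ \<delta>) = \<Psi> 1" using \<Phi>(2) by simp
  then show ?thesis
    using transport_solution[OF \<delta> \<Psi>(1)] \<Psi>(2) transport_eq[OF \<gamma> \<Phi>] by simp
qed

lemma transport_reverse:
  assumes \<gamma>: "path \<gamma>" "path_image \<gamma> \<subseteq> X"
  shows "transport \<omega> X \<gamma> ** transport \<omega> X (reversepath \<gamma>) = mat 1"
proof -
  have r: "path (reversepath \<gamma>)" "path_image (reversepath \<gamma>) \<subseteq> X" using \<gamma> by auto
  obtain \<Phi> where \<Phi>: "solution_on \<omega> X (reversepath \<gamma>) 0 1 \<Phi>" "\<Phi> 0 = mat 1" using solution_on_exists[OF r] by blast
  have "solution_on \<omega> X \<gamma> 0 1 (\<lambda>t. \<Phi> (1 - t))"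
    by (rule solution_on_reparametrize[OF \<Phi>(1), of "\<lambda>t. 1 - t"]) (auto simp: reversepath_def)
  from transport_solution[OF \<gamma> this] show ?thesis
    using transport_eq[OF r \<Phi>] \<Phi>(2) by simp
qed

lemma transport_reverse':
  assumes \<gamma>: "path \<gamma>" "path_image \<gamma> \<subseteq> X"
  shows "transport \<omega> X (reversepath \<gamma>) ** transport \<omega> X \<gamma> = mat 1"
  using transport_reverse[of "reversepath \<gamma>"] \<gamma> by simp

text \<open>A solution along \<delta> is obtained by following \<gamma> up to time \<open>t\<close>
  and then crossing straight to \<open>\<delta> t\<close> inside a ball. At both ends the paths meet
  and the crossing is trivial.\<close>

lemma transport_nearby:
  assumes \<gamma>: "path \<gamma>" "path_image \<gamma> \<subseteq> X"
  shows "\<exists>e>0. \<forall>\<delta>. path \<delta> \<and> pathstart \<delta> = pathstart \<gamma> \<and> pathfinish \<delta> = pathfinish \<gamma> \<and>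
     (\<forall>t\<in>{0..1}. dist (\<gamma> t) (\<delta> t) < e) \<longrightarrow> transport \<omega> X \<delta> = transport \<omega> X \<gamma>"
proof -
  have cont: "continuous_on {0..1} \<gamma>" using \<gamma>(1) by (simp add: path_def)
  obtain \<Phi> where \<Phi>: "solution_on \<omega> X \<gamma> 0 1 \<Phi>" "\<Phi> 0 = mat 1" using solution_on_exists[OF \<gamma>] by blast
  obtain e where e: "0 < e" "\<And>y x. y \<in> path_image \<gamma> \<Longrightarrow> dist y x < 2 * e \<Longrightarrow> x \<in> X"
  proof -
    obtain d where d: "0 < d" "{x. \<exists>y\<in>path_image \<gamma>. dist y x < d} \<subseteq> X"
      using compact_subset_open_imp_ball_epsilon_subset[OF compact_path_image[OF \<gamma>(1)] open_X \<gamma>(2)]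
      by (auto simp: subset_iff)
    show thesis by (rule that[of "d / 2"]) (use d in auto)
  qed
  have ballX: "ball (\<gamma> t) (2 * e) \<subseteq> X" if "t \<in> {0..1}" for t
    using e(2)[of "\<gamma> t"] that by (auto simp: path_image_def)
  have "\<forall>t\<in>{0..1}. \<exists>F. solves_on \<omega> (ball (\<gamma> t) (2 * e)) F \<and> F (\<gamma> t) = mat 1"
    using local_solution ballX e(1) by auto
  then obtain G where G: "\<And>t. t \<in> {0..1} \<Longrightarrow> solves_on \<omega> (ball (\<gamma> t) (2 * e)) (G t)" "\<And>t. t \<in> {0..1} \<Longrightarrow> G t (\<gamma> t) = mat 1"
    by metis
  show ?thesis
  proof (rule exI[of _ e], rule conjI[OF e(1)], rule allI, rule impI, elim conjE)
    fix \<delta> assume \<delta>: "path \<delta>" "pathstart \<delta> = pathstart \<gamma>" "pathfinish \<delta> = pathfinish \<gamma>"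
      and near: "\<forall>t\<in>{0..1}. dist (\<gamma> t) (\<delta> t) < e"
    note \<delta> = \<delta> near[rule_format]
    have \<delta>X: "path_image \<delta> \<subseteq> X"
    proof
      fix y assume "y \<in> path_image \<delta>"
      then obtain t where t: "t \<in> {0..1}" "y = \<delta> t" by (auto simp: path_image_def)
      show "y \<in> X" using ballX[OF t(1)] \<delta>(4)[OF t(1)] t(2) e(1) by auto
    qed
    have cont\<delta>: "continuous_on {0..1} \<delta>" using \<delta>(1) by (simp add: path_def)
    \<comment> \<open>\<open>G t\<close> is the local solution normalized at
      \<open>\<gamma> t\<close>. For \<open>s\<close> near \<open>t0\<close> the functions
      \<open>G s ** \<Phi> s\<close> and \<open>G t0 ** \<Phi> t0\<close> agree at
      \<open>\<gamma> s\<close>, hence at \<open>\<delta> s\<close>, since both points lie in a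
      convex intersection of balls. The radius \<open>2 * e\<close> leaves room for the distance
      \<open>e\<close> between the paths.\<close>
    have "solution_on \<omega> X \<delta> 0 1 (\<lambda>t. G t (\<delta> t) ** \<Phi> t)"
      unfolding solution_on_def
    proof
      fix t0 :: real assume t0: "t0 \<in> {0..1}"
      obtain r F where F: "0 < r" "ball (\<gamma> t0) r \<subseteq> X" "solves_on \<omega> (ball (\<gamma> t0) r) F" "\<Phi> t0 = F (\<gamma> t0)"
        "\<forall>\<^sub>F s in nhds t0. s \<in> {0..1} \<longrightarrow> \<Phi> s = F (\<gamma> s)" by (rule solution_onE[OF \<Phi>(1) t0])
      define F' where "F' y = G t0 y ** \<Phi> t0" for y
      have F': "solves_on \<omega> (ball (\<gamma> t0) (2 * e)) F'"
        unfolding F'_def by (rule solves_on_mult_const[OF G(1)[OF t0]])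
      define m where "m = min r e"
      have m: "0 < m" "ball (\<gamma> t0) m \<subseteq> ball (\<gamma> t0) r" "ball (\<gamma> t0) m \<subseteq> ball (\<gamma> t0) (2 * e)"
        using F(1) e(1) by (auto simp: m_def)
      have FF': "F y = F' y" if "y \<in> ball (\<gamma> t0) m" for y
        by (rule solves_on_unique[where p = "\<gamma> t0", OF solves_on_subset[OF F(3) m(2)] solves_on_subset[OF F' m(3)] convex_ball _ that])
          (use m(1) F(4) G(2)[OF t0] in \<open>auto simp: F'_def\<close>)
      have d0: "\<delta> t0 \<in> ball (\<gamma> t0) (2 * e)" using \<delta>(4)[OF t0] e(1) by simp
      obtain q where q: "0 < q" "ball (\<delta> t0) q \<subseteq> ball (\<gamma> t0) (2 * e)"
        using d0 open_ball open_contains_ball by blast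
      have "\<forall>\<^sub>F s in nhds t0. s \<in> {0..1} \<longrightarrow> G s (\<delta> s) ** \<Phi> s = F' (\<delta> s)"
        using F(5) path_eventually_ball[OF cont t0 m(1)] path_eventually_ball[OF cont\<delta> t0 q(1)]
      proof eventually_elim
        case (elim s)
        show ?case
        proof
          assume s: "s \<in> {0..1}"
          have s1: "solves_on \<omega> (ball (\<gamma> s) e \<inter> ball (\<gamma> t0) (2 * e)) (\<lambda>y. G s y ** \<Phi> s)"
            by (rule solves_on_mult_const, rule solves_on_subset[OF G(1)[OF s]]) (use e(1) in auto)
          have s2: "solves_on \<omega> (ball (\<gamma> s) e \<inter> ball (\<gamma> t0) (2 * e)) F'"
            by (rule solves_on_subset[OF F']) auto
          have gs: "\<gamma> s \<in> ball (\<gamma> t0) m" using elim s by blast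
          have "\<Phi> s = F' (\<gamma> s)" using elim(1) s FF'[OF gs] by simp
          then have eq: "G s (\<gamma> s) ** \<Phi> s = F' (\<gamma> s)" using G(2)[OF s] by simp
          have mem: "\<gamma> s \<in> ball (\<gamma> s) e \<inter> ball (\<gamma> t0) (2 * e)" using gs m(3) e(1) by auto
          have mem': "\<delta> s \<in> ball (\<gamma> s) e \<inter> ball (\<gamma> t0) (2 * e)" using elim(3) s q(2) \<delta>(4)[OF s] by auto
          show "G s (\<delta> s) ** \<Phi> s = F' (\<delta> s)"
            by (rule solves_on_unique[OF s1 s2 convex_Int[OF convex_ball convex_ball] mem mem' eq])
        qed
      qed
      then show "\<exists>U F. open U \<and> \<delta> t0 \<in> U \<and> U \<subseteq> X \<and> solves_on \<omega> U F \<and>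
        (\<forall>\<^sub>F s in nhds t0. s \<in> {0..1} \<longrightarrow> G s (\<delta> s) ** \<Phi> s = F (\<delta> s))"
        using d0 ballX[OF t0] F' by (intro exI[of _ "ball (\<gamma> t0) (2 * e)"] exI[of _ F']) auto
    qed
    from transport_eq[OF \<delta>(1) \<delta>X this]
    have "transport \<omega> X \<delta> = G 1 (\<delta> 1) ** \<Phi> 1"
      using \<delta>(2) G(2)[of 0] \<Phi>(2) by (simp add: pathstart_def)
    also have "\<dots> = \<Phi> 1" using \<delta>(3) G(2)[of 1] by (simp add: pathfinish_def)
    also have "\<dots> = transport \<omega> X \<gamma>" by (rule transport_eq[OF \<gamma> \<Phi>, symmetric])
    finally show "transport \<omega> X \<delta> = transport \<omega> X \<gamma>" .
  qed
qed

text \<open>Uniform continuity of the homotopy makes its intermediate paths uniformly close for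
  nearby parameters, so by \<open>transport_nearby\<close> their transports are locally constant in
  the homotopy parameter.\<close>

theorem transport_homotopic:
  assumes "homotopic_paths X \<gamma> \<delta>"
  shows "transport \<omega> X \<gamma> = transport \<omega> X \<delta>"
proof -
  from iffD1[OF homotopic_paths assms] obtain h :: "real \<times> real \<Rightarrow> complex^'n" where h: "continuous_on ({0..1} \<times> {0..1}) h" "h \<in> ({0..1} \<times> {0..1}) \<rightarrow> X"
    "\<forall>x\<in>{0..1}. h (0, x) = \<gamma> x" "\<forall>x\<in>{0..1}. h (1, x) = \<delta> x"
    "\<forall>s\<in>{0..1}. pathstart (h \<circ> Pair s) = pathstart \<gamma> \<and> pathfinish (h \<circ> Pair s) = pathfinish \<gamma>"
    by (elim exE conjE)
  define p where "p s = h \<circ> Pair s" for s :: real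
  have path_p: "path (p s)" "path_image (p s) \<subseteq> X" if "s \<in> {0..1}" for s
  proof -
    have "continuous_on {0..1} (Pair s :: real \<Rightarrow> _)" by (rule continuous_on_Pair[OF continuous_on_const continuous_on_id])
    then show "path (p s)"
      unfolding p_def path_def by (rule continuous_on_compose) (rule continuous_on_subset[OF h(1)], use that in auto)
    show "path_image (p s) \<subseteq> X" using h(2) that by (auto simp: p_def path_image_def Pi_iff)
  qed
  have uc: "uniformly_continuous_on ({0..1} \<times> {0..1}) h"
    by (rule compact_uniformly_continuous[OF h(1)]) (auto intro: compact_Times)
  have "(\<lambda>s. transport \<omega> X (p s)) constant_on {0..1}"
  proof (rule locally_constant_imp_constant)
    show "connected {0..1::real}" by (rule connected_Icc)
    fix s :: real assume s: "s \<in> {0..1}"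
    obtain e where e: "0 < e" "\<forall>\<delta>. path \<delta> \<and> pathstart \<delta> = pathstart (p s) \<and> pathfinish \<delta> = pathfinish (p s) \<and>
       (\<forall>t\<in>{0..1}. dist (p s t) (\<delta> t) < e) \<longrightarrow> transport \<omega> X \<delta> = transport \<omega> X (p s)"
      using transport_nearby[OF path_p[OF s]] by (elim exE conjE)
    obtain d where d: "0 < d" "\<forall>x\<in>{0..1} \<times> {0..1}. \<forall>y\<in>{0..1} \<times> {0..1}. dist y x < d \<longrightarrow> dist (h y) (h x) < e"
      using uc[unfolded uniformly_continuous_on_def, THEN spec, THEN mp, OF e(1)] by (elim exE conjE)
    have tr: "transport \<omega> X (p s') = transport \<omega> X (p s)" if s': "s' \<in> {0..1}" "dist s s' < d" for s'
    proof (rule e(2)[THEN spec, THEN mp], intro conjI ballI)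
      show "path (p s')" by (rule path_p[OF s'(1)])
      show "pathstart (p s') = pathstart (p s)" "pathfinish (p s') = pathfinish (p s)"
        unfolding p_def using h(5)[rule_format, OF s] h(5)[rule_format, OF s'(1)] by simp_all
      fix t :: real assume t: "t \<in> {0..1}"
      show "dist (p s t) (p s' t) < e"
        unfolding p_def o_def
        by (rule d(2)[rule_format]) (use s s' t in \<open>simp_all add: dist_Pair_Pair\<close>)
    qed
    show "\<exists>T. openin (top_of_set {0..1}) T \<and> s \<in> T \<and> (\<forall>x\<in>T. transport \<omega> X (p x) = transport \<omega> X (p s))"
    proof (intro exI conjI)
      show "openin (top_of_set {0..1}) ({0..1} \<inter> ball s d)" by (rule openin_open_Int[OF open_ball])
      show "s \<in> {0..1} \<inter> ball s d" using s d(1) by simp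
      show "\<forall>x\<in>{0..1} \<inter> ball s d. transport \<omega> X (p x) = transport \<omega> X (p s)" using tr by simp
    qed
  qed
  then obtain c where c: "\<And>s. s \<in> {0..1} \<Longrightarrow> transport \<omega> X (p s) = c" unfolding constant_on_def by blast
  have "transport \<omega> X (p 0) = transport \<omega> X \<gamma>" "transport \<omega> X (p 1) = transport \<omega> X \<delta>"
    using homotopic_paths_imp_path[OF assms] homotopic_paths_imp_subset[OF assms] h(3,4)
    by (auto intro!: transport_cong simp: p_def)
  then show ?thesis using c[of 0] c[of 1] by simp
qed

end

section \<open>Hyperplanes and holonomy Lie algebras\<close>

text \<open>A basis of \<open>H\<close> and one vector \<open>a\<close> outside \<open>H\<close>
  form a basis of the whole space; the coordinate along \<open>a\<close> is the required
  form.\<close>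

lemma codim_form_exists:
  fixes H :: "(complex^'n) set"
  assumes "codim_subspace 1 H"
  shows "\<exists>b. is_linear_form_of H b"
proof -
  have H: "vec.subspace H" and dim: "vec.dim H + 1 = CARD('n)"
    using assms by (auto simp: codim_subspace_def)
  obtain B where B: "B \<subseteq> H" "vec.independent B" "H \<subseteq> vec.span B" "card B = vec.dim H"
    using vec.basis_exists by blast
  have spanB: "vec.span B = H" using B H by (metis subset_antisym vec.span_minimal)
  have "H \<noteq> UNIV" using dim by (metis Suc_eq_plus1 n_not_Suc_n vec_dim_card)
  then obtain a where a: "a \<notin> H" by blast
  then have aB: "a \<notin> B" using B(1) by blast
  have indep: "vec.independent (insert a B)" using a B spanB by (simp add: vec.independent_insert)
  have span: "vec.span (insert a B) = UNIV"
  proof (rule vec.subspace_dim_equal)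
    have "vec.dim (vec.span (insert a B)) = card (insert a B)"
      by (rule vec.dim_span_eq_card_independent[OF indep])
    also have "\<dots> = CARD('n)"
      using aB B dim vec.finiteI_independent[OF B(2)] by simp
    finally show "vec.dim (UNIV :: (complex^'n) set) \<le> vec.dim (vec.span (insert a B))"
      by (simp only: vec_dim_card)
  qed auto
  define b where "b v = vec.representation (insert a B) v a" for v
  have lin: "Vector_Spaces.linear (*s) (*) b"
    unfolding b_def by (rule vec.linear_representation[OF indep span])
  interpret b: Vector_Spaces.linear "(*s)" "(*)" b by (rule lin)
  have ba: "b a = 1" by (simp add: b_def vec.representation_basis[OF indep])
  have b0: "b v = 0" if "v \<in> H" for v
  proof -
    have "vec.representation (insert a B) v = vec.representation B v"
      by (rule vec.representation_extend[OF indep]) (use that spanB in auto)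
    then show ?thesis unfolding b_def using vec.representation_ne_zero[of B v a] aB by auto
  qed
  have "v \<in> H" if "b v = 0" for v
  proof -
    have "v \<in> vec.span (insert a B)" using span by simp
    then obtain k where k: "v - k *s a \<in> H" unfolding vec.span_insert spanB by blast
    have "b (v - k *s a) = - k" by (simp add: b.diff b.scale that ba)
    then show ?thesis using k b0[OF k] by simp
  qed
  then show ?thesis using lin b0 unfolding is_linear_form_of_def by blast
qed

lemma linear_form_of: "codim_subspace 1 H \<Longrightarrow> is_linear_form_of H (linear_form_of H)"
  unfolding linear_form_of_def by (rule someI_ex[OF codim_form_exists])

lemma codim_subspace_eq:
  assumes "codim_subspace k H" "codim_subspace k K" "H \<subseteq> K"
  shows "H = K"
  using assms by (intro vec.subspace_dim_equal) (auto simp: codim_subspace_def)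

text \<open>The sum of two distinct hyperplanes is strictly larger than either, hence everything,
  and the dimension formula gives the intersection.\<close>

lemma codim_subspace_Int:
  fixes H K :: "(complex^'n) set"
  assumes H: "codim_subspace 1 H" and K: "codim_subspace 1 K" and ne: "H \<noteq> K"
  shows "codim_subspace 2 (H \<inter> K)"
proof -
  have sub: "vec.subspace H" "vec.subspace K" and dim: "vec.dim H + 1 = CARD('n)" "vec.dim K + 1 = CARD('n)"
    using H K by (auto simp: codim_subspace_def)
  let ?S = "{x + y |x y. x \<in> H \<and> y \<in> K}"
  have S: "vec.subspace ?S" by (rule vec.subspace_sums[OF sub])
  have HS: "H \<subseteq> ?S"
  proof
    fix x assume "x \<in> H"
    then have "x = x + 0 \<and> x \<in> H \<and> 0 \<in> K" using vec.subspace_0[OF sub(2)] by simp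
    then show "x \<in> ?S" by blast
  qed
  have KS: "K \<subseteq> ?S"
  proof
    fix x assume "x \<in> K"
    then have "x = 0 + x \<and> 0 \<in> H \<and> x \<in> K" using vec.subspace_0[OF sub(1)] by simp
    then show "x \<in> ?S" by blast
  qed
  have "vec.dim ?S \<noteq> vec.dim H"
  proof
    assume "vec.dim ?S = vec.dim H"
    then have "H = ?S" by (intro vec.subspace_dim_equal[OF sub(1) S HS]) simp
    then have "K \<subseteq> H" using KS by simp
    then show False using codim_subspace_eq[OF K H] ne by simp
  qed
  moreover have "vec.dim H \<le> vec.dim ?S" by (rule vec.dim_subset[OF HS])
  moreover have "vec.dim ?S \<le> vec.dim (UNIV :: (complex^'n) set)" by (rule vec.dim_subset) simp
  ultimately have "vec.dim ?S = CARD('n)" using dim by (simp only: vec_dim_card)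
  then show ?thesis
    using vec.dim_sums_Int[OF sub] dim vec.subspace_inter[OF sub] by (simp add: codim_subspace_def)
qed

lemma arrangement_codim: "H \<in> arrangement W \<Longrightarrow> codim_subspace 1 H"
  by (auto simp: arrangement_def reflections_def reflection_def)

lemma finite_arrangement: "finite W \<Longrightarrow> finite (arrangement W)"
  by (simp add: arrangement_def reflections_def)

lemma hyperplane_system_codim:
  fixes \<A> :: "(complex^'n) set set"
  assumes "finite \<A>" and codim: "\<And>H. H \<in> \<A> \<Longrightarrow> codim_subspace 1 H"
  shows "hyperplane_system \<A>"
proof (rule hyperplane_system.intro)
  show "Vector_Spaces.linear (*s) (*) (linear_form_of H)" if "H \<in> \<A>" for H
    using linear_form_of[OF codim[OF that]] unfolding is_linear_form_of_def by blast
  show "linear_form_of H x = 0 \<longleftrightarrow> x \<in> H" if "H \<in> \<A>" for H x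
    using linear_form_of[OF codim[OF that]] unfolding is_linear_form_of_def by blast
  show "H = K" if "H \<in> \<A>" "K \<in> \<A>" "H \<subseteq> K" for H K
    using codim_subspace_eq[OF codim codim] that by blast
qed (rule assms(1))

section \<open>Representations of presented Lie algebras\<close>

lemma lie_terms_simps [simp]:
  "LGen H \<in> lie_terms G \<longleftrightarrow> H \<in> G" "LZero \<in> lie_terms G"
  "LAdd x y \<in> lie_terms G \<longleftrightarrow> x \<in> lie_terms G \<and> y \<in> lie_terms G"
  "LSmult c x \<in> lie_terms G \<longleftrightarrow> x \<in> lie_terms G"
  "LBracket x y \<in> lie_terms G \<longleftrightarrow> x \<in> lie_terms G \<and> y \<in> lie_terms G"
  by (auto simp: lie_terms_def)

lemma foldr_lie_terms: "set Hs \<subseteq> G \<Longrightarrow> foldr (\<lambda>H. LAdd (LGen H)) Hs LZero \<in> lie_terms G"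
  by (induction Hs) auto

lemma lie_class_in_carrier: "x \<in> lie_terms G \<Longrightarrow> lie_class G R x \<in> carrier (presented_lie_algebra G R)"
  by (simp add: presented_lie_algebra_def)

locale lie_representation =
  fixes G :: "'g set" and R :: "'g lie_term set" and \<rho> :: "'g lie_term set \<Rightarrow> complex^'m^'m"
  assumes hom: "\<rho> \<in> lie_hom (presented_lie_algebra G R) gl"
begin

lemma add:
  assumes x: "x \<in> lie_terms G" and y: "y \<in> lie_terms G"
  shows "\<rho> (lie_class G R (LAdd x y)) = \<rho> (lie_class G R x) + \<rho> (lie_class G R y)"
proof -
  have "\<forall>a\<in>carrier (presented_lie_algebra G R). \<forall>b\<in>carrier (presented_lie_algebra G R).
      \<rho> (lie_add (presented_lie_algebra G R) a b) = \<rho> a + \<rho> b"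
    using hom unfolding lie_hom_def gl_def by simp
  from this[rule_format, OF lie_class_in_carrier[OF x] lie_class_in_carrier[OF y]]
  show ?thesis unfolding presented_lie_operations(1)[OF x y] .
qed

lemma bracket:
  assumes x: "x \<in> lie_terms G" and y: "y \<in> lie_terms G"
  shows "\<rho> (lie_class G R (LBracket x y)) =
      \<rho> (lie_class G R x) ** \<rho> (lie_class G R y) - \<rho> (lie_class G R y) ** \<rho> (lie_class G R x)"
proof -
  have "\<forall>a\<in>carrier (presented_lie_algebra G R). \<forall>b\<in>carrier (presented_lie_algebra G R).
      \<rho> (lie_bracket (presented_lie_algebra G R) a b) = \<rho> a ** \<rho> b - \<rho> b ** \<rho> a"
    using hom unfolding lie_hom_def gl_def by simp
  from this[rule_format, OF lie_class_in_carrier[OF x] lie_class_in_carrier[OF y]]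
  show ?thesis unfolding presented_lie_operations(3)[OF x y] .
qed

lemma zero: "\<rho> (lie_class G R LZero) = 0"
proof -
  have "lie_class G R (LAdd LZero LZero) = lie_class G R LZero"
    by (rule lie_class_cong[OF lie_cong.add_zero]) simp
  then show ?thesis using add[of LZero LZero] by simp
qed

lemma relator: "r \<in> R \<Longrightarrow> r \<in> lie_terms G \<Longrightarrow> \<rho> (lie_class G R r) = 0"
  using lie_class_cong[OF lie_cong.relator] zero by metis

lemma sum: "set Hs \<subseteq> G \<Longrightarrow> distinct Hs \<Longrightarrow>
    \<rho> (lie_class G R (foldr (\<lambda>H. LAdd (LGen H)) Hs LZero)) = (\<Sum>H\<in>set Hs. \<rho> (lie_class G R (LGen H)))"
  by (induction Hs) (simp_all add: zero add foldr_lie_terms)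

end

text \<open>The relator for \<open>Z = H \<inter> K\<close>, a codimension 2 subspace, is sent to
  zero. Its first entry is a formal sum over a list, so an enumeration of the pencil is chosen and
  then evaluated as a sum over a set.\<close>

lemma flat_system_holonomy:
  fixes \<A> :: "(complex^'n) set set" and \<rho> :: "(complex^'n) set lie_term set \<Rightarrow> complex^'m^'m"
  assumes fin: "finite \<A>" and codim: "\<And>H. H \<in> \<A> \<Longrightarrow> codim_subspace 1 H"
    and \<rho>: "\<rho> \<in> lie_hom (holonomy \<A>) gl"
  shows "flat_system \<A> (\<lambda>H. \<rho> (holonomy_gen \<A> H))"
proof (rule flat_system.intro[OF hyperplane_system_codim[OF fin codim]], assumption, rule flat_system_axioms.intro)
  fix H K assume HK: "H \<in> \<A>" "K \<in> \<A>" "H \<noteq> K"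
  let ?R = "holonomy_relators \<A>"
  interpret lie_representation \<A> ?R \<rho>
    using \<rho> by unfold_locales (simp add: holonomy_def)
  obtain Hs where Hs: "set Hs = {L\<in>\<A>. H \<inter> K \<subseteq> L}" "distinct Hs"
    using finite_distinct_list[of "{L\<in>\<A>. H \<inter> K \<subseteq> L}"] fin by auto
  let ?t = "foldr (\<lambda>H. LAdd (LGen H)) Hs LZero"
  have t: "?t \<in> lie_terms \<A>" by (rule foldr_lie_terms) (use Hs in auto)
  have "LBracket ?t (LGen H) \<in> ?R"
    unfolding holonomy_relators_def
    using HK Hs codim_subspace_Int[OF codim[OF HK(1)] codim[OF HK(2)] HK(3)]
    by (intro CollectI exI[of _ Hs] exI[of _ H] exI[of _ "H \<inter> K"]) (auto simp: hyperplanes_containing_def)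
  then have "\<rho> (lie_class \<A> ?R (LBracket ?t (LGen H))) = 0"
    by (rule relator) (use t HK in simp)
  moreover have "\<rho> (lie_class \<A> ?R ?t) = (\<Sum>L\<in>{L\<in>\<A>. H \<inter> K \<subseteq> L}. \<rho> (holonomy_gen \<A> L))"
    unfolding holonomy_gen_def Hs(1)[symmetric] by (rule sum) (use Hs in auto)
  ultimately show "(\<Sum>L\<in>{L\<in>\<A>. H \<inter> K \<subseteq> L}. \<rho> (holonomy_gen \<A> L)) ** \<rho> (holonomy_gen \<A> H)
      = \<rho> (holonomy_gen \<A> H) ** (\<Sum>L\<in>{L\<in>\<A>. H \<inter> K \<subseteq> L}. \<rho> (holonomy_gen \<A> L))"
    using bracket[OF t, of "LGen H"] HK by (simp add: holonomy_gen_def)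
qed

text \<open>
  A codimension 2 subspace contained in two hyperplanes of the parabolic subarrangement contains
  \<open>I\<close>, so its relators are relators of \<open>\<A>\<close>; the remaining relators are \<open>[t\<^sub>H, t\<^sub>H]\<close>.
\<close>

lemma parabolic_relator:
  fixes \<A> :: "(complex^'n) set set"
  assumes codim: "\<And>H. H \<in> \<A> \<Longrightarrow> codim_subspace 1 H"
    and r: "r \<in> holonomy_relators (hyperplanes_containing \<A> I)"
  shows "lie_cong \<A> (holonomy_relators \<A>) r LZero"
proof -
  let ?A0 = "hyperplanes_containing \<A> I" and ?R = "holonomy_relators \<A>"
  obtain Hs H0 Z where h: "r = LBracket (foldr (\<lambda>H. LAdd (LGen H)) Hs LZero) (LGen H0)"
    "H0 \<in> ?A0" "codim_subspace 2 Z" "Z \<subseteq> H0" "distinct Hs" "set Hs = hyperplanes_containing ?A0 Z"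
    using r unfolding holonomy_relators_def by blast
  have H0: "H0 \<in> \<A>" "I \<subseteq> H0" using h(2) by (auto simp: hyperplanes_containing_def)
  show ?thesis
  proof (cases "\<exists>H\<in>?A0. H \<noteq> H0 \<and> Z \<subseteq> H")
    case True
    then obtain H where H: "H \<in> \<A>" "I \<subseteq> H" "H \<noteq> H0" "Z \<subseteq> H" by (auto simp: hyperplanes_containing_def)
    have "Z = H \<inter> H0"
      by (rule codim_subspace_eq[OF h(3) codim_subspace_Int[OF codim[OF H(1)] codim[OF H0(1)] H(3)]]) (use H h(4) in auto)
    then have "hyperplanes_containing ?A0 Z = hyperplanes_containing \<A> Z"
      using H H0 by (auto simp: hyperplanes_containing_def)
    then have "r \<in> ?R"
      unfolding holonomy_relators_def using h H0
      by (intro CollectI exI[of _ Hs] exI[of _ H0] exI[of _ Z]) auto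
    moreover have "r \<in> lie_terms \<A>"
      unfolding h(1) using H0 h(6) by (auto intro!: foldr_lie_terms simp: hyperplanes_containing_def)
    ultimately show ?thesis by (rule lie_cong.relator)
  next
    case False
    then have "set Hs = {H0}" using h(2,4,6) by (auto simp: hyperplanes_containing_def)
    then obtain xs where xs: "Hs = H0 # xs" by (cases Hs) auto
    then have "xs = []" using \<open>set Hs = {H0}\<close> h(5) by (cases xs) auto
    then have "Hs = [H0]" using xs by simp
    then have r: "r = LBracket (LAdd (LGen H0) LZero) (LGen H0)" using h(1) by simp
    have g: "LGen H0 \<in> lie_terms \<A>" using H0 by simp
    have "lie_cong \<A> ?R (LAdd (LGen H0) LZero) (LGen H0)"
      by (rule lie_cong.trans[OF lie_cong.add_comm[OF g] lie_cong.add_zero[OF g]]) simp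
    then have "lie_cong \<A> ?R r (LBracket (LGen H0) (LGen H0))"
      unfolding r by (rule lie_cong.bracket[OF _ lie_cong.refl[OF g]])
    then show ?thesis by (rule lie_cong.trans[OF _ lie_cong.bracket_self[OF g]])
  qed
qed

text \<open>Congruences survive the passage to more generators as long as the old relators remain
  congruent to zero. This makes \<open>t_H \<mapsto> t_H\<close> well defined on classes.\<close>

lemma lie_cong_mono:
  assumes c: "lie_cong G R x y" and G: "G \<subseteq> G'" and R: "\<And>r. r \<in> R \<Longrightarrow> lie_cong G' R' r LZero"
  shows "lie_cong G' R' x y"
proof -
  have sub: "x \<in> lie_terms G \<Longrightarrow> x \<in> lie_terms G'" for x using G by (auto simp: lie_terms_def)
  show ?thesis
    using c
  proof (induction rule: lie_cong.induct)
    case (trans x y z)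
    show ?case by (rule lie_cong.trans[OF trans.IH])
  qed (blast intro: lie_cong.intros(1,2,4-20) sub R lie_cong.jacobi)+
qed

text \<open>All members of the small class stay congruent in the large algebra, so the union
  defining \<open>holonomy_incl\<close> collapses to one class.\<close>

lemma holonomy_incl_gen:
  fixes \<A> :: "(complex^'n) set set"
  assumes codim: "\<And>H. H \<in> \<A> \<Longrightarrow> codim_subspace 1 H" and H: "H \<in> hyperplanes_containing \<A> I"
  shows "holonomy_incl \<A> (holonomy_gen (hyperplanes_containing \<A> I) H) = holonomy_gen \<A> H"
proof -
  let ?A0 = "hyperplanes_containing \<A> I"
  have mono: "lie_cong \<A> (holonomy_relators \<A>) x y" if "lie_cong ?A0 (holonomy_relators ?A0) x y" for x y
    by (rule lie_cong_mono[OF that _ parabolic_relator[OF codim]]) (auto simp: hyperplanes_containing_def)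
  have mem: "LGen H \<in> holonomy_gen ?A0 H"
    using H by (simp add: holonomy_gen_def lie_class_def lie_cong.refl)
  have eq: "lie_class \<A> (holonomy_relators \<A>) u = holonomy_gen \<A> H" if "u \<in> holonomy_gen ?A0 H" for u
    using that mono unfolding holonomy_gen_def
    by (intro lie_class_cong[symmetric]) (simp add: lie_class_def)
  show ?thesis unfolding holonomy_incl_def using mem eq by auto
qed

lemma matrix_inv:
  fixes A :: "'a::semiring_1^'n^'m"
  assumes "invertible A"
  shows "A ** matrix_inv A = mat 1" "matrix_inv A ** A = mat 1"
  using someI_ex[OF assms[unfolded invertible_def]] unfolding matrix_inv_def by (blast, blast)

lemma image_fixed_space:
  fixes w s :: "complex^'n^'n"
  assumes "invertible w"
  shows "(*v) w ` fixed_space s = fixed_space (w ** s ** matrix_inv w)"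
proof
  have i: "matrix_inv w ** w = mat 1" "w ** matrix_inv w = mat 1"
    using assms by (auto intro: matrix_inv)
  show "(*v) w ` fixed_space s \<subseteq> fixed_space (w ** s ** matrix_inv w)"
  proof
    fix v assume "v \<in> (*v) w ` fixed_space s"
    then obtain u where u: "s *v u = u" "v = w *v u" by (auto simp: fixed_space_def)
    have "(w ** s ** matrix_inv w) *v v = w *v (s *v ((matrix_inv w ** w) *v u))"
      by (simp only: u(2) matrix_vector_mul_assoc matrix_mul_assoc)
    then show "v \<in> fixed_space (w ** s ** matrix_inv w)" by (simp add: i u fixed_space_def)
  qed
  show "fixed_space (w ** s ** matrix_inv w) \<subseteq> (*v) w ` fixed_space s"
  proof
    fix v assume "v \<in> fixed_space (w ** s ** matrix_inv w)"
    then have *: "w *v (s *v (matrix_inv w *v v)) = v"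
      by (simp only: fixed_space_def mem_Collect_eq matrix_vector_mul_assoc matrix_mul_assoc)
    have inv: "matrix_inv w *v (w *v u) = u" "w *v (matrix_inv w *v u) = u" for u
      by (simp_all only: matrix_vector_mul_assoc i matrix_vector_mul_lid)
    have "s *v (matrix_inv w *v v) = matrix_inv w *v v"
      using arg_cong[OF *, of "(*v) (matrix_inv w)"] by (simp only: inv)
    then show "v \<in> (*v) w ` fixed_space s"
      by (intro image_eqI[of _ _ "matrix_inv w *v v"]) (simp_all add: inv fixed_space_def)
  qed
qed

section \<open>Transport and gauge transformations\<close>

lemma solution_on_gauge:
  assumes P: "gauges \<omega> \<omega>' U P" and U: "open U" "U \<subseteq> X" and \<gamma>: "\<gamma> ` {a..b} \<subseteq> U"
    and \<Phi>: "solution_on \<omega>' X' \<gamma> a b \<Phi>"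
  shows "solution_on \<omega> X \<gamma> a b (\<lambda>t. P (\<gamma> t) ** \<Phi> t)"
  unfolding solution_on_def
proof
  fix t assume t: "t \<in> {a..b}"
  obtain V F where F: "open V" "\<gamma> t \<in> V" "V \<subseteq> X'" "solves_on \<omega>' V F"
        "\<forall>\<^sub>F s in nhds t. s \<in> {a..b} \<longrightarrow> \<Phi> s = F (\<gamma> s)" using \<Phi> t unfolding solution_on_def by blast
  show "\<exists>U F. open U \<and> \<gamma> t \<in> U \<and> U \<subseteq> X \<and> solves_on \<omega> U F \<and>
        (\<forall>\<^sub>F s in nhds t. s \<in> {a..b} \<longrightarrow> P (\<gamma> s) ** \<Phi> s = F (\<gamma> s))"
  proof (intro exI conjI)
    show "open (U \<inter> V)" using U(1) F(1) by (rule open_Int)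
    show "\<gamma> t \<in> U \<inter> V" using \<gamma> t F(2) by blast
    show "U \<inter> V \<subseteq> X" using U(2) by blast
    show "solves_on \<omega> (U \<inter> V) (\<lambda>x. P x ** F x)"
      by (rule solves_on_gauge[OF gauges_subset[OF P] solves_on_subset[OF F(4)]]) auto
    show "\<forall>\<^sub>F s in nhds t. s \<in> {a..b} \<longrightarrow> P (\<gamma> s) ** \<Phi> s = P (\<gamma> s) ** F (\<gamma> s)"
      using F(5) by eventually_elim simp
  qed
qed

text \<open>Multiplying the normalized solution for \<omega>' by \<open>P\<close> gives a solution
  for \<omega> with initial value \<open>P (pathstart \<gamma>)\<close>; its end value is then
  computed in two ways.\<close>

theorem transport_gauge:
  assumes "local_system \<omega> X" "local_system \<omega>' X'"
    and P: "gauges \<omega> \<omega>' U P" and U: "open U" "U \<subseteq> X" "U \<subseteq> X'"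
    and \<gamma>: "path \<gamma>" "path_image \<gamma> \<subseteq> U"
  shows "transport \<omega> X \<gamma> ** P (pathstart \<gamma>) = P (pathfinish \<gamma>) ** transport \<omega>' X' \<gamma>"
proof -
  interpret L: local_system \<omega> X by fact
  interpret L': local_system \<omega>' X' by fact
  have X: "path_image \<gamma> \<subseteq> X" "path_image \<gamma> \<subseteq> X'" using \<gamma>(2) U by auto
  obtain \<Phi> where \<Phi>: "solution_on \<omega>' X' \<gamma> 0 1 \<Phi>" "\<Phi> 0 = mat 1" using L'.solution_on_exists[OF \<gamma>(1) X(2)] by blast
  have "solution_on \<omega> X \<gamma> 0 1 (\<lambda>t. P (\<gamma> t) ** \<Phi> t)"
    by (rule solution_on_gauge[OF P U(1,2) _ \<Phi>(1)]) (use \<gamma>(2) in \<open>simp add: path_image_def\<close>)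
  from L.transport_solution[OF \<gamma>(1) X(1) this] show ?thesis
    using \<Phi>(2) L'.transport_eq[OF \<gamma>(1) X(2) \<Phi>] by (simp add: pathstart_def pathfinish_def)
qed

section \<open>Equivariance of transport\<close>

definition const_series :: "complex^'m^'m \<Rightarrow> complex fps^'m^'m" where
  "const_series A = (\<chi> i j. fps_const (A $ i $ j))"

lemma coeff_const_series: "coeff_matrix k (const_series A) = (if k = 0 then A else 0)"
  by (simp add: coeff_matrix_def const_series_def vec_eq_iff)

lemma coeff_const_mult_left: "coeff_matrix k (const_series A ** F) = A ** coeff_matrix k F"
proof -
  have "coeff_matrix k (const_series A ** F) = (\<Sum>a\<le>k. if a = 0 then A ** coeff_matrix (k - a) F else 0)"
    unfolding coeff_matrix_mult by (intro sum.cong) (auto simp: coeff_const_series)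
  then show ?thesis by simp
qed

lemma coeff_const_mult_right: "coeff_matrix k (F ** const_series A) = coeff_matrix k F ** A"
proof -
  have "coeff_matrix k (F ** const_series A) = (\<Sum>a\<le>k. if a = k then coeff_matrix a F ** A else 0)"
    unfolding coeff_matrix_mult by (intro sum.cong) (auto simp: coeff_const_series)
  then show ?thesis by simp
qed

lemma const_series_mult: "const_series (A ** B) = const_series A ** const_series B"
  by (rule coeff_matrix_eqI) (simp add: coeff_const_mult_left coeff_const_series)

lemma const_series_one: "const_series (mat 1) = mat 1"
  by (rule coeff_matrix_eqI) (simp add: coeff_const_series coeff_matrix_one)

text \<open>The translate of a solution by \<open>w\<close>, multiplied on the left by
  \<open>s\<close>, is again a solution. The constant factor on the right restores the
  normalization, as \<open>s ** s'\<close> is the identity in the application.\<close>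

lemma solves_on_equivariant:
  fixes w w' :: "complex^'n^'n" and s s' :: "complex^'m^'m"
  assumes w: "w ** w' = mat 1" and s: "s' ** s = mat 1"
    and \<omega>: "\<And>x v. \<omega> (w *v x) (w *v v) = s ** \<omega> x v ** s'"
    and F: "solves_on \<omega> U F"
  shows "solves_on \<omega> {y. w' *v y \<in> U} (\<lambda>y. const_series s ** F (w' *v y) ** const_series s')"
  unfolding solves_on_gauges gauges_def coeff_const_mult_left coeff_const_mult_right
proof (intro ballI allI)
  fix y k assume y: "y \<in> {y. w' *v y \<in> U}"
  let ?c = "\<lambda>k. coeff_matrix k (F (w' *v y))"
  have ww: "w *v (w' *v u) = u" for u by (simp add: matrix_vector_mul_assoc w)
  have 1: "((\<lambda>z. coeff_matrix k (F z)) has_derivative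
      (\<lambda>v. if k = 0 then 0 else \<omega> (w' *v y) v ** ?c (k - 1) - ?c (k - 1) ** 0)) (at (w' *v y))"
    using F y unfolding solves_on_gauges gauges_def by blast
  have 2: "((\<lambda>z. w' *v z) has_derivative (\<lambda>v. w' *v v)) (at y)"
    by (rule bounded_linear_imp_has_derivative[OF matrix_vector_mul_bounded_linear])
  have 3: "bounded_linear (\<lambda>a. s ** a ** s')"
    by (intro bounded_linear_compose[OF matrix_mult.bounded_linear_left matrix_mult.bounded_linear_right])
  have 4: "s ** (\<omega> (w' *v y) (w' *v v) ** c) ** s' = \<omega> y v ** (s ** c ** s')" for v c
  proof -
    have "\<omega> y v ** (s ** c ** s') = (s ** \<omega> (w' *v y) (w' *v v) ** s') ** (s ** c ** s')"
      using \<omega>[of "w' *v y" "w' *v v"] by (simp add: ww)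
    also have "\<dots> = s ** \<omega> (w' *v y) (w' *v v) ** (s' ** s) ** c ** s'" by (simp only: matrix_mul_assoc)
    finally show ?thesis by (simp add: s matrix_mul_assoc)
  qed
  show "((\<lambda>y. s ** coeff_matrix k (F (w' *v y)) ** s') has_derivative
     (\<lambda>v. if k = 0 then 0 else \<omega> y v ** (s ** ?c (k - 1) ** s') - (s ** ?c (k - 1) ** s') ** 0)) (at y)"
  proof (rule has_derivative_eq_rhs[OF bounded_linear.has_derivative[OF 3 has_derivative_compose[OF 2 1]]])
    show "(\<lambda>v. s ** (if k = 0 then 0 else \<omega> (w' *v y) (w' *v v) ** ?c (k - 1) - ?c (k - 1) ** 0) ** s') =
      (\<lambda>v. if k = 0 then 0 else \<omega> y v ** (s ** ?c (k - 1) ** s') - (s ** ?c (k - 1) ** s') ** 0)"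
      by (rule ext) (simp add: 4)
  qed
qed

theorem transport_equivariant:
  fixes w w' :: "complex^'n^'n" and s s' :: "complex^'m^'m"
  assumes "local_system \<omega> X"
    and w: "w ** w' = mat 1" "w' ** w = mat 1" and s: "s ** s' = mat 1" "s' ** s = mat 1"
    and \<omega>: "\<And>x v. \<omega> (w *v x) (w *v v) = s ** \<omega> x v ** s'"
    and X: "\<And>x. x \<in> X \<Longrightarrow> w *v x \<in> X"
    and \<gamma>: "path \<gamma>" "path_image \<gamma> \<subseteq> X"
  shows "transport \<omega> X (\<lambda>t. w *v \<gamma> t) = const_series s ** transport \<omega> X \<gamma> ** const_series s'"
proof -
  interpret local_system \<omega> X by fact
  have ww: "w' *v (w *v u) = u" "w *v (w' *v u) = u" for u by (simp_all add: matrix_vector_mul_assoc w)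
  obtain \<Phi> where \<Phi>: "solution_on \<omega> X \<gamma> 0 1 \<Phi>" "\<Phi> 0 = mat 1" using solution_on_exists[OF \<gamma>] by blast
  have sol: "solution_on \<omega> X (\<lambda>t. w *v \<gamma> t) 0 1 (\<lambda>t. const_series s ** \<Phi> t ** const_series s')"
    unfolding solution_on_def
  proof
    fix t :: real assume t: "t \<in> {0..1}"
    obtain U F where F: "open U" "\<gamma> t \<in> U" "U \<subseteq> X" "solves_on \<omega> U F"
        "\<forall>\<^sub>F r in nhds t. r \<in> {0..1} \<longrightarrow> \<Phi> r = F (\<gamma> r)" using \<Phi>(1) t unfolding solution_on_def by blast
    show "\<exists>U F. open U \<and> w *v \<gamma> t \<in> U \<and> U \<subseteq> X \<and> solves_on \<omega> U F \<and>
        (\<forall>\<^sub>F r in nhds t. r \<in> {0..1} \<longrightarrow> const_series s ** \<Phi> r ** const_series s' = F (w *v \<gamma> r))"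
    proof (intro exI conjI)
      have "open ((*v) w' -` U)"
        by (rule open_vimage[OF F(1)]) (rule linear_continuous_on[OF matrix_vector_mul_bounded_linear])
      then show "open {y. w' *v y \<in> U}" by (simp only: vimage_def)
      show "w *v \<gamma> t \<in> {y. w' *v y \<in> U}" using F(2) ww by simp
      show "{y. w' *v y \<in> U} \<subseteq> X"
      proof
        fix y assume "y \<in> {y. w' *v y \<in> U}"
        then have "w *v (w' *v y) \<in> X" using F(3) X by blast
        then show "y \<in> X" by (simp only: ww)
      qed
      show "solves_on \<omega> {y. w' *v y \<in> U} (\<lambda>y. const_series s ** F (w' *v y) ** const_series s')"
        by (rule solves_on_equivariant[OF w(1) s(2) \<omega> F(4)])
      show "\<forall>\<^sub>F r in nhds t. r \<in> {0..1} \<longrightarrow> const_series s ** \<Phi> r ** const_series s' =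
          const_series s ** F (w' *v (w *v \<gamma> r)) ** const_series s'"
        using F(5) by eventually_elim (simp add: ww)
    qed
  qed
  have p: "path (\<lambda>t. w *v \<gamma> t)" "path_image (\<lambda>t. w *v \<gamma> t) \<subseteq> X"
    using \<gamma> X by (auto simp: path_def path_image_def intro!: continuous_on_compose2[OF linear_continuous_on[OF matrix_vector_mul_bounded_linear]])
  have 0: "const_series s ** \<Phi> 0 ** const_series s' = mat 1"
    by (simp add: \<Phi>(2) const_series_mult[symmetric] s const_series_one)
  from transport_eq[OF p sol 0] show ?thesis using transport_eq[OF \<gamma> \<Phi>] by simp
qed

definition gauge_series ::
  "(complex^'n) set set \<Rightarrow> ((complex^'n) set \<Rightarrow> complex^'m^'m) \<Rightarrow> complex^'n \<Rightarrow> complex^'n \<Rightarrow> complex fps^'m^'m" where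
  "gauge_series S t x1 x = series_matrix (\<lambda>k. gauge S t x1 k x)"

section \<open>The local system of an arrangement and its gauge series\<close>

context flat_system
begin

lemma gauges_gauge_series:
  "gauges (log_form S t) (log_form (center_hyperplanes x1) t) (cone_domain S x1) (gauge_series S t x1)"
  unfolding gauges_def gauge_series_def coeff_series_matrix
proof (intro ballI allI)
  fix x k assume x: "x \<in> cone_domain S x1"
  show "(gauge S t x1 k has_derivative (\<lambda>v. if k = 0 then 0 else log_form S t x v ** gauge S t x1 (k - 1) x -
      gauge S t x1 (k - 1) x ** log_form (center_hyperplanes x1) t x v)) (at x)"
  proof (cases k)
    case 0
    have "gauge S t x1 0 = (\<lambda>x. mat 1)" by (rule ext) (rule gauge_0)
    then show ?thesis by (simp add: 0)
  next
    case (Suc j)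
    then show ?thesis using has_derivative_gauge[OF x, of j] by simp
  qed
qed

lemma closed_hyperplane: "H \<in> S \<Longrightarrow> closed H"
proof -
  assume H: "H \<in> S"
  have "closed (linear_form_of H -` {0})"
    by (rule closed_vimage[OF closed_singleton]) (rule linear_continuous_on[OF bounded_linear_form[OF H]])
  moreover have "linear_form_of H -` {0} = H" using kernel[OF H] by auto
  ultimately show ?thesis by simp
qed

text \<open>No hyperplane passes through \<open>p\<close>, so the form subtracted on the right is
  zero and the gauge series centred at \<open>p\<close> is itself a solution with value 1 at
  \<open>p\<close>.\<close>

lemma local_system_complement: "local_system (log_form S t) (- \<Union>S)"
proof
  show "open (- \<Union>S)"
    unfolding open_closed double_complement by (intro closed_Union finite_S ballI closed_hyperplane)
  fix p r assume r: "ball p r \<subseteq> - \<Union>S" "0 < r"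
  have p: "p \<notin> \<Union>S" using r centre_in_ball by blast
  have c: "center_hyperplanes p = {}" using p kernel by auto
  have "log_form (center_hyperplanes p) t = (\<lambda>x v. 0)" unfolding log_form_def c by simp
  then have "solves_on (log_form S t) (cone_domain S p) (gauge_series S t p)"
    using gauges_gauge_series[of p] unfolding solves_on_gauges by simp
  then have "solves_on (log_form S t) (ball p r) (gauge_series S t p)"
    by (rule solves_on_subset) (rule ball_subset_cone_domain, use r(1) in auto)
  moreover have "gauge_series S t p p = mat 1"
  proof (rule coeff_matrix_eqI)
    fix k
    show "coeff_matrix k (gauge_series S t p p) = coeff_matrix k (mat 1)"
      unfolding gauge_series_def coeff_series_matrix coeff_matrix_one
      using gauge_at_center[OF p] gauge_0 by (cases k) auto
  qed
  ultimately show "\<exists>F. solves_on (log_form S t) (ball p r) F \<and> F p = mat 1" by blast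
qed

lemma flat_system_center: "flat_system (center_hyperplanes x1) t"
proof (rule flat_system.intro[OF hyperplane_system.intro flat_system_axioms.intro])
  show "Vector_Spaces.linear (*s) (*) (linear_form_of H)" if "H \<in> center_hyperplanes x1" for H
    by (rule linear_form) (use that in simp)
  fix H K assume HK: "H \<in> center_hyperplanes x1" "K \<in> center_hyperplanes x1" "H \<noteq> K"
  have "{L\<in>center_hyperplanes x1. H \<inter> K \<subseteq> L} = {L\<in>S. H \<inter> K \<subseteq> L}"
    using HK kernel by auto
  then show "(\<Sum>L\<in>{L\<in>center_hyperplanes x1. H \<inter> K \<subseteq> L}. t L) ** t H = t H ** (\<Sum>L\<in>{L\<in>center_hyperplanes x1. H \<inter> K \<subseteq> L}. t L)"
    using relation[of H K] HK by simp
qed (use not_subset in \<open>simp_all add: finite_S kernel\<close>)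

theorem transport_cone_domain:
  assumes "path \<gamma>" "path_image \<gamma> \<subseteq> cone_domain S x1"
  shows "transport (log_form S t) (- \<Union>S) \<gamma> ** gauge_series S t x1 (pathstart \<gamma>) =
    gauge_series S t x1 (pathfinish \<gamma>) **
      transport (log_form (center_hyperplanes x1) t) (- \<Union>(center_hyperplanes x1)) \<gamma>"
proof (rule transport_gauge[OF local_system_complement flat_system.local_system_complement[OF flat_system_center]
      gauges_gauge_series open_cone_domain _ _ assms])
  show "cone_domain S x1 \<subseteq> - \<Union>S" using cone_domain_avoids by blast
  then show "cone_domain S x1 \<subseteq> - \<Union>(center_hyperplanes x1)" by blast
qed

lemma gauge_series_equivariant:
  fixes s s' :: "complex^'m^'m"
  assumes "invertible w" "w *v x1 = x1" "\<And>H. H \<in> S \<Longrightarrow> (*v) w ` H \<in> S"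
    and "s ** s' = mat 1" "s' ** s = mat 1"
    and "\<And>H. H \<in> S \<Longrightarrow> t ((*v) w ` H) = s ** t H ** s'"
    and "x \<in> cone_domain S x1"
  shows "gauge_series S t x1 (w *v x) = const_series s ** gauge_series S t x1 x ** const_series s'"
  using gauge_equivariant[OF assms]
  by (intro coeff_matrix_eqI) (simp add: coeff_const_mult_left coeff_const_mult_right gauge_series_def coeff_series_matrix)

end

text \<open>The recursion solves \<open>Q P = 1\<close> for the coefficients of \<open>Q\<close>,
  when the constant term of \<open>P\<close> is the identity.\<close>

fun inverse_series :: "(nat \<Rightarrow> complex^'m^'m) \<Rightarrow> nat \<Rightarrow> complex^'m^'m" where
  "inverse_series P n = (if n = 0 then mat 1 else - (\<Sum>k<n. inverse_series P k ** P (n - k)))"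

lemma series_matrix_left_inverse:
  assumes "P 0 = mat 1"
  shows "series_matrix (inverse_series P) ** series_matrix P = mat 1"
proof (rule coeff_matrix_eqI)
  fix n
  have "coeff_matrix n (series_matrix (inverse_series P) ** series_matrix P)
      = (\<Sum>k\<le>n. inverse_series P k ** P (n - k))"
    by (simp only: coeff_matrix_mult coeff_series_matrix)
  also have "\<dots> = inverse_series P n ** P 0 + (\<Sum>k<n. inverse_series P k ** P (n - k))"
    by (simp add: lessThan_Suc_atMost[symmetric] del: inverse_series.simps)
  also have "\<dots> = (if n = 0 then mat 1 else 0)"
    by (subst inverse_series.simps) (simp add: assms del: inverse_series.simps)
  finally show "coeff_matrix n (series_matrix (inverse_series P) ** series_matrix P) = coeff_matrix n (mat 1)"
    by (simp only: coeff_matrix_one)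
qed

section \<open>Passage to Laurent series\<close>

lemma fps_to_fls_sum: "fps_to_fls (\<Sum>k\<in>A. f k) = (\<Sum>k\<in>A. fps_to_fls (f k))"
  by (induction A rule: infinite_finite_induct) auto

lemma to_laurent_mult: "to_laurent (A ** B) = to_laurent A ** to_laurent B"
proof -
  have "fps_to_fls (\<Sum>k\<in>UNIV. A $ i $ k * B $ k $ j) = (\<Sum>k\<in>UNIV. fps_to_fls (A $ i $ k) * fps_to_fls (B $ k $ j))" for i j
    by (simp add: fps_to_fls_sum fls_times_fps_to_fls)
  then show ?thesis by (simp add: to_laurent_def matrix_matrix_mult_def vec_eq_iff)
qed

lemma to_laurent_one: "to_laurent (mat 1) = mat 1"
  by (simp add: to_laurent_def mat_def vec_eq_iff)

lemma const_laurent_series: "const_laurent A = to_laurent (const_series A)"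
  by (simp add: const_laurent_def to_laurent_def const_series_def vec_eq_iff)

text \<open>Laurent series form a field, over which a one-sided inverse of a square matrix is
  two-sided.\<close>

lemma to_laurent_GL:
  assumes "A ** B = mat 1"
  shows "to_laurent A \<in> carrier GL" "to_laurent B \<in> carrier GL"
proof -
  have 1: "to_laurent A ** to_laurent B = mat 1"
    using arg_cong[OF assms, of to_laurent] by (simp only: to_laurent_mult to_laurent_one)
  then have 2: "to_laurent B ** to_laurent A = mat 1" by (simp only: matrix_left_right_inverse)
  show "to_laurent A \<in> carrier GL" "to_laurent B \<in> carrier GL"
    using 1 2 by (auto simp: GL_def invertible_def)
qed

section \<open>Continuous selections from finite sets\<close>

text \<open>Each centre \<open>c\<close> costs at most \<open>2 * \<delta>\<close> between the first
  and the last visit to its \<delta>-ball, plus one step of length below \<eta> to leave it for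
  good. After the last visit the chain stays near the other centres, so induction on their number
  applies. The bound does not depend on the length of the chain.\<close>

lemma chain_drift:
  fixes z :: "nat \<Rightarrow> 'a::metric_space"
  assumes "finite C" and "\<And>j. i \<le> j \<Longrightarrow> j < m \<Longrightarrow> dist (z j) (z (Suc j)) < \<eta>"
    and "\<And>j. i \<le> j \<Longrightarrow> j \<le> m \<Longrightarrow> \<exists>c\<in>C. dist (z j) c < \<delta>" and "i \<le> m" "0 \<le> \<eta>" "0 \<le> \<delta>"
  shows "dist (z i) (z m) \<le> real (card C) * (2 * \<delta> + \<eta>)"
  using assms
proof (induction "card C" arbitrary: C i)
  case 0
  then have "C = {}" by simp
  then show ?case using 0(4)[of i] 0(5) by auto
next
  case (Suc n)
  obtain c where c: "c \<in> C" "dist (z i) c < \<delta>" using Suc.prems(3)[of i] Suc.prems(4) by auto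
  define J where "J = {j. i \<le> j \<and> j \<le> m \<and> dist (z j) c < \<delta>}"
  have J: "finite J" "i \<in> J" using c Suc.prems(4) unfolding J_def by auto
  \<comment> \<open>The last index at which the chain is near \<open>c\<close>, with everything in
    between skipped.\<close>
  define l where "l = Max J"
  have l: "l \<in> J" "\<And>j. j \<in> J \<Longrightarrow> j \<le> l" unfolding l_def using J Max_in Max_ge by blast+
  have il: "dist (z i) (z l) < 2 * \<delta>"
    using c(2) l(1) dist_triangle2[of "z i" "z l" c] unfolding J_def by auto
  have "card C = Suc n" using Suc.hyps(2) by simp
  show ?case
  proof (cases "l = m")
    case True
    have "2 * \<delta> \<le> 1 * (2 * \<delta> + \<eta>)" using Suc.prems(5) by simp
    also have "\<dots> \<le> real (card C) * (2 * \<delta> + \<eta>)"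
      using \<open>card C = Suc n\<close> Suc.prems(5,6) by (intro mult_right_mono) auto
    finally show ?thesis using il True by simp
  next
    case False
    then have lm: "l < m" "i \<le> l" using l(1) unfolding J_def by auto
    have "dist (z (Suc l)) (z m) \<le> real (card (C - {c})) * (2 * \<delta> + \<eta>)"
    proof (rule Suc.hyps(1))
      show "n = card (C - {c})" using \<open>card C = Suc n\<close> c(1) Suc.prems(1) by simp
      show "finite (C - {c})" using Suc.prems(1) by simp
      fix j assume j: "Suc l \<le> j"
      show "dist (z j) (z (Suc j)) < \<eta>" if "j < m" using Suc.prems(2)[of j] j lm that by simp
      show "\<exists>c\<in>C - {c}. dist (z j) c < \<delta>" if "j \<le> m"
      proof -
        have "j \<notin> J" using l(2)[of j] j by auto
        then have "\<not> dist (z j) c < \<delta>" using j lm that unfolding J_def by auto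
        then show ?thesis using Suc.prems(3)[of j] j lm that by auto
      qed
    qed (use lm Suc.prems in auto)
    then have "dist (z (Suc l)) (z m) \<le> real n * (2 * \<delta> + \<eta>)"
      using \<open>card C = Suc n\<close> c(1) Suc.prems(1) by simp
    moreover have "dist (z l) (z (Suc l)) < \<eta>" using Suc.prems(2) lm by simp
    moreover have "dist (z i) (z m) \<le> dist (z i) (z l) + dist (z l) (z (Suc l)) + dist (z (Suc l)) (z m)"
      using dist_triangle[of "z i" "z m" "z l"] dist_triangle[of "z l" "z m" "z (Suc l)"] by linarith
    ultimately have "dist (z i) (z m) \<le> 2 * \<delta> + \<eta> + real n * (2 * \<delta> + \<eta>)" using il by linarith
    then show ?thesis using \<open>card C = Suc n\<close> by (simp add: algebra_simps)
  qed
qed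

text \<open>A finite-valued map of the unit interval, continuous for the Hausdorff distance, with a
  uniform bound on the number of values. The bound is what makes \<open>chain_drift\<close>
  uniform.\<close>

locale multifunction =
  fixes f :: "real \<Rightarrow> 'a::euclidean_space set" and N :: nat and y0 :: 'a
  assumes finite_f: "t \<in> {0..1} \<Longrightarrow> finite (f t)" and card_f: "t \<in> {0..1} \<Longrightarrow> card (f t) \<le> N"
    and y0: "y0 \<in> f 0"
    and hausdorff: "t0 \<in> {0..1} \<Longrightarrow> 0 < \<delta> \<Longrightarrow> \<exists>d>0. \<forall>t\<in>{0..1}. dist t t0 < d \<longrightarrow>
       (\<forall>y\<in>f t. \<exists>y'\<in>f t0. dist y y' < \<delta>) \<and> (\<forall>y\<in>f t0. \<exists>y'\<in>f t. dist y y' < \<delta>)"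
begin

text \<open>Around each \<open>t0\<close> the values are \<delta>/2-close in both directions; a
  Lebesgue number for these intervals lets two close parameters be compared through a common
  \<open>t0\<close>.\<close>

lemma uniform:
  assumes "0 < \<delta>"
  shows "\<exists>\<tau>>0. \<forall>t\<in>{0..1}. \<forall>t'\<in>{0..1}. dist t t' < \<tau> \<longrightarrow> (\<forall>y\<in>f t. \<exists>y'\<in>f t'. dist y y' < \<delta>)"
proof -
  have "\<forall>t0\<in>{0..1}. \<exists>d>0. \<forall>t\<in>{0..1}. dist t t0 < d \<longrightarrow>
       (\<forall>y\<in>f t. \<exists>y'\<in>f t0. dist y y' < \<delta> / 2) \<and> (\<forall>y\<in>f t0. \<exists>y'\<in>f t. dist y y' < \<delta> / 2)"
    using hausdorff[of _ "\<delta> / 2"] assms by simp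
  from bchoice[OF this] obtain d where D: "\<forall>t0\<in>{0..1}. d t0 > 0 \<and> (\<forall>t\<in>{0..1}. dist t t0 < d t0 \<longrightarrow>
       (\<forall>y\<in>f t. \<exists>y'\<in>f t0. dist y y' < \<delta> / 2) \<and> (\<forall>y\<in>f t0. \<exists>y'\<in>f t. dist y y' < \<delta> / 2))"
    by (elim exE)
  have d: "\<And>t0. t0 \<in> {0..1} \<Longrightarrow> 0 < d t0"
    "\<And>t0 t y. t0 \<in> {0..1} \<Longrightarrow> t \<in> {0..1} \<Longrightarrow> dist t t0 < d t0 \<Longrightarrow> y \<in> f t \<Longrightarrow> \<exists>y'\<in>f t0. dist y y' < \<delta> / 2"
    "\<And>t0 t y. t0 \<in> {0..1} \<Longrightarrow> t \<in> {0..1} \<Longrightarrow> dist t t0 < d t0 \<Longrightarrow> y \<in> f t0 \<Longrightarrow> \<exists>y'\<in>f t. dist y y' < \<delta> / 2"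
    using D by blast+
  have cover: "{0..1} \<subseteq> \<Union>((\<lambda>t. ball t (d t)) ` {0..1})"
  proof
    fix t :: real assume "t \<in> {0..1}"
    then have "t \<in> ball t (d t)" using d(1) by simp
    then show "t \<in> \<Union>((\<lambda>t. ball t (d t)) ` {0..1})" using \<open>t \<in> {0..1}\<close> by blast
  qed
  obtain e where e: "0 < e" "\<And>x. x \<in> {0..1} \<Longrightarrow> \<exists>G\<in>(\<lambda>t. ball t (d t)) ` {0..1}. ball x e \<subseteq> G"
    by (rule Heine_Borel_lemma[OF compact_Icc cover]) auto
  show ?thesis
  proof (rule exI[of _ e], intro conjI e(1) ballI impI)
    fix t t' y assume t: "t \<in> {0..1}" "t' \<in> {0..1}" "dist t t' < e" "y \<in> f t"
    obtain t0 where t0: "t0 \<in> {0..1}" "ball t e \<subseteq> ball t0 (d t0)" using e(2)[OF t(1)] by blast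
    have "t \<in> ball t e" "t' \<in> ball t e" using t(3) e(1) by simp_all
    then have "t \<in> ball t0 (d t0)" "t' \<in> ball t0 (d t0)" using t0(2) by blast+
    then have dd: "dist t t0 < d t0" "dist t' t0 < d t0" by (simp_all add: dist_commute)
    obtain y1 where y1: "y1 \<in> f t0" "dist y y1 < \<delta> / 2" using d(2)[OF t0(1) t(1) dd(1) t(4)] by blast
    obtain y2 where y2: "y2 \<in> f t'" "dist y1 y2 < \<delta> / 2" using d(3)[OF t0(1) t(2) dd(2) y1(1)] by blast
    have "dist y y2 < \<delta>" using y1(2) y2(2) dist_triangle[of y y2 y1] by linarith
    then show "\<exists>y'\<in>f t'. dist y y' < \<delta>" using y2(1) by blast
  qed
qed

text \<open>A value has a partner at every nearby parameter, so emptiness is locally constant, and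
  it fails at 0.\<close>

lemma nonempty:
  assumes "t \<in> {0..1}"
  shows "f t \<noteq> {}"
proof -
  have "(\<lambda>t. f t = {}) constant_on {0..1}"
  proof (rule locally_constant_imp_constant)
    show "connected {0..1::real}" by (rule connected_Icc)
    obtain \<tau> where \<tau>: "0 < \<tau>" "\<forall>t\<in>{0..1}. \<forall>t'\<in>{0..1}. dist t t' < \<tau> \<longrightarrow> (\<forall>y\<in>f t. \<exists>y'\<in>f t'. dist y y' < 1)"
      using uniform[OF zero_less_one] by (elim exE conjE)
    fix t :: real assume t: "t \<in> {0..1}"
    have eq: "f s = {} \<longleftrightarrow> f t = {}" if "s \<in> {0..1} \<inter> ball t \<tau>" for s
    proof -
      have "s \<in> {0..1}" "dist s t < \<tau>" "dist t s < \<tau>" using that by (auto simp: dist_commute)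
      then show ?thesis using \<tau>(2)[rule_format, of s t] \<tau>(2)[rule_format, of t s] t by blast
    qed
    show "\<exists>T. openin (top_of_set {0..1}) T \<and> t \<in> T \<and> (\<forall>s\<in>T. (f s = {}) = (f t = {}))"
    proof (intro exI conjI)
      show "openin (top_of_set {0..1}) ({0..1} \<inter> ball t \<tau>)" by (rule openin_open_Int[OF open_ball])
      show "t \<in> {0..1} \<inter> ball t \<tau>" using t \<tau>(1) by simp
      show "\<forall>s\<in>{0..1} \<inter> ball t \<tau>. (f s = {}) = (f t = {})" using eq by blast
    qed
  qed
  then obtain c where c: "\<forall>t\<in>{0..1}. (f t = {}) = c" unfolding constant_on_def by (elim exE)
  have "(0::real) \<in> {0..1}" by simp
  then have "(f 0 = {}) = c" using c by (rule bspec[rotated])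
  then have "\<not> c" using y0 by auto
  then show ?thesis using bspec[OF c assms] by simp
qed

lemma bounded_values: "\<exists>M. \<forall>t\<in>{0..1}. \<forall>y\<in>f t. norm y \<le> M"
proof -
  define P where "P a b \<longleftrightarrow> (\<exists>M. \<forall>t\<in>{a..b} \<inter> {0..1}. \<forall>y\<in>f t. norm y \<le> M)" for a b
  have "P 0 1"
  proof (rule Bolzano)
    fix a b c :: real assume "P a b" "P b c"
    then obtain M M' where M: "\<forall>t\<in>{a..b} \<inter> {0..1}. \<forall>y\<in>f t. norm y \<le> M" "\<forall>t\<in>{b..c} \<inter> {0..1}. \<forall>y\<in>f t. norm y \<le> M'"
      unfolding P_def by (elim exE)
    show "P a c" unfolding P_def
    proof (intro exI[of _ "max M M'"] ballI)
      fix t y assume t: "t \<in> {a..c} \<inter> {0..1}" "y \<in> f t"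
      show "norm y \<le> max M M'"
      proof (cases "t \<le> b")
        case True
        then have "norm y \<le> M" using M(1) t by auto
        then show ?thesis by simp
      next
        case False
        then have "norm y \<le> M'" using M(2) t by auto
        then show ?thesis by simp
      qed
    qed
  next
    fix x :: real assume "0 \<le> x" "x \<le> 1"
    then have x: "x \<in> {0..1}" by simp
    obtain d where d: "0 < d" "\<forall>t\<in>{0..1}. dist t x < d \<longrightarrow> (\<forall>y\<in>f t. \<exists>y'\<in>f x. dist y y' < 1) \<and> (\<forall>y\<in>f x. \<exists>y'\<in>f t. dist y y' < 1)"
      using hausdorff[OF x zero_less_one] by (elim exE conjE)
    obtain M where M: "\<forall>y\<in>f x. norm y \<le> M"
      using finite_imp_bounded[OF finite_f[OF x]] unfolding bounded_iff by (elim exE)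
    show "\<exists>d>0. \<forall>a b. a \<le> x \<and> x \<le> b \<and> b - a < d \<longrightarrow> P a b"
    proof (intro exI[of _ d] conjI d(1) allI impI)
      fix a b assume ab: "a \<le> x \<and> x \<le> b \<and> b - a < d"
      show "P a b" unfolding P_def
      proof (intro exI[of _ "M + 1"] ballI)
        fix t y assume t: "t \<in> {a..b} \<inter> {0..1}" "y \<in> f t"
        have "dist t x < d" using ab t(1) by (auto simp: dist_real_def)
        then obtain y' where y': "y' \<in> f x" "dist y y' < 1" using d(2) t by blast
        have "norm y \<le> norm y' + dist y y'" by (simp add: dist_norm norm_triangle_sub)
        moreover have "norm y' \<le> M" using M y'(1) by blast
        ultimately show "norm y \<le> M + 1" using y'(2) by linarith
      qed
    qed
  qed simp
  then show ?thesis unfolding P_def by simp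
qed

definition closest :: "real \<Rightarrow> 'a \<Rightarrow> 'a" where
  "closest t y = (SOME y'. y' \<in> f t \<and> (\<forall>z\<in>f t. dist y y' \<le> dist y z))"

lemma closest:
  assumes "t \<in> {0..1}"
  shows "closest t y \<in> f t" "\<And>z. z \<in> f t \<Longrightarrow> dist y (closest t y) \<le> dist y z"
proof -
  have "\<exists>y'. y' \<in> f t \<and> (\<forall>z\<in>f t. dist y y' \<le> dist y z)"
    using ex_min_if_finite[of "dist y ` f t"] finite_f[OF assms] nonempty[OF assms]
    by (auto simp: not_less)
  from someI_ex[OF this] show "closest t y \<in> f t" "\<And>z. z \<in> f t \<Longrightarrow> dist y (closest t y) \<le> dist y z"
    unfolding closest_def[symmetric] by auto
qed

text \<open>
  At each of \<open>n\<close> steps, move to a closest value. The bound \<open>N\<close> on the number of values makes these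
  chains equicontinuous in the limit, so that a subsequence converges to a continuous selection.
\<close>

primrec chain :: "nat \<Rightarrow> nat \<Rightarrow> 'a" where
  "chain n 0 = y0"
| "chain n (Suc i) = closest (real (Suc i) / real n) (chain n i)"

lemma chain_in: "0 < n \<Longrightarrow> i \<le> n \<Longrightarrow> chain n i \<in> f (real i / real n)"
  using y0 closest(1) by (cases i) (auto simp: field_simps)

text \<open>Between the two indices every point of the chain is \<delta>-close to one fixed finite
  set of at most \<open>N\<close> values, and every step is shorter than \<delta>.
  \<open>chain_drift\<close> then gives a modulus of continuity that does not involve
  \<open>n\<close>.\<close>

lemma chain_modulus:
  assumes \<tau>: "\<forall>t\<in>{0..1}. \<forall>t'\<in>{0..1}. dist t t' < \<tau> \<longrightarrow> (\<forall>y\<in>f t. \<exists>y'\<in>f t'. dist y y' < \<delta>)" and "0 < \<delta>"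
    and n: "0 < n" "1 / real n < \<tau> / 2" and t: "0 \<le> t" "t \<le> t'" "t' \<le> 1" "t' - t < \<tau> / 2"
  shows "dist (chain n (nat \<lfloor>real n * t\<rfloor>)) (chain n (nat \<lfloor>real n * t'\<rfloor>)) \<le> real N * (3 * \<delta>)"
proof -
  define i where "i = nat \<lfloor>real n * t\<rfloor>"
  define m where "m = nat \<lfloor>real n * t'\<rfloor>"
  have i: "real i \<le> real n * t" "real n * t < real i + 1"
    unfolding i_def using t n by (simp_all add: of_nat_nat)
  have m: "real m \<le> real n * t'" "real n * t' < real m + 1"
    unfolding m_def using t n by (simp_all add: of_nat_nat)
  have "real n * t \<le> real n * t'" using t by (intro mult_left_mono) auto
  then have im: "i \<le> m" unfolding i_def m_def by (intro nat_mono floor_mono)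
  have "real n * t' \<le> real n * 1" using t by (intro mult_left_mono) auto
  then have mn: "m \<le> n" using m(1) by simp
  have mem: "real j / real n \<in> {0..1}" if "j \<le> n" for j using that n by (simp add: divide_le_eq)
  have iN: "finite (f (real i / real n))" "card (f (real i / real n)) \<le> N"
    using finite_f card_f mem im mn by auto
  have "dist (chain n i) (chain n m) \<le> real (card (f (real i / real n))) * (2 * \<delta> + \<delta>)"
  proof (rule chain_drift[OF iN(1)])
    fix j assume j: "i \<le> j"
    show "dist (chain n j) (chain n (Suc j)) < \<delta>" if "j < m"
    proof -
      have "dist (real j / real n) (real (Suc j) / real n) = 1 / real n"
        by (simp add: dist_real_def diff_divide_distrib[symmetric])
      moreover have "0 < 1 / real n" using n by simp
      ultimately have "dist (real j / real n) (real (Suc j) / real n) < \<tau>" using n(2) by linarith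
      moreover have "j \<le> n" "Suc j \<le> n" using that mn by auto
      ultimately obtain y' where y': "y' \<in> f (real (Suc j) / real n)" "dist (chain n j) y' < \<delta>"
        using \<tau>[rule_format, OF mem mem _ chain_in[OF n(1)], of j "Suc j"] by blast
      have "real (Suc j) / real n \<in> {0..1}" by (rule mem) (use that mn in simp)
      then show ?thesis using closest(2)[OF _ y'(1), of "chain n j"] y'(2) by simp
    qed
    show "\<exists>c\<in>f (real i / real n). dist (chain n j) c < \<delta>" if "j \<le> m"
    proof -
      \<comment> \<open>Half of \<tau> pays for \<open>t' - t\<close>, the other half for the
        rounding error \<open>1 / n\<close> of the two floors.\<close>
      have "real j - real i < real n * t' - real n * t + 1" using that m i by linarith
      also have "\<dots> = real n * (t' - t + 1 / real n)" using n by (simp add: algebra_simps)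
      also have "\<dots> \<le> real n * \<tau>" using t(4) n by (intro mult_left_mono) auto
      finally have "(real j - real i) / real n < \<tau>" using n by (simp add: divide_less_eq mult.commute)
      then have "dist (real j / real n) (real i / real n) < \<tau>"
        using j n by (simp add: dist_real_def diff_divide_distrib[symmetric])
      moreover have "j \<le> n" "i \<le> n" using that mn im by auto
      ultimately show ?thesis using \<tau>[rule_format, OF mem mem _ chain_in[OF n(1)], of j i] by blast
    qed
  qed (use im \<open>0 < \<delta>\<close> in auto)
  also have "\<dots> \<le> real N * (3 * \<delta>)" using iN(2) \<open>0 < \<delta>\<close> by (intro mult_mono) auto
  finally show ?thesis unfolding i_def m_def .
qed

text \<open>On a countable dense set a diagonal subsequence of the chains converges. The modulus
  from \<open>chain_modulus\<close> passes to the limit, which is therefore uniformly continuous and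
  extends to the interval; its values lie in \<open>f t\<close> because finite sets are
  closed.\<close>

theorem continuous_selection:
  obtains y where "continuous_on {0..1} y" "y 0 = y0" "\<And>t. t \<in> {0..1} \<Longrightarrow> y t \<in> f t"
proof -
  define S :: "real set" where "S = \<rat> \<inter> {0..1}"
  define g where "g n t = chain (Suc n) (nat \<lfloor>real (Suc n) * t\<rfloor>)" for n t
  have SI: "S \<subseteq> {0..1}" by (auto simp: S_def)
  have gin: "\<exists>s\<in>{0..1}. dist s t \<le> 1 / real (Suc n) \<and> g n t \<in> f s" if t: "t \<in> {0..1}" for n t
  proof -
    define i where "i = nat \<lfloor>real (Suc n) * t\<rfloor>"
    have i: "real i \<le> real (Suc n) * t" "real (Suc n) * t < real i + 1"
      unfolding i_def using t by (simp_all add: of_nat_nat del: of_nat_Suc)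
    have "real (Suc n) * t \<le> real (Suc n) * 1" using t by (intro mult_left_mono) auto
    then have "real i \<le> real (Suc n)" using i(1) by (metis mult.right_neutral order_trans)
    then have iN: "i \<le> Suc n" by (simp only: of_nat_le_iff)
    have 1: "real i / real (Suc n) \<le> t" using i(1) by (simp add: divide_le_eq mult.commute del: of_nat_Suc)
    have 2: "t < real i / real (Suc n) + 1 / real (Suc n)"
      using i(2) by (simp add: add_divide_distrib[symmetric] less_divide_eq mult.commute del: of_nat_Suc)
    have "g n t \<in> f (real i / real (Suc n))" unfolding g_def i_def[symmetric] by (rule chain_in) (use iN in auto)
    moreover have "real i / real (Suc n) \<in> {0..1}" using iN by (simp add: divide_le_eq del: of_nat_Suc)
    ultimately show ?thesis using 1 2
      by (intro bexI[of _ "real i / real (Suc n)"]) (auto simp: dist_real_def simp del: of_nat_Suc)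
  qed
  obtain M where M: "\<forall>t\<in>{0..1}. \<forall>y\<in>f t. norm y \<le> M" using bounded_values by blast
  have bd: "norm (g n t) \<le> M" if "t \<in> S" for n t
    using gin[of t n] M that SI by blast
  have "countable S" unfolding S_def by (intro countable_Int1 countable_rat)
  then obtain k where k: "strict_mono k" "\<And>t. t \<in> S \<Longrightarrow> \<exists>l. (\<lambda>n. g (k n) t) \<longlonglongrightarrow> l"
    using function_convergent_subsequence[of S g M] bd by blast
  then obtain y where y: "\<And>t. t \<in> S \<Longrightarrow> (\<lambda>n. g (k n) t) \<longlonglongrightarrow> y t" by metis
  have kn: "n \<le> k n" for n by (rule strict_mono_imp_increasing[OF k(1)])
  have small: "\<forall>\<^sub>F n in sequentially. 1 / real (Suc (k n)) < e" if "0 < e" for e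
  proof -
    obtain n0 where n0: "1 / e < real n0" using reals_Archimedean2 by blast
    have "1 / real (Suc (k n)) < e" if "n0 \<le> n" for n
    proof -
      have "1 / e < real (Suc (k n))" using n0 kn[of n] that by linarith
      then show ?thesis using \<open>0 < e\<close> by (simp add: divide_less_eq mult.commute del: of_nat_Suc)
    qed
    then show ?thesis unfolding eventually_sequentially by blast
  qed
  have modulus: "\<exists>\<tau>>0. \<forall>t\<in>S. \<forall>t'\<in>S. dist t t' < \<tau> \<longrightarrow> dist (y t) (y t') \<le> e" if e: "0 < e" for e
  proof -
    \<comment> \<open>Chosen so that the drift \<open>N * (3 * \<delta>)\<close> is at most
      \<open>e\<close>; the summand 1 keeps the denominator positive.\<close>
    define \<delta> where "\<delta> = e / (3 * (real N + 1))"
    have \<delta>: "0 < \<delta>" using e by (simp add: \<delta>_def)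
    have Ne: "real N * (3 * \<delta>) \<le> e"
    proof -
      have "3 * \<delta> = e / (real N + 1)" unfolding \<delta>_def by (simp add: divide_simps)
      then have "real N * (3 * \<delta>) = e * (real N / (real N + 1))" by simp
      also have "\<dots> \<le> e * 1" using e by (intro mult_left_mono) auto
      finally show ?thesis by simp
    qed
    obtain \<tau> where \<tau>: "0 < \<tau>" "\<forall>t\<in>{0..1}. \<forall>t'\<in>{0..1}. dist t t' < \<tau> \<longrightarrow> (\<forall>y\<in>f t. \<exists>y'\<in>f t'. dist y y' < \<delta>)"
      using uniform[OF \<delta>] by blast
    have le: "dist (y t) (y t') \<le> e" if tt: "t \<in> S" "t' \<in> S" "t \<le> t'" "t' - t < \<tau> / 2" for t t'
    proof (rule tendsto_upperbound[OF tendsto_dist[OF y[OF tt(1)] y[OF tt(2)]]])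
      show "\<forall>\<^sub>F n in sequentially. dist (g (k n) t) (g (k n) t') \<le> e"
        using small[OF half_gt_zero[OF \<tau>(1)]]
      proof eventually_elim
        case (elim n)
        then have "dist (g (k n) t) (g (k n) t') \<le> real N * (3 * \<delta>)"
          unfolding g_def using tt SI by (intro chain_modulus[OF \<tau>(2) \<delta>]) auto
        then show "dist (g (k n) t) (g (k n) t') \<le> e" using Ne by linarith
      qed
    qed simp
    have "dist (y t) (y t') \<le> e" if "t \<in> S" "t' \<in> S" "dist t t' < \<tau> / 2" for t t'
    proof (cases "t \<le> t'")
      case True
      then show ?thesis using le[of t t'] that by (simp add: dist_real_def)
    next
      case False
      then show ?thesis using le[of t' t] that by (simp add: dist_real_def dist_commute)
    qed
    then show ?thesis using \<tau>(1) by (intro exI[of _ "\<tau> / 2"]) auto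
  qed
  have uc: "uniformly_continuous_on S y"
    unfolding uniformly_continuous_on_def
  proof (intro allI impI)
    fix e :: real assume "0 < e"
    then obtain \<tau> where "0 < \<tau>" "\<forall>t\<in>S. \<forall>t'\<in>S. dist t t' < \<tau> \<longrightarrow> dist (y t) (y t') \<le> e / 2"
      using modulus[of "e / 2"] by auto
    then show "\<exists>d>0. \<forall>x\<in>S. \<forall>x'\<in>S. dist x' x < d \<longrightarrow> dist (y x') (y x) < e"
      using \<open>0 < e\<close> by (intro exI[of _ \<tau>]) fastforce
  qed
  obtain Y where Y: "uniformly_continuous_on (closure S) Y" "\<And>t. t \<in> S \<Longrightarrow> y t = Y t"
  proof (rule uniformly_continuous_on_extension_on_closure[OF uc])
    fix g assume "uniformly_continuous_on (closure S) g" "\<And>t. t \<in> S \<Longrightarrow> y t = g t"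
    then show thesis by (rule that)
  qed
  have clS: "{0..1} \<subseteq> closure S"
  proof
    fix t :: real assume t: "t \<in> {0..1}"
    show "t \<in> closure S"
      unfolding closure_approachable
    proof (intro allI impI)
      fix e :: real assume e: "0 < e"
      show "\<exists>s\<in>S. dist s t < e"
      proof (cases "t < 1")
        case True
        then have "t < min 1 (t + e)" using e by simp
        then obtain q where "q \<in> \<rat>" "t < q" "q < min 1 (t + e)" using Rats_dense_in_real by blast
        then show ?thesis using t by (intro bexI[of _ q]) (auto simp: S_def dist_real_def)
      next
        case False
        then have "t = 1" using t by simp
        then show ?thesis using e by (intro bexI[of _ 1]) (auto simp: S_def)
      qed
    qed
  qed
  have cY: "continuous_on {0..1} Y"
    using uniformly_continuous_imp_continuous[OF Y(1)] clS by (rule continuous_on_subset)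
  have near: "\<exists>z\<in>f t. dist (Y s) z < 2 * \<delta>" if st: "s \<in> S" "t \<in> {0..1}" "dist s t < \<tau> / 2" and \<delta>: "0 < \<delta>"
    and \<tau>: "0 < \<tau>" "\<forall>t\<in>{0..1}. \<forall>t'\<in>{0..1}. dist t t' < \<tau> \<longrightarrow> (\<forall>y\<in>f t. \<exists>y'\<in>f t'. dist y y' < \<delta>)" for s t \<delta> \<tau>
  proof -
    have "\<forall>\<^sub>F n in sequentially. dist (g (k n) s) (y s) < \<delta>" using y[OF st(1)] \<delta> by (rule tendstoD)
    moreover have "\<forall>\<^sub>F n in sequentially. 1 / real (Suc (k n)) < \<tau> / 2" by (rule small) (use \<tau>(1) in simp)
    ultimately have "\<forall>\<^sub>F n in sequentially. dist (g (k n) s) (y s) < \<delta> \<and> 1 / real (Suc (k n)) < \<tau> / 2"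
      by eventually_elim simp
    then obtain n where n: "dist (g (k n) s) (y s) < \<delta>" "1 / real (Suc (k n)) < \<tau> / 2"
      using eventually_happens'[OF sequentially_bot] by blast
    obtain r where r: "r \<in> {0..1}" "dist r s \<le> 1 / real (Suc (k n))" "g (k n) s \<in> f r"
      using gin[of s "k n"] st(1) SI by blast
    have "dist r t < \<tau>" using r(2) n(2) st(3) dist_triangle[of r t s] by linarith
    then obtain z where "z \<in> f t" "dist (g (k n) s) z < \<delta>" using \<tau>(2) r st(2) by blast
    moreover have "dist (Y s) z \<le> dist (g (k n) s) (y s) + dist (g (k n) s) z"
      using Y(2)[OF st(1)] dist_triangle3[of "Y s" z "g (k n) s"] by (simp add: dist_commute)
    ultimately show ?thesis using n(1) by (intro bexI[of _ z]) auto
  qed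
  have "Y t \<in> f t" if t: "t \<in> {0..1}" for t
  proof (rule ccontr)
    assume "Y t \<notin> f t"
    have "closed (f t)" using finite_f[OF t] by (rule finite_imp_closed)
    then have "open (- f t)" by (rule open_Compl)
    moreover have "Y t \<in> - f t" using \<open>Y t \<notin> f t\<close> by simp
    ultimately obtain e where e: "0 < e" "ball (Y t) e \<subseteq> - f t" unfolding open_contains_ball by blast
    \<comment> \<open>A value of \<open>f t\<close> within \<open>2 * (e / 4)\<close> of
      \<open>Y s\<close>, and \<open>Y s\<close> within \<open>e / 2\<close> of \<open>Y t\<close>,
      together land in the forbidden ball of radius \<open>e\<close>.\<close>
    have e4: "0 < e / 4" "0 < e / 2" using e(1) by simp_all
    obtain \<tau> where \<tau>: "0 < \<tau>" "\<forall>t\<in>{0..1}. \<forall>t'\<in>{0..1}. dist t t' < \<tau> \<longrightarrow> (\<forall>y\<in>f t. \<exists>y'\<in>f t'. dist y y' < e / 4)"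
      using uniform[OF e4(1)] by (elim exE conjE)
    obtain d where d: "0 < d" "\<forall>s\<in>closure S. dist s t < d \<longrightarrow> dist (Y s) (Y t) < e / 2"
      using uniformly_continuous_imp_continuous[OF Y(1), unfolded continuous_on_iff, THEN bspec, THEN spec, THEN mp,
          OF subsetD[OF clS t] e4(2)] by (elim exE conjE)
    obtain s where s: "s \<in> S" "dist s t < min d (\<tau> / 2)"
    proof -
      have "0 < min d (\<tau> / 2)" using d(1) \<tau>(1) by simp
      then show thesis using subsetD[OF clS t] that unfolding closure_approachable by blast
    qed
    have "\<exists>z\<in>f t. dist (Y s) z < 2 * (e / 4)"
      by (rule near[OF s(1) t _ e4(1) \<tau>]) (use s(2) in simp)
    then obtain z where z: "z \<in> f t" "dist (Y s) z < 2 * (e / 4)" by blast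
    have "s \<in> closure S" using s(1) closure_subset by blast
    then have "dist (Y s) (Y t) < e / 2" using d(2) s(2) by simp
    then have "dist (Y t) z < e" using z(2) dist_triangle3[of "Y t" z "Y s"] by linarith
    then have "z \<in> ball (Y t) e" by simp
    then show False using e(2) z(1) by blast
  qed
  moreover have "Y 0 = y0"
  proof -
    have 0: "0 \<in> S" by (simp add: S_def)
    have "(\<lambda>n. g (k n) 0) \<longlonglongrightarrow> y 0" by (rule y[OF 0])
    moreover have "g n 0 = y0" for n by (simp add: g_def)
    ultimately have "y 0 = y0" by (simp add: LIMSEQ_const_iff)
    then show ?thesis using Y(2)[OF 0] by simp
  qed
  ultimately show thesis using that cY by blast
qed

end

section \<open>Fundamental groups and orbit spaces\<close>

lemma path_homotopic_endpoints: "path_homotopic T \<gamma> \<delta> \<Longrightarrow> \<delta> 0 = \<gamma> 0 \<and> \<delta> 1 = \<gamma> 1"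
  unfolding path_homotopic_def by (drule homotopic_with_imp_property) blast

lemma path_homotopic_pathin: "path_homotopic T \<gamma> \<delta> \<Longrightarrow> pathin T \<gamma> \<and> pathin T \<delta>"
  unfolding path_homotopic_def pathin_def by (drule homotopic_with_imp_continuous_maps) blast

text \<open>Paths are functions on all reals, but homotopies see only the unit interval. This is how
  a path is replaced by the projection of a lift that agrees with it there.\<close>

lemma path_homotopic_cong:
  assumes "pathin T \<gamma>" "\<And>t. t \<in> {0..1} \<Longrightarrow> \<gamma> t = \<delta> t"
  shows "path_homotopic T \<gamma> \<delta>"
  unfolding path_homotopic_def
  by (rule homotopic_with_equal) (use assms in \<open>auto simp: pathin_def\<close>)

lemma path_homotopic_refl: "pathin T \<gamma> \<Longrightarrow> path_homotopic T \<gamma> \<gamma>"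
  by (erule path_homotopic_cong) (rule HOL.refl)

lemma path_homotopic_sym:
  assumes "path_homotopic T \<gamma> \<delta>"
  shows "path_homotopic T \<delta> \<gamma>"
  using assms path_homotopic_endpoints[OF assms] unfolding path_homotopic_def
  by (subst homotopic_with_sym) simp

lemma path_homotopic_trans:
  assumes a: "path_homotopic T \<gamma> \<delta>" and b: "path_homotopic T \<delta> \<epsilon>"
  shows "path_homotopic T \<gamma> \<epsilon>"
proof -
  have "homotopic_with (\<lambda>\<eta>. \<eta> 0 = \<gamma> 0 \<and> \<eta> 1 = \<gamma> 1) (top_of_set {0..1}) T \<delta> \<epsilon>"
    using b path_homotopic_endpoints[OF a] unfolding path_homotopic_def by simp
  then show ?thesis using a unfolding path_homotopic_def by (rule homotopic_with_trans[rotated])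
qed

lemma path_class_eq: "path_homotopic T \<gamma> \<delta> \<Longrightarrow> path_class T \<gamma> = path_class T \<delta>"
  unfolding path_class_def by (blast intro: path_homotopic_sym path_homotopic_trans)

lemma path_class_eq_iff: "pathin T \<delta> \<Longrightarrow> path_class T \<gamma> = path_class T \<delta> \<longleftrightarrow> path_homotopic T \<gamma> \<delta>"
  using path_class_eq path_homotopic_refl by (fastforce simp: path_class_def)

lemma path_homotopic_compose:
  assumes "continuous_map T T' f" "path_homotopic T \<gamma> \<delta>"
  shows "path_homotopic T' (f \<circ> \<gamma>) (f \<circ> \<delta>)"
  using assms(2) unfolding path_homotopic_def
  by (rule homotopic_with_compose_continuous_map_left[OF _ assms(1)]) auto

lemma path_join_joinpaths: "path_join = (+++)"
  by (intro ext) (simp add: path_join_def joinpaths_def)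

lemma path_reverse_reversepath: "path_reverse = reversepath"
  by (intro ext) (simp add: path_reverse_def reversepath_def)

lemma path_homotopic_top_of_set: "path_homotopic (top_of_set S) = homotopic_paths S"
  by (intro ext) (simp add: path_homotopic_def homotopic_paths_def pathstart_def pathfinish_def)

lemma path_homotopic_join:
  assumes a: "path_homotopic T \<gamma> \<gamma>'" and b: "path_homotopic T \<delta> \<delta>'" and j: "\<gamma> 1 = \<delta> 0"
  shows "path_homotopic T (path_join \<gamma> \<delta>) (path_join \<gamma>' \<delta>')"
proof -
  let ?Q = "prod_topology (top_of_set {0..1::real}) (top_of_set {0..1::real})"
  obtain h :: "real \<times> real \<Rightarrow> 'a" where h: "continuous_map ?Q T h" "\<forall>x. h (0, x) = \<gamma> x" "\<forall>x. h (1, x) = \<gamma>' x"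
    "\<forall>t\<in>{0..1}. h (t, 0) = \<gamma> 0 \<and> h (t, 1) = \<gamma> 1"
    using a unfolding path_homotopic_def homotopic_with_def by (elim exE conjE)
  obtain k :: "real \<times> real \<Rightarrow> 'a" where k: "continuous_map ?Q T k" "\<forall>x. k (0, x) = \<delta> x" "\<forall>x. k (1, x) = \<delta>' x"
    "\<forall>t\<in>{0..1}. k (t, 0) = \<delta> 0 \<and> k (t, 1) = \<delta> 1"
    using b unfolding path_homotopic_def homotopic_with_def by (elim exE conjE)
  define m where "m z = (if snd z \<le> 1/2 then h (fst z, 2 * snd z) else k (fst z, 2 * snd z - 1))" for z
  have Q: "?Q = top_of_set ({0..1} \<times> {0..1})" by (simp add: prod_topology_subtopology_eu)
  have "continuous_map ?Q T m"
    unfolding m_def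
  proof (rule continuous_map_cases_le[where p = snd and q = "\<lambda>z. 1/2"])
    show "continuous_map ?Q euclideanreal snd" unfolding Q by (auto intro: continuous_intros)
    show "continuous_map ?Q euclideanreal (\<lambda>z. 1/2)" by simp
    have "continuous_map (subtopology ?Q {x \<in> topspace ?Q. snd x \<le> 1/2}) ?Q (\<lambda>z. (fst z, 2 * snd z))"
      unfolding Q subtopology_subtopology by (auto intro!: continuous_intros)
    from continuous_map_compose[OF this h(1)]
    show "continuous_map (subtopology ?Q {x \<in> topspace ?Q. snd x \<le> 1/2}) T (\<lambda>z. h (fst z, 2 * snd z))"
      by (simp only: o_def)
    have "continuous_map (subtopology ?Q {x \<in> topspace ?Q. 1/2 \<le> snd x}) ?Q (\<lambda>z. (fst z, 2 * snd z - 1))"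
      unfolding Q subtopology_subtopology by (auto intro!: continuous_intros)
    from continuous_map_compose[OF this k(1)]
    show "continuous_map (subtopology ?Q {x \<in> topspace ?Q. 1/2 \<le> snd x}) T (\<lambda>z. k (fst z, 2 * snd z - 1))"
      by (simp only: o_def)
    fix z assume "z \<in> topspace ?Q" "snd z = 1/2"
    then have "fst z \<in> {0..1}" "2 * snd z = 1" by (auto simp: Q)
    then show "h (fst z, 2 * snd z) = k (fst z, 2 * snd z - 1)"
      using bspec[OF h(4), of "fst z"] bspec[OF k(4), of "fst z"] j by simp
  qed
  moreover have "\<forall>x. m (0, x) = path_join \<gamma> \<delta> x" "\<forall>x. m (1, x) = path_join \<gamma>' \<delta>' x"
    using h k by (auto simp: m_def path_join_def)
  moreover have "\<forall>t\<in>{0..1}. m (t, 0) = path_join \<gamma> \<delta> 0 \<and> m (t, 1) = path_join \<gamma> \<delta> 1"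
    using h(4) k(4) by (auto simp: m_def path_join_def)
  ultimately show ?thesis
    unfolding path_homotopic_def homotopic_with_def by (intro exI[of _ m] conjI)
qed

lemma pathin_path_join:
  assumes "pathin T \<gamma>" "pathin T \<delta>" "\<gamma> 1 = \<delta> 0"
  shows "pathin T (path_join \<gamma> \<delta>)"
  using path_homotopic_pathin[OF path_homotopic_join[OF path_homotopic_refl path_homotopic_refl]] assms by blast

lemma pathin_path_reverse: "pathin T \<gamma> \<Longrightarrow> pathin T (path_reverse \<gamma>)"
proof -
  assume "pathin T \<gamma>"
  then have g: "continuous_map (top_of_set {0..1}) T \<gamma>" by (simp add: pathin_def)
  have "continuous_map (top_of_set {0..1}) (top_of_set {0..1}) (\<lambda>t::real. 1 - t)"
    by (auto intro!: continuous_intros)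
  from continuous_map_compose[OF this g] show ?thesis by (simp add: pathin_def path_reverse_def[abs_def] o_def)
qed

lemma path_reverse_reverse [simp]: "path_reverse (path_reverse \<gamma>) = \<gamma>"
  by (rule ext) (simp add: path_reverse_def)

lemma pathin_compose: "pathin T \<gamma> \<Longrightarrow> continuous_map T T' f \<Longrightarrow> pathin T' (f \<circ> \<gamma>)"
  unfolding pathin_def by (rule continuous_map_compose)

text \<open>
  All paths in the word \<open>b (b\<^sup>-\<^sup>1 g b) b\<^sup>-\<^sup>1\<close> factor through one map \<open>q\<close> from the interval \<open>[-1, 2]\<close>, in
  which paths with the same endpoints are homotopic.
\<close>

lemma path_homotopic_rebase:
  assumes b: "pathin T b" and g: "pathin T g" "g 0 = b 0" "g 1 = b 0"
  shows "path_homotopic T g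
    (path_join b (path_join (path_join (path_reverse b) (path_join g b)) (path_reverse b)))"
proof -
  define q where "q s = (if s \<le> 1 then (if s \<le> 0 then b (- s) else g s) else b (s - 1))" for s :: real
  let ?I = "top_of_set {-1..2::real}"
  have B: "continuous_map (top_of_set {0..1}) T b" and G: "continuous_map (top_of_set {0..1}) T g"
    using b g by (simp_all add: pathin_def)
  have 1: "continuous_map (top_of_set {-1..1}) T (\<lambda>s. if s \<le> 0 then b (- s) else g s)"
  proof (rule continuous_map_cases_le[where p = "\<lambda>s. s" and q = "\<lambda>s. 0"])
    have "continuous_map (subtopology (top_of_set {-1..1}) {x \<in> topspace (top_of_set {-1..1}). x \<le> 0}) (top_of_set {0..1}) (\<lambda>s::real. - s)"
      unfolding subtopology_subtopology by (auto intro!: continuous_intros)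
    from continuous_map_compose[OF this B]
    show "continuous_map (subtopology (top_of_set {-1..1}) {x \<in> topspace (top_of_set {-1..1}). x \<le> 0}) T (\<lambda>s. b (- s))"
      by (simp only: o_def)
    have "continuous_map (subtopology (top_of_set {-1..1}) {x \<in> topspace (top_of_set {-1..1}). 0 \<le> x}) (top_of_set {0..1}) (\<lambda>s::real. s)"
      unfolding subtopology_subtopology by (auto intro!: continuous_intros)
    from continuous_map_compose[OF this G]
    show "continuous_map (subtopology (top_of_set {-1..1}) {x \<in> topspace (top_of_set {-1..1}). 0 \<le> x}) T (\<lambda>s. g s)"
      by (simp only: o_def)
  qed (use g in auto)
  have "continuous_map ?I T q"
    unfolding q_def
  proof (rule continuous_map_cases_le[where p = "\<lambda>s. s" and q = "\<lambda>s. 1"])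
    have "subtopology ?I {x \<in> topspace ?I. x \<le> 1} = top_of_set {-1..1}"
      unfolding subtopology_subtopology by (rule arg_cong[where f = top_of_set]) auto
    then show "continuous_map (subtopology ?I {x \<in> topspace ?I. x \<le> 1}) T (\<lambda>s. if s \<le> 0 then b (- s) else g s)"
      using 1 by (simp only:)
    have "continuous_map (subtopology ?I {x \<in> topspace ?I. 1 \<le> x}) (top_of_set {0..1}) (\<lambda>s::real. s - 1)"
      unfolding subtopology_subtopology by (auto intro!: continuous_intros)
    from continuous_map_compose[OF this B]
    show "continuous_map (subtopology ?I {x \<in> topspace ?I. 1 \<le> x}) T (\<lambda>s. b (s - 1))"
      by (simp only: o_def)
  qed (use g in auto)
  note q = this
  \<comment> \<open>The word as a walk on the line: from 0 to -1 it traces \<open>b\<close>, back to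
    0 the reverse of \<open>b\<close>, from 0 to 1 \<open>g\<close>, on to 2 again \<open>b\<close>,
    and back to 1 its reverse.\<close>
  define r where "r = linepath 0 (-1) +++ ((linepath (-1) 0 +++ (linepath 0 1 +++ linepath 1 2)) +++ linepath 2 (1::real))"
  have "homotopic_paths {-1..2} (linepath 0 1) r"
  proof -
    have seg: "path_image (linepath x y) \<subseteq> {-1..2::real}" if "x \<in> {-1..2}" "y \<in> {-1..2}" for x y
      using that by (auto simp: closed_segment_eq_real_ivl split: if_splits)
    show "homotopic_paths {-1..2} (linepath 0 1) r"
    proof (rule homotopic_paths_linear)
      show "path (linepath 0 (1::real))" by simp
      show "path r" unfolding r_def by (simp add: path_join_eq)
      show "pathstart r = pathstart (linepath 0 1)" "pathfinish r = pathfinish (linepath 0 1)"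
        unfolding r_def by simp_all
      have "path_image r \<subseteq> {-1..2}" unfolding r_def by (intro subset_path_image_join seg) auto
      fix t :: real assume t: "t \<in> {0..1}"
      have "linepath 0 1 t \<in> {-1..2::real}" using seg[of 0 1] t by (auto simp: path_image_def)
      moreover have "r t \<in> path_image r" using t unfolding path_image_def by blast
      then have "r t \<in> {-1..2}" using \<open>path_image r \<subseteq> {-1..2}\<close> by blast
      ultimately show "closed_segment (linepath 0 1 t) (r t) \<subseteq> {-1..2}"
        by (simp add: closed_segment_subset convex_real_interval)
    qed
  qed
  then have "path_homotopic T (q \<circ> linepath 0 1) (q \<circ> r)"
    by (intro path_homotopic_compose[OF q]) (simp add: path_homotopic_top_of_set)
  moreover have "path_homotopic T g (q \<circ> linepath 0 1)"
    by (rule path_homotopic_cong[OF g(1)]) (use g in \<open>auto simp: q_def linepath_def\<close>)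
  moreover have "path_homotopic T (q \<circ> r)
      (path_join b (path_join (path_join (path_reverse b) (path_join g b)) (path_reverse b)))"
  proof (rule path_homotopic_cong)
    show "pathin T (q \<circ> r)" using path_homotopic_pathin[OF calculation(1)] by blast
    have l: "linepath x y s = x + s * (y - x)" for x y s :: real by (simp add: linepath_def algebra_simps)
    fix t :: real assume "t \<in> {0..1}"
    then show "(q \<circ> r) t = path_join b (path_join (path_join (path_reverse b) (path_join g b)) (path_reverse b)) t"
      using g unfolding o_def r_def path_join_def joinpaths_def path_reverse_def l
      by (auto simp: q_def)
  qed
  ultimately show ?thesis by (blast intro: path_homotopic_trans)
qed

text \<open>Operations on classes are defined as unions over all representatives; independence of
  the representative collapses such a union to a single class.\<close>

lemma UN_eq_of_const: "c \<in> C \<Longrightarrow> (\<And>x. x \<in> C \<Longrightarrow> F x = F c) \<Longrightarrow> (\<Union>x\<in>C. F x) = F c"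
  by blast

lemma path_class_self: "pathin T \<gamma> \<Longrightarrow> \<gamma> \<in> path_class T \<gamma>"
  by (simp add: path_class_def path_homotopic_refl)

lemma fundamental_group_mult:
  assumes "pathin T \<gamma>" "pathin T \<delta>" "\<gamma> 0 = \<delta> 1"
  shows "mult (fundamental_group T p) (path_class T \<gamma>) (path_class T \<delta>) = path_class T (path_join \<delta> \<gamma>)"
proof -
  have eq: "path_class T (path_join \<delta>' \<gamma>') = path_class T (path_join \<delta> \<gamma>)"
    if "\<gamma>' \<in> path_class T \<gamma>" "\<delta>' \<in> path_class T \<delta>" for \<gamma>' \<delta>'
    using that assms(3) by (intro path_class_eq[symmetric] path_homotopic_join) (auto simp: path_class_def)
  have "(\<Union>\<delta>'\<in>path_class T \<delta>. path_class T (path_join \<delta>' \<gamma>')) = path_class T (path_join \<delta> \<gamma>)"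
    if "\<gamma>' \<in> path_class T \<gamma>" for \<gamma>'
    using eq[OF that] path_class_self[OF assms(2)] by blast
  then show ?thesis
    using path_class_self[OF assms(1)] by (simp add: fundamental_group_def) blast
qed

lemma pi1_map_class:
  assumes "continuous_map T T' f" "pathin T \<gamma>"
  shows "pi1_map T' f (path_class T \<gamma>) = path_class T' (f \<circ> \<gamma>)"
  unfolding pi1_map_def
proof (rule UN_eq_of_const[where F = "\<lambda>\<delta>. path_class T' (f \<circ> \<delta>)", OF path_class_self[OF assms(2)]])
  fix \<delta> assume "\<delta> \<in> path_class T \<gamma>"
  then show "path_class T' (f \<circ> \<delta>) = path_class T' (f \<circ> \<gamma>)"
    by (intro path_class_eq[symmetric] path_homotopic_compose[OF assms(1)]) (simp add: path_class_def)
qed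

lemma pi1_rebase_class:
  assumes "pathin T \<beta>" "pathin T \<gamma>" "\<gamma> 0 = \<beta> 1" "\<gamma> 1 = \<beta> 1"
  shows "pi1_rebase T \<beta> (path_class T \<gamma>) = path_class T (path_join \<beta> (path_join \<gamma> (path_reverse \<beta>)))"
  unfolding pi1_rebase_def
proof (rule UN_eq_of_const[where F = "\<lambda>\<delta>. path_class T (path_join \<beta> (path_join \<delta> (path_reverse \<beta>)))",
      OF path_class_self[OF assms(2)]])
  fix \<delta> assume d: "\<delta> \<in> path_class T \<gamma>"
  have h: "path_homotopic T \<gamma> \<delta>" using d by (simp add: path_class_def)
  have "path_homotopic T (path_join \<gamma> (path_reverse \<beta>)) (path_join \<delta> (path_reverse \<beta>))"
    by (rule path_homotopic_join[OF h path_homotopic_refl[OF pathin_path_reverse[OF assms(1)]]])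
      (simp add: assms path_reverse_def)
  then have "path_homotopic T (path_join \<beta> (path_join \<gamma> (path_reverse \<beta>))) (path_join \<beta> (path_join \<delta> (path_reverse \<beta>)))"
    by (rule path_homotopic_join[OF path_homotopic_refl[OF assms(1)]]) (simp add: assms path_join_def)
  then show "path_class T (path_join \<beta> (path_join \<delta> (path_reverse \<beta>))) = path_class T (path_join \<beta> (path_join \<gamma> (path_reverse \<beta>)))"
    by (rule path_class_eq[symmetric])
qed

lemma carrier_fundamental_group:
  "c \<in> carrier (fundamental_group T p) \<longleftrightarrow> (\<exists>\<gamma>. c = path_class T \<gamma> \<and> pathin T \<gamma> \<and> \<gamma> 0 = p \<and> \<gamma> 1 = p)"
  by (auto simp: fundamental_group_def)

section \<open>Lifting paths from orbit spaces of finite linear groups\<close>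

locale finite_linear_group =
  fixes W :: "(complex^'n^'n) set"
  assumes finite_W: "finite W" and one_W: "mat 1 \<in> W"
    and mult_W: "v \<in> W \<Longrightarrow> w \<in> W \<Longrightarrow> v ** w \<in> W"
    and inv_W: "w \<in> W \<Longrightarrow> matrix_inv w \<in> W"
    and inv_left: "w \<in> W \<Longrightarrow> matrix_inv w ** w = mat 1" and inv_right: "w \<in> W \<Longrightarrow> w ** matrix_inv w = mat 1"
begin

lemma act_inv: "w \<in> W \<Longrightarrow> matrix_inv w *v (w *v x) = x" "w \<in> W \<Longrightarrow> w *v (matrix_inv w *v x) = x"
  by (simp_all add: matrix_vector_mul_assoc inv_left inv_right)

lemma orbit_self: "x \<in> orbit W x"
  unfolding orbit_def using one_W by (intro image_eqI[of _ _ "mat 1"]) auto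

lemma orbit_act: "w \<in> W \<Longrightarrow> orbit W (w *v x) = orbit W x"
proof
  assume w: "w \<in> W"
  show "orbit W (w *v x) \<subseteq> orbit W x"
    unfolding orbit_def using mult_W[OF _ w] by (auto simp: matrix_vector_mul_assoc)
  show "orbit W x \<subseteq> orbit W (w *v x)"
  proof
    fix y assume "y \<in> orbit W x"
    then obtain v where v: "v \<in> W" "y = v *v x" unfolding orbit_def by auto
    then have "y = (v ** matrix_inv w) *v (w *v x)"
      by (simp add: matrix_vector_mul_assoc[symmetric] act_inv(1)[OF w])
    then show "y \<in> orbit W (w *v x)" unfolding orbit_def using mult_W[OF v(1) inv_W[OF w]] by blast
  qed
qed

lemma orbit_eq:
  assumes "y \<in> orbit W x"
  shows "orbit W y = orbit W x"
proof -
  obtain w where "w \<in> W" "y = w *v x" using assms unfolding orbit_def by blast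
  then show ?thesis using orbit_act by simp
qed

text \<open>A common Lipschitz constant of the group: if one point of an orbit is close to one point
  of another orbit, then the orbits are close in the Hausdorff distance.\<close>

lemma operator_bound: obtains K where "0 < K" "\<And>w (v :: complex^'n). w \<in> W \<Longrightarrow> norm (w *v v) \<le> norm v * K"
proof -
  have "\<forall>w\<in>W. \<exists>K. 0 \<le> K \<and> (\<forall>v. norm (w *v v) \<le> norm v * K)"
  proof
    fix w :: "complex^'n^'n"
    have "bounded_linear ((*v) w)" by (rule matrix_vector_mul_bounded_linear)
    from bounded_linear.nonneg_bounded[OF this] show "\<exists>K. 0 \<le> K \<and> (\<forall>v. norm (w *v v) \<le> norm v * K)" by blast
  qed
  from bchoice[OF this] obtain K where K: "\<forall>w\<in>W. 0 \<le> K w \<and> (\<forall>v. norm (w *v v) \<le> norm v * K w)" by (elim exE)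
  show thesis
  proof (rule that[of "1 + (\<Sum>w\<in>W. K w)"])
    show "0 < 1 + (\<Sum>w\<in>W. K w)" using sum_nonneg[of W K] K by fastforce
    fix w and v :: "complex^'n" assume w: "w \<in> W"
    have "K w \<le> (\<Sum>w\<in>W. K w)" by (rule member_le_sum[OF w]) (use K finite_W in auto)
    then have "norm v * K w \<le> norm v * (1 + (\<Sum>w\<in>W. K w))" by (intro mult_left_mono) auto
    moreover have "norm (w *v v) \<le> norm v * K w" using K w by blast
    ultimately show "norm (w *v v) \<le> norm v * (1 + (\<Sum>w\<in>W. K w))" by linarith
  qed
qed

text \<open>The action need not be free: the lift is a continuous selection of the orbits.\<close>

theorem path_lift:
  assumes Y: "\<And>w y. w \<in> W \<Longrightarrow> y \<in> Y \<Longrightarrow> w *v y \<in> Y"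
    and \<gamma>: "pathin (orbit_space W Y) \<gamma>" "\<gamma> 0 = orbit W y0" and y0: "y0 \<in> Y"
  obtains \<delta> where "path \<delta>" "path_image \<delta> \<subseteq> Y" "\<delta> 0 = y0" "\<And>t. t \<in> {0..1} \<Longrightarrow> \<gamma> t = orbit W (\<delta> t)"
proof -
  have cont: "continuous_map (top_of_set {0..1}) (orbit_space W Y) \<gamma>" using \<gamma>(1) by (simp add: pathin_def)
  have val: "\<exists>x\<in>Y. \<gamma> t = orbit W x" if "t \<in> {0..1}" for t
  proof -
    have "\<gamma> ` {0..1} \<subseteq> orbit W ` Y"
      using continuous_map_image_subset_topspace[OF cont] by (simp add: topspace_orbit_space)
    then show ?thesis using that by blast
  qed
  have val': "x \<in> Y \<and> \<gamma> t = orbit W x" if t: "t \<in> {0..1}" and x: "x \<in> \<gamma> t" for t x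
  proof -
    obtain u where u: "u \<in> Y" "\<gamma> t = orbit W u" using val[OF t] by blast
    then obtain w where "w \<in> W" "x = w *v u" using x unfolding orbit_def by auto
    then show ?thesis using Y u orbit_act by simp
  qed
  obtain K where K: "0 < K" "\<And>w (v :: complex^'n). w \<in> W \<Longrightarrow> norm (w *v v) \<le> norm v * K"
    using operator_bound by blast
  \<comment> \<open>A point of the orbit space is literally a finite set of vectors, so the path
    itself is the multifunction.\<close>
  interpret multifunction \<gamma> "card W" y0
  proof
    show "y0 \<in> \<gamma> 0" using \<gamma>(2) orbit_self by simp
    fix t0 :: real assume t0: "t0 \<in> {0..1}"
    show "finite (\<gamma> t0)" "card (\<gamma> t0) \<le> card W"
      using val[OF t0] finite_W card_image_le by (auto simp: orbit_def)
    fix \<delta> :: real assume \<delta>: "0 < \<delta>"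
    obtain y where y: "y \<in> Y" "\<gamma> t0 = orbit W y" using val[OF t0] by blast
    \<comment> \<open>Orbits that meet a small ball about \<open>y\<close>. Upstairs this is a union
      of translates, hence open; the radius \<open>\<delta> / K\<close> becomes \<delta> after any
      group element is applied.\<close>
    define V where "V = {Q \<in> orbit W ` Y. Q \<inter> ball y (\<delta> / K) \<noteq> {}}"
    have "openin (orbit_space W Y) V"
      unfolding openin_orbit_space
    proof
      show "V \<subseteq> orbit W ` Y" by (auto simp: V_def)
      have "{x \<in> Y. orbit W x \<in> V} = Y \<inter> (\<Union>w\<in>W. (*v) w -` ball y (\<delta> / K))"
        by (auto simp: V_def orbit_def)
      moreover have "open (\<Union>w\<in>W. (*v) w -` ball y (\<delta> / K))"
        by (intro open_UN ballI open_vimage open_ball linear_continuous_on matrix_vector_mul_bounded_linear)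
      ultimately show "openin (top_of_set Y) {x \<in> Y. orbit W x \<in> V}" by (simp add: openin_open_Int)
    qed
    from openin_continuous_map_preimage[OF cont this]
    obtain A where A: "open A" "{t \<in> {0..1}. \<gamma> t \<in> V} = {0..1} \<inter> A" by (auto simp: openin_open)
    have "\<gamma> t0 \<in> V" using y orbit_self[of y] K(1) \<delta> by (auto simp: V_def)
    then have "t0 \<in> A" using A(2) t0 by blast
    then obtain d where d: "0 < d" "ball t0 d \<subseteq> A" using A(1) unfolding open_contains_ball by blast
    show "\<exists>d>0. \<forall>t\<in>{0..1}. dist t t0 < d \<longrightarrow>
       (\<forall>y\<in>\<gamma> t. \<exists>y'\<in>\<gamma> t0. dist y y' < \<delta>) \<and> (\<forall>y\<in>\<gamma> t0. \<exists>y'\<in>\<gamma> t. dist y y' < \<delta>)"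
    proof (rule exI[of _ d], rule conjI[OF d(1)], intro ballI impI)
      fix t :: real assume t: "t \<in> {0..1}" "dist t t0 < d"
      have "t \<in> ball t0 d" using t(2) by (simp add: dist_commute)
      then have "t \<in> {0..1} \<inter> A" using t(1) d(2) by blast
      then have "\<gamma> t \<in> V" using A(2) by blast
      then obtain z where z: "z \<in> \<gamma> t" "dist y z < \<delta> / K" by (auto simp: V_def)
      have zo: "\<gamma> t = orbit W z" using val'[OF t(1) z(1)] by blast
      have wd: "dist (w *v z) (w *v y) < \<delta>" if w: "w \<in> W" for w
      proof -
        have "dist (w *v z) (w *v y) = norm (w *v (z - y))" by (simp add: dist_norm matrix_vector_mult_diff_distrib)
        also have "\<dots> \<le> norm (z - y) * K" by (rule K(2)[OF w])
        also have "\<dots> < \<delta> / K * K" using z(2) K(1) by (intro mult_strict_right_mono) (simp_all add: dist_norm norm_minus_commute)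
        finally show ?thesis using K(1) by simp
      qed
      show "(\<forall>y\<in>\<gamma> t. \<exists>y'\<in>\<gamma> t0. dist y y' < \<delta>) \<and> (\<forall>y\<in>\<gamma> t0. \<exists>y'\<in>\<gamma> t. dist y y' < \<delta>)"
      proof (intro conjI ballI)
        fix u assume "u \<in> \<gamma> t"
        then obtain w where "w \<in> W" "u = w *v z" unfolding zo orbit_def by blast
        then show "\<exists>y'\<in>\<gamma> t0. dist u y' < \<delta>"
          unfolding y(2) orbit_def using wd by (intro bexI[of _ "w *v y"]) auto
      next
        fix u assume "u \<in> \<gamma> t0"
        then obtain w where "w \<in> W" "u = w *v y" unfolding y(2) orbit_def by blast
        then show "\<exists>y'\<in>\<gamma> t. dist u y' < \<delta>"
          unfolding zo orbit_def using wd by (intro bexI[of _ "w *v z"]) (auto simp: dist_commute)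
      qed
    qed
  qed
  obtain \<delta> where \<delta>: "continuous_on {0..1} \<delta>" "\<delta> 0 = y0" "\<And>t. t \<in> {0..1} \<Longrightarrow> \<delta> t \<in> \<gamma> t"
    by (rule continuous_selection) (rule that)
  show thesis
  proof (rule that[of \<delta>])
    show "path \<delta>" using \<delta>(1) by (simp add: path_def)
    show "path_image \<delta> \<subseteq> Y" using val' \<delta>(3) by (auto simp: path_image_def)
    show "\<gamma> t = orbit W (\<delta> t)" if "t \<in> {0..1}" for t using val'[OF that \<delta>(3)[OF that]] by blast
  qed (rule \<delta>(2))
qed

lemma pathin_orbit: "path \<delta> \<Longrightarrow> path_image \<delta> \<subseteq> Y \<Longrightarrow> pathin (orbit_space W Y) (orbit W \<circ> \<delta>)"
proof (rule pathin_compose)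
  show "continuous_map (top_of_set Y) (orbit_space W Y) (orbit W)"
    by (rule quotient_imp_continuous_map[OF quotient_map_orbit])
  show "path \<delta> \<Longrightarrow> path_image \<delta> \<subseteq> Y \<Longrightarrow> pathin (top_of_set Y) \<delta>"
    by (auto simp: pathin_canon_iff path_image_def)
qed

end

section \<open>Monodromy representations\<close>

lemma GL_simps: "carrier GL = {A. invertible A}" "mult GL = (**)" "one GL = mat 1"
  by (simp_all add: GL_def)

lemma matrix_inverse_unique:
  fixes A B C :: "'a::comm_ring_1^'n^'n"
  assumes "B ** A = mat 1" "A ** C = mat 1"
  shows "B = C"
proof -
  have "B = B ** (A ** C)" by (simp add: assms)
  also have "\<dots> = C" unfolding matrix_mul_assoc assms(1) by simp
  finally show ?thesis .
qed

lemma GL_m_inv: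
  fixes A :: "'a::comm_ring_1^'n^'n"
  assumes "invertible A"
  shows "m_inv GL A = matrix_inv A"
  unfolding m_inv_def GL_simps
proof (rule the_equality)
  show "matrix_inv A \<in> {A. invertible A} \<and> A ** matrix_inv A = mat 1 \<and> matrix_inv A ** A = mat 1"
    using matrix_inv[OF assms] by (auto simp: invertible_def)
  show "B = matrix_inv A" if "B \<in> {A. invertible A} \<and> A ** B = mat 1 \<and> B ** A = mat 1" for B
    using matrix_inverse_unique[of B A "matrix_inv A"] matrix_inv[OF assms] that by simp
qed

lemma subgroup_finite_linear_group:
  assumes fin: "finite W" and sub: "subgroup W (GL :: (complex^'n^'n) monoid)"
  shows "finite_linear_group W"
proof -
  have inv: "invertible w" if "w \<in> W" for w
    using subgroup.subset[OF sub] that by (auto simp: GL_simps)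
  show ?thesis
  proof
    show "finite W" by fact
    show "mat 1 \<in> W" using subgroup.one_closed[OF sub] by (simp add: GL_simps)
    fix v w assume w: "w \<in> W"
    show "v ** w \<in> W" if "v \<in> W" using subgroup.m_closed[OF sub that w] by (simp add: GL_simps)
    show "matrix_inv w \<in> W" using subgroup.m_inv_closed[OF sub w] by (simp add: GL_m_inv inv w)
    show "matrix_inv w ** w = mat 1" "w ** matrix_inv w = mat 1" using matrix_inv[OF inv[OF w]] by auto
  qed
qed

context finite_linear_group
begin

lemma invertible_W: "w \<in> W \<Longrightarrow> invertible w"
  using inv_left inv_right unfolding invertible_def by blast

lemma inv_inv: "w \<in> W \<Longrightarrow> matrix_inv (matrix_inv w) = w"
  using matrix_inverse_unique[of "matrix_inv (matrix_inv w)" "matrix_inv w" w] inv_left inv_W by simp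

lemma stabilizer_finite_linear_group: "finite_linear_group (pointwise_stabilizer W I)"
proof
  show "finite (pointwise_stabilizer W I)" using finite_W by (simp add: pointwise_stabilizer_def)
  show "mat 1 \<in> pointwise_stabilizer W I" using one_W by (simp add: pointwise_stabilizer_def)
  fix v w assume w: "w \<in> pointwise_stabilizer W I"
  then have W: "w \<in> W" and fix_w: "\<And>x. x \<in> I \<Longrightarrow> w *v x = x" by (auto simp: pointwise_stabilizer_def)
  show "v ** w \<in> pointwise_stabilizer W I" if "v \<in> pointwise_stabilizer W I"
    using that W fix_w mult_W by (auto simp: pointwise_stabilizer_def matrix_vector_mul_assoc[symmetric])
  have "matrix_inv w *v x = x" if "x \<in> I" for x
    using act_inv(1)[OF W, of x] fix_w[OF that] by simp
  then show "matrix_inv w \<in> pointwise_stabilizer W I"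
    using inv_W[OF W] by (simp add: pointwise_stabilizer_def)
  show "matrix_inv w ** w = mat 1" "w ** matrix_inv w = mat 1" using inv_left[OF W] inv_right[OF W] by auto
qed

text \<open>The image of the hyperplane of \<open>s\<close> is the fixed space of the conjugate of
  \<open>s\<close> by \<open>w\<close>, which is again a reflection in the group.\<close>

lemma arrangement_stable:
  assumes w: "w \<in> W" and H: "H \<in> arrangement W"
  shows "(*v) w ` H \<in> arrangement W"
proof -
  obtain s where s: "s \<in> W" "reflection s" "H = fixed_space s"
    using H by (auto simp: arrangement_def reflections_def)
  let ?s = "w ** s ** matrix_inv w"
  have img: "(*v) w ` H = fixed_space ?s" unfolding s(3) by (rule image_fixed_space[OF invertible_W[OF w]])
  have "?s ** ?s = w ** s ** (matrix_inv w ** w) ** s ** matrix_inv w" by (simp only: matrix_mul_assoc)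
  also have "\<dots> = w ** (s ** s) ** matrix_inv w" by (simp add: inv_left[OF w] matrix_mul_assoc)
  also have "\<dots> = mat 1" using s(2) by (simp add: reflection_def inv_right[OF w])
  finally have sq: "?s ** ?s = mat 1" .
  have codim: "codim_subspace 1 H" using H by (rule arrangement_codim)
  have lin: "Vector_Spaces.linear (*s) (*s) ((*v) w)" by (rule matrix_vector_mul_linear_gen)
  have inj: "inj ((*v) w)" using act_inv(1)[OF w] by (metis injI)
  have "vec.subspace ((*v) w ` H)"
    using codim by (intro vec.linear_subspace_image[OF lin]) (simp add: codim_subspace_def)
  moreover have "vec.dim ((*v) w ` H) = vec.dim H"
    by (rule vec.dim_image_eq[OF lin]) (use inj in \<open>auto intro: inj_on_subset\<close>)
  ultimately have "codim_subspace 1 (fixed_space ?s)"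
    using codim unfolding img by (simp add: codim_subspace_def)
  then have "reflection ?s" using sq by (simp add: reflection_def)
  moreover have "?s \<in> W" using w s mult_W inv_W by simp
  ultimately show ?thesis unfolding img arrangement_def reflections_def by blast
qed

end

text \<open>The relation with \<open>M\<close> exhibits \<open>R\<close> as a conjugate of
  \<open>R'\<close>, and the homomorphism property of \<open>R\<close> is read off from this. For a
  monodromy composed with an embedding, an intertwining relation thus suffices.\<close>

lemma isomorphic_reps_conjugate:
  fixes R R' :: "'g \<Rightarrow> 'a::field^'m^'m"
  assumes R': "R' \<in> hom G GL" and M: "M \<in> carrier GL"
    and eq: "\<And>g. g \<in> carrier G \<Longrightarrow> M ** R g = R' g ** M"
    and closed: "\<And>g h. g \<in> carrier G \<Longrightarrow> h \<in> carrier G \<Longrightarrow> mult G g h \<in> carrier G"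
  shows "isomorphic_reps G R R'"
proof -
  have inv: "M ** matrix_inv M = mat 1" "matrix_inv M ** M = mat 1"
    using M matrix_inv by (auto simp: GL_simps)
  have R: "R g = matrix_inv M ** R' g ** M" if "g \<in> carrier G" for g
  proof -
    have "R g = (matrix_inv M ** M) ** R g" by (simp add: inv)
    then show ?thesis using eq[OF that] by (simp add: matrix_mul_assoc[symmetric])
  qed
  have inv_R': "invertible (R' g)" if "g \<in> carrier G" for g
    using R' that by (auto simp: hom_def GL_simps)
  have "R \<in> hom G GL"
    unfolding hom_def GL_simps
  proof (intro CollectI conjI ballI funcsetI)
    fix g assume g: "g \<in> carrier G"
    have "invertible (matrix_inv M)" "invertible M" using inv by (auto simp: invertible_def)
    then show "invertible (R g)" unfolding R[OF g] by (intro invertible_mult inv_R' g)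
    fix h assume h: "h \<in> carrier G"
    have "R' (mult G g h) = R' g ** R' h" using R' g h by (auto simp: hom_def GL_simps)
    then have "R (mult G g h) = matrix_inv M ** R' g ** R' h ** M"
      using R[OF closed[OF g h]] by (simp add: matrix_mul_assoc)
    also have "\<dots> = matrix_inv M ** R' g ** (M ** matrix_inv M) ** R' h ** M" by (simp add: inv)
    also have "\<dots> = R g ** R h" unfolding R[OF g] R[OF h] by (simp only: matrix_mul_assoc)
    finally show "R (mult G g h) = R g ** R h" .
  qed
  then show ?thesis using R' M eq unfolding isomorphic_reps_def by blast
qed

lemma fundamental_group_closed:
  assumes "c \<in> carrier (fundamental_group T p)" "d \<in> carrier (fundamental_group T p)"
  shows "mult (fundamental_group T p) c d \<in> carrier (fundamental_group T p)"
proof -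
  obtain \<gamma> where \<gamma>: "c = path_class T \<gamma>" "pathin T \<gamma>" "\<gamma> 0 = p" "\<gamma> 1 = p"
    using assms(1) unfolding carrier_fundamental_group by blast
  obtain \<delta> where \<delta>: "d = path_class T \<delta>" "pathin T \<delta>" "\<delta> 0 = p" "\<delta> 1 = p"
    using assms(2) unfolding carrier_fundamental_group by blast
  have "mult (fundamental_group T p) c d = path_class T (path_join \<delta> \<gamma>)"
    unfolding \<gamma>(1) \<delta>(1) by (rule fundamental_group_mult) (simp_all add: \<gamma> \<delta>)
  moreover have "pathin T (path_join \<delta> \<gamma>)" by (rule pathin_path_join) (simp_all add: \<gamma> \<delta>)
  moreover have "path_join \<delta> \<gamma> 0 = p" "path_join \<delta> \<gamma> 1 = p" using \<gamma> \<delta> by (simp_all add: path_join_def)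
  ultimately show ?thesis unfolding carrier_fundamental_group by blast
qed

lemma pathin_top_of_set: "pathin (top_of_set S) \<gamma> \<longleftrightarrow> path \<gamma> \<and> path_image \<gamma> \<subseteq> S"
  by (auto simp: pathin_canon_iff path_image_def)

section \<open>Monodromy of the pure braid group\<close>

context local_system
begin

lemma pure_monodromy_class:
  assumes "path \<gamma>" "path_image \<gamma> \<subseteq> X"
  shows "pure_monodromy \<omega> X (path_class (top_of_set X) \<gamma>) = to_laurent (transport \<omega> X \<gamma>)"
  unfolding pure_monodromy_def
proof (rule the_equality)
  have "\<gamma> \<in> path_class (top_of_set X) \<gamma>" by (rule path_class_self) (simp add: pathin_top_of_set assms)
  then show "\<exists>\<delta>\<in>path_class (top_of_set X) \<gamma>. to_laurent (transport \<omega> X \<gamma>) = to_laurent (transport \<omega> X \<delta>)"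
    by blast
  fix M assume "\<exists>\<delta>\<in>path_class (top_of_set X) \<gamma>. M = to_laurent (transport \<omega> X \<delta>)"
  then obtain \<delta> where "homotopic_paths X \<gamma> \<delta>" "M = to_laurent (transport \<omega> X \<delta>)"
    by (auto simp: path_class_def path_homotopic_top_of_set)
  then show "M = to_laurent (transport \<omega> X \<gamma>)" using transport_homotopic by simp
qed

lemma transport_GL:
  assumes "path \<gamma>" "path_image \<gamma> \<subseteq> X"
  shows "to_laurent (transport \<omega> X \<gamma>) \<in> carrier GL"
  by (rule to_laurent_GL(1)[OF transport_reverse[OF assms]])

lemma pure_monodromy_hom: "pure_monodromy \<omega> X \<in> hom (fundamental_group (top_of_set X) z) GL"
  unfolding hom_def
proof (intro CollectI conjI ballI funcsetI)
  fix c assume "c \<in> carrier (fundamental_group (top_of_set X) z)"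
  then obtain \<gamma> where \<gamma>: "c = path_class (top_of_set X) \<gamma>" "path \<gamma>" "path_image \<gamma> \<subseteq> X" "\<gamma> 0 = z" "\<gamma> 1 = z"
    unfolding carrier_fundamental_group pathin_top_of_set by blast
  show "pure_monodromy \<omega> X c \<in> carrier GL"
    unfolding \<gamma>(1) pure_monodromy_class[OF \<gamma>(2,3)] by (rule transport_GL[OF \<gamma>(2,3)])
  fix d assume "d \<in> carrier (fundamental_group (top_of_set X) z)"
  then obtain \<delta> where \<delta>: "d = path_class (top_of_set X) \<delta>" "path \<delta>" "path_image \<delta> \<subseteq> X" "\<delta> 0 = z" "\<delta> 1 = z"
    unfolding carrier_fundamental_group pathin_top_of_set by blast
  have j: "pathfinish \<delta> = pathstart \<gamma>" using \<gamma> \<delta> by (simp add: pathstart_def pathfinish_def)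
  have "mult (fundamental_group (top_of_set X) z) c d = path_class (top_of_set X) (\<delta> +++ \<gamma>)"
    unfolding \<gamma>(1) \<delta>(1) path_join_joinpaths[symmetric]
    by (rule fundamental_group_mult) (simp_all add: pathin_top_of_set \<gamma> \<delta>)
  moreover have "pure_monodromy \<omega> X (path_class (top_of_set X) (\<delta> +++ \<gamma>)) = to_laurent (transport \<omega> X (\<delta> +++ \<gamma>))"
    by (rule pure_monodromy_class) (use \<gamma> \<delta> j in \<open>simp_all add: subset_path_image_join\<close>)
  ultimately show "pure_monodromy \<omega> X (mult (fundamental_group (top_of_set X) z) c d) =
      mult GL (pure_monodromy \<omega> X c) (pure_monodromy \<omega> X d)"
    by (simp add: GL_simps \<gamma>(1) \<delta>(1) pure_monodromy_class[OF \<gamma>(2,3)] pure_monodromy_class[OF \<delta>(2,3)]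
        transport_join[OF \<delta>(2,3) \<gamma>(2,3) j] to_laurent_mult)
qed

lemma transport_conjugate:
  assumes \<beta>: "path \<beta>" "path_image \<beta> \<subseteq> X" and \<delta>: "path \<delta>" "path_image \<delta> \<subseteq> X" and \<beta>': "path \<beta>'" "path_image \<beta>' \<subseteq> X"
    and j: "pathfinish \<beta> = pathstart \<delta>" "pathfinish \<delta> = pathstart \<beta>'"
  shows "transport \<omega> X (\<beta> +++ (\<delta> +++ \<beta>')) = transport \<omega> X \<beta>' ** transport \<omega> X \<delta> ** transport \<omega> X \<beta>"
proof -
  have p: "path (\<delta> +++ \<beta>')" "path_image (\<delta> +++ \<beta>') \<subseteq> X" using assms by (simp_all add: subset_path_image_join)
  have "transport \<omega> X (\<beta> +++ (\<delta> +++ \<beta>')) = transport \<omega> X (\<delta> +++ \<beta>') ** transport \<omega> X \<beta>"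
    by (rule transport_join[OF \<beta> p]) (simp add: j)
  also have "transport \<omega> X (\<delta> +++ \<beta>') = transport \<omega> X \<beta>' ** transport \<omega> X \<delta>"
    by (rule transport_join[OF \<delta> \<beta>' j(2)])
  finally show ?thesis .
qed

end

section \<open>Monodromy of the braid group\<close>

locale equivariant_system = local_system \<omega> X + finite_linear_group W
  for \<omega> :: "('n::finite, 'm::finite) matrix_form" and X :: "(complex^'n) set" and W :: "(complex^'n^'n) set" +
  fixes \<sigma> :: "complex^'n^'n \<Rightarrow> complex^'m^'m"
  assumes X_stable: "w \<in> W \<Longrightarrow> x \<in> X \<Longrightarrow> w *v x \<in> X"
    and \<sigma>_mult: "v \<in> W \<Longrightarrow> w \<in> W \<Longrightarrow> \<sigma> (v ** w) = \<sigma> v ** \<sigma> w"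
    and \<sigma>_one: "\<sigma> (mat 1) = mat 1"
    and \<omega>_equivariant: "w \<in> W \<Longrightarrow> \<omega> (w *v x) (w *v y) = \<sigma> w ** \<omega> x y ** \<sigma> (matrix_inv w)"
begin

lemma \<sigma>_inv: "w \<in> W \<Longrightarrow> \<sigma> w ** \<sigma> (matrix_inv w) = mat 1" "w \<in> W \<Longrightarrow> \<sigma> (matrix_inv w) ** \<sigma> w = mat 1"
  using \<sigma>_mult inv_left inv_right inv_W \<sigma>_one by metis+

lemma transport_act:
  assumes w: "w \<in> W" and \<gamma>: "path \<gamma>" "path_image \<gamma> \<subseteq> X"
  shows "transport \<omega> X (\<lambda>t. w *v \<gamma> t) = const_series (\<sigma> w) ** transport \<omega> X \<gamma> ** const_series (\<sigma> (matrix_inv w))"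
  by (rule transport_equivariant[OF local_system_axioms inv_right[OF w] inv_left[OF w] \<sigma>_inv[OF w] \<omega>_equivariant[OF w] X_stable[OF w] \<gamma>])

lemma path_act:
  assumes w: "w \<in> W" and \<gamma>: "path \<gamma>" "path_image \<gamma> \<subseteq> X"
  shows "path (\<lambda>t. w *v \<gamma> t)" "path_image (\<lambda>t. w *v \<gamma> t) \<subseteq> X"
  using \<gamma> X_stable[OF w]
  by (auto simp: path_def path_image_def intro!: continuous_on_compose2[OF linear_continuous_on[OF matrix_vector_mul_bounded_linear]])

lemma loop_lift:
  assumes Y: "\<And>w y. w \<in> W \<Longrightarrow> y \<in> Y \<Longrightarrow> w *v y \<in> Y" and z: "z \<in> Y"
    and \<gamma>: "pathin (orbit_space W Y) \<gamma>" "\<gamma> 0 = orbit W z" "\<gamma> 1 = orbit W z"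
  obtains w \<delta> where "w \<in> W" "path \<delta>" "path_image \<delta> \<subseteq> Y" "\<delta> 0 = z" "\<delta> 1 = matrix_inv w *v z"
    "\<And>t. t \<in> {0..1} \<Longrightarrow> \<gamma> t = orbit W (\<delta> t)"
proof -
  obtain \<delta> where \<delta>: "path \<delta>" "path_image \<delta> \<subseteq> Y" "\<delta> 0 = z" "\<And>t. t \<in> {0..1} \<Longrightarrow> \<gamma> t = orbit W (\<delta> t)"
    by (rule path_lift[OF Y \<gamma>(1,2) z]) (assumption, assumption, rule that)
  have "orbit W (\<delta> 1) = orbit W z" using \<delta>(4)[of 1] \<gamma>(3) by simp
  then have "\<delta> 1 \<in> orbit W z" using orbit_self[of "\<delta> 1"] by simp
  then obtain v where v: "v \<in> W" "\<delta> 1 = v *v z" unfolding orbit_def by blast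
  show thesis
    \<comment> \<open>The lift ends at \<open>v *v z\<close>; passing to the inverse of
      \<open>v\<close> expresses the end point in the convention of
      \<open>braid_monodromy\<close>.\<close>
    by (rule that[OF inv_W[OF v(1)] \<delta>(1,2,3) _ \<delta>(4)]) (simp_all add: v inv_inv)
qed

lemma braid_monodromy_class:
  assumes "braid_monodromy W \<sigma> \<omega> X z R" "w \<in> W" "path \<gamma>" "path_image \<gamma> \<subseteq> X" "\<gamma> 0 = z" "\<gamma> 1 = matrix_inv w *v z"
  shows "R (path_class (orbit_space W X) (orbit W \<circ> \<gamma>)) = to_laurent (const_series (\<sigma> w) ** transport \<omega> X \<gamma>)"
  using assms unfolding braid_monodromy_def
  by (simp add: pathstart_def pathfinish_def const_laurent_series to_laurent_mult)

text \<open>If the two factors lift to \<gamma> (with \<open>v\<close>) and \<delta> (with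
  \<open>w\<close>), their product lifts to \<delta> followed by the translate of \<gamma> by
  \<open>w^-1\<close>, which ends at \<open>(v w)^-1 z\<close>. Equivariance of transport turns
  \<open>\<sigma> w\<close> times the transport of the translate into the transport of \<gamma>
  times \<open>\<sigma> w\<close>, and so separates the two factors.\<close>

lemma braid_monodromy_hom:
  assumes R: "braid_monodromy W \<sigma> \<omega> X z R" and z: "z \<in> X"
  shows "R \<in> hom (fundamental_group (orbit_space W X) (orbit W z)) GL"
  unfolding hom_def
proof (intro CollectI conjI ballI funcsetI)
  let ?T = "orbit_space W X"
  have lift: "\<exists>w \<gamma>. w \<in> W \<and> path \<gamma> \<and> path_image \<gamma> \<subseteq> X \<and> \<gamma> 0 = z \<and> \<gamma> 1 = matrix_inv w *v z \<and>
      c = path_class ?T (orbit W \<circ> \<gamma>)" if c: "c \<in> carrier (fundamental_group ?T (orbit W z))" for c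
  proof -
    obtain \<gamma> where \<gamma>: "c = path_class ?T \<gamma>" "pathin ?T \<gamma>" "\<gamma> 0 = orbit W z" "\<gamma> 1 = orbit W z"
      using c unfolding carrier_fundamental_group by blast
    obtain w \<delta> where \<delta>: "w \<in> W" "path \<delta>" "path_image \<delta> \<subseteq> X" "\<delta> 0 = z" "\<delta> 1 = matrix_inv w *v z"
      "\<And>t. t \<in> {0..1} \<Longrightarrow> \<gamma> t = orbit W (\<delta> t)" by (rule loop_lift[OF X_stable z \<gamma>(2-4)]) (assumption, assumption, rule that)
    have "path_homotopic ?T \<gamma> (orbit W \<circ> \<delta>)" by (rule path_homotopic_cong[OF \<gamma>(2)]) (simp add: \<delta>(6))
    from path_class_eq[OF this] show ?thesis using \<gamma>(1) \<delta>(1-5) by blast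
  qed
  fix c assume "c \<in> carrier (fundamental_group ?T (orbit W z))"
  from lift[OF this] obtain v \<gamma> where \<gamma>: "v \<in> W" "path \<gamma>" "path_image \<gamma> \<subseteq> X" "\<gamma> 0 = z" "\<gamma> 1 = matrix_inv v *v z"
    and c: "c = path_class ?T (orbit W \<circ> \<gamma>)" by (elim exE conjE)
  have Rc: "R c = to_laurent (const_series (\<sigma> v) ** transport \<omega> X \<gamma>)"
    unfolding c by (rule braid_monodromy_class[OF R \<gamma>])
  have "const_series (\<sigma> v) ** const_series (\<sigma> (matrix_inv v)) = mat 1"
    by (simp add: const_series_mult[symmetric] \<sigma>_inv[OF \<gamma>(1)] const_series_one)
  from to_laurent_GL(1)[OF this] transport_GL[OF \<gamma>(2,3)]
  show "R c \<in> carrier GL" unfolding Rc to_laurent_mult GL_simps by (simp add: invertible_mult)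
  fix d assume "d \<in> carrier (fundamental_group ?T (orbit W z))"
  from lift[OF this] obtain w \<delta> where \<delta>: "w \<in> W" "path \<delta>" "path_image \<delta> \<subseteq> X" "\<delta> 0 = z" "\<delta> 1 = matrix_inv w *v z"
    and d: "d = path_class ?T (orbit W \<circ> \<delta>)" by (elim exE conjE)
  have Rd: "R d = to_laurent (const_series (\<sigma> w) ** transport \<omega> X \<delta>)"
    unfolding d by (rule braid_monodromy_class[OF R \<delta>])
  let ?w = "matrix_inv w"
  define \<gamma>' where "\<gamma>' t = ?w *v \<gamma> t" for t
  have \<gamma>': "path \<gamma>'" "path_image \<gamma>' \<subseteq> X"
    unfolding \<gamma>'_def by (rule path_act[OF inv_W[OF \<delta>(1)] \<gamma>(2,3)])+
  have j: "pathfinish \<delta> = pathstart \<gamma>'" using \<delta>(5) \<gamma>(4) by (simp add: pathfinish_def pathstart_def \<gamma>'_def)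
  have inv_mult: "matrix_inv (v ** w) = ?w ** matrix_inv v"
  proof (rule matrix_inverse_unique[of _ "v ** w"])
    show "matrix_inv (v ** w) ** (v ** w) = mat 1" by (rule inv_left[OF mult_W[OF \<gamma>(1) \<delta>(1)]])
    have "v ** w ** (?w ** matrix_inv v) = v ** (w ** ?w) ** matrix_inv v" by (simp only: matrix_mul_assoc)
    then show "v ** w ** (?w ** matrix_inv v) = mat 1" by (simp add: inv_right[OF \<delta>(1)] inv_right[OF \<gamma>(1)])
  qed
  have pw: "path_join (orbit W \<circ> \<delta>) (orbit W \<circ> \<gamma>) = orbit W \<circ> (\<delta> +++ \<gamma>')"
    using orbit_act[OF inv_W[OF \<delta>(1)]] by (auto simp: fun_eq_iff path_join_def joinpaths_def \<gamma>'_def)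
  have "mult (fundamental_group ?T (orbit W z)) c d = path_class ?T (orbit W \<circ> (\<delta> +++ \<gamma>'))"
    unfolding c d pw[symmetric]
  proof (rule fundamental_group_mult)
    show "pathin ?T (orbit W \<circ> \<gamma>)" "pathin ?T (orbit W \<circ> \<delta>)" by (intro pathin_orbit \<gamma> \<delta>)+
    show "(orbit W \<circ> \<gamma>) 0 = (orbit W \<circ> \<delta>) 1"
      by (simp add: \<gamma>(4) \<delta>(5) orbit_act[OF inv_W[OF \<delta>(1)]])
  qed
  also have "R \<dots> = to_laurent (const_series (\<sigma> (v ** w)) ** transport \<omega> X (\<delta> +++ \<gamma>'))"
  proof (rule braid_monodromy_class[OF R mult_W[OF \<gamma>(1) \<delta>(1)]])
    show "path (\<delta> +++ \<gamma>')" "path_image (\<delta> +++ \<gamma>') \<subseteq> X" using \<gamma>' \<delta> j by (simp_all add: subset_path_image_join)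
    show "(\<delta> +++ \<gamma>') 0 = z" using \<delta>(4) by (simp add: joinpaths_def)
    show "(\<delta> +++ \<gamma>') 1 = matrix_inv (v ** w) *v z"
      by (simp add: joinpaths_def \<gamma>'_def \<gamma>(5) inv_mult matrix_vector_mul_assoc)
  qed
  also have "const_series (\<sigma> (v ** w)) ** transport \<omega> X (\<delta> +++ \<gamma>') =
      (const_series (\<sigma> v) ** transport \<omega> X \<gamma>) ** (const_series (\<sigma> w) ** transport \<omega> X \<delta>)"
  proof -
    have 1: "transport \<omega> X \<gamma>' = const_series (\<sigma> ?w) ** transport \<omega> X \<gamma> ** const_series (\<sigma> w)"
      using transport_act[OF inv_W[OF \<delta>(1)] \<gamma>(2,3)] unfolding \<gamma>'_def inv_inv[OF \<delta>(1)] .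
    have 2: "const_series (\<sigma> w) ** const_series (\<sigma> ?w) = mat 1"
      by (simp add: const_series_mult[symmetric] \<sigma>_inv[OF \<delta>(1)] const_series_one)
    have "const_series (\<sigma> (v ** w)) ** transport \<omega> X (\<delta> +++ \<gamma>') =
       const_series (\<sigma> v) ** (const_series (\<sigma> w) ** const_series (\<sigma> ?w)) ** transport \<omega> X \<gamma> ** const_series (\<sigma> w) ** transport \<omega> X \<delta>"
      unfolding \<sigma>_mult[OF \<gamma>(1) \<delta>(1)] const_series_mult transport_join[OF \<delta>(2,3) \<gamma>' j] 1
      by (simp only: matrix_mul_assoc)
    then show ?thesis by (simp add: 2 matrix_mul_assoc)
  qed
  finally show "R (mult (fundamental_group ?T (orbit W z)) c d) = mult GL (R c) (R d)"
    by (simp add: GL_simps Rc Rd to_laurent_mult)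
qed

text \<open>
  The loop lifts to \<open>\<beta>\<close>, then \<open>\<delta>\<close>, then the translate of the reverse of \<open>\<beta>\<close> ending at \<open>w\<^sup>-\<^sup>1 z\<close>.
\<close>

lemma braid_monodromy_conjugate:
  assumes R: "braid_monodromy W \<sigma> \<omega> X z R" and w: "w \<in> W"
    and \<beta>: "path \<beta>" "path_image \<beta> \<subseteq> X" "\<beta> 0 = z" "\<beta> 1 = x" and \<delta>: "path \<delta>" "path_image \<delta> \<subseteq> X" "\<delta> 0 = x" "\<delta> 1 = matrix_inv w *v x"
  shows "R (path_class (orbit_space W X)
      (path_join (orbit W \<circ> \<beta>) (path_join (orbit W \<circ> \<delta>) (path_reverse (orbit W \<circ> \<beta>))))) =
    to_laurent (transport \<omega> X (reversepath \<beta>) ** (const_series (\<sigma> w) ** transport \<omega> X \<delta>) ** transport \<omega> X \<beta>)"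
proof -
  let ?w = "matrix_inv w"
  define \<beta>' where "\<beta>' t = ?w *v reversepath \<beta> t" for t
  have r: "path (reversepath \<beta>)" "path_image (reversepath \<beta>) \<subseteq> X" using \<beta> by simp_all
  have \<beta>': "path \<beta>'" "path_image \<beta>' \<subseteq> X"
    unfolding \<beta>'_def by (rule path_act[OF inv_W[OF w] r])+
  have j: "pathfinish \<beta> = pathstart \<delta>" "pathfinish \<delta> = pathstart \<beta>'"
    using \<beta> \<delta> by (simp_all add: pathfinish_def pathstart_def \<beta>'_def reversepath_def)
  have pw: "path_join (orbit W \<circ> \<beta>) (path_join (orbit W \<circ> \<delta>) (path_reverse (orbit W \<circ> \<beta>))) = orbit W \<circ> (\<beta> +++ (\<delta> +++ \<beta>'))"
    using orbit_act[OF inv_W[OF w]]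
    by (auto simp: fun_eq_iff path_join_def path_reverse_def joinpaths_def \<beta>'_def reversepath_def)
  have "R (path_class (orbit_space W X) (orbit W \<circ> (\<beta> +++ (\<delta> +++ \<beta>')))) =
      to_laurent (const_series (\<sigma> w) ** transport \<omega> X (\<beta> +++ (\<delta> +++ \<beta>')))"
  proof (rule braid_monodromy_class[OF R w])
    show "path (\<beta> +++ (\<delta> +++ \<beta>'))" "path_image (\<beta> +++ (\<delta> +++ \<beta>')) \<subseteq> X"
      using \<beta> \<delta> \<beta>' j by (simp_all add: subset_path_image_join)
    show "(\<beta> +++ (\<delta> +++ \<beta>')) 0 = z" using \<beta>(3) by (simp add: joinpaths_def)
    show "(\<beta> +++ (\<delta> +++ \<beta>')) 1 = ?w *v z" using \<beta>(3) by (simp add: joinpaths_def \<beta>'_def reversepath_def)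
  qed
  also have "const_series (\<sigma> w) ** transport \<omega> X (\<beta> +++ (\<delta> +++ \<beta>')) =
      transport \<omega> X (reversepath \<beta>) ** (const_series (\<sigma> w) ** transport \<omega> X \<delta>) ** transport \<omega> X \<beta>"
  proof -
    have 1: "transport \<omega> X \<beta>' = const_series (\<sigma> ?w) ** transport \<omega> X (reversepath \<beta>) ** const_series (\<sigma> w)"
      using transport_act[OF inv_W[OF w] r] unfolding \<beta>'_def inv_inv[OF w] .
    have 2: "const_series (\<sigma> w) ** const_series (\<sigma> ?w) = mat 1"
      by (simp add: const_series_mult[symmetric] \<sigma>_inv[OF w] const_series_one)
    have "const_series (\<sigma> w) ** transport \<omega> X (\<beta> +++ (\<delta> +++ \<beta>')) =
      (const_series (\<sigma> w) ** const_series (\<sigma> ?w)) ** transport \<omega> X (reversepath \<beta>) ** (const_series (\<sigma> w) ** transport \<omega> X \<delta>) ** transport \<omega> X \<beta>"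
      unfolding transport_conjugate[OF \<beta>(1,2) \<delta>(1,2) \<beta>' j] 1 by (simp only: matrix_mul_assoc)
    then show ?thesis by (simp add: 2)
  qed
  finally show ?thesis unfolding pw .
qed

end

section \<open>Parabolic subgroups\<close>

text \<open>The free contraction of \<gamma> by the factor \<open>a\<close> moves the end points. To
  keep them fixed, the new path first runs inwards along the ray of \<open>\<gamma> 0\<close>, then
  along the contracted path, then outwards along the ray of \<open>\<gamma> 1\<close>.\<close>

lemma radial_deformation:
  fixes \<gamma> :: "real \<Rightarrow> 'a::real_normed_vector"
  assumes \<gamma>: "path \<gamma>" "path_image \<gamma> \<subseteq> Y" and ends: "\<gamma> 0 \<in> \<Omega>" "\<gamma> 1 \<in> \<Omega>"
    and cone: "\<And>x s. x \<in> Y \<Longrightarrow> 0 < s \<Longrightarrow> s \<le> 1 \<Longrightarrow> c + s *\<^sub>R (x - c) \<in> Y"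
    and star: "\<And>x s. x \<in> \<Omega> \<Longrightarrow> 0 < s \<Longrightarrow> s \<le> 1 \<Longrightarrow> c + s *\<^sub>R (x - c) \<in> \<Omega>"
    and a: "0 < a" "a \<le> 1" "\<And>x. x \<in> path_image \<gamma> \<Longrightarrow> c + a *\<^sub>R (x - c) \<in> \<Omega>"
  obtains \<delta> where "path \<delta>" "path_image \<delta> \<subseteq> Y \<inter> \<Omega>" "homotopic_paths Y \<gamma> \<delta>"
proof -
  define q where "q = (\<lambda>y :: real \<times> real. c + snd y *\<^sub>R (\<gamma> (fst y) - c))"
  define Q where "Q = {0..1::real} \<times> {a..1}"
  have conv: "convex Q" unfolding Q_def by (intro convex_Times) simp_all
  have contq: "continuous_on Q q"
    unfolding q_def Q_def
    by (intro continuous_intros continuous_on_compose2[OF \<gamma>(1)[unfolded path_def]]) auto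
  have qY: "q y \<in> Y" if y: "y \<in> Q" for y
  proof -
    have "\<gamma> (fst y) \<in> Y" using \<gamma>(2) y unfolding path_image_def Q_def by auto
    then show ?thesis unfolding q_def by (rule cone) (use y a in \<open>auto simp: Q_def\<close>)
  qed
  define l where "l = linepath (0, 1) (1 :: real, 1 :: real)"
  \<comment> \<open>Left, bottom and right side of the parameter rectangle \<open>Q\<close>; its top
    side \<open>l\<close> corresponds to \<gamma>, and convexity of \<open>Q\<close> joins both
    routes.\<close>
  define r1 where "r1 = linepath (0, 1) (0 :: real, a)"
  define r2 where "r2 = linepath (0, a) (1 :: real, a)"
  define r3 where "r3 = linepath (1, a) (1 :: real, 1 :: real)"
  define r where "r = r1 +++ (r2 +++ r3)"
  have seg: "path_image (linepath x y) \<subseteq> C" if "convex C" "x \<in> C" "y \<in> C" for x y :: "real \<times> real" and C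
    unfolding path_image_linepath by (rule closed_segment_subset[OF that(2,3,1)])
  have corners: "(0, 1) \<in> Q" "(0, a) \<in> Q" "(1, a) \<in> Q" "(1, 1) \<in> Q" using a by (simp_all add: Q_def)
  have rQ: "path_image r \<subseteq> Q"
    unfolding r_def r1_def r2_def r3_def by (intro subset_path_image_join seg[OF conv] corners)
  have lQ: "path_image l \<subseteq> Q" unfolding l_def by (intro seg[OF conv] corners)
  have hom: "homotopic_paths Q l r"
  proof (rule homotopic_paths_linear)
    show "path l" by (simp add: l_def)
    show "path r" unfolding r_def r1_def r2_def r3_def by simp
    show "pathstart r = pathstart l" "pathfinish r = pathfinish l"
      unfolding r_def r1_def r2_def r3_def l_def by simp_all
    fix u :: real assume u: "u \<in> {0..1}"
    have "l u \<in> Q" "r u \<in> Q" using lQ rQ u unfolding path_image_def by blast+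
    then show "closed_segment (l u) (r u) \<subseteq> Q" using conv by (rule closed_segment_subset)
  qed
  have "homotopic_paths Y (q \<circ> l) (q \<circ> r)"
    by (rule homotopic_paths_continuous_image[OF hom contq]) (use qY in blast)
  moreover have "q \<circ> l = \<gamma>" by (rule ext) (simp add: q_def l_def linepath_def)
  ultimately have h: "homotopic_paths Y \<gamma> (q \<circ> r)" by simp
  have p1: "path_image r1 \<subseteq> {0} \<times> {a..1}" unfolding r1_def by (rule seg[OF convex_Times]) (use a in auto)
  have p2: "path_image r2 \<subseteq> {0..1} \<times> {a}" unfolding r2_def by (rule seg[OF convex_Times]) (use a in auto)
  have p3: "path_image r3 \<subseteq> {1} \<times> {a..1}" unfolding r3_def by (rule seg[OF convex_Times]) (use a in auto)
  have "q y \<in> \<Omega>" if "y \<in> path_image r" for y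
  proof -
    have "path_image r \<subseteq> path_image r1 \<union> (path_image r2 \<union> path_image r3)"
      unfolding r_def by (rule order_trans[OF path_image_join_subset Un_mono[OF order_refl path_image_join_subset]])
    from subsetD[OF this that] consider "y \<in> path_image r1" | "y \<in> path_image r2" | "y \<in> path_image r3"
      by (elim UnE)
    then show ?thesis
    proof cases
      case 1
      then have y: "fst y = 0" "a \<le> snd y" "snd y \<le> 1" using subsetD[OF p1] by (simp_all add: mem_Times_iff)
      show ?thesis unfolding q_def y(1) by (rule star[OF ends(1) less_le_trans[OF a(1) y(2)] y(3)])
    next
      case 2
      then have y: "fst y \<in> {0..1}" "snd y = a" using subsetD[OF p2] by (simp_all add: mem_Times_iff)
      have "\<gamma> (fst y) \<in> path_image \<gamma>" unfolding path_image_def using y(1) by (rule imageI)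
      then show ?thesis unfolding q_def y(2) by (rule a(3))
    next
      case 3
      then have y: "fst y = 1" "a \<le> snd y" "snd y \<le> 1" using subsetD[OF p3] by (simp_all add: mem_Times_iff)
      show ?thesis unfolding q_def y(1) by (rule star[OF ends(2) less_le_trans[OF a(1) y(2)] y(3)])
    qed
  qed
  then have "path_image (q \<circ> r) \<subseteq> Y \<inter> \<Omega>"
    unfolding path_image_compose using qY rQ by blast
  then show thesis using that[of "q \<circ> r"] homotopic_paths_imp_path[OF h] h by blast
qed

lemma path_class_rebase_eq:
  assumes "pathin T b" "path_homotopic T g g'" "g 0 = b 1" "g 1 = b 1"
  shows "path_class T (path_join b (path_join g (path_reverse b))) =
    path_class T (path_join b (path_join g' (path_reverse b)))"
proof -
  have g: "pathin T g" "pathin T g'" "g' 0 = b 1" "g' 1 = b 1"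
    using path_homotopic_pathin[OF assms(2)] path_homotopic_endpoints[OF assms(2)] assms(3,4) by simp_all
  show ?thesis
    using pi1_rebase_class[OF assms(1) g(1) assms(3,4)] pi1_rebase_class[OF assms(1) g(2-4)]
      path_class_eq[OF assms(2)] by simp
qed

text \<open>The common pattern of the embeddings of \<open>P\<^sub>0\<close> in \<open>P\<close> and of \<open>B\<^sub>0\<close> in \<open>B\<close>.\<close>

lemma embedding_class:
  assumes k: "continuous_map Y U k" and f: "continuous_map Y T f"
    and a: "pathin U a" "a 1 = k p" and b: "pathin T b" "b 1 = f p"
    and \<gamma>: "pathin U \<gamma>" "\<gamma> 0 = a 0" "\<gamma> 1 = a 0"
    and surj: "\<And>g. pathin U g \<Longrightarrow> g 0 = k p \<Longrightarrow> g 1 = k p \<Longrightarrow>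
      \<exists>\<delta>. pathin Y \<delta> \<and> \<delta> 0 = p \<and> \<delta> 1 = p \<and> path_homotopic U g (k \<circ> \<delta>)"
  obtains \<delta> where "pathin Y \<delta>" "\<delta> 0 = p" "\<delta> 1 = p"
    "path_class U \<gamma> = path_class U (path_join a (path_join (k \<circ> \<delta>) (path_reverse a)))"
    "(pi1_rebase T b \<circ> pi1_map T f \<circ> inv_into (carrier (fundamental_group Y p)) (pi1_map U k) \<circ>
        pi1_rebase U (path_reverse a)) (path_class U \<gamma>) =
      path_class T (path_join b (path_join (f \<circ> \<delta>) (path_reverse b)))"
proof -
  let ?G = "fundamental_group Y p"
  define g where "g = path_join (path_reverse a) (path_join \<gamma> a)"
  have g: "pathin U g" "g 0 = k p" "g 1 = k p"
    unfolding g_def using a \<gamma>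
    by (auto intro!: pathin_path_join pathin_path_reverse simp: path_reverse_def path_join_def)
  have rebase_g: "pi1_rebase U (path_reverse a) (path_class U \<gamma>) = path_class U g"
    unfolding g_def using pi1_rebase_class[OF pathin_path_reverse[OF a(1)] \<gamma>(1)] \<gamma>(2,3)
    by (simp add: path_reverse_def[of a 1])
  obtain \<delta>0 where \<delta>0: "pathin Y \<delta>0" "\<delta>0 0 = p" "\<delta>0 1 = p" "path_homotopic U g (k \<circ> \<delta>0)"
    using surj[OF g] by (elim exE conjE)
  have "path_class Y \<delta>0 \<in> carrier ?G"
    unfolding carrier_fundamental_group using \<delta>0(1-3) by blast
  moreover have "path_class U g = pi1_map U k (path_class Y \<delta>0)"
    using pi1_map_class[OF k \<delta>0(1)] path_class_eq[OF \<delta>0(4)] by simp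
  ultimately have img: "path_class U g \<in> pi1_map U k ` carrier ?G" by (rule rev_image_eqI)
  \<comment> \<open>\<open>surj\<close> places the class of \<open>g\<close> in the image, so
    \<open>inv_into\<close> returns a genuine preimage; a representative of it serves as the loop
    \<delta> in both conclusions.\<close>
  define c where "c = inv_into (carrier ?G) (pi1_map U k) (path_class U g)"
  have c: "c \<in> carrier ?G" "pi1_map U k c = path_class U g"
    unfolding c_def by (rule inv_into_into[OF img], rule f_inv_into_f[OF img])
  obtain \<delta> where \<delta>: "c = path_class Y \<delta>" "pathin Y \<delta>" "\<delta> 0 = p" "\<delta> 1 = p"
    using c(1) unfolding carrier_fundamental_group by (elim exE conjE)
  have pin: "pathin U (k \<circ> \<delta>)" "pathin T (f \<circ> \<delta>)"
    by (rule pathin_compose[OF \<delta>(2) k], rule pathin_compose[OF \<delta>(2) f])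
  have "path_class U g = path_class U (k \<circ> \<delta>)"
    using c(2) pi1_map_class[OF k \<delta>(2)] by (simp add: \<delta>(1))
  then have hom: "path_homotopic U g (k \<circ> \<delta>)" using path_class_eq_iff[OF pin(1)] by simp
  have "path_class U \<gamma> = path_class U (path_join a (path_join g (path_reverse a)))"
    unfolding g_def by (rule path_class_eq[OF path_homotopic_rebase[OF a(1) \<gamma>]])
  also have "\<dots> = path_class U (path_join a (path_join (k \<circ> \<delta>) (path_reverse a)))"
    by (rule path_class_rebase_eq[OF a(1) hom]) (simp_all add: g a)
  finally have 1: "path_class U \<gamma> = path_class U (path_join a (path_join (k \<circ> \<delta>) (path_reverse a)))" .
  have "pi1_map T f c = path_class T (f \<circ> \<delta>)"
    unfolding \<delta>(1) by (rule pi1_map_class[OF f \<delta>(2)])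
  moreover have "pi1_rebase T b (path_class T (f \<circ> \<delta>)) =
      path_class T (path_join b (path_join (f \<circ> \<delta>) (path_reverse b)))"
    by (rule pi1_rebase_class[OF b(1) pin(2)]) (simp_all add: \<delta> b)
  ultimately show thesis
    by (intro that[OF \<delta>(2-4) 1]) (simp add: rebase_g c_def[symmetric])
qed

text \<open>The matrix algebra common to the pure and the braid case. In the application
  \<open>a\<close> and \<open>b\<close> are the transports along \<beta> and \<beta>0,
  \<open>a'\<close> and \<open>b'\<close> their inverses, \<open>P\<close> the gauge at
  \<open>x2\<close> with inverse \<open>Q\<close>, and \<open>E\<close>, \<open>F\<close> the two
  monodromies of one loop seen from \<open>x2\<close>.\<close>

lemma conjugation_transfer:
  fixes a a' b b' P Q E F :: "complex fps^'m^'m"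
  assumes a: "a ** a' = mat 1" and b: "b' ** b = mat 1" "b ** b' = mat 1"
    and P: "Q ** P = mat 1" "E ** P = P ** F"
  shows "to_laurent (b' ** Q ** a) \<in> carrier GL"
    and "to_laurent (b' ** Q ** a) ** to_laurent (a' ** E ** a) = to_laurent (b' ** F ** b) ** to_laurent (b' ** Q ** a)"
proof -
  have G: "to_laurent a \<in> carrier GL" "to_laurent b' \<in> carrier GL" "to_laurent Q \<in> carrier GL"
    using to_laurent_GL(1)[OF a] to_laurent_GL(1)[OF b(1)] to_laurent_GL(1)[OF P(1)] .
  then show "to_laurent (b' ** Q ** a) \<in> carrier GL"
    unfolding to_laurent_mult GL_simps by (simp add: invertible_mult)
  have QP: "to_laurent Q ** to_laurent P = mat 1"
    unfolding to_laurent_mult[symmetric] P(1) by (rule to_laurent_one)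
  then have PQ: "to_laurent P ** to_laurent Q = mat 1" by (simp only: matrix_left_right_inverse)
  have EP: "to_laurent E ** to_laurent P = to_laurent P ** to_laurent F"
    using arg_cong[OF P(2), of to_laurent] by (simp only: to_laurent_mult)
  have aa: "to_laurent a ** to_laurent a' = mat 1" "to_laurent b ** to_laurent b' = mat 1"
    unfolding to_laurent_mult[symmetric] a b by (rule to_laurent_one)+
  have "to_laurent Q ** to_laurent E = to_laurent Q ** (to_laurent E ** to_laurent P) ** to_laurent Q"
    by (simp only: matrix_mul_assoc[symmetric] PQ matrix_mul_rid)
  also have "\<dots> = (to_laurent Q ** to_laurent P) ** to_laurent F ** to_laurent Q"
    unfolding EP by (simp only: matrix_mul_assoc)
  finally have QE: "to_laurent Q ** to_laurent E = to_laurent F ** to_laurent Q" by (simp add: QP)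
  have "to_laurent (b' ** Q ** a) ** to_laurent (a' ** E ** a) =
      to_laurent b' ** to_laurent Q ** (to_laurent a ** to_laurent a') ** to_laurent E ** to_laurent a"
    by (simp only: to_laurent_mult matrix_mul_assoc)
  also have "\<dots> = to_laurent b' ** (to_laurent Q ** to_laurent E) ** to_laurent a"
    by (simp only: aa matrix_mul_rid matrix_mul_assoc)
  also have "\<dots> = to_laurent b' ** to_laurent F ** (to_laurent b ** to_laurent b') ** to_laurent Q ** to_laurent a"
    unfolding QE aa by (simp only: matrix_mul_rid matrix_mul_assoc)
  also have "\<dots> = to_laurent (b' ** F ** b) ** to_laurent (b' ** Q ** a)"
    by (simp only: to_laurent_mult matrix_mul_assoc)
  finally show "to_laurent (b' ** Q ** a) ** to_laurent (a' ** E ** a) = to_laurent (b' ** F ** b) ** to_laurent (b' ** Q ** a)" .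
qed

text \<open>The Hermitian ball is represented by three properties: off the hyperplanes through
  \<open>x1\<close> it lies in the cone domain, it is star-shaped about \<open>x1\<close>, and
  contraction brings every compact set into it.\<close>

locale parabolic = flat_system S t
  for S :: "(complex^'n) set set" and t :: "(complex^'n) set \<Rightarrow> complex^'m^'m" +
  fixes x1 x2 z z0 :: "complex^'n" and \<Omega> :: "(complex^'n) set" and \<beta> \<beta>0 :: "real \<Rightarrow> complex^'n"
  assumes \<Omega>_cone: "\<Omega> \<inter> - \<Union>{H \<in> S. linear_form_of H x1 = 0} \<subseteq> cone_domain S x1"
    and star: "x \<in> \<Omega> \<Longrightarrow> 0 < s \<Longrightarrow> s \<le> 1 \<Longrightarrow> x1 + s *\<^sub>R (x - x1) \<in> \<Omega>"
    and absorbing: "compact C \<Longrightarrow> \<exists>s. 0 < s \<and> s \<le> 1 \<and> (\<forall>x\<in>C. x1 + s *\<^sub>R (x - x1) \<in> \<Omega>)"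
    and x2: "x2 \<in> \<Omega>" "x2 \<in> - \<Union>S"
    and \<beta>: "path \<beta>" "path_image \<beta> \<subseteq> - \<Union>S" "\<beta> 0 = z" "\<beta> 1 = x2"
    and \<beta>0: "path \<beta>0" "path_image \<beta>0 \<subseteq> - \<Union>{H \<in> S. linear_form_of H x1 = 0}" "\<beta>0 0 = z0" "\<beta>0 1 = x2"
begin

abbreviation "X \<equiv> - \<Union>S"
abbreviation "X0 \<equiv> - \<Union>(center_hyperplanes x1)"
abbreviation "\<omega> \<equiv> log_form S t"
abbreviation "\<omega>0 \<equiv> log_form (center_hyperplanes x1) t"
abbreviation "T \<equiv> transport \<omega> X"
abbreviation "T0 \<equiv> transport \<omega>0 X0"
abbreviation "P \<equiv> gauge_series S t x1"

sublocale L: local_system \<omega> X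
  by (rule local_system_complement)

sublocale L0: local_system \<omega>0 X0
  by (rule flat_system.local_system_complement[OF flat_system_center])

lemma x2_X0: "x2 \<in> X0"
  using x2(2) by blast

lemma \<Omega>_X: "X0 \<inter> \<Omega> \<subseteq> X \<inter> \<Omega>"
  using \<Omega>_cone cone_domain_avoids by blast

lemma X_\<Omega>_cone: "X \<inter> \<Omega> \<subseteq> cone_domain S x1"
  using \<Omega>_cone by blast

lemma X0_cone:
  assumes x: "x \<in> X0" and s: "0 < s"
  shows "x1 + s *\<^sub>R (x - x1) \<in> X0"
proof (rule ccontr)
  assume "x1 + s *\<^sub>R (x - x1) \<notin> X0"
  then obtain H where H: "H \<in> S" "linear_form_of H x1 = 0" "x1 + s *\<^sub>R (x - x1) \<in> H" by blast
  then have "linear_form_of H (x1 + s *\<^sub>R (x - x1)) = 0" using kernel by blast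
  then have "linear_form_of H x = 0" using s H(2) by (simp add: radial_form[OF H(1)])
  then have "x \<in> H" using kernel[OF H(1)] by blast
  then show False using x H by blast
qed

lemma shrink:
  assumes \<gamma>: "path \<gamma>" "path_image \<gamma> \<subseteq> X0" and ends: "\<gamma> 0 \<in> \<Omega>" "\<gamma> 1 \<in> \<Omega>"
  obtains \<delta> where "path \<delta>" "path_image \<delta> \<subseteq> X \<inter> \<Omega>" "homotopic_paths X0 \<gamma> \<delta>"
proof -
  obtain a where a: "0 < a" "a \<le> 1" "\<forall>x\<in>path_image \<gamma>. x1 + a *\<^sub>R (x - x1) \<in> \<Omega>"
    using absorbing[OF compact_path_image[OF \<gamma>(1)]] by (elim exE conjE)
  obtain \<delta> where \<delta>: "path \<delta>" "path_image \<delta> \<subseteq> X0 \<inter> \<Omega>" "homotopic_paths X0 \<gamma> \<delta>"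
    by (rule radial_deformation[OF \<gamma> ends X0_cone star a(1,2) bspec[OF a(3)]])
      (assumption, assumption, assumption, assumption, assumption, assumption, rule that)
  show thesis by (rule that[OF \<delta>(1) order_trans[OF \<delta>(2) \<Omega>_X] \<delta>(3)])
qed

lemma transport_\<Omega>:
  assumes \<delta>: "path \<delta>" "path_image \<delta> \<subseteq> X \<inter> \<Omega>"
  shows "T \<delta> ** P (\<delta> 0) = P (\<delta> 1) ** T0 \<delta>"
  using transport_cone_domain[OF \<delta>(1) order_trans[OF \<delta>(2) X_\<Omega>_cone]]
  unfolding pathstart_def pathfinish_def .

definition Q :: "complex fps^'m^'m" where
  "Q = series_matrix (inverse_series (\<lambda>k. gauge S t x1 k x2))"

lemma Q_P: "Q ** P x2 = mat 1"
  unfolding Q_def gauge_series_def by (rule series_matrix_left_inverse) (rule gauge_0)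

text \<open>The intertwiner carries the fibre at \<open>z\<close> along \<beta> to
  \<open>x2\<close>, changes from \<omega> to \<omega>0 there by the inverse gauge, and returns
  along \<beta>0 to the fibre at \<open>z0\<close>.\<close>

definition M :: "complex fls^'m^'m" where
  "M = to_laurent (T0 (reversepath \<beta>0) ** Q ** T \<beta>)"

lemmas transfer = conjugation_transfer[OF L.transport_reverse[OF \<beta>(1,2)]
    L0.transport_reverse'[OF \<beta>0(1,2)] L0.transport_reverse[OF \<beta>0(1,2)] Q_P]

lemma M_GL: "M \<in> carrier GL"
  unfolding M_def by (rule transfer(1)[where E = "mat 1" and F = "mat 1"]) simp

theorem pure_isomorphic:
  "isomorphic_reps (fundamental_group (top_of_set X0) z0)
     (pure_monodromy \<omega> X \<circ> pure_embedding X X0 \<Omega> x2 \<beta>0 \<beta>) (pure_monodromy \<omega>0 X0)"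
proof (rule isomorphic_reps_conjugate[OF L0.pure_monodromy_hom M_GL _ fundamental_group_closed])
  have X0sub: "X \<inter> \<Omega> \<subseteq> X0" by blast
  fix c assume "c \<in> carrier (fundamental_group (top_of_set X0) z0)"
  then obtain \<gamma> where c: "c = path_class (top_of_set X0) \<gamma>"
    and \<gamma>: "pathin (top_of_set X0) \<gamma>" "\<gamma> 0 = \<beta>0 0" "\<gamma> 1 = \<beta>0 0"
    unfolding carrier_fundamental_group \<beta>0(3) by (elim exE conjE)
  obtain \<delta> where \<delta>: "pathin (top_of_set (X \<inter> \<Omega>)) \<delta>" "\<delta> 0 = x2" "\<delta> 1 = x2"
    and eq0: "path_class (top_of_set X0) \<gamma> =
      path_class (top_of_set X0) (path_join \<beta>0 (path_join (id \<circ> \<delta>) (path_reverse \<beta>0)))"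
    and eq: "(pi1_rebase (top_of_set X) \<beta> \<circ> pi1_map (top_of_set X) id \<circ>
        inv_into (carrier (fundamental_group (top_of_set (X \<inter> \<Omega>)) x2)) (pi1_map (top_of_set X0) id) \<circ>
        pi1_rebase (top_of_set X0) (path_reverse \<beta>0)) (path_class (top_of_set X0) \<gamma>) =
      path_class (top_of_set X) (path_join \<beta> (path_join (id \<circ> \<delta>) (path_reverse \<beta>)))"
  proof (rule embedding_class[where Y = "top_of_set (X \<inter> \<Omega>)" and U = "top_of_set X0" and T = "top_of_set X"
        and k = id and f = id and p = x2 and a = \<beta>0 and b = \<beta> and \<gamma> = \<gamma>])
    show "pathin (top_of_set X0) \<gamma>" "\<gamma> 0 = \<beta>0 0" "\<gamma> 1 = \<beta>0 0" by (rule \<gamma>)+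
    show "continuous_map (top_of_set (X \<inter> \<Omega>)) (top_of_set X0) id"
      "continuous_map (top_of_set (X \<inter> \<Omega>)) (top_of_set X) id"
      unfolding continuous_map_in_subtopology using X0sub by (auto simp del: Compl_iff)
    show "pathin (top_of_set X0) \<beta>0" "pathin (top_of_set X) \<beta>"
      unfolding pathin_top_of_set using \<beta>(1,2) \<beta>0(1,2) by blast+
    show "\<beta>0 1 = id x2" "\<beta> 1 = id x2" using \<beta>(4) \<beta>0(4) by simp_all
    fix g assume "pathin (top_of_set X0) g" "g 0 = id x2" "g 1 = id x2"
    then have g: "path g" "path_image g \<subseteq> X0" "g 0 = x2" "g 1 = x2" unfolding pathin_top_of_set by simp_all
    have gO: "g 0 \<in> \<Omega>" "g 1 \<in> \<Omega>" using g x2(1) by simp_all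
    obtain \<delta> where \<delta>: "path \<delta>" "path_image \<delta> \<subseteq> X \<inter> \<Omega>" "homotopic_paths X0 g \<delta>"
      by (rule shrink[OF g(1,2) gO]) (rule that)
    have "\<delta> 0 = x2" "\<delta> 1 = x2"
      using homotopic_paths_imp_pathstart[OF \<delta>(3)] homotopic_paths_imp_pathfinish[OF \<delta>(3)] g(3,4)
      unfolding pathstart_def pathfinish_def by simp_all
    then show "\<exists>\<delta>. pathin (top_of_set (X \<inter> \<Omega>)) \<delta> \<and> \<delta> 0 = x2 \<and> \<delta> 1 = x2 \<and>
        path_homotopic (top_of_set X0) g (id \<circ> \<delta>)"
      unfolding pathin_top_of_set path_homotopic_top_of_set id_o using \<delta> by blast
  qed (rule that)
  have \<delta>p: "path \<delta>" "path_image \<delta> \<subseteq> X \<inter> \<Omega>" using \<delta>(1) unfolding pathin_top_of_set by blast+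
  then have \<delta>X: "path_image \<delta> \<subseteq> X" "path_image \<delta> \<subseteq> X0" by blast+
  have j: "pathfinish \<beta> = pathstart \<delta>" "pathfinish \<delta> = pathstart (reversepath \<beta>)"
    "pathfinish \<beta>0 = pathstart \<delta>" "pathfinish \<delta> = pathstart (reversepath \<beta>0)"
    using \<beta>(4) \<beta>0(4) \<delta>(2,3) by (simp_all add: pathfinish_def pathstart_def reversepath_def)
  have r: "path (reversepath \<beta>)" "path_image (reversepath \<beta>) \<subseteq> X"
    "path (reversepath \<beta>0)" "path_image (reversepath \<beta>0) \<subseteq> X0"
    unfolding path_image_reversepath path_reversepath using \<beta>(1,2) \<beta>0(1,2) .
  have "pure_embedding X X0 \<Omega> x2 \<beta>0 \<beta> c = path_class (top_of_set X) (\<beta> +++ (\<delta> +++ reversepath \<beta>))"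
    using eq unfolding pure_embedding_def c path_join_joinpaths path_reverse_reversepath id_o .
  moreover have "pure_monodromy \<omega> X (path_class (top_of_set X) (\<beta> +++ (\<delta> +++ reversepath \<beta>))) =
      to_laurent (T (\<beta> +++ (\<delta> +++ reversepath \<beta>)))"
    by (rule L.pure_monodromy_class)
      (intro path_join_imp subset_path_image_join \<beta>(1,2) \<delta>p(1) \<delta>X r j | simp only: pathstart_join j)+
  ultimately have 1: "pure_monodromy \<omega> X (pure_embedding X X0 \<Omega> x2 \<beta>0 \<beta> c) =
      to_laurent (T (reversepath \<beta>) ** T \<delta> ** T \<beta>)"
    unfolding L.transport_conjugate[OF \<beta>(1,2) \<delta>p(1) \<delta>X(1) r(1,2) j(1,2)] by simp
  have "c = path_class (top_of_set X0) (\<beta>0 +++ (\<delta> +++ reversepath \<beta>0))"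
    using eq0 unfolding c path_join_joinpaths path_reverse_reversepath id_o .
  moreover have "pure_monodromy \<omega>0 X0 (path_class (top_of_set X0) (\<beta>0 +++ (\<delta> +++ reversepath \<beta>0))) =
      to_laurent (T0 (\<beta>0 +++ (\<delta> +++ reversepath \<beta>0)))"
    by (rule L0.pure_monodromy_class)
      (intro path_join_imp subset_path_image_join \<beta>0(1,2) \<delta>p(1) \<delta>X r j | simp only: pathstart_join j)+
  ultimately have 2: "pure_monodromy \<omega>0 X0 c = to_laurent (T0 (reversepath \<beta>0) ** T0 \<delta> ** T0 \<beta>0)"
    unfolding L0.transport_conjugate[OF \<beta>0(1,2) \<delta>p(1) \<delta>X(2) r(3,4) j(3,4)] by simp
  have E: "T \<delta> ** P x2 = P x2 ** T0 \<delta>" using transport_\<Omega>[OF \<delta>p] \<delta>(2,3) by simp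
  show "M ** (pure_monodromy \<omega> X \<circ> pure_embedding X X0 \<Omega> x2 \<beta>0 \<beta>) c = pure_monodromy \<omega>0 X0 c ** M"
    unfolding o_apply 1 2 M_def by (rule transfer(2)[OF E])
qed

end

section \<open>The parabolic braid group\<close>

locale equivariant_parabolic = parabolic S t x1 x2 z z0 \<Omega> \<beta> \<beta>0
  for S :: "(complex^'n) set set" and t :: "(complex^'n) set \<Rightarrow> complex^'m^'m"
    and x1 x2 z z0 :: "complex^'n" and \<Omega> :: "(complex^'n) set" and \<beta> \<beta>0 :: "real \<Rightarrow> complex^'n" +
  fixes W W0 :: "(complex^'n^'n) set" and \<sigma> :: "complex^'n^'n \<Rightarrow> complex^'m^'m"
  assumes equivariant: "equivariant_system (log_form S t) (- \<Union>S) W \<sigma>"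
    and equivariant0: "equivariant_system (log_form (center_hyperplanes x1) t) (- \<Union>(center_hyperplanes x1)) W0 \<sigma>"
    and W0: "W0 \<subseteq> W"
    and fix_x1: "w \<in> W0 \<Longrightarrow> w *v x1 = x1"
    and \<Omega>_stable: "w \<in> W0 \<Longrightarrow> x \<in> \<Omega> \<Longrightarrow> w *v x \<in> \<Omega>"
    and S_stable: "w \<in> W0 \<Longrightarrow> H \<in> S \<Longrightarrow> (*v) w ` H \<in> S"
    and t_equivariant: "w \<in> W0 \<Longrightarrow> H \<in> S \<Longrightarrow> t ((*v) w ` H) = \<sigma> w ** t H ** \<sigma> (matrix_inv w)"
begin

sublocale E: equivariant_system \<omega> X W \<sigma>
  by (rule equivariant)

sublocale E0: equivariant_system \<omega>0 X0 W0 \<sigma>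
  by (rule equivariant0)

lemma saturate_orbit: "(\<Union>y\<in>orbit W0 x. orbit W y) = orbit W x"
proof (rule UN_eq_of_const[OF E0.orbit_self])
  fix y assume "y \<in> orbit W0 x"
  then have "y \<in> orbit W x" using W0 unfolding orbit_def by blast
  then show "orbit W y = orbit W x" by (rule E.orbit_eq)
qed

lemma continuous_inclusion0: "continuous_map (orbit_space W0 (X \<inter> \<Omega>)) (orbit_space W0 X0) id"
proof (rule continuous_compose_quotient_map[OF quotient_map_orbit])
  have "X \<inter> \<Omega> \<subseteq> X0" by blast
  with quotient_imp_continuous_map[OF quotient_map_orbit]
  show "continuous_map (top_of_set (X \<inter> \<Omega>)) (orbit_space W0 X0) (id \<circ> orbit W0)"
    unfolding id_o by (rule continuous_map_from_subtopology_mono)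
qed

lemma continuous_inclusion:
  "continuous_map (orbit_space W0 (X \<inter> \<Omega>)) (orbit_space W X) (\<lambda>Q. \<Union>x\<in>Q. orbit W x)"
proof (rule continuous_compose_quotient_map[OF quotient_map_orbit])
  have eq: "(\<lambda>Q. \<Union>x\<in>Q. orbit W x) \<circ> orbit W0 = orbit W" by (rule ext) (simp only: o_apply saturate_orbit)
  show "continuous_map (top_of_set (X \<inter> \<Omega>)) (orbit_space W X) ((\<lambda>Q. \<Union>x\<in>Q. orbit W x) \<circ> orbit W0)"
    unfolding eq by (rule continuous_map_from_subtopology_mono[OF quotient_imp_continuous_map[OF quotient_map_orbit] Int_lower1])
qed

text \<open>The contraction is carried out on a lift. Its end point, a \<open>W0\<close>-translate
  of \<open>x2\<close>, lies in \<Omega> because \<Omega> is \<open>W0\<close>-stable, so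
  \<open>shrink\<close> applies and the result is projected back.\<close>

lemma shrink_orbit_loop:
  assumes g: "pathin (orbit_space W0 X0) g" "g 0 = orbit W0 x2" "g 1 = orbit W0 x2"
  shows "\<exists>\<delta>. pathin (orbit_space W0 (X \<inter> \<Omega>)) \<delta> \<and> \<delta> 0 = orbit W0 x2 \<and> \<delta> 1 = orbit W0 x2 \<and>
    path_homotopic (orbit_space W0 X0) g \<delta>"
proof -
  obtain w \<eta> where \<eta>: "w \<in> W0" "path \<eta>" "path_image \<eta> \<subseteq> X0" "\<eta> 0 = x2" "\<eta> 1 = matrix_inv w *v x2"
    "\<And>t. t \<in> {0..1} \<Longrightarrow> g t = orbit W0 (\<eta> t)"
    by (rule E0.loop_lift[OF E0.X_stable x2_X0 g]) (assumption, assumption, rule that)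
  have \<eta>O: "\<eta> 0 \<in> \<Omega>" "\<eta> 1 \<in> \<Omega>" using \<eta>(4,5) x2(1) \<Omega>_stable[OF E0.inv_W[OF \<eta>(1)]] by simp_all
  obtain \<delta> where \<delta>: "path \<delta>" "path_image \<delta> \<subseteq> X \<inter> \<Omega>" "homotopic_paths X0 \<eta> \<delta>"
    by (rule shrink[OF \<eta>(2,3) \<eta>O]) (rule that)
  have e: "\<delta> 0 = \<eta> 0" "\<delta> 1 = \<eta> 1"
    using homotopic_paths_imp_pathstart[OF \<delta>(3)] homotopic_paths_imp_pathfinish[OF \<delta>(3)]
    unfolding pathstart_def pathfinish_def by simp_all
  have 1: "path_homotopic (orbit_space W0 X0) g (orbit W0 \<circ> \<eta>)"
    by (rule path_homotopic_cong[OF g(1)]) (simp only: o_apply \<eta>(6))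
  have 2: "path_homotopic (orbit_space W0 X0) (orbit W0 \<circ> \<eta>) (orbit W0 \<circ> \<delta>)"
    by (rule path_homotopic_compose[OF quotient_imp_continuous_map[OF quotient_map_orbit]])
      (unfold path_homotopic_top_of_set, rule \<delta>(3))
  show ?thesis
  proof (intro exI conjI)
    show "pathin (orbit_space W0 (X \<inter> \<Omega>)) (orbit W0 \<circ> \<delta>)" by (rule E0.pathin_orbit[OF \<delta>(1,2)])
    show "path_homotopic (orbit_space W0 X0) g (orbit W0 \<circ> \<delta>)" by (rule path_homotopic_trans[OF 1 2])
    show "(orbit W0 \<circ> \<delta>) 0 = orbit W0 x2" "(orbit W0 \<circ> \<delta>) 1 = orbit W0 x2"
      using E0.orbit_act[OF E0.inv_W[OF \<eta>(1)]] by (simp_all add: e \<eta>(4,5))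
  qed
qed

text \<open>One lift \<eta> of the loop in the orbit space of \<open>X \<inter> \<Omega>\<close>
  represents both the given class of \<open>B0\<close> and its image in \<open>B\<close>, with the
  same \<open>w\<close>. The two monodromies can therefore be compared on a single path.\<close>

lemma braid_embedding_class:
  assumes "c \<in> carrier (fundamental_group (orbit_space W0 X0) (orbit W0 z0))"
  obtains w \<eta> where "w \<in> W0" "path \<eta>" "path_image \<eta> \<subseteq> X \<inter> \<Omega>" "\<eta> 0 = x2" "\<eta> 1 = matrix_inv w *v x2"
    "c = path_class (orbit_space W0 X0)
      (path_join (orbit W0 \<circ> \<beta>0) (path_join (orbit W0 \<circ> \<eta>) (path_reverse (orbit W0 \<circ> \<beta>0))))"
    "braid_embedding W W0 X X0 \<Omega> x2 \<beta>0 \<beta> c = path_class (orbit_space W X)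
      (path_join (orbit W \<circ> \<beta>) (path_join (orbit W \<circ> \<eta>) (path_reverse (orbit W \<circ> \<beta>))))"
proof -
  let ?Y = "orbit_space W0 (X \<inter> \<Omega>)" and ?U = "orbit_space W0 X0" and ?T = "orbit_space W X"
  let ?f = "\<lambda>Q. \<Union>x\<in>Q. orbit W x"
  obtain \<gamma> where c: "c = path_class ?U \<gamma>" and \<gamma>: "pathin ?U \<gamma>" "\<gamma> 0 = orbit W0 z0" "\<gamma> 1 = orbit W0 z0"
    using assms unfolding carrier_fundamental_group by (elim exE conjE)
  have b: "pathin ?T (orbit W \<circ> \<beta>)" and b0: "pathin ?U (orbit W0 \<circ> \<beta>0)"
    by (rule E.pathin_orbit[OF \<beta>(1,2)], rule E0.pathin_orbit[OF \<beta>0(1,2)])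
  obtain \<delta> where \<delta>: "pathin ?Y \<delta>" "\<delta> 0 = orbit W0 x2" "\<delta> 1 = orbit W0 x2"
    and eq0: "path_class ?U \<gamma> =
      path_class ?U (path_join (orbit W0 \<circ> \<beta>0) (path_join (id \<circ> \<delta>) (path_reverse (orbit W0 \<circ> \<beta>0))))"
    and eq: "(pi1_rebase ?T (orbit W \<circ> \<beta>) \<circ> pi1_map ?T ?f \<circ>
        inv_into (carrier (fundamental_group ?Y (orbit W0 x2))) (pi1_map ?U id) \<circ>
        pi1_rebase ?U (path_reverse (orbit W0 \<circ> \<beta>0))) (path_class ?U \<gamma>) =
      path_class ?T (path_join (orbit W \<circ> \<beta>) (path_join (?f \<circ> \<delta>) (path_reverse (orbit W \<circ> \<beta>))))"
  proof (rule embedding_class[where Y = ?Y and U = ?U and T = ?T and k = id and f = ?f and p = "orbit W0 x2"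
        and a = "orbit W0 \<circ> \<beta>0" and b = "orbit W \<circ> \<beta>" and \<gamma> = \<gamma>])
    show "pathin ?U (orbit W0 \<circ> \<beta>0)" by (rule b0)
    show "pathin ?T (orbit W \<circ> \<beta>)" by (rule b)
    show "pathin ?U \<gamma>" by (rule \<gamma>)
    show "\<gamma> 0 = (orbit W0 \<circ> \<beta>0) 0" "\<gamma> 1 = (orbit W0 \<circ> \<beta>0) 0" unfolding o_apply \<beta>0(3) by (rule \<gamma>)+
    show "continuous_map ?Y ?U id" by (rule continuous_inclusion0)
    show "continuous_map ?Y ?T ?f" by (rule continuous_inclusion)
    show "(orbit W0 \<circ> \<beta>0) 1 = id (orbit W0 x2)" unfolding o_apply \<beta>0(4) id_apply ..
    show "(orbit W \<circ> \<beta>) 1 = ?f (orbit W0 x2)" unfolding o_apply \<beta>(4) saturate_orbit ..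
    show "\<exists>\<delta>. pathin ?Y \<delta> \<and> \<delta> 0 = orbit W0 x2 \<and> \<delta> 1 = orbit W0 x2 \<and> path_homotopic ?U g (id \<circ> \<delta>)"
      if "pathin ?U g" "g 0 = id (orbit W0 x2)" "g 1 = id (orbit W0 x2)" for g
      using that unfolding id_o id_apply by (rule shrink_orbit_loop)
  qed (rule that)
  have Y_stable: "w *v y \<in> X \<inter> \<Omega>" if w: "w \<in> W0" and y: "y \<in> X \<inter> \<Omega>" for w y
    using E.X_stable[OF subsetD[OF W0 w]] \<Omega>_stable[OF w] y by blast
  have x2Y: "x2 \<in> X \<inter> \<Omega>" using x2 by blast
  obtain w \<eta> where w: "w \<in> W0" and \<eta>: "path \<eta>" "path_image \<eta> \<subseteq> X \<inter> \<Omega>" "\<eta> 0 = x2" "\<eta> 1 = matrix_inv w *v x2"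
    and \<delta>\<eta>: "\<And>t. t \<in> {0..1} \<Longrightarrow> \<delta> t = orbit W0 (\<eta> t)"
    by (rule E0.loop_lift[OF Y_stable x2Y \<delta>]) (assumption, assumption, rule that)
  have \<eta>X: "path_image \<eta> \<subseteq> X" "path_image \<eta> \<subseteq> X0" using \<eta>(2) by blast+
  have inv: "matrix_inv w \<in> W0" "matrix_inv w \<in> W" using E0.inv_W[OF w] W0 by blast+
  have "c = path_class ?U (path_join (orbit W0 \<circ> \<beta>0) (path_join \<delta> (path_reverse (orbit W0 \<circ> \<beta>0))))"
    using eq0 unfolding c id_o .
  also have "\<dots> = path_class ?U (path_join (orbit W0 \<circ> \<beta>0) (path_join (orbit W0 \<circ> \<eta>) (path_reverse (orbit W0 \<circ> \<beta>0))))"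
  proof (rule path_class_rebase_eq[OF b0, symmetric])
    show "path_homotopic ?U (orbit W0 \<circ> \<eta>) \<delta>"
      by (rule path_homotopic_cong[OF E0.pathin_orbit[OF \<eta>(1) \<eta>X(2)]]) (simp only: o_apply \<delta>\<eta>)
    show "(orbit W0 \<circ> \<eta>) 0 = (orbit W0 \<circ> \<beta>0) 1" "(orbit W0 \<circ> \<eta>) 1 = (orbit W0 \<circ> \<beta>0) 1"
      by (simp_all only: o_apply \<eta>(3,4) \<beta>0(4) E0.orbit_act[OF inv(1)])
  qed
  finally have 1: "c = path_class ?U
    (path_join (orbit W0 \<circ> \<beta>0) (path_join (orbit W0 \<circ> \<eta>) (path_reverse (orbit W0 \<circ> \<beta>0))))" .
  have "braid_embedding W W0 X X0 \<Omega> x2 \<beta>0 \<beta> c =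
      path_class ?T (path_join (orbit W \<circ> \<beta>) (path_join (?f \<circ> \<delta>) (path_reverse (orbit W \<circ> \<beta>))))"
    using eq unfolding braid_embedding_def c .
  also have "\<dots> = path_class ?T (path_join (orbit W \<circ> \<beta>) (path_join (orbit W \<circ> \<eta>) (path_reverse (orbit W \<circ> \<beta>))))"
  proof (rule path_class_rebase_eq[OF b, symmetric])
    show "path_homotopic ?T (orbit W \<circ> \<eta>) (?f \<circ> \<delta>)"
      by (rule path_homotopic_cong[OF E.pathin_orbit[OF \<eta>(1) \<eta>X(1)]]) (simp only: o_apply \<delta>\<eta> saturate_orbit)
    show "(orbit W \<circ> \<eta>) 0 = (orbit W \<circ> \<beta>) 1" "(orbit W \<circ> \<eta>) 1 = (orbit W \<circ> \<beta>) 1"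
      by (simp_all only: o_apply \<eta>(3,4) \<beta>(4) E.orbit_act[OF inv(2)])
  qed
  finally show thesis by (rule that[OF w \<eta> 1])
qed

theorem braid_isomorphic:
  assumes R: "braid_monodromy W \<sigma> \<omega> X z R" and R0: "braid_monodromy W0 \<sigma> \<omega>0 X0 z0 R0"
  shows "isomorphic_reps (fundamental_group (orbit_space W0 X0) (orbit W0 z0))
     (R \<circ> braid_embedding W W0 X X0 \<Omega> x2 \<beta>0 \<beta>) R0"
proof -
  have "\<beta>0 0 \<in> path_image \<beta>0" unfolding path_image_def by (rule imageI) simp
  then have z0: "z0 \<in> X0" using \<beta>0(2) unfolding \<beta>0(3) by (rule subsetD[rotated])
  show ?thesis
  proof (rule isomorphic_reps_conjugate[OF E0.braid_monodromy_hom[OF R0 z0] M_GL _ fundamental_group_closed])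
    fix c assume "c \<in> carrier (fundamental_group (orbit_space W0 X0) (orbit W0 z0))"
    then obtain w \<eta> where w: "w \<in> W0" and \<eta>: "path \<eta>" "path_image \<eta> \<subseteq> X \<inter> \<Omega>" "\<eta> 0 = x2" "\<eta> 1 = matrix_inv w *v x2"
      and c: "c = path_class (orbit_space W0 X0)
        (path_join (orbit W0 \<circ> \<beta>0) (path_join (orbit W0 \<circ> \<eta>) (path_reverse (orbit W0 \<circ> \<beta>0))))"
      and emb: "braid_embedding W W0 X X0 \<Omega> x2 \<beta>0 \<beta> c = path_class (orbit_space W X)
        (path_join (orbit W \<circ> \<beta>) (path_join (orbit W \<circ> \<eta>) (path_reverse (orbit W \<circ> \<beta>))))"
      by (rule braid_embedding_class)
    have \<eta>X: "path_image \<eta> \<subseteq> X" "path_image \<eta> \<subseteq> X0" using \<eta>(2) by blast+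
    have inv: "matrix_inv w \<in> W0" by (rule E0.inv_W[OF w])
    have 1: "R (braid_embedding W W0 X X0 \<Omega> x2 \<beta>0 \<beta> c) =
        to_laurent (T (reversepath \<beta>) ** (const_series (\<sigma> w) ** T \<eta>) ** T \<beta>)"
      unfolding emb by (rule E.braid_monodromy_conjugate[OF R subsetD[OF W0 w] \<beta> \<eta>(1) \<eta>X(1) \<eta>(3,4)])
    have 2: "R0 c = to_laurent (T0 (reversepath \<beta>0) ** (const_series (\<sigma> w) ** T0 \<eta>) ** T0 \<beta>0)"
      unfolding c by (rule E0.braid_monodromy_conjugate[OF R0 w \<beta>0 \<eta>(1) \<eta>X(2) \<eta>(3,4)])
    let ?w = "matrix_inv w"
    have ww: "const_series (\<sigma> w) ** const_series (\<sigma> ?w) = mat 1"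
      unfolding const_series_mult[symmetric] E0.\<sigma>_inv(1)[OF w] by (rule const_series_one)
    have x2c: "x2 \<in> cone_domain S x1" using X_\<Omega>_cone x2 by blast
    \<comment> \<open>Equivariance moves the gauge from the end point of \<eta> back to
      \<open>x2\<close>; the factor \<open>\<sigma> w\<close> in the braid monodromy then cancels
      the conjugating factor on the left.\<close>
    have Pw: "P (?w *v x2) = const_series (\<sigma> ?w) ** P x2 ** const_series (\<sigma> w)"
      by (rule gauge_series_equivariant[OF E0.invertible_W[OF inv] fix_x1[OF inv] S_stable[OF inv]
            E0.\<sigma>_inv(2)[OF w] E0.\<sigma>_inv(1)[OF w] _ x2c])
        (assumption, use t_equivariant[OF inv] in \<open>simp only: E0.inv_inv[OF w]\<close>)
    have "const_series (\<sigma> w) ** T \<eta> ** P x2 = const_series (\<sigma> w) ** (T \<eta> ** P x2)"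
      by (rule matrix_mul_assoc[symmetric])
    also have "T \<eta> ** P x2 = P (?w *v x2) ** T0 \<eta>" using transport_\<Omega>[OF \<eta>(1,2)] unfolding \<eta>(3,4) .
    also have "const_series (\<sigma> w) ** \<dots> =
        (const_series (\<sigma> w) ** const_series (\<sigma> ?w)) ** (P x2 ** (const_series (\<sigma> w) ** T0 \<eta>))"
      unfolding Pw by (simp only: matrix_mul_assoc)
    finally have E: "const_series (\<sigma> w) ** T \<eta> ** P x2 = P x2 ** (const_series (\<sigma> w) ** T0 \<eta>)"
      unfolding ww by (simp only: matrix_mul_lid)
    show "M ** (R \<circ> braid_embedding W W0 X X0 \<Omega> x2 \<beta>0 \<beta>) c = R0 c ** M"
      unfolding o_apply 1 2 M_def by (rule transfer(2)[OF E])
  qed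
qed

end

section \<open>The braid groups of a reflection group\<close>

lemma hermitian_scaleR:
  fixes \<phi> :: "complex^'n \<Rightarrow> complex^'n \<Rightarrow> complex"
  assumes "hermitian_inner \<phi>"
  shows "\<phi> (r *\<^sub>R x) y = r *\<^sub>R \<phi> x y" "\<phi> x (r *\<^sub>R y) = r *\<^sub>R \<phi> x y"
proof -
  have s: "r *\<^sub>R u = complex_of_real r *s u" for u :: "complex^'n"
    unfolding vec_eq_iff by (simp add: scaleR_conv_of_real[symmetric])
  have left: "\<phi> (c *s u) v = c * \<phi> u v" for c u v using assms unfolding hermitian_inner_def by blast
  have cnj: "\<phi> u v = cnj (\<phi> v u)" for u v using assms unfolding hermitian_inner_def by blast
  show "\<phi> (r *\<^sub>R x) y = r *\<^sub>R \<phi> x y" unfolding s left by (rule scaleR_conv_of_real[symmetric])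
  show "\<phi> x (r *\<^sub>R y) = r *\<^sub>R \<phi> x y"
    unfolding s cnj[of x "complex_of_real r *s y"] left cnj[of x y] by (simp add: scaleR_conv_of_real)
qed

lemma hermitian_norm_scaleR:
  assumes "hermitian_inner \<phi>" "0 \<le> r"
  shows "hermitian_norm \<phi> (r *\<^sub>R x) = r * hermitian_norm \<phi> x"
proof -
  have "Re (\<phi> (r *\<^sub>R x) (r *\<^sub>R x)) = r\<^sup>2 * Re (\<phi> x x)"
    unfolding hermitian_scaleR[OF assms(1)] by (simp add: power2_eq_square)
  then show ?thesis unfolding hermitian_norm_def using assms(2) by (simp add: real_sqrt_mult)
qed

lemma hermitian_norm_nonneg:
  assumes "hermitian_inner \<phi>"
  shows "0 \<le> hermitian_norm \<phi> x"
proof (cases "x = 0")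
  case True
  then show ?thesis using hermitian_norm_scaleR[OF assms, of 0 0] by simp
next
  case False
  then have "0 < Re (\<phi> x x)" using assms unfolding hermitian_inner_def by blast
  then show ?thesis by (simp add: hermitian_norm_def)
qed

lemma continuous_on_hermitian_norm:
  assumes "hermitian_inner \<phi>"
  shows "continuous_on S (\<lambda>x. hermitian_norm \<phi> (x - c))"
proof -
  have add: "\<phi> (x + y) z = \<phi> x z + \<phi> y z" for x y z using assms unfolding hermitian_inner_def by blast
  have cnj: "\<phi> u v = cnj (\<phi> v u)" for u v using assms unfolding hermitian_inner_def by blast
  have add': "\<phi> x (y + z) = \<phi> x y + \<phi> x z" for x y z
    unfolding cnj[of x] add by simp
  have "bilinear \<phi>"
    unfolding bilinear_def
    by (intro allI conjI linearI) (simp_all add: add add' hermitian_scaleR[OF assms])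
  then have "bounded_bilinear \<phi>" by (simp add: bilinear_conv_bounded_bilinear)
  then have "continuous_on S (\<lambda>x. \<phi> (x - c) (x - c))"
    by (rule bounded_bilinear.continuous_on) (intro continuous_intros)+
  then show ?thesis
    unfolding hermitian_norm_def by (intro continuous_on_real_sqrt continuous_on_Re)
qed

lemma hermitian_ball_absorbing:
  assumes \<phi>: "hermitian_inner \<phi>" and \<epsilon>: "0 < \<epsilon>" and C: "compact C"
  shows "\<exists>s. 0 < s \<and> s \<le> 1 \<and> (\<forall>x\<in>C. c + s *\<^sub>R (x - c) \<in> {x. hermitian_norm \<phi> (x - c) \<le> \<epsilon>})"
proof -
  have "bounded ((\<lambda>x. hermitian_norm \<phi> (x - c)) ` C)"
    by (rule compact_imp_bounded[OF compact_continuous_image[OF continuous_on_hermitian_norm[OF \<phi>] C]])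
  then obtain B where B: "0 < B" "\<And>x. x \<in> C \<Longrightarrow> hermitian_norm \<phi> (x - c) \<le> B"
    unfolding bounded_pos by fastforce
  \<comment> \<open>\<open>B\<close> bounds the distance from \<open>c\<close> on the compact set,
    so the factor \<open>\<epsilon> / B\<close> brings it into the ball.\<close>
  define s where "s = min 1 (\<epsilon> / B)"
  have s: "0 < s" "s \<le> 1" "s * B \<le> \<epsilon>" using \<epsilon> B(1) by (auto simp: s_def min_def field_simps)
  have "hermitian_norm \<phi> (s *\<^sub>R (x - c)) \<le> \<epsilon>" if "x \<in> C" for x
  proof -
    have "hermitian_norm \<phi> (s *\<^sub>R (x - c)) = s * hermitian_norm \<phi> (x - c)"
      by (rule hermitian_norm_scaleR[OF \<phi>]) (use s in simp)
    also have "\<dots> \<le> s * B" using B(2)[OF that] s(1) by (simp add: mult_left_mono)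
    finally show ?thesis using s(3) by simp
  qed
  then show ?thesis using s(1,2) by (intro exI[of _ s]) simp
qed

section \<open>From reflection groups to the abstract setting\<close>

lemma equivariant_log_form:
  assumes "flat_system S t" and S': "S' \<subseteq> S" and loc: "local_system (log_form S' t) (- \<Union>S')"
    and V: "finite_linear_group V"
    and stable: "\<And>w H. w \<in> V \<Longrightarrow> H \<in> S' \<Longrightarrow> (*v) w ` H \<in> S'"
    and mult: "\<And>v w. v \<in> V \<Longrightarrow> w \<in> V \<Longrightarrow> \<sigma> (v ** w) = \<sigma> v ** \<sigma> w" and one: "\<sigma> (mat 1) = mat 1"
    and t: "\<And>w H. w \<in> V \<Longrightarrow> H \<in> S' \<Longrightarrow> t ((*v) w ` H) = \<sigma> w ** t H ** \<sigma> (matrix_inv w)"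
  shows "equivariant_system (log_form S' t) (- \<Union>S') V \<sigma>"
proof (rule equivariant_system.intro[OF loc V equivariant_system_axioms.intro])
  interpret flat_system S t by fact
  interpret V: finite_linear_group V by fact
  fix w assume w: "w \<in> V"
  show "log_form S' t (w *v x) (w *v y) = \<sigma> w ** log_form S' t x y ** \<sigma> (matrix_inv w)" for x y
    by (rule log_form_equivariant[OF S' stable[OF w] V.invertible_W[OF w] t[OF w]])
  show "w *v x \<in> - \<Union>S'" if x: "x \<in> - \<Union>S'" for x
  proof (rule ccontr)
    assume "w *v x \<notin> - \<Union>S'"
    then obtain H where H: "H \<in> S'" "w *v x \<in> H" by blast
    have "matrix_inv w *v (w *v x) \<in> (*v) (matrix_inv w) ` H" using H(2) by (rule imageI)
    then have "x \<in> (*v) (matrix_inv w) ` H" unfolding V.act_inv(1)[OF w] .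
    then show False using stable[OF V.inv_W[OF w] H(1)] x by blast
  qed
  show "\<sigma> (v ** w) = \<sigma> v ** \<sigma> w" if "v \<in> V" for v by (rule mult[OF that w])
qed (rule one)

text \<open>\<open>\<sigma> (mat 1)\<close> is an invertible idempotent, hence the identity;
  uniqueness of inverses then identifies the image of an inverse.\<close>

lemma equivariant_rep_one:
  assumes "finite_linear_group W" "equivariant_rep W \<sigma> \<rho>"
  shows "\<And>v w. v \<in> W \<Longrightarrow> w \<in> W \<Longrightarrow> \<sigma> (v ** w) = \<sigma> v ** \<sigma> w" "\<sigma> (mat 1) = mat 1"
    "\<And>w. w \<in> W \<Longrightarrow> \<sigma> (matrix_inv w) = matrix_inv (\<sigma> w)"
proof -
  interpret finite_linear_group W by fact
  have hom: "\<sigma> \<in> hom (GL\<lparr>carrier := W\<rparr>) GL" using assms(2) by (simp add: equivariant_rep_def)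
  show mult: "\<And>v w. v \<in> W \<Longrightarrow> w \<in> W \<Longrightarrow> \<sigma> (v ** w) = \<sigma> v ** \<sigma> w"
    using hom by (auto simp: hom_def GL_simps)
  have inv: "invertible (\<sigma> w)" if "w \<in> W" for w using hom that by (auto simp: hom_def GL_simps)
  have "\<sigma> (mat 1) ** \<sigma> (mat 1) = \<sigma> (mat 1)" using mult[OF one_W one_W] by simp
  then have "matrix_inv (\<sigma> (mat 1)) ** (\<sigma> (mat 1) ** \<sigma> (mat 1)) = matrix_inv (\<sigma> (mat 1)) ** \<sigma> (mat 1)"
    by (rule arg_cong)
  then show one: "\<sigma> (mat 1) = mat 1"
    unfolding matrix_mul_assoc matrix_inv(2)[OF inv[OF one_W]] by simp
  show "\<sigma> (matrix_inv w) = matrix_inv (\<sigma> w)" if w: "w \<in> W" for w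
    by (rule matrix_inverse_unique[of _ "\<sigma> w"])
      (simp_all add: mult[symmetric] inv_left inv_W w one matrix_inv(1)[OF inv[OF w]])
qed

theorem theorem2p9:
  fixes W W0 :: "(complex^'n^'n) set"
    and I X X0 \<Omega> :: "(complex^'n) set"
    and \<A> \<A>0 :: "(complex^'n) set set"
    and \<rho> \<rho>0 :: "(complex^'n) set lie_term set \<Rightarrow> complex^'m^'m"
    and \<omega> \<omega>0 :: "('n, 'm) matrix_form"
    and \<phi> :: "complex^'n \<Rightarrow> complex^'n \<Rightarrow> complex"
    and z z0 x1 x2 :: "complex^'n"
    and \<epsilon> :: real
    and \<beta> \<beta>0 :: "real \<Rightarrow> complex^'n"
  defines "\<A> \<equiv> arrangement W"
    and "X \<equiv> arr_complement \<A>"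
    and "W0 \<equiv> pointwise_stabilizer W I"
    and "\<A>0 \<equiv> hyperplanes_containing \<A> I"
    and "X0 \<equiv> arr_complement \<A>0"
    and "\<rho>0 \<equiv> \<rho> \<circ> holonomy_incl \<A>"
    and "\<omega> \<equiv> holonomy_form \<A> \<rho>"
    and "\<omega>0 \<equiv> holonomy_form \<A>0 \<rho>0"
    and "\<Omega> \<equiv> {x. hermitian_norm \<phi> (x - x1) \<le> \<epsilon>}"
  assumes "complex_reflection_group W"
    and "\<rho> \<in> lie_hom (holonomy \<A>) gl"
    and "vec.subspace I" "I \<noteq> UNIV"
    \<comment> \<open>base points\<close>
    and "z \<in> X" "z0 \<in> X0"
    \<comment> \<open>the choices defining the embeddings\<close>
    and "invariant_hermitian W \<phi>"
    and "x1 \<in> I" "\<forall>H\<in>\<A> - \<A>0. x1 \<notin> H"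
    and "\<epsilon> > 0" "\<forall>H\<in>\<A> - \<A>0. \<Omega> \<inter> H = {}"
    and "x2 \<in> X" "hermitian_norm \<phi> (x2 - x1) < \<epsilon>"
    and "path \<beta>" "path_image \<beta> \<subseteq> X" "pathstart \<beta> = z" "pathfinish \<beta> = x2"
    and "path \<beta>0" "path_image \<beta>0 \<subseteq> X0" "pathstart \<beta>0 = z0" "pathfinish \<beta>0 = x2"
  shows
    "isomorphic_reps (fundamental_group (top_of_set X0) z0)
       (pure_monodromy \<omega> X \<circ> pure_embedding X X0 \<Omega> x2 \<beta>0 \<beta>)
       (pure_monodromy \<omega>0 X0) \<and>
     (\<forall>\<sigma> R R0.
        equivariant_rep W \<sigma> \<rho> \<and>
        braid_monodromy W \<sigma> \<omega> X z R \<and>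
        braid_monodromy W0 \<sigma> \<omega>0 X0 z0 R0 \<longrightarrow>
        isomorphic_reps (fundamental_group (orbit_space W0 X0) (orbit W0 z0))
          (R \<circ> braid_embedding W W0 X X0 \<Omega> x2 \<beta>0 \<beta>)
          R0)"
proof -
  let ?t = "\<lambda>H. \<rho> (holonomy_gen \<A> H)"
  have fin: "finite W" and sub: "subgroup W GL" using assms(10) by (simp_all add: complex_reflection_group_def)
  interpret W: finite_linear_group W by (rule subgroup_finite_linear_group[OF fin sub])
  have codim: "codim_subspace 1 H" if "H \<in> \<A>" for H using that unfolding \<A>_def by (rule arrangement_codim)
  have finA: "finite \<A>" unfolding \<A>_def by (rule finite_arrangement[OF fin])
  have flat: "flat_system \<A> ?t"
    by (rule flat_system_holonomy[OF finA codim assms(11)])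
  then have hs: "hyperplane_system \<A>" unfolding flat_system_def by blast
  have \<A>0: "\<A>0 \<subseteq> \<A>" by (auto simp: \<A>0_def hyperplanes_containing_def)
  \<comment> \<open>The hyperplanes through \<open>x1\<close> are those of \<A>0: these contain
    \<open>I\<close> and hence \<open>x1\<close>, and \<open>x1\<close> was chosen off all
    others.\<close>
  have center: "{H \<in> \<A>. linear_form_of H x1 = 0} = \<A>0"
    using \<A>0 \<open>x1 \<in> I\<close> \<open>\<forall>H\<in>\<A> - \<A>0. x1 \<notin> H\<close> hyperplane_system.kernel[OF hs]
    unfolding \<A>0_def hyperplanes_containing_def by blast
  have X: "X = - \<Union>\<A>" "X0 = - \<Union>\<A>0" unfolding X_def X0_def arr_complement_def by (rule HOL.refl)+
  have \<omega>: "\<omega> = log_form \<A> ?t" unfolding \<omega>_def by (rule holonomy_form_log_form)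
  \<comment> \<open>\<rho>0 takes the same values as \<rho> on the generators, so \<omega>0 is the
    part of \<omega> supported on \<A>0.\<close>
  have \<omega>0: "\<omega>0 = log_form \<A>0 ?t"
  proof -
    have "\<rho>0 (holonomy_gen \<A>0 H) = \<rho> (holonomy_gen \<A> H)" if "H \<in> \<A>0" for H
      using holonomy_incl_gen[OF codim that[unfolded \<A>0_def]] unfolding \<rho>0_def \<A>0_def by simp
    then show ?thesis
      unfolding \<omega>0_def holonomy_form_log_form log_form_def by (intro ext sum.cong) simp_all
  qed
  have \<phi>: "hermitian_inner \<phi>" using assms(16) by (simp add: invariant_hermitian_def)
  have star: "x1 + s *\<^sub>R (x - x1) \<in> \<Omega>" if x: "x \<in> \<Omega>" and s: "0 \<le> s" "s \<le> 1" for x s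
  proof -
    have "hermitian_norm \<phi> (s *\<^sub>R (x - x1)) \<le> 1 * hermitian_norm \<phi> (x - x1)"
      unfolding hermitian_norm_scaleR[OF \<phi> s(1)] by (rule mult_right_mono[OF s(2) hermitian_norm_nonneg[OF \<phi>]])
    then show ?thesis using x by (simp add: \<Omega>_def)
  qed
  have par: "parabolic \<A> ?t x1 x2 z z0 \<Omega> \<beta> \<beta>0"
  proof (rule parabolic.intro[OF flat parabolic_axioms.intro], unfold center)
    \<comment> \<open>The segment from \<open>x1\<close> to a point of the ball stays in the ball,
      which misses every hyperplane outside \<A>0.\<close>
    show "\<Omega> \<inter> - \<Union>\<A>0 \<subseteq> cone_domain \<A> x1"
    proof
      fix x assume x: "x \<in> \<Omega> \<inter> - \<Union>\<A>0"
      have off: "y \<notin> H" if "y \<in> \<Omega>" "H \<in> \<A> - \<A>0" for y H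
        using that \<open>\<forall>H\<in>\<A> - \<A>0. \<Omega> \<inter> H = {}\<close> by blast
      show "x \<in> cone_domain \<A> x1"
      proof (rule flat_system.cone_domainI[OF flat])
        show "x \<notin> \<Union>\<A>" using x off by blast
        fix H s assume H: "H \<in> \<A>" "x1 \<notin> H" and s: "(0::real) \<le> s" "s \<le> 1"
        have "H \<notin> \<A>0" using H(2) \<open>x1 \<in> I\<close> unfolding \<A>0_def hyperplanes_containing_def by blast
        then show "x1 + s *\<^sub>R (x - x1) \<notin> H" using H(1) x s by (intro off star) auto
      qed
    qed
    show "x1 + s *\<^sub>R (x - x1) \<in> \<Omega>" if "x \<in> \<Omega>" "0 < s" "s \<le> 1" for x s using that by (intro star) auto
    show "\<exists>s>0. s \<le> 1 \<and> (\<forall>x\<in>C. x1 + s *\<^sub>R (x - x1) \<in> \<Omega>)" if "compact C" for C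
      unfolding \<Omega>_def by (rule hermitian_ball_absorbing[OF \<phi> \<open>\<epsilon> > 0\<close> that])
    show "x2 \<in> \<Omega>" using \<open>hermitian_norm \<phi> (x2 - x1) < \<epsilon>\<close> by (simp add: \<Omega>_def)
    show "x2 \<in> - \<Union>\<A>" using \<open>x2 \<in> X\<close> unfolding X .
    show "path \<beta>" "path \<beta>0" by fact+
    show "path_image \<beta> \<subseteq> - \<Union>\<A>" "path_image \<beta>0 \<subseteq> - \<Union>\<A>0"
      using \<open>path_image \<beta> \<subseteq> X\<close> \<open>path_image \<beta>0 \<subseteq> X0\<close> unfolding X .
    show "\<beta> 0 = z" "\<beta> 1 = x2" "\<beta>0 0 = z0" "\<beta>0 1 = x2"
      using \<open>pathstart \<beta> = z\<close> \<open>pathfinish \<beta> = x2\<close> \<open>pathstart \<beta>0 = z0\<close> \<open>pathfinish \<beta>0 = x2\<close>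
      unfolding pathstart_def pathfinish_def .
  qed
  show ?thesis
  proof (intro conjI allI impI)
    show "isomorphic_reps (fundamental_group (top_of_set X0) z0)
       (pure_monodromy \<omega> X \<circ> pure_embedding X X0 \<Omega> x2 \<beta>0 \<beta>) (pure_monodromy \<omega>0 X0)"
      using parabolic.pure_isomorphic[OF par] unfolding center X \<omega> \<omega>0 .
    fix \<sigma> R R0
    assume asm: "equivariant_rep W \<sigma> \<rho> \<and> braid_monodromy W \<sigma> \<omega> X z R \<and> braid_monodromy W0 \<sigma> \<omega>0 X0 z0 R0"
    then have eq: "equivariant_rep W \<sigma> \<rho>" by blast
    note \<sigma> = equivariant_rep_one[OF W.finite_linear_group_axioms eq]
    have W0: "W0 \<subseteq> W" "\<And>w x. w \<in> W0 \<Longrightarrow> x \<in> I \<Longrightarrow> w *v x = x"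
      by (auto simp: W0_def pointwise_stabilizer_def)
    have stable: "(*v) w ` H \<in> \<A>" if "w \<in> W" "H \<in> \<A>" for w H
      using that unfolding \<A>_def by (rule W.arrangement_stable)
    have stable0: "(*v) w ` H \<in> \<A>0" if w: "w \<in> W0" and H: "H \<in> \<A>0" for w H
    proof -
      have IH: "I \<subseteq> H" "H \<in> \<A>" using H by (simp_all add: \<A>0_def hyperplanes_containing_def)
      have "I \<subseteq> (*v) w ` H"
      proof
        fix x assume x: "x \<in> I"
        then have "w *v x \<in> (*v) w ` H" using IH(1) by blast
        then show "x \<in> (*v) w ` H" unfolding W0(2)[OF w x] .
      qed
      then show ?thesis using stable[OF subsetD[OF W0(1) w] IH(2)] by (simp add: \<A>0_def hyperplanes_containing_def)
    qed
    have t: "?t ((*v) w ` H) = \<sigma> w ** ?t H ** \<sigma> (matrix_inv w)" if "w \<in> W" "H \<in> \<A>" for w H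
      using eq that unfolding equivariant_rep_def \<sigma>(3)[OF that(1)] \<A>_def by blast
    have E: "equivariant_system (log_form \<A> ?t) (- \<Union>\<A>) W \<sigma>"
      by (rule equivariant_log_form[OF flat order_refl flat_system.local_system_complement[OF flat]
            W.finite_linear_group_axioms stable \<sigma>(1,2) t])
    have E0: "equivariant_system (log_form \<A>0 ?t) (- \<Union>\<A>0) W0 \<sigma>"
    proof (rule equivariant_log_form[OF flat \<A>0 _ _ stable0 \<sigma>(1) \<sigma>(2) t])
      show "local_system (log_form \<A>0 ?t) (- \<Union>\<A>0)"
        using flat_system.local_system_complement[OF flat_system.flat_system_center[OF flat, of x1]] unfolding center .
      show "finite_linear_group W0" unfolding W0_def by (rule W.stabilizer_finite_linear_group)
    qed (use W0(1) \<A>0 in blast)+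
    have "equivariant_parabolic \<A> ?t x1 x2 z z0 \<Omega> \<beta> \<beta>0 W W0 \<sigma>"
    proof (rule equivariant_parabolic.intro[OF par equivariant_parabolic_axioms.intro], unfold center)
      fix w assume w: "w \<in> W0"
      then have wW: "w \<in> W" using W0(1) by blast
      show fix_x1: "w *v x1 = x1" by (rule W0(2)[OF w \<open>x1 \<in> I\<close>])
      show "w *v x \<in> \<Omega>" if "x \<in> \<Omega>" for x
      proof -
        have "w *v x - x1 = w *v (x - x1)" by (simp add: matrix_vector_mult_diff_distrib fix_x1)
        moreover have "\<phi> (w *v u) (w *v u) = \<phi> u u" for u
          using assms(16) wW unfolding invariant_hermitian_def by blast
        ultimately show ?thesis using that by (simp add: \<Omega>_def hermitian_norm_def)
      qed
    qed (use E E0 W0(1) stable t in blast)+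
    from equivariant_parabolic.braid_isomorphic[OF this] asm
    show "isomorphic_reps (fundamental_group (orbit_space W0 X0) (orbit W0 z0))
          (R \<circ> braid_embedding W W0 X X0 \<Omega> x2 \<beta>0 \<beta>) R0"
      unfolding center X \<omega> \<omega>0 by blast
  qed
qed

end
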